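(* Let $p,n\ge 1$ be integers and let $V=S^p\mathbb{R}^n$ be equipped with the Bombieri inner product. Let $X\subset V$ be the manifold of all non-zero elements of the form $\pm u^p$ with $u\in\mathbb{R}^n$. When $v\in V$ is drawn from the standard Gaussian distribution relative to the Bombieri norm, the expected number of critical points on $X$ of $d_v(x)=\|v-x\|^2$ equals $$\frac{1}{2^{(n^2+3n-2)/4}\prod_{i=1}^n\Gamma(i/2)}\int_{\lambda_2\le\cdots\le\lambda_n}\int_{-\infty}^{\infty}\left(\prod_{i=2}^n\left|\sqrt{p}\,w_0-\sqrt{p-1}\,\lambda_i\right|\right)\left(\prod_{2\le i<j\le n}(\lambda_j-\lambda_i)\right)e^{-w_0^2/2-\sum_{i=2}^n\lambda_i^2/4}\,dw_0\,d\lambda_2\cdots d\lambda_n.$$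
   Context: $S^p\mathbb{R}^n$ is the space of homogeneous polynomials of degree $p$ in the standard basis $e_1,\dots,e_n$ of $\mathbb{R}^n$. The Bombieri inner product is the one in which the monomials $e_1^{\alpha_1}\cdots e_n^{\alpha_n}$ ($\sum_i\alpha_i=p$) form an orthogonal basis with squared norms $\|e_1^{\alpha_1}\cdots e_n^{\alpha_n}\|^2=\frac{\alpha_1!\cdots\alpha_n!}{p!}$. The standard Gaussian distribution relative to this norm is the one for which the coordinates of $v$ in an orthonormal basis are independent standard normal variables. For $u=\sum_i t_ie_i$, $u^p$ denotes the polynomial $(\sum_i t_ie_i)^p$. A point $x\in X$ is a critical point of $d_v$ on $X$ if $v-x\perp T_xX$. $\Gamma$ is Euler's gamma function. *)

theory Defs
  imports "HOL-Probability.Probability" "HOL-Library.Poly_Mapping"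
begin

text \<open>
  Real polynomials in variables \<open>e\<^sub>i\<close> indexed by a finite type \<open>'n\<close> are elements of the monoid
  algebra \<open>('n \<Rightarrow>\<^sub>0 nat) \<Rightarrow>\<^sub>0 real\<close>: an exponent vector \<open>\<alpha> :: 'n \<Rightarrow>\<^sub>0 nat\<close> is mapped to the coefficient
  of the monomial with that exponent vector, and multiplication is the convolution product.
\<close>

type_synonym 'n mpoly = "('n \<Rightarrow>\<^sub>0 nat) \<Rightarrow>\<^sub>0 real"

abbreviation mcoeff :: "'n mpoly \<Rightarrow> ('n \<Rightarrow>\<^sub>0 nat) \<Rightarrow> real" where
  "mcoeff \<equiv> Poly_Mapping.lookup"

definition const_poly :: "real \<Rightarrow> 'n mpoly" where
  "const_poly c = Poly_Mapping.single 0 c"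

definition var_poly :: "'n \<Rightarrow> 'n mpoly" where
  "var_poly i = Poly_Mapping.single (Poly_Mapping.single i 1) 1"

definition linear_form :: "real ^ 'n \<Rightarrow> ('n::finite) mpoly" where
  "linear_form t = (\<Sum>i\<in>UNIV. const_poly (t $ i) * var_poly i)"

definition sym_power :: "nat \<Rightarrow> ('n::finite) mpoly set" where
  "sym_power p = {f. \<forall>\<alpha>\<in>Poly_Mapping.keys f. (\<Sum>i\<in>UNIV. Poly_Mapping.lookup \<alpha> i) = p}"

text \<open>
  The bilinear form for which the monomials are orthogonal, the monomial with exponent vector
  \<open>\<alpha>\<close> having squared norm \<open>(\<Prod>i. \<alpha>\<^sub>i!) / p!\<close>; it is the Bombieri inner product on \<open>sym_power p\<close>.
\<close>

definition bombieri :: "nat \<Rightarrow> ('n::finite) mpoly \<Rightarrow> 'n mpoly \<Rightarrow> real" where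
  "bombieri p f g =
     (\<Sum>\<alpha>\<in>Poly_Mapping.keys f.
        mcoeff f \<alpha> * mcoeff g \<alpha> * ((\<Prod>i\<in>UNIV. fact (Poly_Mapping.lookup \<alpha> i)) / fact p))"

definition bombieri_orthonormal_basis :: "nat \<Rightarrow> ('n::finite) mpoly set \<Rightarrow> bool" where
  "bombieri_orthonormal_basis p B \<longleftrightarrow>
     finite B \<and> B \<subseteq> sym_power p \<and>
     (\<forall>f\<in>B. \<forall>g\<in>B. bombieri p f g = (if f = g then 1 else 0)) \<and>
     (\<forall>f\<in>sym_power p. \<exists>c. f = (\<Sum>g\<in>B. const_poly (c g) * g))"

definition standard_gaussian :: "nat \<Rightarrow> 'w measure \<Rightarrow> ('w \<Rightarrow> ('n::finite) mpoly) \<Rightarrow> bool" where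
  "standard_gaussian p M v \<longleftrightarrow>
     prob_space M \<and> (\<forall>\<omega>\<in>space M. v \<omega> \<in> sym_power p) \<and>
     (\<exists>B. bombieri_orthonormal_basis p B \<and>
        prob_space.indep_vars M (\<lambda>_. borel) (\<lambda>b \<omega>. bombieri p (v \<omega>) b) B \<and>
        (\<forall>b\<in>B. distributed M lborel (\<lambda>\<omega>. bombieri p (v \<omega>) b) std_normal_density))"

definition power_manifold :: "nat \<Rightarrow> ('n::finite) mpoly set" where
  "power_manifold p = {x. x \<noteq> 0 \<and> (\<exists>u. x = linear_form u ^ p \<or> x = - (linear_form u ^ p))}"

text \<open>
  Velocities at \<open>x\<close> of smooth curves through \<open>x\<close> that stay in \<open>X\<close>.  The curve is \<open>c 0\<close>, and \<open>c k\<close>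
  is its \<open>k\<close>-th derivative.  On a space \<open>sym_power p\<close>, which is finite-dimensional, differentiability
  is the same as differentiability of every coefficient.
\<close>

definition tangent_space :: "('n::finite) mpoly set \<Rightarrow> 'n mpoly \<Rightarrow> 'n mpoly set" where
  "tangent_space X x =
     {w. \<exists>(\<epsilon>::real) (c :: nat \<Rightarrow> real \<Rightarrow> 'n mpoly).
        \<epsilon> > 0 \<and> c 0 0 = x \<and> c 1 0 = w \<and>
        (\<forall>t\<in>{-\<epsilon><..<\<epsilon>}. c 0 t \<in> X \<and>
           (\<forall>k \<alpha>. ((\<lambda>s. mcoeff (c k s) \<alpha>) has_real_derivative mcoeff (c (Suc k) t) \<alpha>) (at t)))}"

definition critical_points ::
  "nat \<Rightarrow> ('n::finite) mpoly set \<Rightarrow> 'n mpoly \<Rightarrow> 'n mpoly set" where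
  "critical_points p X v = {x\<in>X. \<forall>w\<in>tangent_space X x. bombieri p (v - x) w = 0}"

text \<open>The number of elements, with value \<open>\<infinity>\<close> for infinite sets (unlike \<open>card\<close>).\<close>

definition num_elements :: "'a set \<Rightarrow> ennreal" where
  "num_elements S = emeasure (count_space UNIV) S"

end

(*
  A critical point of d_v on X is x = eps * u^p, where u solves D_i f(u) = eps p |u|^(2p-2) u_i for all i
  and f(u) = <v, u^p> is a Gaussian homogeneous polynomial whose law is invariant under rotations.
  Up to the scale of u, these are the pairs s, -s of critical points, with nonzero critical value, of f
  restricted to the unit sphere.  Averaging the number of critical points in a small cap over the centre
  of the cap, applying the area formula to the Gaussian coefficients that determine the gradient at the centre, and
  shrinking the cap gives a Kac-Rice formula: the expected number is a constant times the expected value of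
  |det(sqrt p w_0 - sqrt(p-1) C)|, where C is a matrix of the Gaussian orthogonal ensemble.
  The law of the eigenvalues of C is not needed: the Kac-Rice formula for p = 2, weighted by products of
  characteristic polynomials, counts the eigenvectors of C, whose number is almost surely known, and so
  expresses the expectation for matrices of size m + 1 through the one for size m.  The integral over the
  Vandermonde density satisfies the same recursion.
*)
theory Submission
 imports Defs "HOL-Combinatorics.Permutations"
begin

section \<open>Gaussian product measures\<close>

text \<open>A Gaussian vector as centre of the cap takes the place of the uniform measure on the
  sphere, and the shrinking cap takes the place of conditioning on a vanishing gradient, so that
  everything happens in Gaussian product measures. The averaging identity is exact for every radius
  r. Both of its sides are \<open>r ^ card K\<close> times a convergent quantity with a common
  constant, and what survives in the quotient is the absolute moment \<open>absmom (card K)\<close>.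
  The product of these moments over all sizes is the product of Gamma values in the result. Weights
  are carried along because the recursion in the matrix size would not close otherwise: passing from
  size m + 1 to size m produces a new factor |det(t - C)|, so the induction has to run over
  arbitrary lists of such factors. The number of eigenvectors is known only where it is finite; that
  it is finite almost surely is itself a consequence of the unweighted Kac-Rice formula.\<close>

definition gauss :: "real measure" where
 "gauss = density lborel (%x. ennreal (std_normal_density x))"

lemma prob_space_gauss: "prob_space gauss"
 unfolding gauss_def by (rule prob_space_normal_density) simp

lemma sets_gauss [simp, measurable_cong]: "sets gauss = sets borel"
 and space_gauss [simp]: "space gauss = UNIV"
 by (simp_all add: gauss_def)

interpretation gauss: prob_space gauss by (rule prob_space_gauss)
interpretation lborelP: product_sigma_finite "%_. lborel :: real measure"
 by unfold_locales
interpretation gaussF: product_sigma_finite "%_. gauss"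
 by unfold_locales

lemma sets_PiM_gauss: "sets (PiM A (%_. gauss)) = sets (PiM A (%_. lborel))"
 by (rule sets_PiM_cong) auto

text \<open>Both measures agree on boxes, where the density factorises, and a finite product measure
  is determined by its boxes.\<close>

lemma PiM_gauss_density:
 assumes A: "finite A"
 shows "PiM A (%_. gauss) =
  density (PiM A (%_. lborel)) (%x. \<Prod>a\<in>A. ennreal (std_normal_density (x a)))"
proof (rule sym, rule gaussF.PiM_eqI[OF A])
 show "sets (density (PiM A (%_. lborel)) (%x. \<Prod>a\<in>A. ennreal (std_normal_density (x a)))) =
  sets (PiM A (%_. gauss))"
  by (simp add: sets_PiM_gauss)
next
 fix F assume F: "!!i. i \<in> A ==> F i \<in> sets gauss"
 have F': "Pi\<^sub>E A F \<in> sets (PiM A (%_. lborel))"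
  using F by (intro sets_PiM_I_finite A) auto
 have "emeasure (density (PiM A (%_. lborel)) (%x. \<Prod>a\<in>A. ennreal (std_normal_density (x a)))) (Pi\<^sub>E A F) =
  (\<integral>\<^sup>+x. (\<Prod>a\<in>A. ennreal (std_normal_density (x a))) * indicator (Pi\<^sub>E A F) x \<partial>PiM A (%_. lborel))"
  by (rule emeasure_density) (use F' in measurable)
 also have "\<dots> = (\<integral>\<^sup>+x. (\<Prod>a\<in>A. ennreal (std_normal_density (x a)) * indicator (F a) (x a)) \<partial>PiM A (%_. lborel))"
 proof (rule nn_integral_cong)
  fix x :: "'a => real" assume x: "x \<in> space (PiM A (%_. lborel))"
  then have ext: "x \<in> extensional A" by (auto simp: space_PiM PiE_def)
  have "indicator (Pi\<^sub>E A F) x = (\<Prod>a\<in>A. indicator (F a) (x a) :: ennreal)"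
  proof (cases "\<forall>a\<in>A. x a \<in> F a")
   case True then show ?thesis using ext by (auto simp: indicator_def PiE_def)
  next
   case False
   then obtain a where "a \<in> A" "x a \<notin> F a" by auto
   then show ?thesis using A by (auto simp: indicator_def PiE_def Pi_def intro!: prod_zero[symmetric])
  qed
  then show "(\<Prod>a\<in>A. ennreal (std_normal_density (x a))) * indicator (Pi\<^sub>E A F) x =
   (\<Prod>a\<in>A. ennreal (std_normal_density (x a)) * indicator (F a) (x a))"
   by (simp add: prod.distrib)
 qed
 also have "\<dots> = (\<Prod>a\<in>A. \<integral>\<^sup>+x. ennreal (std_normal_density x) * indicator (F a) x \<partial>lborel)"
  by (rule lborelP.product_nn_integral_prod[OF A]) (use F in measurable)
 also have "\<dots> = (\<Prod>a\<in>A. emeasure gauss (F a))"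
  unfolding gauss_def by (intro prod.cong refl emeasure_density[symmetric]) (use F in auto)
 finally show "emeasure (density (PiM A (%_. lborel)) (%x. \<Prod>a\<in>A. ennreal (std_normal_density (x a)))) (Pi\<^sub>E A F) = \<dots>" .
qed

lemma nn_integral_PiM_gauss:
 assumes A: "finite A" and f: "f \<in> borel_measurable (PiM A (%_. lborel))"
 shows "(\<integral>\<^sup>+x. f x \<partial>PiM A (%_. gauss)) =
  (\<integral>\<^sup>+x. (\<Prod>a\<in>A. ennreal (std_normal_density (x a))) * f x \<partial>PiM A (%_. lborel))"
 unfolding PiM_gauss_density[OF A] by (rule nn_integral_density) (use f in measurable)

text \<open>Both the translations and the dilations of \<open>\<real>\<^sup>A\<close> are instances of a product map.\<close>

lemma distr_PiM_lborel_map: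
 fixes T :: "'a => real => real"
 assumes A: "finite A" and T: "!!a. a \<in> A ==> T a \<in> borel_measurable borel"
  and s: "!!a X. a \<in> A ==> X \<in> sets borel ==> emeasure lborel (T a -` X) = c * emeasure lborel X"
  and c: "0 < c" "c < \<infinity>"
 shows "distr (PiM A (%_. lborel)) (PiM A (%_. lborel)) (%x. \<lambda>a\<in>A. T a (x a)) =
  scale_measure (c ^ card A) (PiM A (%_. lborel))"
proof -
 let ?L = "PiM A (%_. lborel :: real measure)"
 have Tm: "(%x. \<lambda>a\<in>A. T a (x a)) \<in> ?L \<rightarrow>\<^sub>M ?L"
 proof (rule measurable_restrict)
  fix i assume "i \<in> A"
  then show "(%x. T i (x i)) \<in> ?L \<rightarrow>\<^sub>M lborel"
   using T[of i] by (simp add: measurable_compose[OF measurable_component_singleton])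
 qed
 have ne: "c ^ card A ~= 0" "c ^ card A ~= \<top>" using c by (auto simp: power_eq_top_ennreal)
 \<comment> \<open>The image measure is normalised first, so that its box volumes become those of
   Lebesgue measure and uniqueness of the product measure applies.\<close>
 define D where "D = scale_measure (inverse (c ^ card A)) (distr ?L ?L (%x. \<lambda>a\<in>A. T a (x a)))"
 have "D = ?L"
 proof (rule lborelP.PiM_eqI[OF A])
  show "sets D = sets ?L" by (simp add: D_def)
 next
  fix F :: "'a => real set" assume F: "!!i. i \<in> A ==> F i \<in> sets lborel"
  have F': "Pi\<^sub>E A F \<in> sets ?L" using F by (intro sets_PiM_I_finite A) auto
  have "(%x. \<lambda>a\<in>A. T a (x a)) -` Pi\<^sub>E A F \<inter> space ?L = Pi\<^sub>E A (%a. T a -` F a)"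
   by (auto simp: space_PiM PiE_def Pi_def)
  then have "emeasure (distr ?L ?L (%x. \<lambda>a\<in>A. T a (x a))) (Pi\<^sub>E A F) = emeasure ?L (Pi\<^sub>E A (%a. T a -` F a))"
   by (simp add: emeasure_distr[OF Tm F'])
  also have "\<dots> = (\<Prod>a\<in>A. emeasure lborel (T a -` F a))"
   by (rule lborelP.emeasure_PiM[OF A]) (use measurable_sets_borel[OF T] F in auto)
  also have "\<dots> = (\<Prod>a\<in>A. c * emeasure lborel (F a))"
   using F by (intro prod.cong refl s) auto
  also have "\<dots> = c ^ card A * (\<Prod>a\<in>A. emeasure lborel (F a))" by (simp add: prod.distrib)
  finally have *: "emeasure (distr ?L ?L (%x. \<lambda>a\<in>A. T a (x a))) (Pi\<^sub>E A F) = c ^ card A * (\<Prod>a\<in>A. emeasure lborel (F a))" .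
  show "emeasure D (Pi\<^sub>E A F) = (\<Prod>a\<in>A. emeasure lborel (F a))"
   unfolding D_def emeasure_scale_measure * mult.assoc[symmetric]
   using ne by (simp add: ennreal_inverse_mult mult.commute[of "inverse _"] ennreal_divide_self[unfolded divide_ennreal_def] top.not_eq_extremum)
 qed
 have "scale_measure (c ^ card A) D = distr ?L ?L (%x. \<lambda>a\<in>A. T a (x a))"
  unfolding D_def scale_scale_measure
  using ne by (simp add: ennreal_divide_self[unfolded divide_ennreal_def] top.not_eq_extremum mult.commute)
 then show ?thesis unfolding \<open>D = ?L\<close> by simp
qed

lemma nn_integral_PiM_lborel_translate:
 assumes A: "finite A" and f: "f \<in> borel_measurable (PiM A (%_. lborel))"
 shows "(\<integral>\<^sup>+x. f (\<lambda>a\<in>A. x a + z a) \<partial>PiM A (%_. lborel)) = (\<integral>\<^sup>+x. f x \<partial>PiM A (%_. lborel :: real measure))"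
proof -
 let ?L = "PiM A (%_. lborel :: real measure)"
 have e: "emeasure lborel ((%t. t + z a) -` X) = 1 * emeasure lborel X" if "X \<in> sets borel" for X a
  using emeasure_distr[of "(+) (z a)" lborel borel X] that
  by (simp add: lborel_distr_plus add.commute[of _ "z a"] lborel_distr_plus[of "z a"])
 have m: "(%x. \<lambda>a\<in>A. x a + z a) \<in> ?L \<rightarrow>\<^sub>M ?L" by measurable
 have "(\<integral>\<^sup>+x. f (\<lambda>a\<in>A. x a + z a) \<partial>?L) = (\<integral>\<^sup>+x. f x \<partial>distr ?L ?L (%x. \<lambda>a\<in>A. x a + z a))"
  by (rule nn_integral_distr[symmetric, OF m]) (use f in simp)
 also have "distr ?L ?L (%x. \<lambda>a\<in>A. x a + z a) = scale_measure (1 ^ card A) ?L"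
  by (rule distr_PiM_lborel_map[OF A]) (use e in auto)
 also have "\<dots> = ?L" by simp
 finally show ?thesis .
qed

lemma nn_integral_PiM_lborel_scale:
 assumes A: "finite A" and f: "f \<in> borel_measurable (PiM A (%_. lborel))" and c: "c ~= 0"
 shows "(\<integral>\<^sup>+x. f x \<partial>PiM A (%_. lborel :: real measure)) =
  ennreal (\<bar>c\<bar> ^ card A) * (\<integral>\<^sup>+x. f (\<lambda>a\<in>A. c * x a) \<partial>PiM A (%_. lborel))"
proof -
 let ?L = "PiM A (%_. lborel :: real measure)"
 have e: "emeasure lborel ((%t. c * t) -` X) = ennreal (inverse \<bar>c\<bar>) * emeasure lborel X" if "X \<in> sets borel" for X
  using emeasure_distr[of "(*) c" lborel borel X] that c
  by (simp add: lborel_distr_mult emeasure_density nn_integral_cmult)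
 have m: "(%x. \<lambda>a\<in>A. c * x a) \<in> ?L \<rightarrow>\<^sub>M ?L" by measurable
 have "(\<integral>\<^sup>+x. f (\<lambda>a\<in>A. c * x a) \<partial>?L) = (\<integral>\<^sup>+x. f x \<partial>distr ?L ?L (%x. \<lambda>a\<in>A. c * x a))"
  by (rule nn_integral_distr[symmetric, OF m]) (use f in simp)
 also have "distr ?L ?L (%x. \<lambda>a\<in>A. c * x a) = scale_measure (ennreal (inverse \<bar>c\<bar>) ^ card A) ?L"
  by (rule distr_PiM_lborel_map[OF A]) (use e c in auto)
 also have "(\<integral>\<^sup>+x. f x \<partial>\<dots>) = ennreal (inverse \<bar>c\<bar>) ^ card A * (\<integral>\<^sup>+x. f x \<partial>?L)"
  using f by (rule nn_integral_scale_measure)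
 finally have "ennreal (\<bar>c\<bar> ^ card A) * (\<integral>\<^sup>+x. f (\<lambda>a\<in>A. c * x a) \<partial>?L) =
  ennreal (\<bar>c\<bar> ^ card A) * ennreal (inverse \<bar>c\<bar>) ^ card A * (\<integral>\<^sup>+x. f x \<partial>?L)"
  by (simp only: mult.assoc)
 also have "ennreal (\<bar>c\<bar> ^ card A) * ennreal (inverse \<bar>c\<bar>) ^ card A = 1"
  using c by (simp add: ennreal_power ennreal_mult'[symmetric] power_mult_distrib[symmetric])
 also have "1 * (\<integral>\<^sup>+x. f x \<partial>?L) = (\<integral>\<^sup>+x. f x \<partial>?L)" by simp
 finally show ?thesis by (rule sym)
qed

lemma nn_integral_PiM_lborel_reflect:
 assumes A: "finite A" and f: "f \<in> borel_measurable (PiM A (%_. lborel))"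
 shows "(\<integral>\<^sup>+x. f (\<lambda>a\<in>A. z a - x a) \<partial>PiM A (%_. lborel)) = (\<integral>\<^sup>+x. f x \<partial>PiM A (%_. lborel :: real measure))"
proof -
 let ?L = "PiM A (%_. lborel :: real measure)"
 have m: "(%x. \<lambda>a\<in>A. x a + z a) \<in> ?L \<rightarrow>\<^sub>M ?L" by measurable
 have "(\<integral>\<^sup>+x. f x \<partial>?L) = (\<integral>\<^sup>+x. f (\<lambda>a\<in>A. x a + z a) \<partial>?L)"
  using nn_integral_PiM_lborel_translate[OF A f] by simp
 also have "\<dots> = ennreal (\<bar>-1\<bar> ^ card A) * (\<integral>\<^sup>+x. f (\<lambda>a\<in>A. (\<lambda>a\<in>A. (-1) * x a) a + z a) \<partial>?L)"
  by (rule nn_integral_PiM_lborel_scale[OF A, where c="-1"]) (use f m in auto)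
 also have "\<dots> = (\<integral>\<^sup>+x. f (\<lambda>a\<in>A. z a - x a) \<partial>?L)"
  by (simp cong: restrict_cong)
 finally show ?thesis by simp
qed

text \<open>The density sees only the Euclidean norm and the number of coordinates. Together with
  the invariance of Lebesgue measure this is the source of the orthogonal invariance of the Gaussian
  measure.\<close>

lemma prod_std_normal_density:
 "(\<Prod>a\<in>A. ennreal (std_normal_density (x a))) =
  ennreal ((1 / sqrt (2 * pi)) ^ card A * exp (- (\<Sum>a\<in>A. (x a)\<^sup>2) / 2))"
proof -
 have "(\<Prod>a\<in>A. ennreal (std_normal_density (x a))) = ennreal (\<Prod>a\<in>A. std_normal_density (x a))"
  by (simp add: prod_ennreal)
 also have "(\<Prod>a\<in>A. std_normal_density (x a)) = (1 / sqrt (2 * pi)) ^ card A * (\<Prod>a\<in>A. exp (- (x a)\<^sup>2 / 2))"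
  unfolding std_normal_density_def prod.distrib by simp
 also have "(\<Prod>a\<in>A. exp (- (x a)\<^sup>2 / 2)) = exp (- (\<Sum>a\<in>A. (x a)\<^sup>2) / 2)"
  by (cases "finite A") (simp_all add: exp_sum[symmetric] sum_negf sum_divide_distrib)
 finally show ?thesis .
qed

text \<open>Rows and columns have separate index sets because there are two kinds of use: rotations
  acting on exponents or on coordinates, and the change from an arbitrary orthonormal basis of
  polynomials to the monomial one. The two orthogonality relations together force the sets to have
  equal size.\<close>

locale orth_matrix =
 fixes A :: "'a set" and B :: "'b set" and Q :: "'a => 'b => real"
 assumes finA: "finite A" and finB: "finite B"
  and rows: "!!a a'. a \<in> A ==> a' \<in> A ==> (\<Sum>b\<in>B. Q a b * Q a' b) = (if a = a' then 1 else 0)"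
  and cols: "!!b b'. b \<in> B ==> b' \<in> B ==> (\<Sum>a\<in>A. Q a b * Q a b') = (if b = b' then 1 else 0)"
begin

definition app :: "('a => real) => 'b => real" where
 "app x = (\<lambda>b\<in>B. \<Sum>a\<in>A. Q a b * x a)"

lemma card_eq: "card A = card B"
proof -
 have "real (card A) = (\<Sum>a\<in>A. \<Sum>b\<in>B. Q a b * Q a b)" using rows by simp
 also have "\<dots> = (\<Sum>b\<in>B. \<Sum>a\<in>A. Q a b * Q a b)" by (rule sum.swap)
 also have "\<dots> = real (card B)" using cols by simp
 finally show ?thesis by simp
qed

lemma app_norm: "(\<Sum>b\<in>B. (app x b)\<^sup>2) = (\<Sum>a\<in>A. (x a)\<^sup>2)"
proof -
 have "(\<Sum>b\<in>B. (app x b)\<^sup>2) = (\<Sum>b\<in>B. \<Sum>a\<in>A. \<Sum>a'\<in>A. (Q a b * x a) * (Q a' b * x a'))"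
  by (simp add: app_def power2_eq_square sum_product)
 also have "\<dots> = (\<Sum>a\<in>A. \<Sum>a'\<in>A. \<Sum>b\<in>B. (Q a b * x a) * (Q a' b * x a'))"
  by (subst sum.swap, rule sum.cong[OF refl], rule sum.swap)
 also have "\<dots> = (\<Sum>a\<in>A. \<Sum>a'\<in>A. x a * x a' * (\<Sum>b\<in>B. Q a b * Q a' b))"
  by (simp add: sum_distrib_left algebra_simps)
 also have "\<dots> = (\<Sum>a\<in>A. \<Sum>a'\<in>A. if a = a' then x a * x a' else 0)"
  by (intro sum.cong refl) (simp add: rows)
 also have "\<dots> = (\<Sum>a\<in>A. (x a)\<^sup>2)"
  using finA by (simp add: power2_eq_square)
 finally show ?thesis .
qed

lemma app_surj:
 assumes b: "b \<in> B" shows "(\<Sum>a\<in>A. Q a b * (\<Sum>b'\<in>B. Q a b' * z b')) = z b"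
proof -
 have "(\<Sum>a\<in>A. Q a b * (\<Sum>b'\<in>B. Q a b' * z b')) = (\<Sum>a\<in>A. \<Sum>b'\<in>B. Q a b * Q a b' * z b')"
  by (simp add: sum_distrib_left algebra_simps)
 also have "\<dots> = (\<Sum>b'\<in>B. z b' * (\<Sum>a\<in>A. Q a b * Q a b'))"
  by (subst sum.swap) (simp add: sum_distrib_left algebra_simps)
 also have "\<dots> = (\<Sum>b'\<in>B. if b = b' then z b' else 0)"
  by (intro sum.cong refl) (simp add: cols b)
 also have "\<dots> = z b" using finB b by simp
 finally show ?thesis .
qed

lemma app_measurable [measurable]: "app \<in> PiM A (%_. lborel) \<rightarrow>\<^sub>M PiM B (%_. lborel)"
 unfolding app_def[abs_def] by (rule measurable_restrict) (simp, measurable)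

lemma app_component_measurable [measurable (raw)]:
 "f \<in> M \<rightarrow>\<^sub>M PiM A (%_. lborel) ==> b \<in> B ==> (%x. app (f x) b) \<in> borel_measurable M"
 using measurable_compose[OF measurable_compose[OF _ app_measurable], of f M "%x. x b" borel]
 by simp

text \<open>The image measure is translation invariant, and translation invariant measures on \<open>\<real>\<^sup>B\<close> are
 proportional, by Tonelli; the constant is found by integrating a Gaussian density.\<close>

lemma nn_integral_lborel_app:
 assumes H: "H \<in> borel_measurable (PiM B (%_. lborel))"
 shows "(\<integral>\<^sup>+x. H (app x) \<partial>PiM A (%_. lborel)) = (\<integral>\<^sup>+x. H x \<partial>PiM B (%_. lborel))"
proof -
 let ?LA = "PiM A (%_. lborel :: real measure)" and ?LB = "PiM B (%_. lborel :: real measure)"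
 define g where "g x = (\<Prod>b\<in>B. ennreal (std_normal_density (x b)))" for x :: "'b => real"
 have g[measurable]: "g \<in> borel_measurable ?LB" unfolding g_def by measurable
 have [measurable]: "H \<in> borel_measurable ?LB" by fact
 interpret LA: sigma_finite_measure ?LA by (rule lborelP.sigma_finite[OF finA])
 interpret LB: sigma_finite_measure ?LB by (rule lborelP.sigma_finite[OF finB])
 interpret P: pair_sigma_finite ?LA ?LB by unfold_locales
 have one: "(\<integral>\<^sup>+x. (\<Prod>a\<in>C. ennreal (std_normal_density (x a))) \<partial>PiM C (%_. lborel)) = 1"
  if "finite C" for C :: "'c set"
 proof -
  interpret G: prob_space "PiM C (%_. gauss)" by (rule prob_space_PiM) (rule prob_space_gauss)
  show ?thesis using nn_integral_PiM_gauss[OF that, of "%_. 1"] G.emeasure_space_1 by simp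
 qed
 have app_add: "app (\<lambda>a\<in>A. x a + (\<Sum>b'\<in>B. Q a b' * z b')) = (\<lambda>b\<in>B. app x b + z b)" for x z
  using app_surj[of _ z] by (auto simp: app_def fun_eq_iff algebra_simps sum.distrib)
 have tr: "(\<integral>\<^sup>+x. F (\<lambda>b\<in>B. app x b + z b) \<partial>?LA) = (\<integral>\<^sup>+x. F (app x) \<partial>?LA)"
  if [measurable]: "F \<in> borel_measurable ?LB" for F z
  using nn_integral_PiM_lborel_translate[OF finA, of "%x. F (app x)" "%a. \<Sum>b'\<in>B. Q a b' * z b'"]
  by (simp only: app_add) simp
 have ga: "(\<integral>\<^sup>+x. g (app x) \<partial>?LA) = 1"
  using one[OF finA] by (simp add: g_def prod_std_normal_density app_norm card_eq)
 have sub_add: "app x \<in> space ?LB" for x by (simp add: app_def space_PiM)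
 \<comment> \<open>The total mass 1 of the Gaussian \<open>g\<close> is inserted and shifted by
   \<open>app x\<close>; after swapping the integrals, a translation moves the shift from
   \<open>g\<close> to \<open>H\<close>. The inner integral over y is then that of \<open>H\<close>,
   and the factor left over is the mass of \<open>g (app x)\<close>, which is 1 because
   \<open>app\<close> preserves the norm.\<close>
 have "(\<integral>\<^sup>+x. H (app x) \<partial>?LA) = (\<integral>\<^sup>+x. H (app x) * (\<integral>\<^sup>+y. g y \<partial>?LB) \<partial>?LA)"
  using one[OF finB] by (simp add: g_def)
 also have "\<dots> = (\<integral>\<^sup>+x. H (app x) * (\<integral>\<^sup>+y. g (\<lambda>b\<in>B. y b + app x b) \<partial>?LB) \<partial>?LA)"
  by (subst nn_integral_PiM_lborel_translate[OF finB g]) simp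
 also have "\<dots> = (\<integral>\<^sup>+x. (\<integral>\<^sup>+y. H (app x) * g (\<lambda>b\<in>B. y b + app x b) \<partial>?LB) \<partial>?LA)"
  by (intro nn_integral_cong nn_integral_cmult[symmetric]) measurable
 also have "\<dots> = (\<integral>\<^sup>+y. (\<integral>\<^sup>+x. H (app x) * g (\<lambda>b\<in>B. y b + app x b) \<partial>?LA) \<partial>?LB)"
  by (rule P.Fubini'[symmetric]) measurable
 also have "\<dots> = (\<integral>\<^sup>+y. (\<integral>\<^sup>+x. H (\<lambda>b\<in>B. app x b - y b) * g (app x) \<partial>?LA) \<partial>?LB)"
 proof (rule nn_integral_cong)
  fix y assume y: "y \<in> space ?LB"
  let ?F = "%u. H (\<lambda>b\<in>B. u b - y b) * g u"
  have F: "?F \<in> borel_measurable ?LB" by measurable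
  have "H (\<lambda>b\<in>B. (\<lambda>b\<in>B. app x b + y b) b - y b) = H (app x)" for x
   by (rule arg_cong[where f=H]) (auto simp: app_def fun_eq_iff)
  then have "(\<integral>\<^sup>+x. H (app x) * g (\<lambda>b\<in>B. y b + app x b) \<partial>?LA) = (\<integral>\<^sup>+x. ?F (\<lambda>b\<in>B. app x b + y b) \<partial>?LA)"
   by (simp add: add.commute)
  then show "(\<integral>\<^sup>+x. H (app x) * g (\<lambda>b\<in>B. y b + app x b) \<partial>?LA) = (\<integral>\<^sup>+x. ?F (app x) \<partial>?LA)"
   using tr[OF F, of y] by simp
 qed
 also have "\<dots> = (\<integral>\<^sup>+x. (\<integral>\<^sup>+y. H (\<lambda>b\<in>B. app x b - y b) * g (app x) \<partial>?LB) \<partial>?LA)"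
  by (rule P.Fubini') measurable
 also have "\<dots> = (\<integral>\<^sup>+x. (\<integral>\<^sup>+y. H y \<partial>?LB) * g (app x) \<partial>?LA)"
  by (subst nn_integral_multc, measurable, subst nn_integral_PiM_lborel_reflect[OF finB H]) simp
 also have "\<dots> = (\<integral>\<^sup>+y. H y \<partial>?LB)"
  by (subst nn_integral_cmult) (simp_all add: ga)
 finally show ?thesis .
qed

lemma nn_integral_gauss_app:
 assumes [measurable]: "H \<in> borel_measurable (PiM B (%_. lborel))"
 shows "(\<integral>\<^sup>+x. H (app x) \<partial>PiM A (%_. gauss)) = (\<integral>\<^sup>+x. H x \<partial>PiM B (%_. gauss))"
proof -
 have "(\<integral>\<^sup>+x. H (app x) \<partial>PiM A (%_. gauss)) =
  (\<integral>\<^sup>+x. (\<Prod>b\<in>B. ennreal (std_normal_density (app x b))) * H (app x) \<partial>PiM A (%_. lborel))"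
  by (subst nn_integral_PiM_gauss[OF finA]) (simp_all add: prod_std_normal_density app_norm card_eq)
 also have "\<dots> = (\<integral>\<^sup>+x. (\<Prod>b\<in>B. ennreal (std_normal_density (x b))) * H x \<partial>PiM B (%_. lborel))"
  by (rule nn_integral_lborel_app) measurable
 also have "\<dots> = (\<integral>\<^sup>+x. H x \<partial>PiM B (%_. gauss))"
  by (rule nn_integral_PiM_gauss[symmetric, OF finB]) measurable
 finally show ?thesis .
qed

end

section \<open>Absolute moments of the standard normal distribution\<close>

lemma even_gauss_moment: "fact (2 * m) / (2 ^ m * fact m) = 2 ^ m * Gamma (real m + 1/2) / sqrt pi"
proof (induction m)
 case 0 then show ?case by (simp add: Gamma_one_half_real)
next
 case (Suc m)
 have "real m + 1 / 2 ~= 0" "real m + 1/2 > 0" by auto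
 then have "real m + 1/2 \<notin> \<int>\<^sub>\<le>\<^sub>0" by (auto elim!: nonpos_Ints_cases)
 then have g: "Gamma (real (Suc m) + 1/2) = (real m + 1/2) * Gamma (real m + 1/2)"
  using Gamma_plus1[of "real m + 1/2"] by (simp add: algebra_simps)
 have "fact (2 * Suc m) / (2 ^ Suc m * fact (Suc m)) = (2 * real m + 1) * (fact (2 * m) / (2 ^ m * fact m))"
 proof -
  have f2: "(fact (2 * Suc m) :: real) = (2 * real m + 2) * ((2 * real m + 1) * fact (2 * m))"
   by (simp add: algebra_simps)
  have f1: "(2 ^ Suc m * fact (Suc m) :: real) = (2 * real m + 2) * (2 ^ m * fact m)"
   by (simp add: algebra_simps)
  have "2 * real m + 2 ~= 0" by simp
  then show ?thesis unfolding f1 f2 by simp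
 qed
 then show ?case unfolding Suc g by (simp add: algebra_simps add_divide_distrib)
qed

text \<open>Even moments are double factorials, odd absolute moments carry
  \<open>sqrt (2 / pi)\<close> and a factorial; the values of Gamma at half-integers and integers
  merge both into one expression, the form in which the product over all k is taken at the
  end.\<close>

lemma gauss_abs_moment:
 "(\<integral>\<^sup>+t. ennreal (\<bar>t\<bar> ^ k) \<partial>gauss) = ennreal (2 powr (real k / 2) * Gamma ((real k + 1) / 2) / sqrt pi)"
proof -
 have "has_bochner_integral lborel (%x. std_normal_density x * \<bar>x\<bar> ^ k) (2 powr (real k / 2) * Gamma ((real k + 1) / 2) / sqrt pi)"
 proof (cases "even k")
  case True
  then obtain m where k: "k = 2 * m" by auto
  have "2 powr (real k / 2) = 2 ^ m" by (simp add: k powr_realpow)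
  moreover have G: "Gamma ((real k + 1) / 2) = Gamma (real m + 1/2)" by (rule arg_cong[where f=Gamma]) (simp add: k)
  ultimately have e: "2 powr (real k / 2) * Gamma ((real k + 1) / 2) / sqrt pi = fact (2 * m) / (2 ^ m * fact m)"
   by (simp only: even_gauss_moment G)
  show ?thesis unfolding e using std_normal_moment_even[of m] by (simp add: k power_even_abs)
 next
  case False
  then obtain m where k: "k = 2 * m + 1" by (elim oddE)
  have "2 powr (real k / 2) = 2 powr (real m + 1/2)" by (simp add: k field_simps)
  also have "\<dots> = 2 ^ m * sqrt 2" by (simp add: powr_add powr_realpow powr_half_sqrt)
  finally have 1: "2 powr (real k / 2) = 2 ^ m * sqrt 2" .
  have "(real k + 1) / 2 = 1 + real m" by (simp add: k field_simps)
  then have 2: "Gamma ((real k + 1) / 2) = fact m" using Gamma_fact[of m, where 'a=real] by metis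
  have e: "2 powr (real k / 2) * Gamma ((real k + 1) / 2) / sqrt pi = sqrt (2 / pi) * 2 ^ m * fact m"
   unfolding 1 2 by (simp add: real_sqrt_divide)
  show ?thesis unfolding e using std_normal_moment_abs_odd[of m] by (simp add: k)
 qed
 then have "(\<integral>\<^sup>+x. ennreal (std_normal_density x * \<bar>x\<bar> ^ k) \<partial>lborel) = ennreal (2 powr (real k / 2) * Gamma ((real k + 1) / 2) / sqrt pi)"
  by (subst nn_integral_eq_integral) (auto simp: has_bochner_integral_iff)
 then show ?thesis
  unfolding gauss_def by (subst nn_integral_density) (auto simp: ennreal_mult')
qed

section \<open>The area formula for counting preimages\<close>

text \<open>Real integrands are read as vectors of length 1 to fit the vector-valued change of
  variables theorem.\<close>

lemma change_of_variables_real: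
 fixes g :: "real^'k::{finite,wellorder} => real^'k::_" and k :: "real^'k::_ => real"
 assumes S: "S \<in> sets lebesgue"
  and der: "!!x. x \<in> S ==> (g has_derivative g' x) (at x within S)"
  and inj: "inj_on g S" and k: "k absolutely_integrable_on (g ` S)"
 shows "(%x. \<bar>det (matrix (g' x))\<bar> * k (g x)) absolutely_integrable_on S"
  and "integral S (%x. \<bar>det (matrix (g' x))\<bar> * k (g x)) = integral (g ` S) k"
proof -
 have "(%x. \<bar>det (matrix (g' x))\<bar> *\<^sub>R (vec (k (g x)) :: real^1)) absolutely_integrable_on S \<and>
   integral S (%x. \<bar>det (matrix (g' x))\<bar> *\<^sub>R (vec (k (g x)) :: real^1)) = vec (integral (g ` S) k)"
  by (rule iffD2[OF has_absolute_integral_change_of_variables[OF S der inj]])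
    (use k in \<open>auto simp: absolutely_integrable_on_1_iff integral_on_1_eq\<close>)
 then show "(%x. \<bar>det (matrix (g' x))\<bar> * k (g x)) absolutely_integrable_on S"
  and "integral S (%x. \<bar>det (matrix (g' x))\<bar> * k (g x)) = integral (g ` S) k"
  by (auto simp: absolutely_integrable_on_1_iff integral_on_1_eq)
qed

text \<open>Reduces convergence of derivatives in operator norm to convergence of their columns,
  which is what continuity of \<open>%x. g' x w\<close> for each w provides.\<close>

lemma onorm_le_sum_axis:
 fixes h :: "real^'k => real^'m"
 assumes "linear h"
 shows "onorm h \<le> (\<Sum>j\<in>UNIV. norm (h (axis j 1)))"
proof (rule onorm_bound)
 show "0 \<le> (\<Sum>j\<in>UNIV. norm (h (axis j 1)))" by (intro sum_nonneg) auto
 fix x :: "real^'k"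
 have "h x = (\<Sum>j\<in>UNIV. x $ j *\<^sub>R h (axis j 1))"
  using linear_sum[OF assms, of "%j. x $ j *\<^sub>R axis j 1" UNIV] linear_scale[OF assms]
  by (simp add: basis_expansion scalar_mult_eq_scaleR[symmetric])
 then have "norm (h x) \<le> (\<Sum>j\<in>UNIV. \<bar>x $ j\<bar> * norm (h (axis j 1)))"
  using norm_sum[of "%j. x $ j *\<^sub>R h (axis j 1)" UNIV] by simp
 also have "\<dots> \<le> (\<Sum>j\<in>UNIV. norm x * norm (h (axis j 1)))"
  by (intro sum_mono mult_right_mono component_le_norm_cart) auto
 finally show "norm (h x) \<le> (\<Sum>j\<in>UNIV. norm (h (axis j 1))) * norm x"
  by (simp add: sum_distrib_left mult.commute)
qed

lemma locally_injective_C1: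
 fixes g :: "real^'k::{finite,wellorder} => real^'k::_"
 assumes U: "open U" "a \<in> U"
  and der: "!!x. x \<in> U ==> (g has_derivative g' x) (at x)"
  and cont: "!!w. continuous_on U (%x. g' x w)"
  and det: "det (matrix (g' a)) ~= 0"
 obtains r where "r > 0" "ball a r \<subseteq> U" "inj_on g (ball a r)"
proof -
 have lin: "linear (g' x)" if "x \<in> U" for x using der[OF that] by (rule has_derivative_linear)
 obtain B where B: "linear B" "B \<circ> g' a = id"
  using det lin[OF U(2)] by (metis det_nz_iff_inj linear_injective_left_inverse)
 have "\<exists>d>0. \<forall>x. dist a x < d --> onorm (%v. g' x v - g' a v) < e" if "e > 0" for e
 proof -
  let ?F = "%x. \<Sum>j\<in>UNIV. norm (g' x (axis j 1) - g' a (axis j 1))"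
  have "continuous_on U ?F" by (intro continuous_intros cont)
  then have "isCont ?F a" using U continuous_on_eq_continuous_at by blast
  then have "\<forall>\<^sub>F x in at a. ?F x < e"
   using order_tendstoD(2)[of ?F "?F a" "at a" e] that by (simp add: isCont_def)
  then obtain d1 where d1: "d1 > 0" "!!x. x ~= a ==> dist x a < d1 ==> ?F x < e"
   by (auto simp: eventually_at)
  obtain d2 where d2: "d2 > 0" "ball a d2 \<subseteq> U" using U open_contains_ball by blast
  show ?thesis
  proof (intro exI[of _ "min d1 d2"] conjI allI impI)
   show "min d1 d2 > 0" using d1 d2 by simp
   fix x assume x: "dist a x < min d1 d2"
   then have xU: "x \<in> U" using d2 by auto
   have "onorm (%v. g' x v - g' a v) \<le> ?F x"
    by (rule onorm_le_sum_axis) (intro linear_compose_sub lin xU U)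
   moreover have "?F x < e" using d1(2)[of x] x that by (cases "x = a") (auto simp: dist_commute)
   ultimately show "onorm (%v. g' x v - g' a v) < e" by simp
  qed
 qed
 then show ?thesis
  using has_derivative_locally_injective[of a U B g' g, OF U(2,1) _ B(2) der] B(1) that
  by (auto simp: linear_conv_bounded_linear)
qed

text \<open>At regular points the map is locally injective, so countably many open sets of
  injectivity cover them. Cut to disjoint pieces, each piece contributes by the change of variables,
  and the number of regular preimages of c is the number of pieces whose image contains c. Critical
  points contribute nothing on the right, where the Jacobian vanishes, and their values form a null
  set by Sard's theorem.\<close>

lemma area_formula_wellorder:
 fixes g :: "real^'k::{finite,wellorder} => real^'k::_" and k :: "real^'k::_ => real"
 assumes U: "open U"
  and der: "!!x. x \<in> U ==> (g has_derivative g' x) (at x)"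
  and cont: "!!w. continuous_on U (%x. g' x w)"
  and S: "S \<in> sets borel" "S \<subseteq> U"
  and k: "k \<in> borel_measurable borel" "!!x. 0 \<le> k x" "integrable lborel k"
 shows "(\<integral>\<^sup>+c. ennreal (k c) * num_elements {x\<in>S. g x = c} \<partial>lborel) =
  (\<integral>\<^sup>+x. indicator S x * (ennreal \<bar>det (matrix (g' x))\<bar> * ennreal (k (g x))) \<partial>lborel)"
proof -
 define J where "J x = det (matrix (g' x))" for x
 have contJ: "continuous_on U J"
  unfolding J_def det_def matrix_def
  by (intro continuous_intros) (simp, intro continuous_intros cont)
 define S0 where "S0 = {x\<in>S. J x ~= 0}"
 define S1 where "S1 = {x\<in>S. J x = 0}"
 have "open {x\<in>U. J x ~= 0}"
  using continuous_open_preimage[OF contJ U, of "-{0}"] by (auto simp: vimage_def Int_def)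
 moreover have "S0 = S \<inter> {x\<in>U. J x ~= 0}" using S by (auto simp: S0_def)
 ultimately have S0: "S0 \<in> sets borel" using S by auto
 \<comment> \<open>Boundedness of the sets and of the Jacobian makes the Jacobian integrable on each
   piece, which is how the images of the pieces are shown to be Lebesgue measurable.\<close>
 define F where "F = {B. open B \<and> B \<subseteq> U \<and> inj_on g B \<and> bounded B \<and> (\<exists>N. \<forall>x\<in>B. \<bar>J x\<bar> \<le> N)}"
 have "\<exists>B\<in>F. x \<in> B" if "x \<in> S0" for x
 proof -
  have x: "x \<in> U" "J x ~= 0" using that S by (auto simp: S0_def)
  obtain r where r: "r > 0" "ball x r \<subseteq> U" "inj_on g (ball x r)"
   using locally_injective_C1[OF U x(1) der cont] x(2) unfolding J_def by metis
  have op: "open {y\<in>U. \<bar>J y\<bar> < \<bar>J x\<bar> + 1}"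
   using continuous_open_preimage[OF continuous_on_rabs[OF contJ] U, of "{..<\<bar>J x\<bar> + 1}"]
   by (auto simp: vimage_def Int_def)
  let ?B = "ball x r \<inter> {y\<in>U. \<bar>J y\<bar> < \<bar>J x\<bar> + 1}"
  have "open ?B" using op by auto
  moreover have "?B \<subseteq> U" by auto
  moreover have "inj_on g ?B" using r(3) by (rule inj_on_subset) auto
  moreover have "bounded ?B" by (rule bounded_subset[OF bounded_ball[of x r]]) auto
  moreover have "\<forall>y\<in>?B. \<bar>J y\<bar> \<le> \<bar>J x\<bar> + 1" by auto
  ultimately have "?B \<in> F" unfolding F_def by blast
  then show ?thesis by (rule rev_bexI) (use x r in auto)
 qed
 then have S0F: "S0 \<subseteq> \<Union>F" by auto
 obtain F' where F': "F' \<subseteq> F" "countable F'" "\<Union>F' = \<Union>F"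
  using Lindelof[of F] by (auto simp: F_def)
 define B where "B = from_nat_into (insert {} F')"
 have "{} \<in> F" by (auto simp: F_def)
 have BF: "B j \<in> F" for j
  using from_nat_into[of "insert {} F'" j] F' \<open>{} \<in> F\<close> unfolding B_def by auto
 have "range B = insert {} F'" unfolding B_def using F'(2) by (intro range_from_nat_into) auto
 then have UB: "(\<Union>j. B j) = \<Union>F" using F'(3) by auto
 define T where "T j = S0 \<inter> disjointed B j" for j
 have Bb: "B j \<in> sets borel" for j using BF[of j] by (auto simp: F_def)
 have dB: "disjointed B j \<in> sets borel" for j
  by (rule sets.range_disjointed_sets'[THEN subsetD, of B]) (use Bb in auto)
 have T: "T j \<in> sets borel" for j unfolding T_def using S0 dB by auto
 have TB: "T j \<subseteq> B j" for j unfolding T_def using disjointed_subset[of B j] by auto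
 have disj: "disjoint_family T"
  using disjoint_family_disjointed[of B] unfolding T_def disjoint_family_on_def by blast
 have UT: "(\<Union>j. T j) = S0" using S0F UB UN_disjointed_eq[of B] unfolding T_def by blast
 have injT: "inj_on g (T j)" for j using BF[of j] TB[of j] by (auto simp: F_def intro: inj_on_subset)
 have derT: "(g has_derivative g' x) (at x within T j)" if "x \<in> T j" for x j
  by (rule has_derivative_at_withinI[OF der]) (use that TB[of j] BF[of j] in \<open>auto simp: F_def\<close>)
 have gT: "g ` T j \<in> sets lebesgue" for j
 proof -
  obtain N where N: "!!x. x \<in> B j ==> \<bar>J x\<bar> \<le> N" and bd: "bounded (B j)" "B j \<subseteq> U" using BF[of j] by (auto simp: F_def)
  have "bounded (T j)" using bd TB[of j] bounded_subset by blast
  then have Tl: "T j \<in> lmeasurable" using T[of j] by (intro bounded_set_imp_lmeasurable) auto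
  have "J \<in> borel_measurable (lebesgue_on (T j))"
   by (rule borel_measurable_det_Jacobian[OF _ derT, folded J_def]) (use T in auto)
  then have "(%x. \<bar>J x\<bar>) \<in> borel_measurable (lebesgue_on (T j))" by simp
  then have "(%x. \<bar>J x\<bar>) absolutely_integrable_on T j"
   using N TB[of j] Tl
   by (intro measurable_bounded_by_integrable_imp_absolutely_integrable[where g="%_. N"])
     (auto intro: fmeasurableD integrable_on_const)
  then have "g ` T j \<in> lmeasurable"
   using measurable_differentiable_image_alt[OF _ derT injT, of j] T[of j] by (simp add: J_def)
  then show ?thesis by auto
 qed
 have kT: "k absolutely_integrable_on (g ` T j)" for j
 proof -
  have "integrable lebesgue k" using k integrable_completion by blast
  then have "set_integrable lebesgue UNIV k" by (simp add: set_integrable_def)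
  then show ?thesis by (rule set_integrable_subset) (use gT in auto)
 qed
 note cov = change_of_variables_real[OF _ derT injT kT]
 have Tl: "T j \<in> sets lebesgue" for j using T by simp
 have step: "(\<integral>\<^sup>+c. ennreal (k c) * indicator (g ` T j) c \<partial>lebesgue) =
  (\<integral>\<^sup>+x. ennreal (\<bar>J x\<bar> * k (g x)) * indicator (T j) x \<partial>lebesgue)" for j
 proof -
  have 1: "(k has_integral integral (g ` T j) k) (g ` T j)"
   using kT[of j] by (simp add: absolutely_integrable_on_def integrable_integral)
  have 2: "((%x. \<bar>J x\<bar> * k (g x)) has_integral integral (g ` T j) k) (T j)"
   using cov(1)[OF Tl] cov(2)[OF Tl] unfolding J_def
   by (metis (no_types, lifting) absolutely_integrable_on_def integrable_integral)
  show ?thesis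
   unfolding nn_integral_completion
   using nn_integral_has_integral_lebesgue'[OF _ 1] nn_integral_has_integral_lebesgue'[OF _ 2] k(2)
   by (simp add: zero_le_mult_iff)
 qed
 have "rank (matrix (g' x)) < CARD('k)" if "x \<in> S1" for x
  using that has_derivative_linear[OF der, of x] S
  by (auto simp: S1_def J_def less_rank_noninjective det_nz_iff_inj[symmetric])
 then have "negligible (g ` S1)"
  by (intro baby_Sard[where f'=g']) (use S der in \<open>auto simp: S1_def intro: has_derivative_at_withinI\<close>)
 then have "AE c in lebesgue. c \<notin> g ` S1"
  by (auto simp: negligible_iff_null_sets intro: AE_not_in)
 then have ae: "AE c in lebesgue. ennreal (k c) * emeasure (count_space UNIV) {x\<in>S. g x = c} =
   suminf (%j. ennreal (k c) * indicator (g ` T j) c)"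
 proof eventually_elim
  case (elim c)
  have "{x\<in>S. g x = c} = (\<Union>j. {x \<in> T j. g x = c})"
  proof -
   have "{x\<in>S. g x = c} = {x\<in>S0. g x = c}" using elim by (auto simp: S0_def S1_def)
   then show ?thesis unfolding UT[symmetric] by auto
  qed
  moreover have "disjoint_family (%j. {x \<in> T j. g x = c})"
   using disj unfolding disjoint_family_on_def by blast
  ultimately have "emeasure (count_space UNIV) {x\<in>S. g x = c} = suminf (%j. emeasure (count_space UNIV) {x \<in> T j. g x = c})"
   using suminf_emeasure[of "%j. {x \<in> T j. g x = c}" "count_space UNIV"] by auto
  also have "\<dots> = suminf (%j. indicator (g ` T j) c)"
  proof (intro suminf_cong)
   fix j
   show "emeasure (count_space UNIV) {x \<in> T j. g x = c} = indicator (g ` T j) c"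
   proof (cases "c \<in> g ` T j")
    case True
    then obtain x where "x \<in> T j" "g x = c" by auto
    then have "{x \<in> T j. g x = c} = {x}" using injT[of j] by (auto simp: inj_on_def)
    then show ?thesis using True by simp
   next
    case False
    then have "{x \<in> T j. g x = c} = {}" by auto
    then show ?thesis using False by (metis emeasure_empty indicator_simps(2))
   qed
  qed
  finally show ?case by (simp add: ennreal_suminf_cmult)
 qed
 have "(\<integral>\<^sup>+c. ennreal (k c) * emeasure (count_space UNIV) {x\<in>S. g x = c} \<partial>lborel) =
  (\<integral>\<^sup>+c. ennreal (k c) * emeasure (count_space UNIV) {x\<in>S. g x = c} \<partial>lebesgue)"
  by (rule nn_integral_completion[symmetric])
 also have "\<dots> = (\<integral>\<^sup>+c. suminf (%j. ennreal (k c) * indicator (g ` T j) c) \<partial>lebesgue)"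
  by (rule nn_integral_cong_AE) (rule ae)
 also have "\<dots> = suminf (%j. \<integral>\<^sup>+c. ennreal (k c) * indicator (g ` T j) c \<partial>lebesgue)"
 proof (rule nn_integral_suminf)
  fix j
  have "k \<in> borel_measurable lebesgue" using k(1) by (simp add: measurable_completion)
  then show "(%c. ennreal (k c) * indicator (g ` T j) c) \<in> borel_measurable lebesgue" 
   using gT[of j] by measurable
 qed
 also have "\<dots> = suminf (%j. \<integral>\<^sup>+x. ennreal (\<bar>J x\<bar> * k (g x)) * indicator (T j) x \<partial>lebesgue)"
  by (simp only: step)
 also have "\<dots> = (\<integral>\<^sup>+x. suminf (%j. ennreal (\<bar>J x\<bar> * k (g x)) * indicator (T j) x) \<partial>lebesgue)"
 proof (rule nn_integral_suminf[symmetric])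
  fix j
  have "(%x. indicator (T j) x *\<^sub>R (\<bar>J x\<bar> * k (g x))) \<in> borel_measurable lebesgue"
   using cov(1)[OF Tl, of j] unfolding J_def set_integrable_def by (rule borel_measurable_integrable)
  then have "(%x. ennreal (indicator (T j) x *\<^sub>R (\<bar>J x\<bar> * k (g x)))) \<in> borel_measurable lebesgue"
   by measurable
  also have "(%x. ennreal (indicator (T j) x *\<^sub>R (\<bar>J x\<bar> * k (g x)))) = (%x. ennreal (\<bar>J x\<bar> * k (g x)) * indicator (T j) x)"
   by (auto simp: fun_eq_iff indicator_def)
  finally show "(%x. ennreal (\<bar>J x\<bar> * k (g x)) * indicator (T j) x) \<in> borel_measurable lebesgue" .
 qed
 also have "\<dots> = (\<integral>\<^sup>+x. indicator S x * (ennreal \<bar>J x\<bar> * ennreal (k (g x))) \<partial>lebesgue)"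
 proof (rule nn_integral_cong)
  fix x
  have "suminf (%j. ennreal (\<bar>J x\<bar> * k (g x)) * indicator (T j) x) = ennreal (\<bar>J x\<bar> * k (g x)) * indicator S0 x"
   using suminf_indicator[OF disj, of x] by (simp add: ennreal_suminf_cmult UT)
  also have "\<dots> = indicator S x * (ennreal \<bar>J x\<bar> * ennreal (k (g x)))"
   using k(2) by (auto simp: S0_def indicator_def ennreal_mult)
  finally show "suminf (%j. ennreal (\<bar>J x\<bar> * k (g x)) * indicator (T j) x) = \<dots>" .
 qed
 also have "\<dots> = (\<integral>\<^sup>+x. indicator S x * (ennreal \<bar>J x\<bar> * ennreal (k (g x))) \<partial>lborel)"
  by (rule nn_integral_completion)
 finally show ?thesis by (simp add: J_def num_elements_def)
qed

section \<open>Transfer of the area formula to coordinate subspaces\<close>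

lemma num_elements_bij:
 assumes "bij_betw f A B" shows "num_elements A = num_elements B"
proof (cases "finite A")
 case True
 then have "finite B" using assms bij_betw_finite by blast
 then show ?thesis using True bij_betw_same_card[OF assms] by (simp add: num_elements_def)
next
 case False
 then have "infinite B" using assms bij_betw_finite by blast
 then show ?thesis using False by (simp add: num_elements_def)
qed

text \<open>The change of variables theorem asks for a well-ordered index type. This copy of
  \<open>'a\<close>, ordered as an initial segment of the natural numbers, makes it available for
  every finite index type, at the price of a relabelling.\<close>

typedef (overloaded) ('a::finite) widx = "{..<CARD('a)}"
 by (rule exI[of _ 0]) simp

instance widx :: (finite) finite
proof
 have "finite (Rep_widx ` (UNIV :: 'a widx set))"
  by (rule finite_subset[of _ "{..<CARD('a)}"]) (use Rep_widx in auto)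
 then show "finite (UNIV :: 'a widx set)"
  by (rule finite_imageD) (simp add: inj_on_def Rep_widx_inject)
qed

instantiation widx :: (finite) wellorder
begin
definition "x \<le> y \<longleftrightarrow> Rep_widx x \<le> Rep_widx y"
definition "x < y \<longleftrightarrow> Rep_widx x < Rep_widx y"
instance
proof
 fix P :: "'a widx => bool" and a :: "'a widx"
 assume *: "!!x. (!!y. y < x ==> P y) ==> P x"
 show "P a"
  by (induction a rule: measure_induct_rule[of Rep_widx]) (use * in \<open>auto simp: less_widx_def\<close>)
qed (auto simp: less_eq_widx_def less_widx_def Rep_widx_inject)
end

lemma card_widx: "CARD('a::finite widx) = CARD('a)"
proof -
 have "Rep_widx ` (UNIV :: 'a widx set) = {..<CARD('a)}"
  using type_definition.Rep_range[OF type_definition_widx] .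
 then have "card (Rep_widx ` (UNIV :: 'a widx set)) = CARD('a)" by simp
 then show ?thesis by (subst (asm) card_image) (auto simp: inj_on_def Rep_widx_inject)
qed

lemma ex_bij_widx: "\<exists>h :: 'a::finite => 'a widx. bij h"
 using finite_same_card_bij[of "UNIV :: 'a set" "UNIV :: 'a widx set"] card_widx[where 'a='a] by auto

text \<open>Conjugation with \<open>h\<close> is a sign-preserving bijection between the
  permutations of the two index types, under which the Leibniz sums agree term by term.\<close>

lemma det_relabel:
 fixes h :: "'a::finite => 'b::finite" and A :: "real^'b^'b"
 assumes h: "bij h"
 shows "det (\<chi> i j. A $ h i $ h j) = det A"
proof -
 have hi: "inv h (h x) = x" "h (inv h y) = y" for x y
  using h by (auto simp: bij_is_inj bij_is_surj surj_f_inv_f)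
 have "(\<Sum>q | q permutes UNIV. of_int (sign q) * (\<Prod>i\<in>UNIV. A $ h i $ h (q i))) =
  (\<Sum>q | q permutes UNIV. of_int (sign q) * (\<Prod>i\<in>UNIV. A $ i $ q i))"
 proof (rule sum.reindex_bij_witness[of _ "%q. inv h \<circ> q \<circ> h" "%q. h \<circ> q \<circ> inv h"])
  fix q :: "'a => 'a" assume "q \<in> {q. q permutes UNIV}"
  then have q: "q permutes UNIV" by simp
  then show "inv h \<circ> (h \<circ> q \<circ> inv h) \<circ> h = q" by (simp add: fun_eq_iff hi)
  have "bij q" using q by (rule permutes_bij)
  then have "bij (h \<circ> q \<circ> inv h)" using h by (intro bij_comp bij_imp_bij_inv)
  then show "h \<circ> q \<circ> inv h \<in> {q. q permutes UNIV}" by (auto intro!: bij_imp_permutes)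
  have "sign (map_permutation UNIV h q) = sign q"
   using h q by (intro sign_map_permutation) (auto simp: bij_is_inj)
  moreover have "map_permutation UNIV h q = h \<circ> q \<circ> inv h"
   using h by (auto simp: map_permutation_def restrict_id_def bij_is_surj fun_eq_iff)
  moreover have "(\<Prod>i\<in>UNIV. A $ i $ (h \<circ> q \<circ> inv h) i) = (\<Prod>i\<in>UNIV. A $ h i $ h (q i))"
   by (rule prod.reindex_bij_witness[of _ h "inv h"]) (auto simp: hi)
  ultimately show "of_int (sign (h \<circ> q \<circ> inv h)) * (\<Prod>i\<in>UNIV. A $ i $ (h \<circ> q \<circ> inv h) i) =
   of_int (sign q) * (\<Prod>i\<in>UNIV. A $ h i $ h (q i))" by simp
 next
  fix q :: "'b => 'b" assume "q \<in> {q. q permutes UNIV}"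
  then have q: "q permutes UNIV" by simp
  then show "h \<circ> (inv h \<circ> q \<circ> h) \<circ> inv h = q" by (simp add: fun_eq_iff hi)
  have "bij (inv h \<circ> q \<circ> h)" using h permutes_bij[OF q] by (intro bij_comp bij_imp_bij_inv)
  then show "inv h \<circ> q \<circ> h \<in> {q. q permutes UNIV}" by (auto intro!: bij_imp_permutes)
 qed
 then show ?thesis by (simp add: det_def)
qed

lemma vec_component_measurable [measurable]: "(%x::real^'n. x $ i) \<in> borel_measurable borel"
 by (intro borel_measurable_continuous_onI continuous_intros)

lemma borel_measurable_vec [measurable (raw)]:
 fixes f :: "'a => 'n::finite => real"
 assumes "!!i. (%x. f x i) \<in> borel_measurable M"
 shows "(%x. \<chi> i. f x i) \<in> borel_measurable M"
proof (rule iffD2[OF borel_measurable_euclidean_space], rule ballI)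
 fix b :: "real^'n" assume "b \<in> Basis"
 then obtain i where "b = axis i 1" by (auto simp: Basis_vec_def)
 then show "(%x. (\<chi> i. f x i) \<bullet> b) \<in> borel_measurable M" using assms[of i] by (simp add: inner_axis)
qed

text \<open>Vectors and functions on an index set carry the same Lebesgue measure, since both
  measures give boxes their volume; \<open>h\<close> absorbs the change of index type.\<close>

lemma nn_integral_lborel_vec:
 fixes F :: "real^'b::finite => ennreal" and h :: "'b => 'a::finite"
 assumes h: "bij h" and F: "F \<in> borel_measurable borel"
 shows "(\<integral>\<^sup>+x. F x \<partial>lborel) = (\<integral>\<^sup>+x. F (\<chi> j. x (h j)) \<partial>PiM (UNIV::'a set) (%_. lborel))"
proof -
 let ?L = "PiM (UNIV::'a set) (%_. lborel :: real measure)"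
 have m: "(%x. \<chi> j. x (h j)) \<in> ?L \<rightarrow>\<^sub>M borel" by measurable
 have hi: "inv h (h x) = x" "h (inv h y) = y" for x y
  using h by (auto simp: bij_is_inj bij_is_surj surj_f_inv_f)
 have "lborel = distr ?L borel (%x. \<chi> j. x (h j))"
 proof (rule lborel_eqI)
  fix l u :: "real^'b" assume lu: "!!b. b \<in> Basis ==> l \<bullet> b \<le> u \<bullet> b"
  have "(%x. \<chi> j. x (h j)) -` box l u \<inter> space ?L = PiE UNIV (%a. {l $ inv h a <..< u $ inv h a})"
   by (auto simp: mem_box_cart space_PiM PiE_def Pi_def) (metis hi)+
  then have "emeasure (distr ?L borel (%x. \<chi> j. x (h j))) (box l u) = (\<Prod>a\<in>UNIV. emeasure lborel {l $ inv h a <..< u $ inv h a})"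
   by (simp add: emeasure_distr[OF m] lborelP.emeasure_PiM)
  also have "\<dots> = (\<Prod>a\<in>UNIV. ennreal (u $ inv h a - l $ inv h a))"
   using lu[of "axis _ 1"] by (intro prod.cong refl emeasure_lborel_Ioo) (auto simp: inner_axis Basis_vec_def)
  also have "\<dots> = (\<Prod>j\<in>UNIV. ennreal (u $ j - l $ j))"
   by (rule prod.reindex_bij_witness[of _ h "inv h"]) (auto simp: hi)
  also have "\<dots> = ennreal (\<Prod>j\<in>UNIV. u $ j - l $ j)"
   using lu[of "axis _ 1"] by (intro prod_ennreal) (auto simp: inner_axis Basis_vec_def)
  also have "(\<Prod>j\<in>UNIV. u $ j - l $ j) = (\<Prod>b\<in>Basis. (u - l) \<bullet> b)"
  proof -
   have B: "(Basis :: (real^'b) set) = (%j. axis j 1) ` UNIV" by (auto simp: Basis_vec_def)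
   have "inj (%j::'b. axis j (1::real))" by (auto simp: inj_on_def axis_eq_axis)
   then show ?thesis unfolding B by (subst prod.reindex) (auto simp: inner_axis)
  qed
  finally show "emeasure (distr ?L borel (%x. \<chi> j. x (h j))) (box l u) = ennreal (\<Prod>b\<in>Basis. (u - l) \<bullet> b)" .
 qed simp
 then show ?thesis using nn_integral_distr[OF m, of F] F by simp
qed

text \<open>The dimension varies while the index type stays fixed: a subset \<open>K\<close> of the
  indices stands for the subspace of vectors that vanish outside \<open>K\<close>.\<close>

definition vecK :: "'n set => ('n => real) => real^'n::finite" where
 "vecK K y = (\<chi> i. if i \<in> K then y i else 0)"

lemma vecK_nth [simp]: "vecK K y $ i = (if i \<in> K then y i else 0)"
 by (simp add: vecK_def)

definition coord_space :: "'n set => (real^'n::finite) set" where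
 "coord_space K = {x. \<forall>i. i \<notin> K --> x $ i = 0}"

text \<open>The identity block outside \<open>K\<close> makes the determinant that of the minor on
  \<open>K\<close>.\<close>

definition matK :: "'n set => ('n => 'n => real) => real^'n^'n::finite" where
 "matK K A = (\<chi> i j. if i \<in> K \<and> j \<in> K then A i j else if i = j then 1 else 0)"

text \<open>Continuous differentiability with the partial derivatives as explicit data, so that
  Jacobian matrices can be written entry by entry and evaluated at a point.\<close>

definition has_grad :: "(real^'n) set => (real^'n => real) => ('n::finite => real^'n => real) => bool" where
 "has_grad U F D \<longleftrightarrow> (\<forall>y\<in>U. (F has_derivative (%w. \<Sum>i\<in>UNIV. D i y * w $ i)) (at y)) \<and> (\<forall>i. continuous_on U (D i))"

text \<open>The coordinates outside \<open>K\<close> run over unit intervals and integrate to 1;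
  this turns integrals over a coordinate subspace into integrals over the full space.\<close>

lemma nn_integral_PiM_dummy:
 fixes K :: "'n::finite set" and q :: "('n => real) => ennreal"
 assumes q: "q \<in> borel_measurable (PiM K (%_. lborel))"
 shows "(\<integral>\<^sup>+x. q (restrict x K) * (\<Prod>i\<in>-K. indicator {0..1} (x i)) \<partial>PiM UNIV (%_. lborel)) =
  (\<integral>\<^sup>+x. q x \<partial>PiM K (%_. lborel :: real measure))"
proof -
 let ?f = "%x. q (restrict x K) * (\<Prod>i\<in>-K. indicator {0..1} (x i))"
 have U: "UNIV = K \<union> -K" by auto
 have [measurable]: "(%x. restrict x K) \<in> PiM UNIV (%_. lborel) \<rightarrow>\<^sub>M PiM K (%_. lborel :: real measure)"
  by (rule measurable_restrict_subset) simp
 note [measurable] = q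
 have "(\<integral>\<^sup>+x. ?f x \<partial>PiM UNIV (%_. lborel)) = (\<integral>\<^sup>+x. ?f x \<partial>PiM (K \<union> -K) (%_. lborel))"
  by (simp only: U[symmetric])
 also have "\<dots> = (\<integral>\<^sup>+x. (\<integral>\<^sup>+y. ?f (merge K (-K) (x, y)) \<partial>PiM (-K) (%_. lborel)) \<partial>PiM K (%_. lborel))"
 proof (rule lborelP.product_nn_integral_fold)
  have "?f \<in> borel_measurable (PiM UNIV (%_. lborel))" by measurable
  then show "?f \<in> borel_measurable (PiM (K \<union> -K) (%_. lborel))" by (simp only: U[symmetric])
 qed auto
 also have "\<dots> = (\<integral>\<^sup>+x. (\<integral>\<^sup>+y. q x * (\<Prod>i\<in>-K. indicator {0..1::real} (y i)) \<partial>PiM (-K) (%_. lborel)) \<partial>PiM K (%_. lborel))"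
 proof (rule nn_integral_cong, rule nn_integral_cong)
  fix x y :: "'n => real" assume x: "x \<in> space (PiM K (%_. lborel :: real measure))"
  have "restrict (merge K (-K) (x, y)) K = x" using x by (auto simp: merge_def space_PiM PiE_def extensional_def fun_eq_iff)
  moreover have "(\<Prod>i\<in>-K. indicator {0..1} (merge K (-K) (x, y) i)) = (\<Prod>i\<in>-K. indicator {0..1} (y i) :: ennreal)"
   by (intro prod.cong) (auto simp: merge_def)
  ultimately show "?f (merge K (-K) (x, y)) = q x * (\<Prod>i\<in>-K. indicator {0..1} (y i))" by simp
 qed
 also have "\<dots> = (\<integral>\<^sup>+x. q x * (\<integral>\<^sup>+y. (\<Prod>i\<in>-K. indicator {0..1::real} (y i)) \<partial>PiM (-K) (%_. lborel)) \<partial>PiM K (%_. lborel))"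
  by (intro nn_integral_cong nn_integral_cmult) measurable
 also have "(\<integral>\<^sup>+y. (\<Prod>i\<in>-K. indicator {0..1::real} (y i)) \<partial>PiM (-K) (%_. lborel)) = (1::ennreal)"
  using lborelP.product_nn_integral_prod[of "-K" "%_. indicator {0..1::real}"] by simp
 finally show ?thesis by (simp only: mult_1_right)
qed

text \<open>The map on the subspace is extended by the identity in the coordinates outside
  \<open>K\<close>, which are confined to the unit interval. The extension has the same Jacobian
  determinant and fibres of the same size, so the full-dimensional formula applies, and the dummy
  coordinates are integrated out on both sides.\<close>

lemma area_formula_K:
 fixes K :: "'n::finite set" and F :: "'n => real^'n => real" and k :: "('n => real) => real"
 assumes U: "open U"
  and grad: "!!i. i \<in> K ==> has_grad U (F i) (D i)"
  and S: "S \<in> sets borel" "S \<subseteq> U"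
  and k: "k \<in> borel_measurable (PiM K (%_. lborel))" "!!c. 0 \<le> k c"
   "(\<integral>\<^sup>+c. ennreal (k c) \<partial>PiM K (%_. lborel)) < \<infinity>"
  and num: "(%c. num_elements {y \<in> coord_space K \<inter> S. \<forall>i\<in>K. F i y = c i}) \<in> borel_measurable (PiM K (%_. lborel))"
 shows "(\<integral>\<^sup>+c. ennreal (k c) * num_elements {y \<in> coord_space K \<inter> S. \<forall>i\<in>K. F i y = c i} \<partial>PiM K (%_. lborel)) =
  (\<integral>\<^sup>+y. indicator S (vecK K y) * (ennreal \<bar>det (matK K (%i j. D i j (vecK K y)))\<bar> *
    ennreal (k (\<lambda>i\<in>K. F i (vecK K y)))) \<partial>PiM K (%_. lborel))"
proof -
 obtain h :: "'n => 'n widx" where h: "bij h" using ex_bij_widx by blast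
 define hi where "hi = inv h"
 have bhi: "bij hi" using h by (simp add: hi_def bij_imp_bij_inv)
 have [simp]: "hi (h x) = x" "h (hi y) = y" for x y
  using h by (auto simp: hi_def bij_is_inj bij_is_surj surj_f_inv_f)
 have hinj[simp]: "h x = h y \<longleftrightarrow> x = y" for x y using h by (auto simp: bij_is_inj inj_eq)
 define pK where "pK X = vecK K (%i. X $ h i)" for X :: "real^'n widx"
 have pK_lin: "bounded_linear pK"
  by (rule linear_conv_bounded_linear[THEN iffD1]) (auto intro!: linearI simp: pK_def vec_eq_iff)
 define g where "g X = (\<chi> j. if hi j \<in> K then F (hi j) (pK X) else X $ j)" for X :: "real^'n widx"
 define g' where "g' X W = (\<chi> j. if hi j \<in> K then (\<Sum>l\<in>UNIV. D (hi j) l (pK X) * pK W $ l) else W $ j)" for X W :: "real^'n widx"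
 define U' where "U' = pK -` U"
 define S' where "S' = {X. pK X \<in> S \<and> (\<forall>i\<in>-K. X $ h i \<in> {0..1})}"
 define q where "q C = k (\<lambda>i\<in>K. C $ h i) * (\<Prod>i\<in>-K. indicator {0..1} (C $ h i))" for C :: "real^'n widx"
 have pKc: "continuous_on A pK" for A by (rule linear_continuous_on[OF pK_lin])
 have U': "open U'" unfolding U'_def by (rule open_vimage[OF U pKc])
 have pKm[measurable]: "pK \<in> borel_measurable borel" by (rule borel_measurable_continuous_onI[OF pKc])
 note [measurable] = S(1) k(1)
 have S'm[measurable]: "S' \<in> sets borel" unfolding S'_def by measurable
 have S'U: "S' \<subseteq> U'" using S(2) by (auto simp: S'_def U'_def)
 have der: "(g has_derivative g' X) (at X)" if "X \<in> U'" for X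
 proof (rule has_derivative_componentwise_within[THEN iffD2], rule ballI)
  fix b :: "real^'n widx" assume "b \<in> Basis"
  then obtain j where b: "b = axis j 1" by (auto simp: Basis_vec_def)
  have "((%X. if hi j \<in> K then F (hi j) (pK X) else X $ j) has_derivative
   (%W. if hi j \<in> K then \<Sum>l\<in>UNIV. D (hi j) l (pK X) * pK W $ l else W $ j)) (at X)"
  proof (cases "hi j \<in> K")
   case True
   have "(F (hi j) has_derivative (%w. \<Sum>l\<in>UNIV. D (hi j) l (pK X) * w $ l)) (at (pK X))"
    using grad[OF True] that by (auto simp: has_grad_def U'_def)
   from has_derivative_compose[OF bounded_linear_imp_has_derivative[OF pK_lin] this]
   show ?thesis using True by simp
  qed (simp add: bounded_linear_imp_has_derivative bounded_linear_vec_nth)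
  then show "((%X. g X \<bullet> b) has_derivative (%W. g' X W \<bullet> b)) (at X)"
   unfolding b inner_axis g_def g'_def by simp
 qed
 have Dc: "continuous_on U' (%X. D i l (pK X))" if "i \<in> K" for i l
  by (rule continuous_on_compose2[OF _ pKc, where t=U]) (use grad[OF that] in \<open>auto simp: has_grad_def U'_def\<close>)
 have cont: "continuous_on U' (%X. g' X W)" for W
  unfolding g'_def
 proof (rule continuous_on_vec_lambda)
  fix j
  show "continuous_on U' (%X. if hi j \<in> K then \<Sum>l\<in>UNIV. D (hi j) l (pK X) * pK W $ l else W $ j)"
   by (cases "hi j \<in> K") (auto intro!: continuous_intros Dc)
 qed
 have J: "det (matrix (g' X)) = det (matK K (%i j. D i j (pK X)))" for X
 proof -
  have p: "pK (axis (h j) 1) = (if j \<in> K then axis j 1 else 0)" for j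
   by (auto simp: pK_def vec_eq_iff axis_def)
  have "matrix (g' X) $ h i $ h j = matK K (%i j. D i j (pK X)) $ i $ j" for i j
  proof (cases "j \<in> K")
   case True
   have "(\<Sum>l\<in>UNIV. D i l (pK X) * (axis j 1 :: real^'n) $ l) = D i j (pK X)"
    by (subst sum.remove[of _ j]) (auto simp: axis_def)
   then show ?thesis using True by (simp add: matrix_def matK_def g'_def p) (auto simp: axis_def)
  qed (simp add: matrix_def matK_def g'_def p, auto simp: axis_def)
  then have "matK K (%i j. D i j (pK X)) = (\<chi> i j. matrix (g' X) $ h i $ h j)"
   by (simp add: vec_eq_iff)
  then show ?thesis using det_relabel[OF h, of "matrix (g' X)"] by simp
 qed
 have qm[measurable]: "q \<in> borel_measurable borel"
 proof -
  have [measurable]: "(%C :: real^'n widx. \<lambda>i\<in>K. C $ h i) \<in> borel \<rightarrow>\<^sub>M PiM K (%_. lborel)"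
   by (rule measurable_restrict) (simp add: vec_component_measurable)
  show ?thesis unfolding q_def by measurable
 qed
 have q0: "0 \<le> q C" for C unfolding q_def by (intro mult_nonneg_nonneg k prod_nonneg) auto
 have qx: "ennreal (q (\<chi> j. x (hi j))) = ennreal (k (restrict x K)) * (\<Prod>i\<in>-K. indicator {0..1} (x i))" for x
 proof -
  have "ennreal (\<Prod>i\<in>-K. indicator {0..1} (x i)) = (\<Prod>i\<in>-K. indicator {0..1} (x i))"
   by (subst prod_ennreal[symmetric]) (auto simp: ennreal_indicator)
  moreover have "(\<lambda>i\<in>K. x i) = restrict x K" by simp
  ultimately show ?thesis
   unfolding q_def by (subst ennreal_mult) (auto intro!: k prod_nonneg)
 qed
 have "(\<integral>\<^sup>+C. ennreal (q C) \<partial>lborel) = (\<integral>\<^sup>+c. ennreal (k c) \<partial>PiM K (%_. lborel))"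
  using nn_integral_PiM_dummy[of "%c. ennreal (k c)" K]
  by (subst nn_integral_lborel_vec[OF bhi]) (simp_all only: qx, measurable)
 then have qi: "integrable lborel q"
  using k(3) q0 by (intro integrableI_nonneg) auto
 define n where "n c = num_elements {y \<in> coord_space K \<inter> S. \<forall>i\<in>K. F i y = c i}" for c
 have nm[measurable]: "n \<in> borel_measurable (PiM K (%_. lborel))" using num by (simp add: n_def[abs_def])
 have nr: "n (restrict c K) = n c" for c unfolding n_def by simp
 have fib: "num_elements {X\<in>S'. g X = C} = n (%i. C $ h i)" if C: "\<forall>i\<in>-K. C $ h i \<in> {0..1}" for C
  unfolding n_def
 proof (rule num_elements_bij)
  show "bij_betw pK {X\<in>S'. g X = C} {y \<in> coord_space K \<inter> S. \<forall>i\<in>K. F i y = C $ h i}"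
  proof (rule bij_betw_byWitness[where f'="%y. \<chi> j. if hi j \<in> K then y $ hi j else C $ j"])
   show "\<forall>X\<in>{X\<in>S'. g X = C}. (\<chi> j. if hi j \<in> K then pK X $ hi j else C $ j) = X"
    by (auto simp: vec_eq_iff pK_def g_def)
   have r: "pK (\<chi> j. if hi j \<in> K then y $ hi j else C $ j) = y" if "y \<in> coord_space K" for y
    using that by (auto simp: pK_def vec_eq_iff coord_space_def)
   then show "\<forall>y\<in>{y \<in> coord_space K \<inter> S. \<forall>i\<in>K. F i y = C $ h i}.
    pK (\<chi> j. if hi j \<in> K then y $ hi j else C $ j) = y" by auto
   show "pK ` {X\<in>S'. g X = C} \<subseteq> {y \<in> coord_space K \<inter> S. \<forall>i\<in>K. F i y = C $ h i}"
    by (auto simp: S'_def g_def coord_space_def pK_def)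
   show "(%y. \<chi> j. if hi j \<in> K then y $ hi j else C $ j) ` {y \<in> coord_space K \<inter> S. \<forall>i\<in>K. F i y = C $ h i}
    \<subseteq> {X\<in>S'. g X = C}"
   proof safe
    fix y assume y: "y \<in> coord_space K" "y \<in> S" "\<forall>i\<in>K. F i y = C $ h i"
    let ?X = "\<chi> j. if hi j \<in> K then y $ hi j else C $ j"
    show "?X \<in> S'" using y C r[OF y(1)] by (auto simp: S'_def)
    have "g ?X $ j = C $ j" for j
     unfolding g_def r[OF y(1)] using y(3) by auto
    then show "g ?X = C" by (simp add: vec_eq_iff)
   qed
  qed
 qed
 have "(\<integral>\<^sup>+c. ennreal (k c) * n c \<partial>PiM K (%_. lborel)) =
  (\<integral>\<^sup>+x. (ennreal (k (restrict x K)) * n (restrict x K)) * (\<Prod>i\<in>-K. indicator {0..1} (x i)) \<partial>PiM UNIV (%_. lborel))"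
  by (rule nn_integral_PiM_dummy[symmetric]) measurable
 also have "\<dots> = (\<integral>\<^sup>+x. ennreal (q (\<chi> j. x (hi j))) * n (restrict (%i. (\<chi> j. x (hi j)) $ h i) K) \<partial>PiM UNIV (%_. lborel))"
  by (simp add: qx mult_ac)
 also have "\<dots> = (\<integral>\<^sup>+C. ennreal (q C) * n (\<lambda>i\<in>K. C $ h i) \<partial>lborel)"
 proof (rule nn_integral_lborel_vec[OF bhi, symmetric])
  have [measurable]: "(%C :: real^'n widx. \<lambda>i\<in>K. C $ h i) \<in> borel \<rightarrow>\<^sub>M PiM K (%_. lborel)"
   by (rule measurable_restrict) (simp add: vec_component_measurable)
  show "(%C. ennreal (q C) * n (\<lambda>i\<in>K. C $ h i)) \<in> borel_measurable borel" by measurable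
 qed
 also have "\<dots> = (\<integral>\<^sup>+C. ennreal (q C) * num_elements {X\<in>S'. g X = C} \<partial>lborel)"
 proof (rule nn_integral_cong)
  fix C :: "real^'n widx"
  show "ennreal (q C) * n (\<lambda>i\<in>K. C $ h i) = ennreal (q C) * num_elements {X\<in>S'. g X = C}"
  proof (cases "\<forall>i\<in>-K. C $ h i \<in> {0..1}")
   case True
   then show ?thesis using fib[OF True] nr by simp
  next
   case False
   then obtain i where "i \<in> -K" "C $ h i \<notin> {0..1}" by blast
   then have "(\<Prod>i\<in>-K. indicator {0..1} (C $ h i) :: real) = 0" by (intro prod_zero bexI[of _ i]) auto
   then have "q C = 0" unfolding q_def by simp
   then show ?thesis by simp
  qed
 qed
 also have "\<dots> = (\<integral>\<^sup>+X. indicator S' X * (ennreal \<bar>det (matrix (g' X))\<bar> * ennreal (q (g X))) \<partial>lborel)"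
  by (rule area_formula_wellorder[OF U' der cont S'm S'U qm q0 qi])
 also have "\<dots> = (\<integral>\<^sup>+x. indicator S' (\<chi> j. x (hi j)) * (ennreal \<bar>det (matrix (g' (\<chi> j. x (hi j))))\<bar> * ennreal (q (g (\<chi> j. x (hi j))))) \<partial>PiM UNIV (%_. lborel))"
 proof (rule nn_integral_lborel_vec[OF bhi])
  have cJ: "continuous_on U' (%X. det (matrix (g' X)))"
   unfolding det_def matrix_def
   by (intro continuous_intros) (simp, intro continuous_intros cont)
  have cg: "continuous_on U' g"
   using der by (intro has_derivative_continuous_on) (blast intro: has_derivative_at_withinI)
  \<comment> \<open>The Jacobian and \<open>g\<close> are continuous on \<open>U'\<close> only. Cut
    off to \<open>S'\<close> they are Borel on the whole space, and the outer indicator makes the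
    cut-off invisible.\<close>
  have [measurable]: "(%X. indicator S' X *\<^sub>R det (matrix (g' X))) \<in> borel_measurable borel"
   "(%X. indicator S' X *\<^sub>R g X) \<in> borel_measurable borel"
   by (rule borel_measurable_continuous_on_indicator[OF S'm continuous_on_subset[OF cJ S'U]],
     rule borel_measurable_continuous_on_indicator[OF S'm continuous_on_subset[OF cg S'U]])
  have "(%X. indicator S' X * (ennreal \<bar>det (matrix (g' X))\<bar> * ennreal (q (g X)))) =
   (%X. indicator S' X * (ennreal \<bar>indicator S' X *\<^sub>R det (matrix (g' X))\<bar> * ennreal (q (indicator S' X *\<^sub>R g X))))"
   by (auto simp: fun_eq_iff indicator_def)
  also have "\<dots> \<in> borel_measurable borel" by measurable
  finally show "(%X. indicator S' X * (ennreal \<bar>det (matrix (g' X))\<bar> * ennreal (q (g X)))) \<in> borel_measurable borel" .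
 qed
 also have "\<dots> = (\<integral>\<^sup>+x. indicator S (vecK K (restrict x K)) * (ennreal \<bar>det (matK K (%i j. D i j (vecK K (restrict x K))))\<bar> *
    ennreal (k (\<lambda>i\<in>K. F i (vecK K (restrict x K))))) * (\<Prod>i\<in>-K. indicator {0..1} (x i)) \<partial>PiM UNIV (%_. lborel))"
 proof (rule nn_integral_cong)
  fix x :: "'n => real"
  let ?X = "\<chi> j. x (hi j)"
  have p: "pK ?X = vecK K x" by (simp add: pK_def)
  have r: "vecK K (restrict x K) = vecK K x" by (simp add: vec_eq_iff)
  have S': "indicator S' ?X = indicator S (vecK K x) * (\<Prod>i\<in>-K. indicator {0..1} (x i) :: ennreal)"
  proof (cases "\<forall>i\<in>-K. x i \<in> {0..1}")
   case True
   then show ?thesis by (auto simp: S'_def p indicator_def)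
  next
   case False
   then obtain i where "i \<in> -K" "x i \<notin> {0..1}" by blast
   moreover from this have "(\<Prod>i\<in>-K. indicator {0..1} (x i) :: ennreal) = 0" by (intro prod_zero bexI[of _ i]) auto
   moreover have "?X \<notin> S'" unfolding S'_def using \<open>i \<in> -K\<close> \<open>x i \<notin> {0..1}\<close> by force
   ultimately show ?thesis by simp
  qed
  have g: "g ?X $ h i = (if i \<in> K then F i (vecK K x) else x i)" for i
   by (simp add: g_def p)
  have "q (g ?X) = k (\<lambda>i\<in>K. F i (vecK K x)) * (\<Prod>i\<in>-K. indicator {0..1} (x i))"
   unfolding q_def g by (auto cong: restrict_cong)
  then have key: "(\<Prod>i\<in>-K. indicator {0..1} (x i)) * ennreal (q (g ?X)) = (\<Prod>i\<in>-K. indicator {0..1} (x i)) * ennreal (k (\<lambda>i\<in>K. F i (vecK K x)))"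
  proof (cases "\<forall>i\<in>-K. x i \<in> {0..1}")
   case False
   then obtain i where "i \<in> -K" "x i \<notin> {0..1}" by blast
   then have "(\<Prod>i\<in>-K. indicator {0..1} (x i) :: ennreal) = 0" by (intro prod_zero bexI[of _ i]) auto
   then show ?thesis by (simp only: mult_zero_left)
  qed simp
  have swap: "(s * P) * (d * a) = s * (d * b) * P" if "P * a = P * b" for s P d a b :: ennreal
  proof -
   have "(s * P) * (d * a) = s * d * (P * a)" by (simp only: mult_ac)
   also have "\<dots> = s * (d * b) * P" unfolding that by (simp only: mult_ac)
   finally show ?thesis .
  qed
  show "indicator S' ?X * (ennreal \<bar>det (matrix (g' ?X))\<bar> * ennreal (q (g ?X))) =
   indicator S (vecK K (restrict x K)) * (ennreal \<bar>det (matK K (%i j. D i j (vecK K (restrict x K))))\<bar> *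
    ennreal (k (\<lambda>i\<in>K. F i (vecK K (restrict x K))))) * (\<Prod>i\<in>-K. indicator {0..1} (x i))"
   unfolding S' J p r by (rule swap) (rule key)
 qed
 also have "\<dots> = (\<integral>\<^sup>+y. indicator S (vecK K y) * (ennreal \<bar>det (matK K (%i j. D i j (vecK K y)))\<bar> *
    ennreal (k (\<lambda>i\<in>K. F i (vecK K y)))) \<partial>PiM K (%_. lborel))"
 proof (rule nn_integral_PiM_dummy)
  have [measurable]: "vecK K \<in> PiM K (%_. lborel) \<rightarrow>\<^sub>M borel"
   unfolding vecK_def[abs_def]
  proof (rule borel_measurable_vec)
   fix i show "(%x. if i \<in> K then x i else 0) \<in> borel_measurable (PiM K (%_. lborel))"
    by (cases "i \<in> K") simp_all
  qed
  let ?d = "%y. det (matK K (%i j. D i j y))"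
  have cD: "continuous_on U (D i j)" "continuous_on U (F i)" if "i \<in> K" for i j
   using grad[OF that] by (auto simp: has_grad_def intro!: has_derivative_continuous_on intro: has_derivative_at_withinI)
  have "continuous_on U (%y. if i \<in> K \<and> j \<in> K then D i j y else if i = j then 1 else 0)" for i j
   using cD(1)[of i j] by (cases "i \<in> K \<and> j \<in> K") auto
  then have "continuous_on U ?d"
   unfolding det_def matK_def by (auto intro!: continuous_intros)
  then have d: "(%y. indicator S y *\<^sub>R ?d y) \<in> borel_measurable borel"
   by (rule borel_measurable_continuous_on_indicator[OF S(1) continuous_on_subset[OF _ S(2)]])
  have Fi: "(%y. indicator S y *\<^sub>R F i y) \<in> borel_measurable borel" if "i \<in> K" for i
   by (rule borel_measurable_continuous_on_indicator[OF S(1) continuous_on_subset[OF cD(2)[OF that] S(2)]])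
  have vm: "vecK K \<in> PiM K (%_. lborel) \<rightarrow>\<^sub>M borel" by measurable
  note [measurable] = measurable_compose[OF vm d]
  have [measurable]: "(%y. \<lambda>i\<in>K. indicator S (vecK K y) *\<^sub>R F i (vecK K y)) \<in> PiM K (%_. lborel) \<rightarrow>\<^sub>M PiM K (%_. lborel)"
   by (rule measurable_restrict) (use measurable_compose[OF vm Fi] in simp)
  have "(%y. indicator S (vecK K y) * (ennreal \<bar>indicator S (vecK K y) *\<^sub>R ?d (vecK K y)\<bar> *
     ennreal (k (\<lambda>i\<in>K. indicator S (vecK K y) *\<^sub>R F i (vecK K y))))) \<in> borel_measurable (PiM K (%_. lborel))"
   by measurable
  also have "(%y. indicator S (vecK K y) * (ennreal \<bar>indicator S (vecK K y) *\<^sub>R ?d (vecK K y)\<bar> *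
     ennreal (k (\<lambda>i\<in>K. indicator S (vecK K y) *\<^sub>R F i (vecK K y))))) =
   (%y. indicator S (vecK K y) * (ennreal \<bar>?d (vecK K y)\<bar> * ennreal (k (\<lambda>i\<in>K. F i (vecK K y)))))"
   by (auto simp: fun_eq_iff indicator_def)
  finally show "(%y. indicator S (vecK K y) * (ennreal \<bar>?d (vecK K y)\<bar> * ennreal (k (\<lambda>i\<in>K. F i (vecK K y))))) \<in> borel_measurable (PiM K (%_. lborel))" .
 qed
 finally show ?thesis by (simp only: n_def)
qed

section \<open>Measurability of the number of zeros\<close>

text \<open>By compactness a nonnegative continuous function has a zero in a nonempty
  \<open>K\<close> as soon as its infimum over \<open>K\<close> is 0, and the infimum can be read
  off a countable dense subset; so the uncountable quantifier becomes a countable one.\<close>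

lemma measurable_ex_zero:
 fixes u :: "'w => 'e::euclidean_space => real"
 assumes um: "!!s. (%\<omega>. u \<omega> s) \<in> borel_measurable M"
  and uc: "!!\<omega>. continuous_on UNIV (u \<omega>)" and u0: "!!\<omega> s. 0 \<le> u \<omega> s" and K: "compact K"
 shows "{\<omega>\<in>space M. \<exists>s\<in>K. u \<omega> s = 0} \<in> sets M"
proof -
 obtain D where D: "countable D" "D \<subseteq> K" "K \<subseteq> closure D" using separable by blast
 have "(\<exists>s\<in>K. u \<omega> s = 0) \<longleftrightarrow> (\<forall>i::nat. \<exists>d\<in>D. u \<omega> d < 1 / real (Suc i))" for \<omega>
 proof
  assume "\<exists>s\<in>K. u \<omega> s = 0"
  then obtain s where s: "s \<in> K" "u \<omega> s = 0" by auto
  show "\<forall>i::nat. \<exists>d\<in>D. u \<omega> d < 1 / real (Suc i)"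
  proof
   fix i
   have "open (u \<omega> -` {..<1 / real (Suc i)})" using uc by (intro open_vimage) auto
   moreover have "s \<in> u \<omega> -` {..<1 / real (Suc i)}" using s by simp
   moreover have "s \<in> closure D" using s D by auto
   ultimately have "(u \<omega> -` {..<1 / real (Suc i)}) \<inter> D ~= {}"
    using open_Int_closure_eq_empty[of "u \<omega> -` {..<1 / real (Suc i)}" D] by blast
   then show "\<exists>d\<in>D. u \<omega> d < 1 / real (Suc i)" by auto
  qed
 next
  assume *: "\<forall>i::nat. \<exists>d\<in>D. u \<omega> d < 1 / real (Suc i)"
  then have "K ~= {}" using D by blast
  then obtain s where s: "s \<in> K" "!!t. t \<in> K ==> u \<omega> s \<le> u \<omega> t"
   using continuous_attains_inf[OF K _ continuous_on_subset[OF uc]] by blast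
  have "u \<omega> s \<le> 0"
  proof (rule field_le_epsilon)
   fix e :: real assume "e > 0"
   then obtain i where "1 / real (Suc i) < e" using nat_approx_posE by blast
   moreover obtain d where "d \<in> D" "u \<omega> d < 1 / real (Suc i)" using * by blast
   ultimately show "u \<omega> s \<le> 0 + e" using s(2)[of d] D(2) by auto
  qed
  then show "\<exists>s\<in>K. u \<omega> s = 0" using s u0[of \<omega> s] by (intro bexI[of _ s]) auto
 qed
 then have "{\<omega>\<in>space M. \<exists>s\<in>K. u \<omega> s = 0} = {\<omega>\<in>space M. \<forall>i::nat. \<exists>d\<in>D. u \<omega> d < 1 / real (Suc i)}"
  by simp
 also have "\<dots> \<in> sets M"
  using um D(1) by measurable
 finally show ?thesis .
qed

text \<open>The open condition \<open>g \<omega> s > 0\<close> is exhausted by the closed conditions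
  with bound 1 / (j + 1), each of which merges with \<open>h \<omega> s = 0\<close> into the
  vanishing of one nonnegative function.\<close>

lemma measurable_ex_zero_pos:
 fixes h g :: "'w => 'e::euclidean_space => real"
 assumes hm: "!!s. (%\<omega>. h \<omega> s) \<in> borel_measurable M" and gm: "!!s. (%\<omega>. g \<omega> s) \<in> borel_measurable M"
  and hc: "!!\<omega>. continuous_on UNIV (h \<omega>)" and gc: "!!\<omega>. continuous_on UNIV (g \<omega>)" and K: "compact K"
 shows "{\<omega>\<in>space M. \<exists>s\<in>K. h \<omega> s = 0 \<and> g \<omega> s > 0} \<in> sets M"
proof -
 define u where "u j \<omega> s = \<bar>h \<omega> s\<bar> + max 0 (1 / real (Suc j) - g \<omega> s)" for j \<omega> s
 have u: "u j \<omega> s = 0 \<longleftrightarrow> h \<omega> s = 0 \<and> g \<omega> s \<ge> 1 / real (Suc j)" for j \<omega> s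
  unfolding u_def by (subst add_nonneg_eq_0_iff) auto
 have "(\<exists>s\<in>K. h \<omega> s = 0 \<and> g \<omega> s > 0) \<longleftrightarrow> (\<exists>j. \<exists>s\<in>K. u j \<omega> s = 0)" for \<omega>
 proof
  assume "\<exists>s\<in>K. h \<omega> s = 0 \<and> g \<omega> s > 0"
  then obtain s where s: "s \<in> K" "h \<omega> s = 0" "g \<omega> s > 0" by auto
  then obtain j where "1 / real (Suc j) < g \<omega> s" using nat_approx_posE by blast
  then show "\<exists>j. \<exists>s\<in>K. u j \<omega> s = 0" using s u by (meson less_imp_le)
 next
  assume "\<exists>j. \<exists>s\<in>K. u j \<omega> s = 0"
  then obtain j s where "s \<in> K" "h \<omega> s = 0" "g \<omega> s \<ge> 1 / real (Suc j)" using u by auto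
  moreover have "1 / real (Suc j) > 0" by simp
  ultimately show "\<exists>s\<in>K. h \<omega> s = 0 \<and> g \<omega> s > 0" by (meson less_le_trans)
 qed
 then have "{\<omega>\<in>space M. \<exists>s\<in>K. h \<omega> s = 0 \<and> g \<omega> s > 0} = (\<Union>j. {\<omega>\<in>space M. \<exists>s\<in>K. u j \<omega> s = 0})"
  by auto
 also have "\<dots> \<in> sets M"
 proof -
  have "{\<omega>\<in>space M. \<exists>s\<in>K. u j \<omega> s = 0} \<in> sets M" for j
  proof (rule measurable_ex_zero)
   show "(%\<omega>. u j \<omega> s) \<in> borel_measurable M" for s unfolding u_def using hm gm by measurable
   show "continuous_on UNIV (u j \<omega>)" for \<omega> unfolding u_def by (intro continuous_intros hc gc)
  qed (auto simp: u_def K)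
  then show ?thesis by auto
 qed
 finally show ?thesis .
qed

lemma num_elements_ge_card:
 assumes "finite T" "T \<subseteq> S" shows "of_nat (card T) \<le> num_elements S"
proof -
 have "of_nat (card T) = emeasure (count_space UNIV) T" using assms by simp
 also have "\<dots> \<le> num_elements S" unfolding num_elements_def by (rule emeasure_mono) (use assms in auto)
 finally show ?thesis .
qed

lemma num_elements_le:
 assumes "!!T. finite T ==> T \<subseteq> S ==> of_nat (card T) \<le> c"
 shows "num_elements S \<le> c"
proof (cases "finite S")
 case True then show ?thesis using assms[of S] by (simp add: num_elements_def)
next
 case False
 have "of_nat n \<le> c" for n :: nat
 proof -
  obtain T where "finite T" "card T = n" "T \<subseteq> S" using infinite_arbitrarily_large[OF False] by blast
  then show ?thesis using assms[of T] by auto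
 qed
 then have "c = \<top>" by (metis ennreal_top_neq_zero ennreal_Ex_less_of_nat not_le top.not_eq_extremum)
 then show ?thesis by simp
qed

text \<open>A set has at least \<open>k\<close> elements if and only if it meets \<open>k\<close> disjoint compact balls from a fixed
 countable family; this makes the number of zeros of a random function measurable.\<close>

lemma measurable_num_zeros:
 fixes h g :: "'w => 'e::euclidean_space => real"
 assumes hm: "!!s. (%\<omega>. h \<omega> s) \<in> borel_measurable M" and gm: "!!s. (%\<omega>. g \<omega> s) \<in> borel_measurable M"
  and hc: "!!\<omega>. continuous_on UNIV (h \<omega>)" and gc: "!!\<omega>. continuous_on UNIV (g \<omega>)"
 shows "(%\<omega>. num_elements {s. h \<omega> s = 0 \<and> g \<omega> s > 0}) \<in> borel_measurable M"
proof -
 define Z where "Z \<omega> = {s. h \<omega> s = 0 \<and> g \<omega> s > 0}" for \<omega>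
 obtain D :: "'e set" where D: "countable D" "closure D = UNIV"
 proof (rule separable[of "UNIV :: 'e set"])
  fix T :: "'e set" assume "countable T" "T \<subseteq> UNIV" "UNIV \<subseteq> closure T"
  then show thesis using that[of T] top.extremum_uniqueI[of "closure T"] by simp
 qed
 define \<K> where "\<K> = (%(c, n). cball c (1 / real (Suc n))) ` (D \<times> (UNIV :: nat set))"
 define \<F> where "\<F> = {F. finite F \<and> F \<subseteq> \<K> \<and> disjoint F}"
 have c\<F>: "countable \<F>"
  by (rule countable_subset[of _ "{F. finite F \<and> F \<subseteq> \<K>}"])
    (auto simp: \<F>_def \<K>_def intro!: countable_Collect_finite_subset countable_image countable_SIGMA D(1))
 define q where "q F \<omega> = (if \<forall>C\<in>F. \<exists>s\<in>C. h \<omega> s = 0 \<and> g \<omega> s > 0 then of_nat (card F) else 0 :: ennreal)" for F \<omega>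
 have qm: "q F \<in> borel_measurable M" if "F \<in> \<F>" for F
 proof -
  have [measurable]: "Measurable.pred M (%\<omega>. \<exists>s\<in>C. h \<omega> s = 0 \<and> g \<omega> s > 0)" if "C \<in> F" for C
  proof -
   have "compact C" using that \<open>F \<in> \<F>\<close> by (auto simp: \<F>_def \<K>_def)
   then show ?thesis unfolding pred_def by (intro measurable_ex_zero_pos hm gm hc gc)
  qed
  have "finite F" using that by (simp add: \<F>_def)
  then show ?thesis unfolding q_def by measurable
 qed
 have "num_elements (Z \<omega>) = (SUP F\<in>\<F>. q F \<omega>)" for \<omega>
 proof (rule antisym)
  show "num_elements (Z \<omega>) \<le> (SUP F\<in>\<F>. q F \<omega>)"
  proof (rule num_elements_le)
   fix T assume T: "finite T" "T \<subseteq> Z \<omega>"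
   obtain \<delta> where \<delta>: "\<delta> > 0" "!!s t. s \<in> T ==> t \<in> T ==> s ~= t ==> \<delta> \<le> dist s t"
   proof -
    let ?S = "insert 1 ((%(s, t). dist s t) ` {(s, t) \<in> T \<times> T. s ~= t})"
    have fin: "finite ?S" using T(1) by (auto intro: finite_subset[of _ "T \<times> T"])
    show ?thesis
    proof (rule that[of "Min ?S"])
     show "Min ?S > 0" using fin by (subst Min_gr_iff) auto
     show "Min ?S \<le> dist s t" if "s \<in> T" "t \<in> T" "s ~= t" for s t
      by (rule Min_le[OF fin]) (use that in force)
    qed
   qed
   \<comment> \<open>With radius below a quarter of the minimal distance, and each centre within one
     radius of its point, two balls that meet would bring their points closer than
     \<open>\<delta>\<close>.\<close>
   obtain n where n: "1 / real (Suc n) < \<delta> / 4" using nat_approx_posE[of "\<delta> / 4"] \<delta>(1) by auto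
   have "\<exists>c\<in>D. dist t c < 1 / real (Suc n)" for t
   proof -
    have "t \<in> closure D" using D by simp
    then obtain c where "c \<in> D" "dist c t < 1 / real (Suc n)"
     unfolding closure_approachable by (metis of_nat_0_less_iff zero_less_Suc zero_less_divide_1_iff)
    then show ?thesis by (auto simp: dist_commute)
   qed
   then obtain c where c: "!!t. c t \<in> D" "!!t. dist t (c t) < 1 / real (Suc n)" by metis
   define B where "B t = cball (c t) (1 / real (Suc n))" for t
   have tB: "t \<in> B t" for t using c(2)[of t] by (simp add: B_def dist_commute)
   have dB: "B s \<inter> B t = {}" if "s \<in> T" "t \<in> T" "s ~= t" for s t
   proof (rule ccontr)
    assume "B s \<inter> B t ~= {}"
    then obtain x where x: "dist (c s) x \<le> 1 / real (Suc n)" "dist (c t) x \<le> 1 / real (Suc n)" by (auto simp: B_def)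
    have "dist s t \<le> dist s (c s) + dist (c s) x + dist (c t) x + dist t (c t)"
     using dist_triangle[of s t "c s"] dist_triangle[of "c s" t x] dist_triangle[of x t "c t"]
     by (simp add: dist_commute)
    then show False using c(2)[of s] c(2)[of t] x n \<delta>(2)[OF that] by linarith
   qed
   then have inj: "inj_on B T" using tB by (metis (no_types, lifting) IntI empty_iff inj_onI)
   have "B ` T \<in> \<F>"
    using T(1) c(1) dB by (auto simp: \<F>_def \<K>_def B_def disjoint_def pairwise_def disjnt_def)
   moreover have "q (B ` T) \<omega> = of_nat (card T)"
    using T(2) tB card_image[OF inj] unfolding q_def by (auto simp: Z_def)
   ultimately show "of_nat (card T) \<le> (SUP F\<in>\<F>. q F \<omega>)" by (metis SUP_upper)
  qed
  show "(SUP F\<in>\<F>. q F \<omega>) \<le> num_elements (Z \<omega>)"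
  proof (rule SUP_least)
   fix F assume F: "F \<in> \<F>"
   show "q F \<omega> \<le> num_elements (Z \<omega>)"
   proof (cases "\<forall>C\<in>F. \<exists>s\<in>C. h \<omega> s = 0 \<and> g \<omega> s > 0")
    case True
    then have "\<forall>C\<in>F. \<exists>s. s \<in> C \<inter> Z \<omega>" by (auto simp: Z_def)
    then obtain s where s: "!!C. C \<in> F ==> s C \<in> C \<inter> Z \<omega>" by metis
    have "inj_on s F"
    proof (rule inj_onI, rule ccontr)
     fix A B assume AB: "A \<in> F" "B \<in> F" "s A = s B" "A ~= B"
     then have "A \<inter> B = {}" using F by (auto simp: \<F>_def disjoint_def)
     then show False using s[OF AB(1)] s[OF AB(2)] AB(3) by auto
    qed
    moreover have "finite F" using F by (simp add: \<F>_def)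
    ultimately have "of_nat (card F) \<le> num_elements (Z \<omega>)"
     using num_elements_ge_card[of "s ` F" "Z \<omega>"] s by (auto simp: card_image)
    then show ?thesis unfolding q_def using True by simp
   qed (auto simp: q_def)
  qed
 qed
 then have "(%\<omega>. num_elements (Z \<omega>)) = (%\<omega>. SUP F\<in>\<F>. q F \<omega>)" by auto
 also have "\<dots> \<in> borel_measurable M" by (rule borel_measurable_SUP[OF c\<F> qm])
 finally show ?thesis by (simp add: Z_def)
qed

section \<open>Gaussian homogeneous polynomials\<close>

definition exps :: "nat => ('n::finite \<Rightarrow>\<^sub>0 nat) set" where
 "exps p = {\<alpha>. (\<Sum>i\<in>UNIV. Poly_Mapping.lookup \<alpha> i) = p}"

abbreviation unit_exp :: "'n => ('n \<Rightarrow>\<^sub>0 nat)" where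
 "unit_exp i \<equiv> Poly_Mapping.single i (Suc 0)"

definition mon :: "('n::finite \<Rightarrow>\<^sub>0 nat) => real^'n => real" where
 "mon \<alpha> x = (\<Prod>i\<in>UNIV. x $ i ^ Poly_Mapping.lookup \<alpha> i)"

text \<open>Truncated subtraction in the exponent is harmless: where the variable does not occur,
  the leading factor is 0.\<close>

definition dmon :: "'n => ('n::finite \<Rightarrow>\<^sub>0 nat) => real^'n => real" where
 "dmon i \<alpha> x = real (Poly_Mapping.lookup \<alpha> i) * mon (\<alpha> - unit_exp i) x"

definition multinom :: "nat => ('n::finite \<Rightarrow>\<^sub>0 nat) => real" where
 "multinom p \<alpha> = fact p / (\<Prod>i\<in>UNIV. fact (Poly_Mapping.lookup \<alpha> i))"

text \<open>The monomials scaled by \<open>sqrt (multinom p \<alpha>)\<close> are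
  Bombieri-orthonormal, so \<open>\<xi>\<close> is a coordinate vector in an orthonormal basis. The
  value at x is also the Bombieri product of the polynomial with the p-th power of the linear form
  of x.\<close>

definition fld :: "nat => (('n::finite \<Rightarrow>\<^sub>0 nat) => real) => real^'n => real" where
 "fld p \<xi> x = (\<Sum>\<alpha>\<in>exps p. \<xi> \<alpha> * (sqrt (multinom p \<alpha>) * mon \<alpha> x))"

definition dfld :: "'n => nat => (('n::finite \<Rightarrow>\<^sub>0 nat) => real) => real^'n => real" where
 "dfld i p \<xi> x = (\<Sum>\<alpha>\<in>exps p. \<xi> \<alpha> * (sqrt (multinom p \<alpha>) * dmon i \<alpha> x))"

lemma finite_exps [simp]: "finite (exps p :: ('n::finite \<Rightarrow>\<^sub>0 nat) set)"
proof -
 have "Poly_Mapping.lookup ` (exps p :: ('n \<Rightarrow>\<^sub>0 nat) set) \<subseteq> PiE UNIV (%_. {..p})"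
  by (auto simp: exps_def PiE_def Pi_def intro!: member_le_sum)
 then have "finite (Poly_Mapping.lookup ` (exps p :: ('n \<Rightarrow>\<^sub>0 nat) set))"
  by (rule finite_subset) (intro finite_PiE; simp)
 then show ?thesis by (rule finite_imageD) (auto simp: inj_on_def poly_mapping_eqI)
qed

lemma multinom_pos: "multinom p \<alpha> > 0"
 unfolding multinom_def by (intro divide_pos_pos prod_pos) auto

lemma lookup_unit [simp]: "Poly_Mapping.lookup (unit_exp i) j = (if i = j then 1 else 0)"
 by (simp add: lookup_single when_def)

lemma exps_add_unit: "\<alpha> + unit_exp i \<in> exps (Suc p) \<longleftrightarrow> \<alpha> \<in> exps p"
 by (simp add: exps_def lookup_add sum.distrib)

lemma exps_Suc_unit:
 assumes "\<beta> \<in> exps (Suc p)" "Poly_Mapping.lookup \<beta> i ~= 0"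
 shows "\<beta> - unit_exp i \<in> exps p" "\<beta> - unit_exp i + unit_exp i = \<beta>"
proof -
 show *: "\<beta> - unit_exp i + unit_exp i = \<beta>"
  using assms(2) by (auto simp: poly_mapping_eq_iff fun_eq_iff lookup_add lookup_minus)
 show "\<beta> - unit_exp i \<in> exps p" using assms(1) exps_add_unit[of "\<beta> - unit_exp i" i p] by (simp add: *)
qed

lemma mon_add: "mon (\<alpha> + \<beta>) x = mon \<alpha> x * mon \<beta> x"
 by (simp add: mon_def lookup_add power_add prod.distrib)

lemma mon_unit: "mon (unit_exp i) x = x $ i"
proof -
 have "mon (unit_exp i) x = (\<Prod>j\<in>UNIV. if j = i then x $ i else 1)"
  unfolding mon_def by (rule prod.cong) auto
 then show ?thesis by simp
qed

lemma coord_dmon: "x $ i * dmon i \<alpha> x = real (Poly_Mapping.lookup \<alpha> i) * mon \<alpha> x"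
proof (cases "Poly_Mapping.lookup \<alpha> i = 0")
 case False
 then have "\<alpha> - unit_exp i + unit_exp i = \<alpha>"
  by (auto simp: poly_mapping_eq_iff fun_eq_iff lookup_add lookup_minus)
 then have "mon \<alpha> x = mon (\<alpha> - unit_exp i) x * x $ i" by (metis mon_add mon_unit)
 then show ?thesis by (simp add: dmon_def)
qed (simp add: dmon_def)

lemma mon_has_derivative:
 "(mon \<alpha> has_derivative (%w. \<Sum>i\<in>UNIV. dmon i \<alpha> x * w $ i)) (at x)"
proof -
 have "((%x. \<Prod>i\<in>UNIV. x $ i ^ Poly_Mapping.lookup \<alpha> i) has_derivative
  (%w. \<Sum>i\<in>UNIV. (of_nat (Poly_Mapping.lookup \<alpha> i) * w $ i * x $ i ^ (Poly_Mapping.lookup \<alpha> i - 1)) *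
    (\<Prod>j\<in>UNIV - {i}. x $ j ^ Poly_Mapping.lookup \<alpha> j))) (at x)"
  by (intro has_derivative_prod has_derivative_power bounded_linear_imp_has_derivative bounded_linear_vec_nth)
 moreover have eq: "(of_nat (Poly_Mapping.lookup \<alpha> i) * w $ i * x $ i ^ (Poly_Mapping.lookup \<alpha> i - 1)) *
    (\<Prod>j\<in>UNIV - {i}. x $ j ^ Poly_Mapping.lookup \<alpha> j) = dmon i \<alpha> x * w $ i" for i w
 proof -
  have "mon (\<alpha> - unit_exp i) x = x $ i ^ (Poly_Mapping.lookup \<alpha> i - 1) * (\<Prod>j\<in>UNIV - {i}. x $ j ^ Poly_Mapping.lookup \<alpha> j)"
   unfolding mon_def by (subst prod.remove[of UNIV i]) (auto simp: lookup_minus intro!: prod.cong)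
  then show ?thesis by (simp add: dmon_def)
 qed
 ultimately show ?thesis unfolding mon_def[abs_def] by (simp only: eq)
qed

lemma continuous_mon [continuous_intros]: "continuous_on A (mon \<alpha>)"
 unfolding mon_def[abs_def] by (intro continuous_intros)

lemma continuous_dmon [continuous_intros]: "continuous_on A (dmon i \<alpha>)"
 unfolding dmon_def[abs_def] by (intro continuous_intros)

lemma fld_has_derivative:
 "(fld p \<xi> has_derivative (%w. \<Sum>i\<in>UNIV. dfld i p \<xi> x * w $ i)) (at x)"
proof -
 have "((%x. \<Sum>\<alpha>\<in>exps p. \<xi> \<alpha> * (sqrt (multinom p \<alpha>) * mon \<alpha> x)) has_derivative
  (%w. \<Sum>\<alpha>\<in>exps p. \<xi> \<alpha> * (sqrt (multinom p \<alpha>) * (\<Sum>i\<in>UNIV. dmon i \<alpha> x * w $ i)))) (at x)"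
  by (intro has_derivative_sum has_derivative_mult_right mon_has_derivative)
 moreover have "(\<Sum>\<alpha>\<in>exps p. \<xi> \<alpha> * (sqrt (multinom p \<alpha>) * (\<Sum>i\<in>UNIV. dmon i \<alpha> x * w $ i))) = (\<Sum>i\<in>UNIV. dfld i p \<xi> x * w $ i)" for w
  unfolding dfld_def sum_distrib_left sum_distrib_right by (subst sum.swap) (simp add: mult_ac)
 ultimately show ?thesis unfolding fld_def[abs_def] by simp
qed

lemma continuous_fld: "continuous_on A (fld p \<xi>)"
 unfolding fld_def[abs_def] by (intro continuous_intros)

lemma continuous_dfld: "continuous_on A (dfld i p \<xi>)"
 unfolding dfld_def[abs_def] by (intro continuous_intros)

lemma euler_fld: "(\<Sum>i\<in>UNIV. x $ i * dfld i p \<xi> x) = real p * fld p \<xi> x"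
proof -
 have "(\<Sum>i\<in>UNIV. x $ i * dfld i p \<xi> x) = (\<Sum>i\<in>UNIV. \<Sum>\<alpha>\<in>exps p. \<xi> \<alpha> * (sqrt (multinom p \<alpha>) * (x $ i * dmon i \<alpha> x)))"
  unfolding dfld_def sum_distrib_left by (simp add: mult_ac)
 also have "\<dots> = (\<Sum>\<alpha>\<in>exps p. \<Sum>i\<in>UNIV. \<xi> \<alpha> * (sqrt (multinom p \<alpha>) * (real (Poly_Mapping.lookup \<alpha> i) * mon \<alpha> x)))"
  by (subst sum.swap) (simp only: coord_dmon)
 also have "\<dots> = (\<Sum>\<alpha>\<in>exps p. \<xi> \<alpha> * (sqrt (multinom p \<alpha>) * (real (\<Sum>i\<in>UNIV. Poly_Mapping.lookup \<alpha> i) * mon \<alpha> x)))"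
  by (simp add: sum_distrib_left sum_distrib_right)
 also have "\<dots> = (\<Sum>\<alpha>\<in>exps p. real p * (\<xi> \<alpha> * (sqrt (multinom p \<alpha>) * mon \<alpha> x)))"
  by (rule sum.cong) (auto simp: exps_def)
 also have "\<dots> = real p * fld p \<xi> x" by (simp add: fld_def sum_distrib_left)
 finally show ?thesis .
qed

lemma mon_scale: "\<alpha> \<in> exps p ==> mon \<alpha> (c *\<^sub>R x) = c ^ p * mon \<alpha> x"
 by (simp add: mon_def exps_def power_mult_distrib prod.distrib power_sum[symmetric])

lemma dmon_scale:
 assumes "\<alpha> \<in> exps p" shows "dmon i \<alpha> (c *\<^sub>R x) = c ^ (p - 1) * dmon i \<alpha> x"
proof (cases "Poly_Mapping.lookup \<alpha> i = 0")
 case False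
 have "p ~= 0"
 proof
  assume "p = 0"
  then have "Poly_Mapping.lookup \<alpha> i = 0" using assms by (simp add: exps_def)
  with False show False by simp
 qed
 then obtain q where q: "p = Suc q" using not0_implies_Suc by blast
 show ?thesis using mon_scale[OF exps_Suc_unit(1)[of \<alpha> q i]] False assms by (simp add: dmon_def q)
qed (simp add: dmon_def)

lemma fld_scale: "fld p \<xi> (c *\<^sub>R x) = c ^ p * fld p \<xi> x"
 unfolding fld_def by (simp add: mon_scale sum_distrib_left mult_ac cong: sum.cong)

lemma dfld_scale: "dfld i p \<xi> (c *\<^sub>R x) = c ^ (p - 1) * dfld i p \<xi> x"
 unfolding dfld_def by (simp add: dmon_scale sum_distrib_left mult_ac cong: sum.cong)

text \<open>The recursion of the multinomial coefficients, summed against an arbitrary function of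
  the exponent; it holds because the fractions of the degree that fall on the single variables sum
  to 1. It is the induction step for the multinomial theorem and for powers of linear forms, and it
  splits a sum over quadratic exponents into a double sum over pairs of variables.\<close>

lemma multinomial_step:
 fixes F :: "('n::finite \<Rightarrow>\<^sub>0 nat) => real"
 shows "(\<Sum>i\<in>UNIV. \<Sum>\<alpha>\<in>exps p. multinom p \<alpha> * F (\<alpha> + unit_exp i)) = (\<Sum>\<beta>\<in>exps (Suc p). multinom (Suc p) \<beta> * F \<beta>)"
proof -
 have m: "multinom p \<alpha> = real (Poly_Mapping.lookup \<alpha> i + 1) / real (Suc p) * multinom (Suc p) (\<alpha> + unit_exp i)" for \<alpha> :: "'n \<Rightarrow>\<^sub>0 nat" and i
 proof -
  have "(\<Prod>j\<in>UNIV. fact (Poly_Mapping.lookup (\<alpha> + unit_exp i) j) :: real) =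
   fact (Poly_Mapping.lookup \<alpha> i + 1) * (\<Prod>j\<in>UNIV-{i}. fact (Poly_Mapping.lookup \<alpha> j))"
   by (subst prod.remove[of UNIV i]) (auto simp: lookup_add intro!: prod.cong)
  also have "\<dots> = real (Poly_Mapping.lookup \<alpha> i + 1) * (\<Prod>j\<in>UNIV. fact (Poly_Mapping.lookup \<alpha> j))"
   using prod.remove[of UNIV i "%j. fact (Poly_Mapping.lookup \<alpha> j) :: real"] by simp
  finally have "(\<Prod>j\<in>UNIV. fact (Poly_Mapping.lookup (\<alpha> + unit_exp i) j) :: real) =
   real (Poly_Mapping.lookup \<alpha> i + 1) * (\<Prod>j\<in>UNIV. fact (Poly_Mapping.lookup \<alpha> j))" .
  moreover have "real (Poly_Mapping.lookup \<alpha> i + 1) ~= 0" "real (Suc p) ~= 0" by linarith+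
  ultimately show ?thesis unfolding multinom_def fact_Suc of_nat_mult
   by (simp del: of_nat_Suc of_nat_add)
 qed
 have "(\<Sum>\<alpha>\<in>exps p. multinom p \<alpha> * F (\<alpha> + unit_exp i)) =
  (\<Sum>\<beta>\<in>exps (Suc p). real (Poly_Mapping.lookup \<beta> i) / real (Suc p) * (multinom (Suc p) \<beta> * F \<beta>))" for i
 proof -
  have "(\<Sum>\<alpha>\<in>exps p. multinom p \<alpha> * F (\<alpha> + unit_exp i)) =
   (\<Sum>\<beta>\<in>{\<beta>\<in>exps (Suc p). Poly_Mapping.lookup \<beta> i ~= 0}. real (Poly_Mapping.lookup \<beta> i) / real (Suc p) * (multinom (Suc p) \<beta> * F \<beta>))"
  proof (rule sum.reindex_bij_witness[of _ "%\<beta>. \<beta> - unit_exp i" "%\<alpha>. \<alpha> + unit_exp i"])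
   fix \<alpha> :: "'n \<Rightarrow>\<^sub>0 nat" assume "\<alpha> \<in> exps p"
   then show "\<alpha> + unit_exp i \<in> {\<beta>\<in>exps (Suc p). Poly_Mapping.lookup \<beta> i ~= 0}"
    by (simp add: exps_add_unit lookup_add)
   show "real (Poly_Mapping.lookup (\<alpha> + unit_exp i) i) / real (Suc p) * (multinom (Suc p) (\<alpha> + unit_exp i) * F (\<alpha> + unit_exp i)) =
    multinom p \<alpha> * F (\<alpha> + unit_exp i)"
    by (subst m[of \<alpha> i]) (simp add: lookup_add)
  qed (use exps_Suc_unit in auto)
  also have "\<dots> = (\<Sum>\<beta>\<in>exps (Suc p). real (Poly_Mapping.lookup \<beta> i) / real (Suc p) * (multinom (Suc p) \<beta> * F \<beta>))"
   by (rule sum.mono_neutral_left) auto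
  finally show ?thesis .
 qed
 then have "(\<Sum>i\<in>UNIV. \<Sum>\<alpha>\<in>exps p. multinom p \<alpha> * F (\<alpha> + unit_exp i)) =
  (\<Sum>i\<in>UNIV. \<Sum>\<beta>\<in>exps (Suc p). real (Poly_Mapping.lookup \<beta> i) / real (Suc p) * (multinom (Suc p) \<beta> * F \<beta>))" by simp
 also have "\<dots> = (\<Sum>\<beta>\<in>exps (Suc p). (\<Sum>i\<in>UNIV. real (Poly_Mapping.lookup \<beta> i)) / real (Suc p) * (multinom (Suc p) \<beta> * F \<beta>))"
  by (subst sum.swap) (simp add: sum_distrib_right sum_divide_distrib)
 also have "\<dots> = (\<Sum>\<beta>\<in>exps (Suc p). multinom (Suc p) \<beta> * F \<beta>)"
 proof (rule sum.cong[OF refl])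
  fix \<beta> :: "'n \<Rightarrow>\<^sub>0 nat" assume "\<beta> \<in> exps (Suc p)"
  then have "(\<Sum>i\<in>UNIV. real (Poly_Mapping.lookup \<beta> i)) = real (Suc p)" by (simp only: exps_def of_nat_sum[symmetric] mem_Collect_eq)
  then show "(\<Sum>i\<in>UNIV. real (Poly_Mapping.lookup \<beta> i)) / real (Suc p) * (multinom (Suc p) \<beta> * F \<beta>) = multinom (Suc p) \<beta> * F \<beta>"
   by simp
 qed
 finally show ?thesis .
qed

lemma exps_0: "exps 0 = {0 :: 'n::finite \<Rightarrow>\<^sub>0 nat}"
 by (auto simp: exps_def poly_mapping_eq_iff fun_eq_iff)

lemma multinomial_theorem: "(\<Sum>\<alpha>\<in>exps p. multinom p \<alpha> * mon \<alpha> z) = (\<Sum>i\<in>UNIV. z $ i) ^ p"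
proof (induction p)
 case 0 then show ?case by (simp add: exps_0 multinom_def mon_def)
next
 case (Suc p)
 have "(\<Sum>\<beta>\<in>exps (Suc p). multinom (Suc p) \<beta> * mon \<beta> z) = (\<Sum>i\<in>UNIV. \<Sum>\<alpha>\<in>exps p. multinom p \<alpha> * (mon \<alpha> z * z $ i))"
  unfolding multinomial_step[symmetric] mon_add mon_unit ..
 also have "\<dots> = (\<Sum>i\<in>UNIV. z $ i) * (\<Sum>\<alpha>\<in>exps p. multinom p \<alpha> * mon \<alpha> z)"
  by (simp add: sum_product mult_ac)
 finally show ?case by (simp add: Suc)
qed

text \<open>The reproducing kernel, obtained from the multinomial theorem at the coordinatewise
  product of x and y. Its dependence on the inner product alone is the rotation invariance of the
  Bombieri norm.\<close>

lemma bombieri_kernel: "(\<Sum>\<alpha>\<in>exps p. multinom p \<alpha> * (mon \<alpha> x * mon \<alpha> y)) = (x \<bullet> y) ^ p"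
proof -
 have "mon \<alpha> x * mon \<alpha> y = mon \<alpha> (\<chi> i. x $ i * y $ i)" for \<alpha>
  by (simp add: mon_def power_mult_distrib prod.distrib)
 then show ?thesis using multinomial_theorem[of p "\<chi> i. x $ i * y $ i"] by (simp add: inner_vec_def)
qed

text \<open>Induction over the variables: grouping by the exponent of one variable gives a
  univariate polynomial that vanishes identically, so each group sums to 0 in the other variables.
  The hypothesis that \<open>S\<close> separates the exponents in \<open>A\<close> survives because
  each group has a fixed exponent in the removed variable.\<close>

lemma monomials_independent_aux:
 fixes c :: "('n \<Rightarrow>\<^sub>0 nat) => real"
 assumes "finite S" "finite A"
  and "!!\<alpha> \<beta>. \<alpha> \<in> A ==> \<beta> \<in> A ==> (!!j. j \<in> S ==> Poly_Mapping.lookup \<alpha> j = Poly_Mapping.lookup \<beta> j) ==> \<alpha> = \<beta>"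
  and "!!x :: 'n => real. (\<Sum>\<alpha>\<in>A. c \<alpha> * (\<Prod>j\<in>S. x j ^ Poly_Mapping.lookup \<alpha> j)) = 0"
  and "\<alpha> \<in> A"
 shows "c \<alpha> = 0"
 using assms
proof (induction S arbitrary: A \<alpha> rule: finite_induct)
 case empty
 then have "A = {\<alpha>}" by auto
 then show ?case using empty.prems(3)[of undefined] by simp
next
 case (insert i S)
 define k where "k = Poly_Mapping.lookup \<alpha> i"
 define Ak where "Ak m = {\<beta>\<in>A. Poly_Mapping.lookup \<beta> i = m}" for m
 define N where "N = Max ((%\<beta>. Poly_Mapping.lookup \<beta> i) ` A)"
 have N: "Poly_Mapping.lookup \<beta> i \<le> N" if "\<beta> \<in> A" for \<beta>
  unfolding N_def using that insert.prems(1) by (intro Max_ge) auto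
 show ?case
 proof (rule insert.IH[of "Ak k"])
  show "finite (Ak k)" using insert.prems(1) by (simp add: Ak_def)
  show "\<beta> = \<gamma>" if "\<beta> \<in> Ak k" "\<gamma> \<in> Ak k" "!!j. j \<in> S ==> Poly_Mapping.lookup \<beta> j = Poly_Mapping.lookup \<gamma> j" for \<beta> \<gamma>
   by (rule insert.prems(2)) (use that in \<open>auto simp: Ak_def\<close>)
  show "\<alpha> \<in> Ak k" using insert.prems(4) by (simp add: Ak_def k_def)
  fix x :: "'n => real"
  let ?P = "%\<beta>. c \<beta> * (\<Prod>j\<in>S. x j ^ Poly_Mapping.lookup \<beta> j)"
  have "(\<Sum>m\<le>N. (\<Sum>\<beta>\<in>Ak m. ?P \<beta>) * t ^ m) = 0" for t
  proof -
   have "(\<Sum>m\<le>N. (\<Sum>\<beta>\<in>Ak m. ?P \<beta>) * t ^ m) = (\<Sum>m\<le>N. \<Sum>\<beta>\<in>Ak m. ?P \<beta> * t ^ Poly_Mapping.lookup \<beta> i)"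
    by (simp add: sum_distrib_right Ak_def)
   also have "\<dots> = (\<Sum>\<beta>\<in>A. ?P \<beta> * t ^ Poly_Mapping.lookup \<beta> i)"
    unfolding Ak_def by (rule sum.group) (use insert.prems(1) N in auto)
   also have "\<dots> = (\<Sum>\<beta>\<in>A. c \<beta> * (\<Prod>j\<in>insert i S. (x(i := t)) j ^ Poly_Mapping.lookup \<beta> j))"
   proof (rule sum.cong[OF refl])
    fix \<beta>
    have "(\<Prod>j\<in>S. (x(i := t)) j ^ Poly_Mapping.lookup \<beta> j) = (\<Prod>j\<in>S. x j ^ Poly_Mapping.lookup \<beta> j)"
     using insert.hyps by (intro prod.cong) auto
    then show "?P \<beta> * t ^ Poly_Mapping.lookup \<beta> i = c \<beta> * (\<Prod>j\<in>insert i S. (x(i := t)) j ^ Poly_Mapping.lookup \<beta> j)"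
     using insert.hyps by simp
   qed
   also have "\<dots> = 0" by (rule insert.prems(3))
   finally show ?thesis .
  qed
  then have "\<forall>m\<le>N. (\<Sum>\<beta>\<in>Ak m. ?P \<beta>) = 0" using polyfun_eq_0[of "%m. \<Sum>\<beta>\<in>Ak m. ?P \<beta>" N] by auto
  moreover have "k \<le> N" unfolding k_def by (rule N[OF insert.prems(4)])
  ultimately show "(\<Sum>\<beta>\<in>Ak k. ?P \<beta>) = 0" by blast
 qed
qed

lemma monomials_independent:
 fixes c :: "('n::finite \<Rightarrow>\<^sub>0 nat) => real"
 assumes "finite A" "!!x. (\<Sum>\<alpha>\<in>A. c \<alpha> * mon \<alpha> x) = 0" "\<alpha> \<in> A"
 shows "c \<alpha> = 0"
proof (rule monomials_independent_aux[of UNIV A c \<alpha>])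
 show "(\<Sum>\<alpha>\<in>A. c \<alpha> * (\<Prod>j\<in>UNIV. x j ^ Poly_Mapping.lookup \<alpha> j)) = 0" for x :: "'n => real"
  using assms(2)[of "\<chi> i. x i"] by (simp add: mon_def)
qed (use assms in \<open>auto intro: poly_mapping_eqI\<close>)

lemma mon_linear_expansion:
 assumes "linear R" "\<alpha> \<in> exps p"
 shows "\<exists>q. \<forall>x :: real^'n::finite. mon \<alpha> (R x) = (\<Sum>\<beta>\<in>exps p. q \<beta> * mon \<beta> x)"
 using assms(2)
proof (induction p arbitrary: \<alpha>)
 case 0
 then show ?case by (intro exI[of _ "%_. 1"]) (simp add: exps_0 mon_def)
next
 case (Suc p)
 have "\<exists>i. Poly_Mapping.lookup \<alpha> i ~= 0"
 proof (rule ccontr)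
  assume "\<not> ?thesis"
  then have "(\<Sum>i\<in>UNIV. Poly_Mapping.lookup \<alpha> i) = 0" by simp
  then show False using Suc.prems by (simp add: exps_def)
 qed
 then obtain i where i: "Poly_Mapping.lookup \<alpha> i ~= 0" by blast
 from Suc.IH[OF exps_Suc_unit(1)[OF Suc.prems i]] obtain q where
  q: "!!x. mon (\<alpha> - unit_exp i) (R x) = (\<Sum>\<beta>\<in>exps p. q \<beta> * mon \<beta> x)" by blast
 define r where "r j = R (axis j 1) $ i" for j
 have r: "R x $ i = (\<Sum>j\<in>UNIV. r j * x $ j)" for x
 proof -
  have "R x = (\<Sum>j\<in>UNIV. x $ j *\<^sub>R R (axis j 1))"
   using linear_sum[OF assms(1), of "%j. x $ j *\<^sub>R axis j 1" UNIV] linear_scale[OF assms(1)]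
   by (simp add: basis_expansion scalar_mult_eq_scaleR[symmetric])
  then show ?thesis by (simp add: r_def mult.commute)
 qed
 have "mon \<alpha> (R x) = (\<Sum>\<gamma>\<in>exps (Suc p). (\<Sum>j\<in>UNIV. \<Sum>\<beta>\<in>exps p. if \<beta> + unit_exp j = \<gamma> then r j * q \<beta> else 0) * mon \<gamma> x)" for x
 proof -
  have "mon \<alpha> (R x) = mon (\<alpha> - unit_exp i) (R x) * R x $ i"
   using exps_Suc_unit(2)[OF Suc.prems i] mon_add mon_unit by metis
  also have "\<dots> = (\<Sum>j\<in>UNIV. \<Sum>\<beta>\<in>exps p. r j * q \<beta> * mon (\<beta> + unit_exp j) x)"
   unfolding q r mon_add mon_unit by (subst mult.commute) (simp add: sum_product mult_ac)
  also have "\<dots> = (\<Sum>j\<in>UNIV. \<Sum>\<beta>\<in>exps p. \<Sum>\<gamma>\<in>exps (Suc p). (if \<beta> + unit_exp j = \<gamma> then r j * q \<beta> else 0) * mon \<gamma> x)"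
  proof (intro sum.cong refl)
   fix j and \<beta> :: "'n \<Rightarrow>\<^sub>0 nat" assume "\<beta> \<in> exps p"
   then have "\<beta> + unit_exp j \<in> exps (Suc p)" by (simp add: exps_add_unit)
   then show "r j * q \<beta> * mon (\<beta> + unit_exp j) x = (\<Sum>\<gamma>\<in>exps (Suc p). (if \<beta> + unit_exp j = \<gamma> then r j * q \<beta> else 0) * mon \<gamma> x)"
    by (subst sum.remove[of _ "\<beta> + unit_exp j"]) (auto intro!: sum.neutral split: if_splits)
  qed
  also have "\<dots> = (\<Sum>j\<in>UNIV. \<Sum>\<gamma>\<in>exps (Suc p). \<Sum>\<beta>\<in>exps p. (if \<beta> + unit_exp j = \<gamma> then r j * q \<beta> else 0) * mon \<gamma> x)"
   by (rule sum.cong[OF refl], rule sum.swap)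
  also have "\<dots> = (\<Sum>\<gamma>\<in>exps (Suc p). \<Sum>j\<in>UNIV. \<Sum>\<beta>\<in>exps p. (if \<beta> + unit_exp j = \<gamma> then r j * q \<beta> else 0) * mon \<gamma> x)"
   by (rule sum.swap)
  finally show ?thesis by (simp add: sum_distrib_right)
 qed
 then show ?case
  by (intro exI[of _ "%\<gamma>. \<Sum>j\<in>UNIV. \<Sum>\<beta>\<in>exps p. if \<beta> + unit_exp j = \<gamma> then r j * q \<beta> else 0"]) simp
qed

text \<open>Rotating the argument of a polynomial acts on its coordinates in the orthonormal basis of
 monomials by an orthogonal matrix, because the reproducing kernel is invariant.\<close>

definition bmon :: "nat => ('n::finite \<Rightarrow>\<^sub>0 nat) => real^'n => real" where
 "bmon p \<alpha> x = sqrt (multinom p \<alpha>) * mon \<alpha> x"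

lemma bmon_independent:
 fixes c :: "('n::finite \<Rightarrow>\<^sub>0 nat) => real"
 assumes "!!x. (\<Sum>\<alpha>\<in>exps p. c \<alpha> * bmon p \<alpha> x) = (\<Sum>\<alpha>\<in>exps p. d \<alpha> * bmon p \<alpha> x)" "\<alpha> \<in> exps p"
 shows "c \<alpha> = d \<alpha>"
proof -
 have "(c \<alpha> - d \<alpha>) * sqrt (multinom p \<alpha>) = 0"
  by (rule monomials_independent[of "exps p"])
    (use assms in \<open>simp_all add: bmon_def algebra_simps sum_subtractf\<close>)
 then show ?thesis using multinom_pos[of p \<alpha>] by simp
qed

lemma bmon_kernel: "(\<Sum>\<alpha>\<in>exps p. bmon p \<alpha> x * bmon p \<alpha> y) = (x \<bullet> y) ^ p"
proof -
 have "bmon p \<alpha> x * bmon p \<alpha> y = multinom p \<alpha> * (mon \<alpha> x * mon \<alpha> y)" for \<alpha>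
  using multinom_pos[of p \<alpha>] by (simp add: bmon_def algebra_simps)
 then show ?thesis by (simp add: bombieri_kernel)
qed

lemma bmon_linear_expansion:
 fixes R :: "real^'n::finite => real^'n"
 assumes "linear R"
 obtains Q where "!!\<alpha> x. \<alpha> \<in> exps p ==> bmon p \<alpha> (R x) = (\<Sum>\<beta>\<in>exps p. Q \<alpha> \<beta> * bmon p \<beta> x)"
proof -
 have "\<forall>\<alpha>\<in>exps p. \<exists>q. \<forall>x. mon \<alpha> (R x) = (\<Sum>\<beta>\<in>exps p. q \<beta> * mon \<beta> x)"
  using mon_linear_expansion[OF assms] by blast
 then obtain q where q: "!!\<alpha> x. \<alpha> \<in> exps p ==> mon \<alpha> (R x) = (\<Sum>\<beta>\<in>exps p. q \<alpha> \<beta> * mon \<beta> x)" by metis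
 have nz: "sqrt (multinom p \<beta>) ~= 0" for \<beta> :: "'n \<Rightarrow>\<^sub>0 nat" using multinom_pos[of p \<beta>] by simp
 show ?thesis
 proof (rule that[of "%\<alpha> \<beta>. sqrt (multinom p \<alpha>) * q \<alpha> \<beta> / sqrt (multinom p \<beta>)"])
  fix \<alpha> :: "'n \<Rightarrow>\<^sub>0 nat" and x assume "\<alpha> \<in> exps p"
  then have "bmon p \<alpha> (R x) = (\<Sum>\<beta>\<in>exps p. sqrt (multinom p \<alpha>) * (q \<alpha> \<beta> * mon \<beta> x))"
   by (simp add: bmon_def q sum_distrib_left)
  also have "\<dots> = (\<Sum>\<beta>\<in>exps p. sqrt (multinom p \<alpha>) * q \<alpha> \<beta> / sqrt (multinom p \<beta>) * bmon p \<beta> x)"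
   using nz by (intro sum.cong refl) (simp add: bmon_def)
  finally show "bmon p \<alpha> (R x) = \<dots>" .
 qed
qed

text \<open>Comparing coefficients twice in the invariant kernel shows that the columns of
  \<open>Q\<close> are orthonormal. The inverse rotation supplies a right inverse \<open>Q'\<close>,
  which must then be the transpose, and this makes the rows orthonormal too.\<close>

lemma rotation_orth_matrix:
 fixes R :: "real^'n::finite => real^'n"
 assumes R: "orthogonal_transformation R"
 obtains Q where "orth_matrix (exps p) (exps p) Q"
  "!!\<alpha> x. \<alpha> \<in> exps p ==> bmon p \<alpha> (R x) = (\<Sum>\<beta>\<in>exps p. Q \<alpha> \<beta> * bmon p \<beta> x)"
proof -
 have lin: "linear R" using R by (rule orthogonal_transformation_linear)
 obtain R' where R': "orthogonal_transformation R'" "!!x. R (R' x) = x"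
  using orthogonal_transformation_inv[OF R] orthogonal_transformation_bij[OF R]
  by (metis bij_inv_eq_iff)
 obtain Q where Q: "!!\<alpha> x. \<alpha> \<in> exps p ==> bmon p \<alpha> (R x) = (\<Sum>\<beta>\<in>exps p. Q \<alpha> \<beta> * bmon p \<beta> x)"
  using bmon_linear_expansion[OF lin] by blast
 obtain Q' where Q': "!!\<alpha> x. \<alpha> \<in> exps p ==> bmon p \<alpha> (R' x) = (\<Sum>\<beta>\<in>exps p. Q' \<alpha> \<beta> * bmon p \<beta> x)"
  using bmon_linear_expansion[OF orthogonal_transformation_linear[OF R'(1)]] by blast
 let ?E = "exps p :: ('n \<Rightarrow>\<^sub>0 nat) set"
 define G where "G \<beta> \<gamma> = (\<Sum>\<alpha>\<in>?E. Q \<alpha> \<beta> * Q \<alpha> \<gamma>)" for \<beta> \<gamma>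
 have G: "G \<beta> \<gamma> = (if \<beta> = \<gamma> then 1 else 0)" if bg: "\<beta> \<in> ?E" "\<gamma> \<in> ?E" for \<beta> \<gamma>
 proof -
  have "(\<Sum>\<gamma>\<in>?E. G \<beta> \<gamma> * bmon p \<gamma> y) = bmon p \<beta> y" if "\<beta> \<in> ?E" for \<beta> y
  proof (rule bmon_independent[OF _ that])
   fix x
   have "(\<Sum>\<beta>\<in>?E. (\<Sum>\<gamma>\<in>?E. G \<beta> \<gamma> * bmon p \<gamma> y) * bmon p \<beta> x) =
    (\<Sum>\<beta>\<in>?E. \<Sum>\<gamma>\<in>?E. \<Sum>\<alpha>\<in>?E. (Q \<alpha> \<beta> * bmon p \<beta> x) * (Q \<alpha> \<gamma> * bmon p \<gamma> y))"
    by (simp add: G_def sum_distrib_left sum_distrib_right mult_ac)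
   also have "\<dots> = (\<Sum>\<beta>\<in>?E. \<Sum>\<alpha>\<in>?E. \<Sum>\<gamma>\<in>?E. (Q \<alpha> \<beta> * bmon p \<beta> x) * (Q \<alpha> \<gamma> * bmon p \<gamma> y))"
    by (rule sum.cong[OF refl], rule sum.swap)
   also have "\<dots> = (\<Sum>\<alpha>\<in>?E. \<Sum>\<beta>\<in>?E. \<Sum>\<gamma>\<in>?E. (Q \<alpha> \<beta> * bmon p \<beta> x) * (Q \<alpha> \<gamma> * bmon p \<gamma> y))"
    by (rule sum.swap)
   also have "\<dots> = (\<Sum>\<alpha>\<in>?E. bmon p \<alpha> (R x) * bmon p \<alpha> (R y))"
    by (simp add: Q sum_product)
   also have "\<dots> = (x \<bullet> y) ^ p" using R by (simp add: bmon_kernel orthogonal_transformation_def)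
   finally show "(\<Sum>\<beta>\<in>?E. (\<Sum>\<gamma>\<in>?E. G \<beta> \<gamma> * bmon p \<gamma> y) * bmon p \<beta> x) = (\<Sum>\<beta>\<in>?E. bmon p \<beta> y * bmon p \<beta> x)"
    by (simp add: bmon_kernel inner_commute)
  qed
  then have "(\<Sum>\<gamma>\<in>?E. G \<beta> \<gamma> * bmon p \<gamma> y) = (\<Sum>\<gamma>\<in>?E. (if \<beta> = \<gamma> then 1 else 0) * bmon p \<gamma> y)" for y
   using bg(1) by (simp add: if_distrib[of "%c. c * _"] cong: if_cong)
  from bmon_independent[OF this bg(2)] show ?thesis .
 qed
 have QQ': "(\<Sum>\<beta>\<in>?E. Q \<alpha> \<beta> * Q' \<beta> \<gamma>) = (if \<alpha> = \<gamma> then 1 else 0)" if ag: "\<alpha> \<in> ?E" "\<gamma> \<in> ?E" for \<alpha> \<gamma>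
 proof -
  have "(\<Sum>\<gamma>\<in>?E. (\<Sum>\<beta>\<in>?E. Q \<alpha> \<beta> * Q' \<beta> \<gamma>) * bmon p \<gamma> x) = (\<Sum>\<gamma>\<in>?E. (if \<alpha> = \<gamma> then 1 else 0) * bmon p \<gamma> x)" for x
  proof -
   have "(\<Sum>\<gamma>\<in>?E. (\<Sum>\<beta>\<in>?E. Q \<alpha> \<beta> * Q' \<beta> \<gamma>) * bmon p \<gamma> x) = (\<Sum>\<gamma>\<in>?E. \<Sum>\<beta>\<in>?E. Q \<alpha> \<beta> * (Q' \<beta> \<gamma> * bmon p \<gamma> x))"
    by (simp add: sum_distrib_right mult.assoc)
   also have "\<dots> = (\<Sum>\<beta>\<in>?E. Q \<alpha> \<beta> * bmon p \<beta> (R' x))"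
    by (subst sum.swap) (simp add: Q' sum_distrib_left)
   also have "\<dots> = bmon p \<alpha> x" using Q[OF ag(1), of "R' x"] by (simp add: R'(2))
   also have "\<dots> = (\<Sum>\<gamma>\<in>?E. (if \<alpha> = \<gamma> then 1 else 0) * bmon p \<gamma> x)"
    using ag(1) by (simp add: if_distrib[of "%c. c * _"] cong: if_cong)
   finally show ?thesis .
  qed
  from bmon_independent[OF this ag(2)] show ?thesis .
 qed
 have Q'Q: "Q' \<beta> \<gamma> = Q \<gamma> \<beta>" if bg: "\<beta> \<in> ?E" "\<gamma> \<in> ?E" for \<beta> \<gamma>
 proof -
  have "Q' \<beta> \<gamma> = (\<Sum>\<delta>\<in>?E. (if \<beta> = \<delta> then 1 else 0) * Q' \<delta> \<gamma>)"
   using bg(1) by (simp add: if_distrib[of "%c. c * _"] cong: if_cong)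
  also have "\<dots> = (\<Sum>\<delta>\<in>?E. G \<beta> \<delta> * Q' \<delta> \<gamma>)"
   using G[OF bg(1)] by (intro sum.cong refl) simp
  also have "\<dots> = (\<Sum>\<delta>\<in>?E. \<Sum>\<alpha>\<in>?E. Q \<alpha> \<beta> * (Q \<alpha> \<delta> * Q' \<delta> \<gamma>))"
   unfolding G_def by (simp add: sum_distrib_right mult.assoc)
  also have "\<dots> = (\<Sum>\<alpha>\<in>?E. Q \<alpha> \<beta> * (\<Sum>\<delta>\<in>?E. Q \<alpha> \<delta> * Q' \<delta> \<gamma>))"
   by (subst sum.swap) (simp add: sum_distrib_left)
  also have "\<dots> = (\<Sum>\<alpha>\<in>?E. Q \<alpha> \<beta> * (if \<alpha> = \<gamma> then 1 else 0))"
   using bg(2) by (simp add: QQ')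
  also have "\<dots> = Q \<gamma> \<beta>" using bg(2) by (simp add: if_distrib[of "%c. _ * c"] cong: if_cong)
  finally show ?thesis .
 qed
 have "orth_matrix ?E ?E Q"
 proof
  show "(\<Sum>b\<in>?E. Q a b * Q a' b) = (if a = a' then 1 else 0)" if "a \<in> ?E" "a' \<in> ?E" for a a'
   using QQ'[OF that] that by (simp add: Q'Q)
  show "(\<Sum>a\<in>?E. Q a b * Q a b') = (if b = b' then 1 else 0)" if "b \<in> ?E" "b' \<in> ?E" for b b'
   using G[OF that] by (simp add: G_def)
 qed simp_all
 then show ?thesis using that Q by blast
qed

lemma rotate_field:
 fixes R :: "real^'n::finite => real^'n"
 assumes R: "orthogonal_transformation R"
 obtains T where "T \<in> PiM (exps p) (%_. lborel) \<rightarrow>\<^sub>M PiM (exps p) (%_. lborel :: real measure)"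
  "!!\<xi> x. fld p (T \<xi>) x = fld p \<xi> (R x)"
  "!!H. H \<in> borel_measurable (PiM (exps p) (%_. lborel)) ==>
    (\<integral>\<^sup>+\<xi>. H (T \<xi>) \<partial>PiM (exps p) (%_. gauss)) = (\<integral>\<^sup>+\<xi>. H \<xi> \<partial>PiM (exps p) (%_. gauss))"
proof -
 obtain Q where Q: "orth_matrix (exps p) (exps p) Q"
  "!!\<alpha> x. \<alpha> \<in> exps p ==> bmon p \<alpha> (R x) = (\<Sum>\<beta>\<in>exps p. Q \<alpha> \<beta> * bmon p \<beta> x)"
  using rotation_orth_matrix[OF R] by blast
 interpret orth_matrix "exps p" "exps p" Q by fact
 show ?thesis
 proof (rule that[OF app_measurable _ nn_integral_gauss_app])
  fix \<xi> x
  have "fld p (app \<xi>) x = (\<Sum>\<beta>\<in>exps p. \<Sum>\<alpha>\<in>exps p. \<xi> \<alpha> * (Q \<alpha> \<beta> * bmon p \<beta> x))"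
   unfolding fld_def bmon_def[symmetric] by (simp add: app_def sum_distrib_right sum_distrib_left mult_ac)
  also have "\<dots> = (\<Sum>\<alpha>\<in>exps p. \<xi> \<alpha> * bmon p \<alpha> (R x))"
   by (subst sum.swap) (simp add: Q(2) sum_distrib_left)
  also have "\<dots> = fld p \<xi> (R x)" by (simp add: fld_def bmon_def)
  finally show "fld p (app \<xi>) x = fld p \<xi> (R x)" .
 qed
qed

section \<open>Critical points on the sphere of a coordinate subspace\<close>

definition crit_eq :: "'n set => nat => (('n::finite \<Rightarrow>\<^sub>0 nat) => real) => real^'n => bool" where
 "crit_eq J p \<xi> x \<longleftrightarrow> (\<forall>i\<in>J. dfld i p \<xi> x * (x \<bullet> x) = real p * fld p \<xi> x * x $ i)"

text \<open>The flag \<open>z\<close> tells whether critical points with critical value \<open>0\<close> are discarded.\<close>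

definition crit :: "bool => 'n set => nat => (('n::finite \<Rightarrow>\<^sub>0 nat) => real) => (real^'n) set" where
 "crit z J p \<xi> = {s \<in> coord_space J. norm s = 1 \<and> crit_eq J p \<xi> s \<and> (z --> fld p \<xi> s ~= 0)}"

lemma inner_coord_space: "w \<in> coord_space J ==> x \<bullet> w = (\<Sum>i\<in>J. x $ i * w $ i)"
 by (auto simp: inner_vec_def coord_space_def intro!: sum.mono_neutral_right)

text \<open>The Lagrange condition in \<open>crit_eq\<close> is homogenised with
  \<open>x \<bullet> x\<close>, so that it also makes sense off the unit sphere, in the chart.
  Tested against directions instead of coordinates it involves only the derivative and inner
  products, the form in which rotations act.\<close>

lemma crit_eq_iff_directional:
 "crit_eq J p \<xi> x \<longleftrightarrow> (\<forall>w\<in>coord_space J. (\<Sum>i\<in>UNIV. dfld i p \<xi> x * w $ i) * (x \<bullet> x) = real p * fld p \<xi> x * (x \<bullet> w))"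
proof
 assume c: "crit_eq J p \<xi> x"
 show "\<forall>w\<in>coord_space J. (\<Sum>i\<in>UNIV. dfld i p \<xi> x * w $ i) * (x \<bullet> x) = real p * fld p \<xi> x * (x \<bullet> w)"
 proof
  fix w :: "real^'a" assume w: "w \<in> coord_space J"
  have "(\<Sum>i\<in>UNIV. dfld i p \<xi> x * w $ i) = (\<Sum>i\<in>J. dfld i p \<xi> x * w $ i)"
   using w by (intro sum.mono_neutral_right) (auto simp: coord_space_def)
  then have "(\<Sum>i\<in>UNIV. dfld i p \<xi> x * w $ i) * (x \<bullet> x) = (\<Sum>i\<in>J. (dfld i p \<xi> x * (x \<bullet> x)) * w $ i)"
   by (simp add: sum_distrib_left mult_ac)
  also have "\<dots> = (\<Sum>i\<in>J. (real p * fld p \<xi> x * x $ i) * w $ i)"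
   using c by (intro sum.cong) (auto simp: crit_eq_def)
  also have "\<dots> = real p * fld p \<xi> x * (x \<bullet> w)"
   unfolding inner_coord_space[OF w] by (simp add: sum_distrib_left mult_ac)
  finally show "(\<Sum>i\<in>UNIV. dfld i p \<xi> x * w $ i) * (x \<bullet> x) = real p * fld p \<xi> x * (x \<bullet> w)" .
 qed
next
 assume *: "\<forall>w\<in>coord_space J. (\<Sum>i\<in>UNIV. dfld i p \<xi> x * w $ i) * (x \<bullet> x) = real p * fld p \<xi> x * (x \<bullet> w)"
 show "crit_eq J p \<xi> x"
  unfolding crit_eq_def
 proof
  fix i assume "i \<in> J"
  then have "axis i 1 \<in> coord_space J" by (auto simp: coord_space_def axis_def)
  moreover have "(\<Sum>j\<in>UNIV. dfld j p \<xi> x * (axis i 1 :: real^'a) $ j) = dfld i p \<xi> x"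
   by (simp add: axis_def if_distrib[of "%c. _ * c"] cong: if_cong)
  moreover have "x \<bullet> axis i 1 = x $ i" by (simp add: inner_axis)
  ultimately show "dfld i p \<xi> x * (x \<bullet> x) = real p * fld p \<xi> x * x $ i" using * by metis
 qed
qed

lemma crit_rotate:
 fixes R :: "real^'n::finite => real^'n"
 assumes R: "orthogonal_transformation R" and RJ: "!!x. R x \<in> coord_space J \<longleftrightarrow> x \<in> coord_space J"
  and f: "!!x. fld p \<xi>' x = fld p \<xi> (R x)"
 shows "s \<in> crit z J p \<xi>' \<longleftrightarrow> R s \<in> crit z J p \<xi>"
proof -
 have lin: "linear R" using R by (rule orthogonal_transformation_linear)
 have "(R has_derivative R) (at x)" for x
  using lin by (intro bounded_linear_imp_has_derivative) (simp add: linear_conv_bounded_linear)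
 then have "((%x. fld p \<xi> (R x)) has_derivative (%w. \<Sum>i\<in>UNIV. dfld i p \<xi> (R s) * R w $ i)) (at s)"
  by (rule has_derivative_compose[OF _ fld_has_derivative])
 moreover have "((%x. fld p \<xi> (R x)) has_derivative (%w. \<Sum>i\<in>UNIV. dfld i p \<xi>' s * w $ i)) (at s)"
  using fld_has_derivative[of p \<xi>' s] by (simp add: f[abs_def])
 ultimately have d: "(%w. \<Sum>i\<in>UNIV. dfld i p \<xi>' s * w $ i) = (%w. \<Sum>i\<in>UNIV. dfld i p \<xi> (R s) * R w $ i)"
  using has_derivative_unique by blast
 have inner: "R x \<bullet> R y = x \<bullet> y" for x y using R by (simp add: orthogonal_transformation_def)
 obtain R' where R': "!!x. R (R' x) = x"
  using orthogonal_transformation_bij[OF R] by (metis bij_inv_eq_iff)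
 have "crit_eq J p \<xi>' s \<longleftrightarrow> (\<forall>w\<in>coord_space J. (\<Sum>i\<in>UNIV. dfld i p \<xi> (R s) * R w $ i) * (R s \<bullet> R s) = real p * fld p \<xi> (R s) * (R s \<bullet> R w))"
  unfolding crit_eq_iff_directional inner f using fun_cong[OF d] by simp
 also have "\<dots> \<longleftrightarrow> crit_eq J p \<xi> (R s)"
 proof -
  have "(\<forall>w\<in>coord_space J. P (R w)) \<longleftrightarrow> (\<forall>w\<in>coord_space J. P w)" for P
  proof safe
   fix w assume "\<forall>w\<in>coord_space J. P (R w)" "w \<in> coord_space J"
   then show "P w" using RJ[of "R' w"] R'[of w] by fastforce
  qed (use RJ in auto)
  from this[of "%w. (\<Sum>i\<in>UNIV. dfld i p \<xi> (R s) * w $ i) * (R s \<bullet> R s) = real p * fld p \<xi> (R s) * (R s \<bullet> w)"]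
  show ?thesis unfolding crit_eq_iff_directional .
 qed
 finally show ?thesis
  using R RJ by (simp add: crit_def f orthogonal_transformation_norm)
qed

section \<open>Rotations of a coordinate subspace and averages over caps\<close>

definition rotJ :: "'n set => (real^'n::finite => real^'n) => bool" where
 "rotJ J R \<longleftrightarrow> orthogonal_transformation R \<and> (\<forall>x i. i \<notin> J --> R x $ i = x $ i)"

lemma rotJ_coord_space: "rotJ J R ==> R x \<in> coord_space J \<longleftrightarrow> x \<in> coord_space J"
 by (simp add: rotJ_def coord_space_def)

lemma rotJ_exists:
 fixes s :: "real^'n::finite"
 assumes s: "s \<in> coord_space J" "norm s = 1" and i: "i \<in> J"
 obtains R where "rotJ J R" "R (axis i 1) = s"
proof -
 define w where "w = s - axis i 1"
 \<comment> \<open>The reflection in the hyperplane orthogonal to \<open>w\<close> exchanges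
   \<open>axis i 1\<close> and \<open>s\<close>, both being unit vectors. For \<open>w = 0\<close>
   it degenerates to the identity, which is then correct.\<close>
 define R where "R x = x - (2 * (x \<bullet> w) / (w \<bullet> w)) *\<^sub>R w" for x
 have wJ: "w $ j = 0" if "j \<notin> J" for j
  using that s(1) i by (auto simp: w_def coord_space_def axis_def)
 have lin: "linear R"
  by (rule linearI) (auto simp: R_def algebra_simps inner_simps add_divide_distrib)
 have in_pres: "R x \<bullet> R y = x \<bullet> y" for x y
  by (cases "w = 0") (simp_all add: R_def inner_simps inner_commute field_simps)
 have ss: "s \<bullet> s = 1" using s(2) by (simp add: norm_eq_1)
 have Re: "R (axis i 1) = s"
 proof (cases "w = 0")
  case False
  have "w \<bullet> w = 2 - 2 * s $ i" "axis i 1 \<bullet> w = s $ i - 1"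
   using ss by (simp_all add: w_def inner_simps inner_axis inner_axis')
  moreover have "w \<bullet> w ~= 0" using False by simp
  ultimately have "2 * (axis i 1 \<bullet> w) / (w \<bullet> w) = -1"
   by (simp add: field_simps)
  then show ?thesis by (simp add: R_def w_def)
 qed (simp add: R_def, simp add: w_def)
 have "orthogonal_transformation R" unfolding orthogonal_transformation_def using lin in_pres by blast
 then have "rotJ J R" by (auto simp: rotJ_def R_def wJ)
 then show ?thesis using that Re by blast
qed

lemma rotJ_orth_matrix:
 fixes R :: "real^'n::finite => real^'n"
 assumes R: "rotJ J R"
 shows "orth_matrix J J (%a b. R (axis a 1) $ b)"
  and "b \<in> J ==> (\<Sum>a\<in>J. R (axis a 1) $ b * g a) = R (vecK J g) $ b"
proof -
 have o: "orthogonal_transformation R" using R by (simp add: rotJ_def)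
 then have lin: "linear R" by (rule orthogonal_transformation_linear)
 have exp: "R (vecK J g) = (\<Sum>a\<in>J. g a *\<^sub>R R (axis a 1))" for g
 proof -
  have "vecK J g = (\<Sum>a\<in>J. g a *\<^sub>R axis a 1)"
   by (auto simp: vec_eq_iff axis_def if_distrib[of "%c. _ * c"] cong: if_cong)
  then show ?thesis by (simp add: linear_sum[OF lin] linear_scale[OF lin])
 qed
 show "b \<in> J ==> (\<Sum>a\<in>J. R (axis a 1) $ b * g a) = R (vecK J g) $ b"
  by (simp add: exp mult.commute)
 obtain R' where R': "!!x. R (R' x) = x"
  using orthogonal_transformation_bij[OF o] by (metis bij_inv_eq_iff)
 have ax: "axis a 1 \<in> coord_space J" if "a \<in> J" for a using that by (auto simp: coord_space_def axis_def)
 have Rax: "R (axis a 1) \<in> coord_space J" if "a \<in> J" for a using rotJ_coord_space[OF R] ax[OF that] by blast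
 have inn: "R x \<bullet> R y = x \<bullet> y" for x y using o by (simp add: orthogonal_transformation_def)
 show "orth_matrix J J (%a b. R (axis a 1) $ b)"
 proof
  show "(\<Sum>b\<in>J. R (axis a 1) $ b * R (axis a' 1) $ b) = (if a = a' then 1 else 0)" if "a \<in> J" "a' \<in> J" for a a'
   using inner_coord_space[OF Rax[OF that(2)], of "R (axis a 1)", symmetric] by (simp add: inn inner_axis_axis)
  show "(\<Sum>a\<in>J. R (axis a 1) $ b * R (axis a 1) $ b') = (if b = b' then 1 else 0)" if b: "b \<in> J" "b' \<in> J" for b b'
  proof -
   have R'J: "R' (axis c 1) \<in> coord_space J" if "c \<in> J" for c
    using rotJ_coord_space[OF R, of "R' (axis c 1)"] R' ax[OF that] by simp
   have c: "R (axis a 1) $ c = R' (axis c 1) $ a" for a c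
    using inn[of "axis a 1" "R' (axis c 1)"] by (simp add: R' inner_axis inner_axis')
   have "R' (axis b 1) \<bullet> R' (axis b' 1) = axis b 1 \<bullet> (axis b' 1 :: real^'n)" by (metis R' inn)
   then show ?thesis using inner_coord_space[OF R'J[OF b(2)], of "R' (axis b 1)", symmetric] by (simp add: c inner_axis_axis)
  qed
 qed simp_all
qed

text \<open>For a unit vector s and nonzero g: the tangent of the angle between the lines of s and g
  is below |r|. The set of such s is therefore a pair of antipodal caps, and g may be scaled freely
  by nonzero factors. Measuring by the tangent makes the cap around an axis a ball of radius r in
  the chart.\<close>

definition cap :: "real => real^'n => real^'n::finite => bool" where
 "cap r g s \<longleftrightarrow> g \<bullet> g < (1 + r\<^sup>2) * (s \<bullet> g)\<^sup>2"

text \<open>The direction of a Gaussian vector serves as a uniformly distributed centre of the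
  cap.\<close>

definition cap_prob :: "real => 'n set => real^'n::finite => ennreal" where
 "cap_prob r J s = (\<integral>\<^sup>+g. indicator {g. cap r (vecK J g) s} g \<partial>PiM J (%_. gauss))"

lemma vecK_measurable [measurable]: "vecK K \<in> PiM K (%_. lborel) \<rightarrow>\<^sub>M borel"
 unfolding vecK_def[abs_def]
proof (rule borel_measurable_vec)
 fix i show "(%x. if i \<in> K then x i else 0) \<in> borel_measurable (PiM K (%_. lborel))"
  by (cases "i \<in> K") simp_all
qed

lemma vecK_measurable_gauss [measurable]: "vecK K \<in> PiM K (%_. gauss) \<rightarrow>\<^sub>M borel"
 using vecK_measurable[of K] by (simp add: measurable_cong_sets[OF sets_PiM_gauss refl])

lemma cap_prob_eq:
 assumes s: "s \<in> coord_space J" "norm s = 1" and i: "i \<in> J"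
 shows "cap_prob r J s = cap_prob r J (axis i 1)"
proof -
 obtain R where R: "rotJ J R" "R (axis i 1) = s" using rotJ_exists[OF s i] by blast
 interpret orth_matrix J J "%a b. R (axis a 1) $ b" by (rule rotJ_orth_matrix[OF R(1)])
 have o: "orthogonal_transformation R" using R by (simp add: rotJ_def)
 have v: "vecK J (app g) = R (vecK J g)" for g
 proof -
  have "R (vecK J g) $ j = 0" if "j \<notin> J" for j using R(1) that by (simp add: rotJ_def)
  then show ?thesis by (auto simp: vec_eq_iff app_def rotJ_orth_matrix(2)[OF R(1)])
 qed
 have c: "cap r (R x) s \<longleftrightarrow> cap r x (axis i 1)" for x
  using o unfolding R(2)[symmetric] by (simp add: cap_def orthogonal_transformation_def)
 have "cap_prob r J s = (\<integral>\<^sup>+g. indicator {g. cap r (vecK J g) s} (app g) \<partial>PiM J (%_. gauss))"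
  unfolding cap_prob_def by (rule nn_integral_gauss_app[symmetric]) (simp add: cap_def, measurable)
 then show ?thesis unfolding cap_prob_def by (simp add: indicator_def[abs_def] v c)
qed

text \<open>All equations are gathered into one sum of absolute values and all strict conditions
  into one minimum, since zeros of one function subject to one strict inequality are what
  \<open>measurable_num_zeros\<close> counts.\<close>

lemma measurable_num_crit:
 fixes \<Xi> :: "'w => ('n::finite \<Rightarrow>\<^sub>0 nat) => real" and \<Gamma> :: "'w => real^'n"
 assumes [measurable]: "!!\<alpha>. \<alpha> \<in> exps p ==> (%\<omega>. \<Xi> \<omega> \<alpha>) \<in> borel_measurable M" "\<Gamma> \<in> borel_measurable M"
 shows "(%\<omega>. num_elements {s \<in> crit z J p (\<Xi> \<omega>). cap r (\<Gamma> \<omega>) s}) \<in> borel_measurable M"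
  and "(%\<omega>. num_elements (crit z J p (\<Xi> \<omega>))) \<in> borel_measurable M"
proof -
 define h where "h \<omega> s = (\<Sum>i\<in>-J. \<bar>s $ i\<bar>) + (\<bar>norm s - 1\<bar> +
  (\<Sum>i\<in>J. \<bar>dfld i p (\<Xi> \<omega>) s * (s \<bullet> s) - real p * fld p (\<Xi> \<omega>) s * s $ i\<bar>))" for \<omega> s
 define b where "b \<omega> s = (if z then \<bar>fld p (\<Xi> \<omega>) s\<bar> else 1)" for \<omega> s
 define g where "g \<omega> s = min (b \<omega> s) ((1 + r\<^sup>2) * (s \<bullet> \<Gamma> \<omega>)\<^sup>2 - \<Gamma> \<omega> \<bullet> \<Gamma> \<omega>)" for \<omega> s
 have hm: "(%\<omega>. h \<omega> s) \<in> borel_measurable M" for s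
  unfolding h_def dfld_def fld_def by measurable
 have bm[measurable]: "(%\<omega>. b \<omega> s) \<in> borel_measurable M" for s
  unfolding b_def fld_def by (cases z) simp_all
 have gm: "(%\<omega>. g \<omega> s) \<in> borel_measurable M" for s
  unfolding g_def by measurable
 have hc: "continuous_on UNIV (h \<omega>)" for \<omega>
  unfolding h_def by (intro continuous_intros continuous_dfld continuous_fld)
 have bc: "continuous_on UNIV (b \<omega>)" for \<omega>
  unfolding b_def by (cases z) (auto intro!: continuous_intros continuous_fld)
 have gc: "continuous_on UNIV (g \<omega>)" for \<omega>
  unfolding g_def by (intro continuous_intros bc)
 have h0: "h \<omega> s = 0 \<longleftrightarrow> s \<in> coord_space J \<and> norm s = 1 \<and> crit_eq J p (\<Xi> \<omega>) s" for \<omega> s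
  unfolding h_def crit_eq_def coord_space_def
  by (subst add_nonneg_eq_0_iff, force intro: sum_nonneg, force intro: sum_nonneg,
    subst add_nonneg_eq_0_iff, force, force intro: sum_nonneg)
    (auto simp: sum_nonneg_eq_0_iff)
 have "{s \<in> crit z J p (\<Xi> \<omega>). cap r (\<Gamma> \<omega>) s} = {s. h \<omega> s = 0 \<and> g \<omega> s > 0}" for \<omega>
  by (auto simp: crit_def h0 g_def b_def cap_def)
 moreover have "crit z J p (\<Xi> \<omega>) = {s. h \<omega> s = 0 \<and> b \<omega> s > 0}" for \<omega>
  by (auto simp: crit_def h0 b_def)
 ultimately show "(%\<omega>. num_elements {s \<in> crit z J p (\<Xi> \<omega>). cap r (\<Gamma> \<omega>) s}) \<in> borel_measurable M"
  "(%\<omega>. num_elements (crit z J p (\<Xi> \<omega>))) \<in> borel_measurable M"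
  using measurable_num_zeros[OF hm gm hc gc] measurable_num_zeros[OF hm bm hc bc] by simp_all
qed

text \<open>Each point of \<open>C\<close> is met by the random cap with the same probability, so
  the formula is additivity of the integral for finite \<open>C\<close>. For infinite
  \<open>C\<close> the finite subsets push the left side to infinity, because that probability is
  positive.\<close>

lemma cap_average_points:
 assumes C: "!!s. s \<in> C ==> s \<in> coord_space J \<and> norm s = 1" and i: "i \<in> J"
  and pos: "cap_prob r J (axis i 1) > 0"
  and m: "(%g. num_elements {s\<in>C. cap r (vecK J g) s}) \<in> borel_measurable (PiM J (%_. gauss))"
 shows "(\<integral>\<^sup>+g. num_elements {s\<in>C. cap r (vecK J g) s} \<partial>PiM J (%_. gauss)) = cap_prob r J (axis i 1) * num_elements C"
proof -
 let ?\<sigma> = "cap_prob r J (axis i 1)"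
 have T: "(\<integral>\<^sup>+g. num_elements {s\<in>T. cap r (vecK J g) s} \<partial>PiM J (%_. gauss)) = ?\<sigma> * of_nat (card T)"
  if T: "finite T" "T \<subseteq> C" for T
 proof -
  have "num_elements {s\<in>T. cap r (vecK J g) s} = (\<Sum>s\<in>T. indicator {g. cap r (vecK J g) s} g)" for g
  proof -
   have "(\<Sum>s\<in>T. indicator {g. cap r (vecK J g) s} g :: ennreal) = (\<Sum>s\<in>T. if cap r (vecK J g) s then 1 else 0)"
    by (simp add: indicator_def of_bool_def)
   also have "\<dots> = of_nat (card {s\<in>T. cap r (vecK J g) s})" using T(1) by (simp add: sum.If_cases Int_def)
   finally show ?thesis using T(1) by (simp add: num_elements_def)
  qed
  then have "(\<integral>\<^sup>+g. num_elements {s\<in>T. cap r (vecK J g) s} \<partial>PiM J (%_. gauss)) = (\<Sum>s\<in>T. cap_prob r J s)"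
   unfolding cap_prob_def by (simp, subst nn_integral_sum) (simp_all add: cap_def)
  also have "\<dots> = (\<Sum>s\<in>T. ?\<sigma>)" by (rule sum.cong) (use T C i cap_prob_eq in blast)+
  finally show ?thesis by (simp add: mult.commute)
 qed
 show ?thesis
 proof (cases "finite C")
  case True
  then show ?thesis using T[OF True] by (simp add: num_elements_def)
 next
  case False
  have "?\<sigma> * of_nat n \<le> (\<integral>\<^sup>+g. num_elements {s\<in>C. cap r (vecK J g) s} \<partial>PiM J (%_. gauss))" for n
  proof -
   obtain T where n: "finite T" "card T = n" "T \<subseteq> C" using infinite_arbitrarily_large[OF False] by blast
   have "(\<integral>\<^sup>+g. num_elements {s\<in>T. cap r (vecK J g) s} \<partial>PiM J (%_. gauss)) \<le> (\<integral>\<^sup>+g. num_elements {s\<in>C. cap r (vecK J g) s} \<partial>PiM J (%_. gauss))"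
    unfolding num_elements_def by (intro nn_integral_mono emeasure_mono) (use n in auto)
   then show ?thesis using T[OF n(1,3)] n(2) by simp
  qed
  then have "(SUP n. ?\<sigma> * of_nat n) \<le> (\<integral>\<^sup>+g. num_elements {s\<in>C. cap r (vecK J g) s} \<partial>PiM J (%_. gauss))"
   by (intro SUP_least)
  moreover have "(SUP n. ?\<sigma> * of_nat n) = ?\<sigma> * (SUP n. of_nat n)" by (rule SUP_mult_left_ennreal[symmetric])
  moreover have "(SUP n. of_nat n :: ennreal) = \<top>" by (rule ennreal_SUP_of_nat_eq_top)
  moreover have "num_elements C = \<top>" using False by (simp add: num_elements_def)
  moreover have "?\<sigma> ~= 0" using pos by simp
  ultimately show ?thesis by (simp add: top.extremum_unique ennreal_mult_top)
 qed
qed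

lemma AE_gauss_nonzero: "AE t in gauss. t ~= 0"
 unfolding gauss_def by (subst AE_density) (use AE_lborel_singleton[of "0::real"] in auto)

text \<open>After the exchange of the two averages, a rotation carries the random centre to the
  axis. The law of the polynomial and the weight \<open>G\<close> are invariant under it, so the
  inner integral is the same for almost every centre, and the global count is reduced to a count
  near one fixed point.\<close>

lemma nn_integral_cap_average:
 fixes J :: "'n::finite set"
 assumes i: "i \<in> J" and pos: "cap_prob r J (axis i 1) > 0"
  and G[measurable]: "G \<in> borel_measurable (PiM (exps p) (%_. lborel))"
  and inv: "!!R \<xi> \<xi>'. rotJ J R ==> (!!x. fld p \<xi>' x = fld p \<xi> (R x)) ==> G \<xi>' = (G \<xi> :: ennreal)"
 shows "cap_prob r J (axis i 1) * (\<integral>\<^sup>+\<xi>. G \<xi> * num_elements (crit z J p \<xi>) \<partial>PiM (exps p) (%_. gauss)) =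
  (\<integral>\<^sup>+\<xi>. G \<xi> * num_elements {s \<in> crit z J p \<xi>. cap r (axis i 1) s} \<partial>PiM (exps p) (%_. gauss))"
proof -
 let ?E = "PiM (exps p) (%_. gauss) :: (('n \<Rightarrow>\<^sub>0 nat) => real) measure" and ?J = "PiM J (%_. gauss)"
 let ?\<sigma> = "cap_prob r J (axis i 1)"
 interpret E: prob_space ?E by (rule prob_space_PiM) (rule prob_space_gauss)
 interpret J: prob_space ?J by (rule prob_space_PiM) (rule prob_space_gauss)
 interpret P: pair_sigma_finite ?E ?J by unfold_locales
 have GE[measurable]: "G \<in> borel_measurable ?E"
  using G by (simp add: measurable_cong_sets[OF sets_PiM_gauss refl])
 define N where "N \<xi> g = num_elements {s \<in> crit z J p \<xi>. cap r g s}" for \<xi> and g :: "real^'n"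
 have Nm[measurable]: "(%(\<xi>, g). N \<xi> (vecK J g)) \<in> borel_measurable (?E \<Otimes>\<^sub>M ?J)"
  unfolding N_def split_beta by (rule measurable_num_crit) measurable
 have Nm2[measurable]: "(%g. N \<xi> (vecK J g)) \<in> borel_measurable ?J" for \<xi>
  unfolding N_def by (rule measurable_num_crit) measurable
 have Nm3[measurable]: "(%\<xi>. N \<xi> g) \<in> borel_measurable (PiM (exps p) (%_. lborel))" for g
  unfolding N_def by (rule measurable_num_crit) measurable
 have cm: "(%\<xi>. num_elements (crit z J p \<xi>)) \<in> borel_measurable ?E"
  by (rule measurable_num_crit(2)[where \<Gamma>="%_. 0"]) measurable
 have "?\<sigma> * (\<integral>\<^sup>+\<xi>. G \<xi> * num_elements (crit z J p \<xi>) \<partial>?E) = (\<integral>\<^sup>+\<xi>. ?\<sigma> * (G \<xi> * num_elements (crit z J p \<xi>)) \<partial>?E)"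
  by (rule nn_integral_cmult[symmetric]) (use cm in measurable)
 also have "\<dots> = (\<integral>\<^sup>+\<xi>. G \<xi> * (\<integral>\<^sup>+g. N \<xi> (vecK J g) \<partial>?J) \<partial>?E)"
 proof (rule nn_integral_cong)
  fix \<xi>
  have "(\<integral>\<^sup>+g. N \<xi> (vecK J g) \<partial>?J) = ?\<sigma> * num_elements (crit z J p \<xi>)"
   unfolding N_def
  proof (rule cap_average_points[OF _ i pos])
   show "s \<in> coord_space J \<and> norm s = 1" if "s \<in> crit z J p \<xi>" for s using that by (simp add: crit_def)
  qed (use Nm2[of \<xi>] in \<open>simp add: N_def\<close>)
  then show "?\<sigma> * (G \<xi> * num_elements (crit z J p \<xi>)) = G \<xi> * (\<integral>\<^sup>+g. N \<xi> (vecK J g) \<partial>?J)"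
   by (simp add: mult.left_commute)
 qed
 also have "\<dots> = (\<integral>\<^sup>+\<xi>. (\<integral>\<^sup>+g. G \<xi> * N \<xi> (vecK J g) \<partial>?J) \<partial>?E)"
  by (intro nn_integral_cong nn_integral_cmult[symmetric]) measurable
 also have "\<dots> = (\<integral>\<^sup>+g. (\<integral>\<^sup>+\<xi>. G \<xi> * N \<xi> (vecK J g) \<partial>?E) \<partial>?J)"
  by (rule P.Fubini'[symmetric]) (use Nm in measurable)
 also have "\<dots> = (\<integral>\<^sup>+g. (\<integral>\<^sup>+\<xi>. G \<xi> * N \<xi> (axis i 1) \<partial>?E) \<partial>?J)"
 proof (rule nn_integral_cong_AE)
  \<comment> \<open>A nonzero i-th coordinate guarantees that the centre has a direction.\<close>
  have "AE g in ?J. g i ~= 0"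
   by (rule AE_PiM_component[OF prob_space_gauss i AE_gauss_nonzero])
  then show "AE g in ?J. (\<integral>\<^sup>+\<xi>. G \<xi> * N \<xi> (vecK J g) \<partial>?E) = (\<integral>\<^sup>+\<xi>. G \<xi> * N \<xi> (axis i 1) \<partial>?E)"
  proof eventually_elim
   case (elim g)
   let ?g = "vecK J g"
   define s where "s = ?g /\<^sub>R norm ?g"
   have "?g $ i ~= 0" using elim i by simp
   then have ng: "norm ?g ~= 0" by (metis norm_eq_zero zero_index)
   have s: "s \<in> coord_space J" "norm s = 1" using ng by (auto simp: s_def coord_space_def)
   have gs: "?g = norm ?g *\<^sub>R s" using ng by (simp add: s_def)
   have capgs: "cap r ?g x \<longleftrightarrow> cap r s x" for x
   proof -
    have "cap r ?g x \<longleftrightarrow> (norm ?g)\<^sup>2 * (s \<bullet> s) < (norm ?g)\<^sup>2 * ((1 + r\<^sup>2) * (x \<bullet> s)\<^sup>2)"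
     unfolding cap_def by (subst (1 2 3) gs) (simp add: power2_eq_square algebra_simps)
    then show ?thesis using ng by (simp add: cap_def)
   qed
   obtain R where R: "rotJ J R" "R (axis i 1) = s" using rotJ_exists[OF s i] by blast
   have o: "orthogonal_transformation R" using R by (simp add: rotJ_def)
   obtain T where T: "T \<in> PiM (exps p) (%_. lborel) \<rightarrow>\<^sub>M PiM (exps p) (%_. lborel :: real measure)"
    "!!\<xi> x. fld p (T \<xi>) x = fld p \<xi> (R x)"
    "!!H. H \<in> borel_measurable (PiM (exps p) (%_. lborel)) ==>
      (\<integral>\<^sup>+\<xi>. H (T \<xi>) \<partial>?E) = (\<integral>\<^sup>+\<xi>. H \<xi> \<partial>?E)"
    using rotate_field[OF o] by blast
   have "N \<xi> s = N (T \<xi>) (axis i 1)" for \<xi>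
    unfolding N_def
   proof (rule num_elements_bij[OF bij_betw_byWitness[where f'=R and f="inv R"]])
    have b: "bij R" by (rule orthogonal_transformation_bij[OF o])
    have cr: "cap r s (R x) \<longleftrightarrow> cap r (axis i 1) x" for x
     using o unfolding R(2)[symmetric] by (simp add: cap_def orthogonal_transformation_def)
    note cc = crit_rotate[OF o rotJ_coord_space[OF R(1)] T(2)]
    show "\<forall>x\<in>{x \<in> crit z J p \<xi>. cap r s x}. R (inv R x) = x" using b by (simp add: bij_is_surj surj_f_inv_f)
    show "\<forall>x\<in>{x \<in> crit z J p (T \<xi>). cap r (axis i 1) x}. inv R (R x) = x" using b by (simp add: bij_is_inj)
    show "R ` {x \<in> crit z J p (T \<xi>). cap r (axis i 1) x} \<subseteq> {x \<in> crit z J p \<xi>. cap r s x}"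
     using cc cr by auto
    show "inv R ` {x \<in> crit z J p \<xi>. cap r s x} \<subseteq> {x \<in> crit z J p (T \<xi>). cap r (axis i 1) x}"
    proof safe
     fix x assume x: "x \<in> crit z J p \<xi>" "cap r s x"
     have "R (inv R x) = x" using b by (simp add: bij_is_surj surj_f_inv_f)
     then show "inv R x \<in> crit z J p (T \<xi>)" "cap r (axis i 1) (inv R x)" using x cc cr by metis+
    qed
   qed
   then have "(\<integral>\<^sup>+\<xi>. G \<xi> * N \<xi> ?g \<partial>?E) = (\<integral>\<^sup>+\<xi>. G (T \<xi>) * N (T \<xi>) (axis i 1) \<partial>?E)"
    using inv[OF R(1) T(2)] by (simp add: N_def capgs)
   also have "\<dots> = (\<integral>\<^sup>+\<xi>. G \<xi> * N \<xi> (axis i 1) \<partial>?E)"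
    by (rule T(3)) measurable
   finally show ?case .
  qed
 qed
 also have "\<dots> = (\<integral>\<^sup>+\<xi>. G \<xi> * N \<xi> (axis i 1) \<partial>?E)" by (simp add: J.emeasure_space_1)
 finally show ?thesis by (simp only: N_def)
qed

section \<open>A chart of the sphere\<close>

lemma crit_eq_scale:
 assumes "c ~= 0" "p \<ge> 1"
 shows "crit_eq J p \<xi> (c *\<^sub>R x) \<longleftrightarrow> crit_eq J p \<xi> x"
proof -
 have cp: "c ^ (p - 1) * c = c ^ p" using assms(2) by (metis Suc_diff_1 less_le_trans power_Suc2 zero_less_one)
 have e1: "dfld i p \<xi> (c *\<^sub>R x) * ((c *\<^sub>R x) \<bullet> (c *\<^sub>R x)) = (c ^ p * c) * (dfld i p \<xi> x * (x \<bullet> x))" for i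
  by (simp add: dfld_scale cp[symmetric] algebra_simps)
 have e2: "real p * fld p \<xi> (c *\<^sub>R x) * (c *\<^sub>R x) $ i = (c ^ p * c) * (real p * fld p \<xi> x * x $ i)" for i
  by (simp add: fld_scale algebra_simps)
 show ?thesis unfolding crit_eq_def e1 e2 using assms by simp
qed

definition chart_eq :: "'n => 'n set => nat => (('n::finite \<Rightarrow>\<^sub>0 nat) => real) => real^'n => bool" where
 "chart_eq i0 K p \<xi> y \<longleftrightarrow> (\<forall>i\<in>K. dfld i p \<xi> (axis i0 1 + y) = y $ i * dfld i0 p \<xi> (axis i0 1 + y))"

text \<open>At a point with \<open>i0\<close>-coordinate 1 the multiplier of the critical equations
  is the \<open>i0\<close>-th partial derivative; inserting it leaves equations that are linear in
  the gradient. Conversely, Euler's identity recovers the multiplier from them.\<close>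

lemma chart_eq_iff:
 fixes y :: "real^'n::finite"
 assumes y: "y \<in> coord_space (J - {i0})" and i0: "i0 \<in> J"
 shows "crit_eq J p \<xi> (axis i0 1 + y) \<longleftrightarrow> chart_eq i0 (J - {i0}) p \<xi> y"
proof -
 let ?x = "axis i0 1 + y"
 have x0: "?x $ i0 = 1" using y by (simp add: coord_space_def axis_def)
 have xi: "?x $ i = y $ i" if "i ~= i0" for i using that by (simp add: axis_def)
 have xJ: "?x $ i = 0" if "i \<notin> J" for i using that y i0 by (auto simp: coord_space_def axis_def)
 have pos: "?x \<bullet> ?x ~= 0" using x0 by (metis inner_eq_zero_iff zero_index zero_neq_one)
 show ?thesis
 proof
  assume c: "crit_eq J p \<xi> ?x"
  have c0: "dfld i0 p \<xi> ?x * (?x \<bullet> ?x) = real p * fld p \<xi> ?x" using c i0 x0 by (simp add: crit_eq_def)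
  show "chart_eq i0 (J - {i0}) p \<xi> y"
   unfolding chart_eq_def
  proof
   fix i assume "i \<in> J - {i0}"
   then have "dfld i p \<xi> ?x * (?x \<bullet> ?x) = real p * fld p \<xi> ?x * y $ i" using c xi by (auto simp: crit_eq_def)
   also have "\<dots> = y $ i * dfld i0 p \<xi> ?x * (?x \<bullet> ?x)" by (simp add: c0[symmetric])
   finally show "dfld i p \<xi> ?x = y $ i * dfld i0 p \<xi> ?x" using pos by simp
  qed
 next
  assume c: "chart_eq i0 (J - {i0}) p \<xi> y"
  have d: "dfld i p \<xi> ?x = ?x $ i * dfld i0 p \<xi> ?x" if "i \<in> J" for i
   using c that x0 xi[of i] by (cases "i = i0") (auto simp: chart_eq_def)
  have "real p * fld p \<xi> ?x = (\<Sum>i\<in>UNIV. ?x $ i * dfld i p \<xi> ?x)" by (rule euler_fld[symmetric])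
  also have "\<dots> = (\<Sum>i\<in>UNIV. (?x $ i * ?x $ i) * dfld i0 p \<xi> ?x)"
  proof (rule sum.cong[OF refl])
   fix i show "?x $ i * dfld i p \<xi> ?x = (?x $ i * ?x $ i) * dfld i0 p \<xi> ?x"
    using d[of i] xJ[of i] by (cases "i \<in> J") simp_all
  qed
  also have "\<dots> = (?x \<bullet> ?x) * dfld i0 p \<xi> ?x" by (simp add: inner_vec_def sum_distrib_right)
  finally have e: "real p * fld p \<xi> ?x = (?x \<bullet> ?x) * dfld i0 p \<xi> ?x" .
  show "crit_eq J p \<xi> ?x" unfolding crit_eq_def
  proof
   fix i assume "i \<in> J"
   show "dfld i p \<xi> ?x * (?x \<bullet> ?x) = real p * fld p \<xi> ?x * ?x $ i"
    unfolding e d[OF \<open>i \<in> J\<close>] by (simp only: mult_ac)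
  qed
 qed
qed

text \<open>Rescaling by r keeps the domain equal to the open unit ball while the cap shrinks, so
  limits are taken on a fixed domain.\<close>

definition chart_set :: "bool => 'n => 'n set => nat => (('n::finite \<Rightarrow>\<^sub>0 nat) => real) => real => (real^'n) set" where
 "chart_set z i0 K p \<xi> r = {y \<in> coord_space K. norm y < 1 \<and> chart_eq i0 K p \<xi> (r *\<^sub>R y) \<and>
   (z --> fld p \<xi> (axis i0 1 + r *\<^sub>R y) ~= 0)}"

lemma num_elements_union:
 assumes "A \<inter> B = {}" shows "num_elements (A \<union> B) = num_elements A + num_elements B"
 unfolding num_elements_def using assms by (intro plus_emeasure[symmetric]) auto

text \<open>Central projection to the tangent hyperplane at the axis identifies each of the two
  antipodal halves of the cap with a ball of radius r, and homogeneity makes the conditions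
  invariant under it. The factor 2 counts the halves, told apart by the sign \<open>\<sigma>\<close>
  of the \<open>i0\<close>-coordinate.\<close>

lemma num_cap_eq_chart:
 fixes J :: "'n::finite set"
 assumes p: "p \<ge> 1" and i0: "i0 \<in> J" and r: "r > 0"
 shows "num_elements {s \<in> crit z J p \<xi>. cap r (axis i0 1) s} = 2 * num_elements (chart_set z i0 (J - {i0}) p \<xi> r)"
proof -
 let ?e = "axis i0 1 :: real^'n"
 let ?K = "J - {i0}"
 define C where "C \<sigma> = {s \<in> crit z J p \<xi>. cap r ?e s \<and> \<sigma> * s $ i0 > 0}" for \<sigma> :: real
 have cap: "cap r ?e s \<longleftrightarrow> 1 < (1 + r\<^sup>2) * (s $ i0)\<^sup>2" for s
  by (simp add: cap_def inner_axis inner_axis_axis)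
 have y0: "y $ i0 = 0" if "y \<in> coord_space ?K" for y using that by (simp add: coord_space_def)
 have key: "t *\<^sub>R (?e + r *\<^sub>R y) \<in> C \<sigma> \<longleftrightarrow> y \<in> chart_set z i0 ?K p \<xi> r \<and> \<sigma> * t > 0"
  if y: "y \<in> coord_space ?K" and t: "t\<^sup>2 * (1 + r\<^sup>2 * (y \<bullet> y)) = 1" and \<sigma>: "\<sigma> ~= 0" for t y \<sigma>
 proof -
  let ?x = "?e + r *\<^sub>R y"
  have ry: "r *\<^sub>R y \<in> coord_space ?K" using y by (simp add: coord_space_def)
  have t0: "t ~= 0" using t by auto
  have xx: "?x \<bullet> ?x = 1 + r\<^sup>2 * (y \<bullet> y)"
   using y0[OF y] by (simp add: inner_simps inner_axis inner_axis' inner_axis_axis power2_eq_square)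
  have "(t *\<^sub>R ?x) \<bullet> (t *\<^sub>R ?x) = t\<^sup>2 * (?x \<bullet> ?x)"
   by (simp only: inner_scaleR_left inner_scaleR_right power2_eq_square mult.assoc)
  then have n: "norm (t *\<^sub>R ?x) = 1" unfolding norm_eq_1 xx t .
  have cJ: "t *\<^sub>R ?x \<in> coord_space J" using y i0 by (auto simp: coord_space_def axis_def)
  have s0: "(t *\<^sub>R ?x) $ i0 = t" using y0[OF y] by (simp add: axis_def)
  have ce: "crit_eq J p \<xi> (t *\<^sub>R ?x) \<longleftrightarrow> chart_eq i0 ?K p \<xi> (r *\<^sub>R y)"
   unfolding crit_eq_scale[OF t0 p] by (rule chart_eq_iff[OF ry i0])
  have f: "fld p \<xi> (t *\<^sub>R ?x) ~= 0 \<longleftrightarrow> fld p \<xi> ?x ~= 0" using t0 by (simp add: fld_scale)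
  have "1 < (1 + r\<^sup>2) * t\<^sup>2 \<longleftrightarrow> t\<^sup>2 * (1 + r\<^sup>2 * (y \<bullet> y)) < t\<^sup>2 * (1 + r\<^sup>2)" unfolding t by (simp add: mult.commute)
  also have "\<dots> \<longleftrightarrow> y \<bullet> y < 1" using t0 r by simp
  also have "\<dots> \<longleftrightarrow> norm y < 1" by (simp add: norm_eq_sqrt_inner)
  finally have c: "cap r ?e (t *\<^sub>R ?x) \<longleftrightarrow> norm y < 1" unfolding cap s0 .
  show ?thesis unfolding C_def crit_def chart_set_def mem_Collect_eq ce f c s0 n using y cJ by blast
 qed
 have b: "num_elements (C \<sigma>) = num_elements (chart_set z i0 ?K p \<xi> r)" if \<sigma>: "\<sigma> = 1 \<or> \<sigma> = -1" for \<sigma>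
 proof (rule num_elements_bij)
  \<comment> \<open>The factor that brings a chart point back to the unit sphere, on the chosen
    half.\<close>
  define T where "T y = \<sigma> / sqrt (1 + r\<^sup>2 * (y \<bullet> y))" for y :: "real^'n"
  have Tp: "1 + r\<^sup>2 * (y \<bullet> y) > 0" for y :: "real^'n" by (intro add_pos_nonneg) auto
  have T2: "(T y)\<^sup>2 * (1 + r\<^sup>2 * (y \<bullet> y)) = 1" for y
   using \<sigma> Tp[of y] by (auto simp: T_def power_divide)
  have T\<sigma>: "\<sigma> * T y > 0" for y using \<sigma> Tp[of y] by (auto simp: T_def)
  have \<sigma>0: "\<sigma> ~= 0" using \<sigma> by auto
  define Y where "Y s = (1 / r) *\<^sub>R ((1 / s $ i0) *\<^sub>R s - ?e)" for s :: "real^'n"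
  have Ys: "Y s \<in> coord_space ?K" "s $ i0 *\<^sub>R (?e + r *\<^sub>R Y s) = s" "(s $ i0)\<^sup>2 * (1 + r\<^sup>2 * (Y s \<bullet> Y s)) = 1"
   if s: "s \<in> C \<sigma>" for s
  proof -
   have s0: "s $ i0 ~= 0" using s by (auto simp: C_def)
   have sJ: "s \<in> coord_space J" "norm s = 1" using s by (auto simp: C_def crit_def)
   show YK: "Y s \<in> coord_space ?K" using sJ s0 by (auto simp: Y_def coord_space_def axis_def)
   show e: "s $ i0 *\<^sub>R (?e + r *\<^sub>R Y s) = s" using s0 r by (simp add: Y_def)
   have "1 = s \<bullet> s" using sJ by (simp add: norm_eq_1)
   also have "\<dots> = (s $ i0 *\<^sub>R (?e + r *\<^sub>R Y s)) \<bullet> (s $ i0 *\<^sub>R (?e + r *\<^sub>R Y s))" by (simp only: e)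
   also have "\<dots> = (s $ i0)\<^sup>2 * ((?e + r *\<^sub>R Y s) \<bullet> (?e + r *\<^sub>R Y s))"
    by (simp only: inner_scaleR_left inner_scaleR_right power2_eq_square mult.assoc)
   also have "(?e + r *\<^sub>R Y s) \<bullet> (?e + r *\<^sub>R Y s) = 1 + r\<^sup>2 * (Y s \<bullet> Y s)"
    using y0[OF YK] by (simp add: inner_add_left inner_add_right inner_axis inner_axis' inner_axis_axis power2_eq_square)
   finally show "(s $ i0)\<^sup>2 * (1 + r\<^sup>2 * (Y s \<bullet> Y s)) = 1" by simp
  qed
  show "bij_betw Y (C \<sigma>) (chart_set z i0 ?K p \<xi> r)"
  proof (rule bij_betw_byWitness[where f'="%y. T y *\<^sub>R (?e + r *\<^sub>R y)"])
   show "\<forall>s\<in>C \<sigma>. T (Y s) *\<^sub>R (?e + r *\<^sub>R Y s) = s"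
   proof
    fix s assume s: "s \<in> C \<sigma>"
    have "(T (Y s))\<^sup>2 = (s $ i0)\<^sup>2" using T2[of "Y s"] Ys(3)[OF s] Tp[of "Y s"]
     by (metis less_irrefl mult_right_cancel)
    moreover have "\<sigma> * s $ i0 > 0" using s by (simp add: C_def)
    ultimately have "T (Y s) = s $ i0" using T\<sigma>[of "Y s"] \<sigma> by (auto simp: power2_eq_iff)
    then show "T (Y s) *\<^sub>R (?e + r *\<^sub>R Y s) = s" using Ys(2)[OF s] by simp
   qed
   show "\<forall>y\<in>chart_set z i0 ?K p \<xi> r. Y (T y *\<^sub>R (?e + r *\<^sub>R y)) = y"
   proof
    fix y assume "y \<in> chart_set z i0 ?K p \<xi> r"
    then have "y $ i0 = 0" using y0 by (auto simp: chart_set_def)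
    moreover have "T y ~= 0" using T\<sigma>[of y] by auto
    ultimately show "Y (T y *\<^sub>R (?e + r *\<^sub>R y)) = y" using r by (simp add: Y_def axis_def)
   qed
   show "Y ` C \<sigma> \<subseteq> chart_set z i0 ?K p \<xi> r"
   proof safe
    fix s assume s: "s \<in> C \<sigma>"
    then show "Y s \<in> chart_set z i0 ?K p \<xi> r" using key[OF Ys(1)[OF s] Ys(3)[OF s] \<sigma>0] Ys(2)[OF s] by simp
   qed
   show "(%y. T y *\<^sub>R (?e + r *\<^sub>R y)) ` chart_set z i0 ?K p \<xi> r \<subseteq> C \<sigma>"
   proof safe
    fix y assume y: "y \<in> chart_set z i0 ?K p \<xi> r"
    then have "y \<in> coord_space ?K" by (simp add: chart_set_def)
    from key[OF this T2 \<sigma>0] y T\<sigma>[of y] show "T y *\<^sub>R (?e + r *\<^sub>R y) \<in> C \<sigma>" by simp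
   qed
  qed
 qed
 have "{s \<in> crit z J p \<xi>. cap r ?e s} = C 1 \<union> C (-1)"
  by (auto simp: C_def cap) (metis linorder_neqE_linordered_idom mult_zero_right not_one_less_zero power_zero_numeral)
 moreover have "C 1 \<inter> C (-1) = {}" by (auto simp: C_def)
 ultimately show ?thesis using b[of 1] b[of "-1"] by (simp add: num_elements_union mult_2)
qed

section \<open>Gradient calculus and the solution of the chart equations\<close>

lemma has_grad_const: "has_grad U (%y. c) (%i y. 0)"
 by (simp add: has_grad_def)

lemma has_grad_coord: "has_grad U (%y. y $ l) (%i y. if i = l then 1 else 0)"
proof -
 have "(\<Sum>i\<in>UNIV. (if i = l then 1 else 0) * w $ i) = w $ l" for w :: "real^'a"
  by (simp add: if_distrib[of "%c. c * _"] cong: if_cong)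
 then show ?thesis by (auto simp: has_grad_def bounded_linear_imp_has_derivative bounded_linear_vec_nth)
qed

lemma has_grad_continuous: "has_grad U F D ==> continuous_on U F"
 by (auto simp: has_grad_def intro!: has_derivative_continuous_on intro: has_derivative_at_withinI)

lemma has_grad_add:
 assumes "has_grad U F D" "has_grad U F' D'"
 shows "has_grad U (%y. F y + F' y) (%i y. D i y + D' i y)"
 using assms unfolding has_grad_def
 by (auto intro!: continuous_intros derivative_eq_intros simp: algebra_simps sum.distrib)

lemma has_grad_mult:
 assumes "has_grad U F D" "has_grad U F' D'"
 shows "has_grad U (%y. F y * F' y) (%i y. D i y * F' y + F y * D' i y)"
proof -
 have "((%y. F y * F' y) has_derivative (%w. \<Sum>i\<in>UNIV. (D i y * F' y + F y * D' i y) * w $ i)) (at y)" if "y \<in> U" for y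
 proof -
  have "((%y. F y * F' y) has_derivative (%w. F y * (\<Sum>i\<in>UNIV. D' i y * w $ i) + (\<Sum>i\<in>UNIV. D i y * w $ i) * F' y)) (at y)"
   using assms that by (intro has_derivative_mult) (auto simp: has_grad_def)
  then show ?thesis by (simp add: sum_distrib_left sum_distrib_right sum.distrib[symmetric] algebra_simps)
 qed
 then show ?thesis
  using assms has_grad_continuous[OF assms(1)] has_grad_continuous[OF assms(2)]
  by (auto simp: has_grad_def intro!: continuous_intros)
qed

lemma has_grad_cmult: "has_grad U F D ==> has_grad U (%y. c * F y) (%i y. c * D i y)"
 using has_grad_mult[OF has_grad_const[of U c]] by simp

lemma has_grad_sum:
 assumes "!!a. a \<in> A ==> has_grad U (F a) (D a)"
 shows "has_grad U (%y. \<Sum>a\<in>A. F a y) (%i y. \<Sum>a\<in>A. D a i y)"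
 using assms by (induction A rule: infinite_finite_induct) (auto intro: has_grad_add simp: has_grad_const)

lemma has_grad_inverse:
 assumes "has_grad U F D" and nz: "!!y. y \<in> U ==> F y ~= 0"
 shows "has_grad U (%y. inverse (F y)) (%i y. - (inverse (F y) * D i y * inverse (F y)))"
proof -
 have "((%y. inverse (F y)) has_derivative (%w. \<Sum>i\<in>UNIV. - (inverse (F y) * D i y * inverse (F y)) * w $ i)) (at y)" if "y \<in> U" for y
 proof -
  have "((%y. inverse (F y)) has_derivative (%w. - (inverse (F y) * (\<Sum>i\<in>UNIV. D i y * w $ i) * inverse (F y)))) (at y)"
   using assms that by (intro Deriv.has_derivative_inverse) (auto simp: has_grad_def)
  then show ?thesis by (simp add: sum_distrib_left sum_distrib_right sum_negf mult_ac)
 qed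
 then show ?thesis
  using assms has_grad_continuous[OF assms(1)] by (auto simp: has_grad_def intro!: continuous_intros)
qed

lemma has_grad_mon_shift: "has_grad U (%y. mon \<alpha> (e + y)) (%i y. dmon i \<alpha> (e + y))"
proof -
 have "((%y. mon \<alpha> (e + y)) has_derivative (%w. \<Sum>i\<in>UNIV. dmon i \<alpha> (e + y) * w $ i)) (at y)" for y
  by (rule has_derivative_compose[OF _ mon_has_derivative, where f="%y. e + y"])
    (auto intro!: derivative_eq_intros)
 moreover have "continuous_on U (%y. dmon i \<alpha> (e + y))" for i
  by (rule continuous_on_compose2[OF continuous_dmon[of UNIV]]) (auto intro!: continuous_intros)
 ultimately show ?thesis by (simp add: has_grad_def)
qed

lemma has_grad_dmon_shift:
 "has_grad U (%y. dmon j \<alpha> (e + y)) (%i y. real (Poly_Mapping.lookup \<alpha> j) * dmon i (\<alpha> - unit_exp j) (e + y))"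
 unfolding dmon_def[of j \<alpha>] by (rule has_grad_cmult[OF has_grad_mon_shift])

lemma mon_single: "mon (Poly_Mapping.single i k) x = x $ i ^ k"
proof -
 have "mon (Poly_Mapping.single i k) x = (\<Prod>j\<in>UNIV. if j = i then x $ i ^ k else 1)"
  unfolding mon_def by (rule prod.cong) (auto simp: lookup_single when_def)
 then show ?thesis by simp
qed

text \<open>The exponent of \<open>x_i0^(p-1) x_j\<close>. For j different from \<open>i0\<close>
  the coefficient at it is, up to a constant, the derivative in direction j at the axis point of
  \<open>i0\<close>; these coefficients are the unknowns for which the critical equations are
  solved.\<close>

definition bexp :: "'n => nat => 'n => ('n \<Rightarrow>\<^sub>0 nat)" where
 "bexp i0 p j = Poly_Mapping.single i0 (p - 1) + unit_exp j"

text \<open>The exponent of \<open>x_i0^(p-2) x_j x_k\<close>, whose coefficients give the second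
  derivatives at the axis point. It has degree p only for p at least 2; for p = 1 its coefficient
  enters \<open>jac\<close> with the factor 0.\<close>

definition qexp :: "'n => nat => 'n => 'n => ('n \<Rightarrow>\<^sub>0 nat)" where
 "qexp i0 p j k = Poly_Mapping.single i0 (p - 2) + unit_exp j + unit_exp k"

lemma lookup_bexp: "Poly_Mapping.lookup (bexp i0 p j) i = (if i = i0 then p - 1 else 0) + (if i = j then 1 else 0)"
 by (auto simp: bexp_def lookup_add lookup_single when_def)

lemma lookup_qexp: "Poly_Mapping.lookup (qexp i0 p j k) i =
  (if i = i0 then p - 2 else 0) + (if i = j then 1 else 0) + (if i = k then 1 else 0)"
 by (auto simp: qexp_def lookup_add lookup_single when_def)

lemma exps_single: "Poly_Mapping.single i p \<in> exps p"
 by (simp add: exps_def lookup_single when_def)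

lemma exps_bexp: "p \<ge> 1 ==> bexp i0 p j \<in> exps p"
 by (simp add: exps_def lookup_bexp sum.distrib)

lemma exps_qexp: "p \<ge> 2 ==> qexp i0 p j k \<in> exps p"
 by (simp add: exps_def lookup_qexp sum.distrib)

lemma inj_on_bexp: "i0 \<notin> K ==> inj_on (bexp i0 p) K"
proof (rule inj_onI)
 fix j k assume "i0 \<notin> K" "j \<in> K" "k \<in> K" "bexp i0 p j = bexp i0 p k"
 then have "Poly_Mapping.lookup (bexp i0 p j) j = Poly_Mapping.lookup (bexp i0 p k) j" by simp
 then show "j = k" by (auto simp: lookup_bexp split: if_splits)
qed

definition rest_exps :: "'n => 'n set => nat => ('n::finite \<Rightarrow>\<^sub>0 nat) set" where
 "rest_exps i0 K p = exps p - bexp i0 p ` K"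

lemma single_rest: "i0 \<notin> K ==> p \<ge> 1 ==> Poly_Mapping.single i0 p \<in> rest_exps i0 K p"
proof -
 assume a: "i0 \<notin> K" "p \<ge> 1"
 have "Poly_Mapping.single i0 p ~= bexp i0 p j" if "j \<in> K" for j
 proof
  assume "Poly_Mapping.single i0 p = bexp i0 p j"
  then have "Poly_Mapping.lookup (Poly_Mapping.single i0 p) i0 = Poly_Mapping.lookup (bexp i0 p j) i0" by simp
  moreover have "i0 ~= j" using a that by auto
  ultimately show False using a by (simp add: lookup_bexp)
 qed
 then show ?thesis using exps_single by (auto simp: rest_exps_def)
qed

lemma qexp_rest: "i0 \<notin> K ==> j \<in> K ==> k \<in> K ==> p \<ge> 2 ==> qexp i0 p j k \<in> rest_exps i0 K p"
proof -
 assume a: "i0 \<notin> K" "j \<in> K" "k \<in> K" "p \<ge> 2"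
 have "qexp i0 p j k ~= bexp i0 p l" if "l \<in> K" for l
 proof
  assume "qexp i0 p j k = bexp i0 p l"
  then have "Poly_Mapping.lookup (qexp i0 p j k) i0 = Poly_Mapping.lookup (bexp i0 p l) i0" by simp
  moreover have "i0 ~= j" "i0 ~= k" "i0 ~= l" using a that by auto
  ultimately show False using a by (simp add: lookup_bexp lookup_qexp)
 qed
 then show ?thesis using exps_qexp[OF a(4)] by (auto simp: rest_exps_def)
qed

definition cf :: "nat => 'n => 'n => ('n::finite \<Rightarrow>\<^sub>0 nat) => real^'n => real" where
 "cf p i0 i \<alpha> y = sqrt (multinom p \<alpha>) * dmon i \<alpha> (axis i0 1 + y)"

text \<open>The contribution of the exponent \<open>\<alpha>\<close> to the residual of the j-th
  chart equation.\<close>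

definition qf :: "nat => 'n => 'n => ('n::finite \<Rightarrow>\<^sub>0 nat) => real^'n => real" where
 "qf p i0 j \<alpha> y = y $ j * cf p i0 i0 \<alpha> y + (-1) * cf p i0 j \<alpha> y"

definition nrmK :: "'n set => real^'n::finite => real" where
 "nrmK K y = (\<Sum>l\<in>K. y $ l * y $ l)"

text \<open>On the chart, the equations for a critical point are linear in the coefficients of the
 monomials \<open>x\<^sub>i\<^sub>0\<^sup>p\<^sup>-\<^sup>1 x\<^sub>j\<close>; \<open>mf\<close> is the solution operator.\<close>

definition mf :: "nat => 'n => 'n set => 'n => ('n::finite \<Rightarrow>\<^sub>0 nat) => real^'n => real" where
 "mf p i0 K j \<alpha> y = inverse (sqrt (real p)) * (qf p i0 j \<alpha> y +
   real (p - 1) * ((y $ j * (\<Sum>l\<in>K. qf p i0 l \<alpha> y * y $ l)) * inverse (1 + (- real (p - 1)) * nrmK K y)))"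

lemma multinom_bexp:
 fixes i0 j :: "'n::finite"
 assumes "p \<ge> 1" "j ~= i0" shows "multinom p (bexp i0 p j) = real p"
proof -
 have "(\<Prod>i\<in>UNIV. fact (Poly_Mapping.lookup (bexp i0 p j) i) :: real) =
  fact (p - 1) * (\<Prod>i\<in>UNIV-{i0}. fact (Poly_Mapping.lookup (bexp i0 p j) i))"
  using assms by (subst prod.remove[of UNIV i0]) (auto simp: lookup_bexp)
 also have "(\<Prod>i\<in>UNIV-{i0}. fact (Poly_Mapping.lookup (bexp i0 p j) i) :: real) = 1"
  by (rule prod.neutral) (auto simp: lookup_bexp)
 finally show ?thesis using assms(1) fact_reduce[of p, where 'a=real] by (simp add: multinom_def)
qed

lemma multinom_qexp:
 fixes i0 j k :: "'n::finite"
 assumes "p \<ge> 2" "j ~= i0" "k ~= i0"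
 shows "multinom p (qexp i0 p j k) = real p * real (p - 1) / (if j = k then 2 else 1)"
proof -
 have "(\<Prod>i\<in>UNIV. fact (Poly_Mapping.lookup (qexp i0 p j k) i) :: real) =
  fact (p - 2) * (\<Prod>i\<in>UNIV-{i0}. fact (Poly_Mapping.lookup (qexp i0 p j k) i))"
  using assms by (subst prod.remove[of UNIV i0]) (auto simp: lookup_qexp)
 also have "(\<Prod>i\<in>UNIV-{i0}. fact (Poly_Mapping.lookup (qexp i0 p j k) i) :: real) =
  (\<Prod>i\<in>UNIV-{i0}. if i = j then (if j = k then 2 else 1) else 1)"
  by (rule prod.cong) (auto simp: lookup_qexp)
 also have "\<dots> = (if j = k then 2 else 1)" using assms by simp
 finally have "multinom p (qexp i0 p j k) = fact p / (fact (p - 2) * (if j = k then 2 else 1))"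
  by (simp add: multinom_def)
 moreover have "(fact p :: real) = real p * (real (p - 1) * fact (p - 2))"
 proof -
  obtain m where "p = Suc (Suc m)" using assms(1) by (metis Suc_le_D numeral_2_eq_2 Suc_le_mono)
  then show ?thesis by (simp del: of_nat_Suc)
 qed
 ultimately show ?thesis by simp
qed

lemma chart_point: "y \<in> coord_space K ==> i0 \<notin> K ==> (axis i0 1 + y) $ i0 = 1"
 "i ~= i0 ==> (axis i0 1 + y) $ i = y $ i"
 by (auto simp: coord_space_def axis_def)

lemma cf_bexp:
 assumes y: "y \<in> coord_space K" and i0: "i0 \<notin> K" and p: "p \<ge> 1" and j: "j \<in> K"
 shows "i \<in> K ==> cf p i0 i (bexp i0 p j) y = (if i = j then sqrt (real p) else 0)"
  and "cf p i0 i0 (bexp i0 p j) y = sqrt (real p) * (real (p - 1) * y $ j)"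
proof -
 have j0: "j ~= i0" using j i0 by auto
 show "cf p i0 i (bexp i0 p j) y = (if i = j then sqrt (real p) else 0)" if "i \<in> K"
 proof -
  have i: "i ~= i0" using that i0 by auto
  have "bexp i0 p j - unit_exp j = Poly_Mapping.single i0 (p - 1)" by (simp add: bexp_def)
  then have "mon (bexp i0 p j - unit_exp j) (axis i0 1 + y) = 1"
   using chart_point(1)[OF y i0] by (simp add: mon_single del: vector_add_component)
  then show ?thesis using i j0 by (auto simp: cf_def dmon_def lookup_bexp multinom_bexp[OF p j0])
 qed
 show "cf p i0 i0 (bexp i0 p j) y = sqrt (real p) * (real (p - 1) * y $ j)"
 proof (cases "p = 1")
  case True
  then show ?thesis using j0 by (auto simp: cf_def dmon_def lookup_bexp)
 next
  case False
  then obtain m where m: "p = Suc (Suc m)" using p by (metis Suc_le_D One_nat_def not0_implies_Suc)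
  have "bexp i0 p j - unit_exp i0 = Poly_Mapping.single i0 m + unit_exp j"
   using j0 by (auto simp: m poly_mapping_eq_iff fun_eq_iff lookup_minus lookup_bexp lookup_add lookup_single when_def)
  then have "mon (bexp i0 p j - unit_exp i0) (axis i0 1 + y) = y $ j"
   using chart_point(1)[OF y i0] chart_point(2)[OF j0, of y] by (simp add: mon_add mon_single del: vector_add_component)
  then show ?thesis using j0 by (simp add: cf_def dmon_def lookup_bexp multinom_bexp[OF p j0])
 qed
qed

lemma exps_split:
 assumes i0: "i0 \<notin> K" and p: "p \<ge> 1"
 shows "(\<Sum>\<alpha>\<in>exps p. h \<alpha>) = (\<Sum>\<alpha>\<in>rest_exps i0 K p. h \<alpha>) + (\<Sum>j\<in>K. h (bexp i0 p j))"
proof -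
 have sub: "bexp i0 p ` K \<subseteq> exps p" using exps_bexp[OF p] by auto
 have "(\<Sum>\<alpha>\<in>exps p. h \<alpha>) = (\<Sum>\<alpha>\<in>rest_exps i0 K p. h \<alpha>) + (\<Sum>\<alpha>\<in>bexp i0 p ` K. h \<alpha>)"
  unfolding rest_exps_def by (rule sum.subset_diff[OF sub]) simp
 then show ?thesis by (simp add: sum.reindex[OF inj_on_bexp[OF i0]] o_def)
qed

text \<open>In the coefficients b_j at \<open>bexp i0 p j\<close> the chart equations are the
  identity perturbed by a rank one term, through the single unknown S, the inner product of b and y.
  Taking the inner product of the system with y determines S as long as (p - 1) |y|^2 < 1, and
  substituting it back gives the closed form \<open>mf\<close>.\<close>

lemma chart_solve:
 fixes K :: "'n::finite set"
 assumes y: "y \<in> coord_space K" and i0: "i0 \<notin> K" and p: "p \<ge> 1" and small: "real (p - 1) * nrmK K y < 1"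
 shows "chart_eq i0 K p \<xi> y \<longleftrightarrow> (\<forall>j\<in>K. (\<Sum>\<alpha>\<in>rest_exps i0 K p. \<xi> \<alpha> * mf p i0 K j \<alpha> y) = \<xi> (bexp i0 p j))"
proof -
 let ?R = "rest_exps i0 K p"
 define a where "a = real (p - 1)"
 define sp where "sp = sqrt (real p)"
 have sp: "sp > 0" using p by (simp add: sp_def)
 define w where "w = 1 - a * nrmK K y"
 have w: "w > 0" using small by (simp add: w_def a_def)
 define b where "b j = \<xi> (bexp i0 p j)" for j
 define q where "q j = (\<Sum>\<alpha>\<in>?R. \<xi> \<alpha> * qf p i0 j \<alpha> y)" for j
 define S where "S = (\<Sum>j\<in>K. b j * y $ j)"
 define T where "T = (\<Sum>l\<in>K. q l * y $ l)"
 have d: "dfld i p \<xi> (axis i0 1 + y) = (\<Sum>\<alpha>\<in>?R. \<xi> \<alpha> * cf p i0 i \<alpha> y) + (\<Sum>j\<in>K. b j * cf p i0 i (bexp i0 p j) y)" for i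
  unfolding dfld_def cf_def[symmetric] b_def by (rule exps_split[OF i0 p])
 have di: "dfld i p \<xi> (axis i0 1 + y) = (\<Sum>\<alpha>\<in>?R. \<xi> \<alpha> * cf p i0 i \<alpha> y) + sp * b i" if "i \<in> K" for i
 proof -
  have "(\<Sum>j\<in>K. b j * cf p i0 i (bexp i0 p j) y) = (\<Sum>j\<in>K. if i = j then sp * b j else 0)"
   using cf_bexp(1)[OF y i0 p _ that] by (intro sum.cong) (auto simp: sp_def)
  then show ?thesis using that by (simp add: d)
 qed
 have d0: "dfld i0 p \<xi> (axis i0 1 + y) = (\<Sum>\<alpha>\<in>?R. \<xi> \<alpha> * cf p i0 i0 \<alpha> y) + sp * a * S"
 proof -
  have "(\<Sum>j\<in>K. b j * cf p i0 i0 (bexp i0 p j) y) = (\<Sum>j\<in>K. sp * a * (b j * y $ j))"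
   using cf_bexp(2)[OF y i0 p] by (intro sum.cong) (auto simp: sp_def a_def)
  then show ?thesis by (simp add: d S_def sum_distrib_left)
 qed
 have q: "q i = y $ i * (\<Sum>\<alpha>\<in>?R. \<xi> \<alpha> * cf p i0 i0 \<alpha> y) - (\<Sum>\<alpha>\<in>?R. \<xi> \<alpha> * cf p i0 i \<alpha> y)" for i
  unfolding q_def qf_def by (simp add: sum_subtractf sum_distrib_left algebra_simps)
 have 1: "chart_eq i0 K p \<xi> y \<longleftrightarrow> (\<forall>i\<in>K. sp * b i = q i + sp * a * S * y $ i)"
  unfolding chart_eq_def
 proof (rule ball_cong[OF refl])
  fix i assume "i \<in> K"
  show "(dfld i p \<xi> (axis i0 1 + y) = y $ i * dfld i0 p \<xi> (axis i0 1 + y)) = (sp * b i = q i + sp * a * S * y $ i)"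
   unfolding di[OF \<open>i \<in> K\<close>] d0 q by (auto simp add: algebra_simps)
 qed
 have m: "(\<Sum>\<alpha>\<in>?R. \<xi> \<alpha> * mf p i0 K j \<alpha> y) = (q j + a * (y $ j * T / w)) / sp" for j
 proof -
  have w': "1 + - a * nrmK K y = w" by (simp add: w_def)
  have "T = (\<Sum>\<alpha>\<in>?R. \<xi> \<alpha> * (\<Sum>l\<in>K. qf p i0 l \<alpha> y * y $ l))"
   unfolding T_def q_def by (simp add: sum_distrib_left sum_distrib_right mult_ac) (rule sum.swap)
  then have "(q j + a * (y $ j * T / w)) / sp = (\<Sum>\<alpha>\<in>?R. (\<xi> \<alpha> * qf p i0 j \<alpha> y + a * (y $ j * (\<xi> \<alpha> * (\<Sum>l\<in>K. qf p i0 l \<alpha> y * y $ l)) / w)) / sp)"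
   by (simp add: q_def sum.distrib sum_divide_distrib sum_distrib_left add_divide_distrib)
  also have "\<dots> = (\<Sum>\<alpha>\<in>?R. \<xi> \<alpha> * mf p i0 K j \<alpha> y)"
   unfolding mf_def a_def[symmetric] sp_def[symmetric] w'
   by (intro sum.cong refl) (simp add: divide_inverse algebra_simps)
  finally show ?thesis ..
 qed
 have 2: "(\<forall>i\<in>K. sp * b i = q i + sp * a * S * y $ i) \<longleftrightarrow> (\<forall>j\<in>K. (q j + a * (y $ j * T / w)) / sp = b j)"
 proof
  assume *: "\<forall>i\<in>K. sp * b i = q i + sp * a * S * y $ i"
  \<comment> \<open>The inner product with y closes the system into one scalar equation for
    \<open>S\<close>, with solution \<open>sp * S = T / w\<close>.\<close>
  have "sp * S = (\<Sum>i\<in>K. (sp * b i) * y $ i)" by (simp add: S_def sum_distrib_left mult_ac)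
  also have "\<dots> = (\<Sum>i\<in>K. q i * y $ i + sp * a * S * (y $ i * y $ i))"
   using * by (intro sum.cong) (auto simp: algebra_simps)
  also have "\<dots> = T + sp * a * S * nrmK K y" by (simp add: sum.distrib T_def nrmK_def sum_distrib_left)
  finally have "T = sp * S - sp * a * S * nrmK K y" by linarith
  also have "\<dots> = sp * S * w" by (simp add: w_def algebra_simps)
  finally have "sp * S * w = T" ..
  then have "sp * S = T / w" using w by (simp add: field_simps)
  then have e: "a * (y $ i * T / w) = sp * a * S * y $ i" for i
   by (metis (no_types, opaque_lifting) mult.assoc mult.commute times_divide_eq_right)
  have "sp * b i = q i + a * (y $ i * T / w)" if "i \<in> K" for i
   unfolding e using * that by blast
  then show "\<forall>j\<in>K. (q j + a * (y $ j * T / w)) / sp = b j" using sp by (simp add: field_simps)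
 next
  assume *: "\<forall>j\<in>K. (q j + a * (y $ j * T / w)) / sp = b j"
  then have b: "sp * b j = q j + a * (y $ j * T / w)" if "j \<in> K" for j using that sp by (auto simp: field_simps)
  have "sp * S = (\<Sum>i\<in>K. (sp * b i) * y $ i)" by (simp add: S_def sum_distrib_left mult_ac)
  also have "\<dots> = (\<Sum>i\<in>K. q i * y $ i + a * T / w * (y $ i * y $ i))"
   using b by (intro sum.cong) (auto simp: algebra_simps)
  also have "\<dots> = T + a * T / w * nrmK K y" by (simp add: sum.distrib T_def nrmK_def sum_distrib_left)
  also have "\<dots> = T / w" using w by (simp add: field_simps w_def)
  finally have "sp * S = T / w" .
  then have "sp * a * S * y $ i = a * (y $ i * T / w)" for i
   by (metis (no_types, opaque_lifting) mult.assoc mult.commute times_divide_eq_right)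
  then show "\<forall>i\<in>K. sp * b i = q i + sp * a * S * y $ i" using b by simp
 qed
 show ?thesis unfolding 1 m b_def[symmetric] by (rule 2)
qed

definition chart_dom :: "nat => 'n set => (real^'n::finite) set" where
 "chart_dom p K = {y. real (p - 1) * nrmK K y < 1}"

lemma open_chart_dom: "open (chart_dom p K)"
 unfolding chart_dom_def nrmK_def by (intro open_Collect_less continuous_intros)

lemma zero_chart_dom: "0 \<in> chart_dom p K"
 by (simp add: chart_dom_def nrmK_def)

lemma has_grad_cf:
 "has_grad U (cf p i0 i \<alpha>) (%k y. sqrt (multinom p \<alpha>) * (real (Poly_Mapping.lookup \<alpha> i) * dmon k (\<alpha> - unit_exp i) (axis i0 1 + y)))"
 unfolding cf_def[abs_def] by (rule has_grad_cmult[OF has_grad_dmon_shift])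

text \<open>The correction term in \<open>mf\<close> vanishes to second order at 0, so the
  derivative there comes from \<open>qf\<close> alone: that of the factor \<open>y $ j\<close>,
  minus a second derivative of the monomial.\<close>

lemma mf_has_grad:
 fixes K :: "'n::finite set"
 obtains D where "has_grad (chart_dom p K) (mf p i0 K j \<alpha>) D"
  "!!k. D k 0 = inverse (sqrt (real p)) * ((if k = j then cf p i0 i0 \<alpha> 0 else 0) -
    sqrt (multinom p \<alpha>) * (real (Poly_Mapping.lookup \<alpha> j) * dmon k (\<alpha> - unit_exp j) (axis i0 1)))"
proof -
 let ?U = "chart_dom p K"
 have nz: "1 + (- real (p - 1)) * nrmK K y ~= 0" if "y \<in> ?U" for y using that by (auto simp: chart_dom_def)
 define Dq where "Dq l k y = ((if k = l then 1 else 0) * cf p i0 i0 \<alpha> y + y $ l *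
   (sqrt (multinom p \<alpha>) * (real (Poly_Mapping.lookup \<alpha> i0) * dmon k (\<alpha> - unit_exp i0) (axis i0 1 + y)))) +
   (-1) * (sqrt (multinom p \<alpha>) * (real (Poly_Mapping.lookup \<alpha> l) * dmon k (\<alpha> - unit_exp l) (axis i0 1 + y)))"
  for l k and y :: "real^'n"
 have q: "has_grad ?U (qf p i0 l \<alpha>) (Dq l)" for l
  unfolding qf_def[abs_def] Dq_def[abs_def]
  by (rule has_grad_add[OF has_grad_mult[OF has_grad_coord has_grad_cf] has_grad_cmult[OF has_grad_cf]])
 have n: "has_grad ?U (nrmK K) (%k y. \<Sum>l\<in>K. (if k = l then 1 else 0) * y $ l + y $ l * (if k = l then 1 else 0))"
  unfolding nrmK_def[abs_def] by (rule has_grad_sum[OF has_grad_mult[OF has_grad_coord has_grad_coord]])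
 note h = has_grad_inverse[OF has_grad_add[OF has_grad_const has_grad_cmult[OF n]] nz]
 have t: "has_grad ?U (%y. \<Sum>l\<in>K. qf p i0 l \<alpha> y * y $ l)
  (%k y. \<Sum>l\<in>K. Dq l k y * y $ l + qf p i0 l \<alpha> y * (if k = l then 1 else 0))"
  by (rule has_grad_sum) (rule has_grad_mult[OF q has_grad_coord])
 note m = has_grad_cmult[OF has_grad_add[OF q[of j] has_grad_cmult[OF has_grad_mult[OF has_grad_mult[OF has_grad_coord t] h]]],
  of "inverse (sqrt (real p))" "real (p - 1)" j]
 show ?thesis
 proof (rule that[OF m[folded mf_def]], goal_cases)
  case (2 k)
  have "(0 :: real^'n) $ l = 0" for l by simp
  then show ?case by (simp only: mult_zero_left mult_zero_right sum.neutral_const add_0_right add_0_left Dq_def)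
    (cases "k = j"; simp)
 qed simp
qed

lemma mon_axis: "mon \<gamma> (axis i0 1) = (if \<forall>i. i ~= i0 --> Poly_Mapping.lookup \<gamma> i = 0 then 1 else 0)"
proof (cases "\<forall>i. i ~= i0 --> Poly_Mapping.lookup \<gamma> i = 0")
 case True
 then have "mon \<gamma> (axis i0 1) = 1" unfolding mon_def by (intro prod.neutral) (auto simp: axis_def)
 then show ?thesis using True by simp
next
 case False
 then obtain i where "i ~= i0" "Poly_Mapping.lookup \<gamma> i ~= 0" by blast
 then have "mon \<gamma> (axis i0 1) = 0" unfolding mon_def by (intro prod_zero bexI[of _ i]) (auto simp: axis_def)
 then show ?thesis using False by simp
qed

lemma exps_eqI:
 assumes "\<alpha> \<in> exps p" "\<beta> \<in> exps p" "!!i. i ~= i0 ==> Poly_Mapping.lookup \<alpha> i = Poly_Mapping.lookup \<beta> i"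
 shows "\<alpha> = \<beta>"
proof -
 have "(\<Sum>i\<in>UNIV-{i0}. Poly_Mapping.lookup \<alpha> i) = (\<Sum>i\<in>UNIV-{i0}. Poly_Mapping.lookup \<beta> i)"
  using assms(3) by (intro sum.cong) auto
 moreover have "(\<Sum>i\<in>UNIV. Poly_Mapping.lookup \<gamma> i) = Poly_Mapping.lookup \<gamma> i0 + (\<Sum>i\<in>UNIV-{i0}. Poly_Mapping.lookup \<gamma> i)"
  for \<gamma> :: "'a \<Rightarrow>\<^sub>0 nat" by (rule sum.remove) auto
 ultimately have "Poly_Mapping.lookup \<alpha> i0 = Poly_Mapping.lookup \<beta> i0" using assms(1,2) by (simp add: exps_def)
 then show ?thesis using assms(3) by (intro poly_mapping_eqI) metis
qed

lemma lookup_minus_unit: "Poly_Mapping.lookup (\<alpha> - unit_exp j) i = Poly_Mapping.lookup \<alpha> i - (if i = j then 1 else 0)"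
 by (simp add: lookup_minus)

text \<open>Among the monomials of degree p, only the one with exponent \<open>bexp i0 p j\<close>
  has a nonzero derivative in direction j at the axis point. Hence the solution \<open>mf\<close>
  vanishes at the centre of the chart.\<close>

lemma cf_rest_zero:
 assumes i0: "i0 \<notin> K" and p: "p \<ge> 1" and j: "j \<in> K" and \<alpha>: "\<alpha> \<in> rest_exps i0 K p"
 shows "cf p i0 j \<alpha> 0 = 0"
proof (rule ccontr)
 assume "cf p i0 j \<alpha> 0 ~= 0"
 then have 1: "Poly_Mapping.lookup \<alpha> j ~= 0" and 2: "mon (\<alpha> - unit_exp j) (axis i0 1) ~= 0"
  by (auto simp: cf_def dmon_def)
 have "\<alpha> = bexp i0 p j"
 proof (rule exps_eqI)
  show "\<alpha> \<in> exps p" using \<alpha> by (simp add: rest_exps_def)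
  show "bexp i0 p j \<in> exps p" by (rule exps_bexp[OF p])
  fix i assume i: "i ~= i0"
  then have "Poly_Mapping.lookup (\<alpha> - unit_exp j) i = 0" using 2 by (auto simp: mon_axis split: if_splits)
  then show "Poly_Mapping.lookup \<alpha> i = Poly_Mapping.lookup (bexp i0 p j) i"
   using 1 i by (auto simp: lookup_minus_unit lookup_bexp split: if_splits)
 qed
 then show False using \<alpha> j by (auto simp: rest_exps_def)
qed

lemma cf_axis:
 assumes \<alpha>: "\<alpha> \<in> exps p" and p: "p \<ge> 1"
 shows "cf p i0 i0 \<alpha> 0 = (if \<alpha> = Poly_Mapping.single i0 p then real p else 0)"
proof (cases "\<alpha> = Poly_Mapping.single i0 p")
 case True
 have "(\<Prod>i\<in>UNIV. fact (Poly_Mapping.lookup (Poly_Mapping.single i0 p) i) :: real) = (\<Prod>i\<in>UNIV. if i = i0 then fact p else 1)"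
  by (rule prod.cong) (auto simp: lookup_single when_def)
 then have "multinom p \<alpha> = 1" by (simp add: multinom_def True)
 moreover have "mon (\<alpha> - unit_exp i0) (axis i0 1) = 1"
  by (simp add: mon_axis True lookup_minus_unit lookup_single when_def)
 ultimately show ?thesis by (simp add: cf_def dmon_def True)
next
 case False
 have "cf p i0 i0 \<alpha> 0 = 0"
 proof (rule ccontr)
  assume "cf p i0 i0 \<alpha> 0 ~= 0"
  then have 2: "mon (\<alpha> - unit_exp i0) (axis i0 1) ~= 0" by (auto simp: cf_def dmon_def)
  have "\<alpha> = Poly_Mapping.single i0 p"
  proof (rule exps_eqI[OF \<alpha> exps_single])
   fix i assume i: "i ~= i0"
   then have "Poly_Mapping.lookup (\<alpha> - unit_exp i0) i = 0" using 2 by (auto simp: mon_axis split: if_splits)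
   then show "Poly_Mapping.lookup \<alpha> i = Poly_Mapping.lookup (Poly_Mapping.single i0 p) i"
    using i by (simp add: lookup_minus_unit lookup_single when_def)
  qed
  then show False using False by simp
 qed
 then show ?thesis using False by simp
qed

text \<open>On the diagonal the second derivative brings a factor 2 and the multinomial
  normalisation a factor 1 / sqrt 2. The resulting sqrt 2 is what gives the diagonal entries of the
  Gaussian orthogonal ensemble variance 2.\<close>

lemma second_coeff:
 fixes i0 :: "'n::finite"
 assumes \<alpha>: "\<alpha> \<in> exps p" and j: "j ~= i0" and k: "k ~= i0"
 shows "sqrt (multinom p \<alpha>) * (real (Poly_Mapping.lookup \<alpha> j) * dmon k (\<alpha> - unit_exp j) (axis i0 1)) =
  (if p \<ge> 2 \<and> \<alpha> = qexp i0 p j k then sqrt (real p) * sqrt (real p - 1) * (if j = k then sqrt 2 else 1) else 0)"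
proof (cases "p \<ge> 2 \<and> \<alpha> = qexp i0 p j k")
 case True
 then have p: "p \<ge> 2" and a: "\<alpha> = qexp i0 p j k" by auto
 have "mon (\<alpha> - unit_exp j - unit_exp k) (axis i0 1) = 1"
  by (simp add: mon_axis a lookup_minus_unit lookup_qexp)
 moreover have "Poly_Mapping.lookup (\<alpha> - unit_exp j) k = 1" "Poly_Mapping.lookup \<alpha> j = (if j = k then 2 else 1)"
  using j k by (auto simp: a lookup_minus_unit lookup_qexp)
 ultimately have "real (Poly_Mapping.lookup \<alpha> j) * dmon k (\<alpha> - unit_exp j) (axis i0 1) = (if j = k then 2 else 1)"
  by (simp add: dmon_def)
 moreover have "sqrt (multinom p \<alpha>) = sqrt (real p) * sqrt (real p - 1) / (if j = k then sqrt 2 else 1)"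
  using p by (simp add: a multinom_qexp[OF p j k] real_sqrt_mult[symmetric] real_sqrt_divide of_nat_diff)
 moreover have "x / sqrt 2 * 2 = x * sqrt 2" for x :: real
  by (simp add: field_simps)
 ultimately show ?thesis using True by auto
next
 case False
 have "sqrt (multinom p \<alpha>) * (real (Poly_Mapping.lookup \<alpha> j) * dmon k (\<alpha> - unit_exp j) (axis i0 1)) = 0"
 proof (rule ccontr)
  assume "\<not> ?thesis"
  then have 1: "Poly_Mapping.lookup \<alpha> j ~= 0" and 2: "Poly_Mapping.lookup (\<alpha> - unit_exp j) k ~= 0"
   and 3: "mon (\<alpha> - unit_exp j - unit_exp k) (axis i0 1) ~= 0"
   unfolding dmon_def by (metis mult_zero_left mult_zero_right of_nat_0)+
  obtain q where q: "p = Suc q" "\<alpha> - unit_exp j \<in> exps q"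
  proof (cases p)
   case 0
   then show ?thesis using \<alpha> 1 by (simp add: exps_0)
  next
   case (Suc q)
   then show ?thesis using that exps_Suc_unit(1)[of \<alpha> q j] \<alpha> 1 by simp
  qed
  have "q ~= 0"
  proof
   assume "q = 0"
   then have "\<alpha> - unit_exp j = 0" using q(2) by (simp add: exps_0)
   then show False using 2 by simp
  qed
  then have p2: "p \<ge> 2" using q(1) by simp
  have "\<alpha> = qexp i0 p j k"
  proof (rule exps_eqI[OF \<alpha> exps_qexp[OF p2]])
   fix i assume i: "i ~= i0"
   then have "Poly_Mapping.lookup (\<alpha> - unit_exp j - unit_exp k) i = 0" using 3 by (auto simp: mon_axis split: if_splits)
   then show "Poly_Mapping.lookup \<alpha> i = Poly_Mapping.lookup (qexp i0 p j k) i"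
    using 1 2 i by (auto simp: lookup_minus_unit lookup_qexp split: if_splits)
  qed
  then show False using False p2 by simp
 qed
 then show ?thesis unfolding if_not_P[OF False] .
qed

definition goe :: "nat => 'n => (('n \<Rightarrow>\<^sub>0 nat) => real) => 'n => 'n => real" where
 "goe p i0 \<xi> j k = (if j = k then sqrt 2 else 1) * \<xi> (qexp i0 p j k)"

text \<open>The matrix sqrt p w_0 - sqrt (p - 1) C of the theorem, with w_0 the coefficient of
  \<open>x_i0^p\<close>, that is, the value of the polynomial at the axis point.\<close>

definition jac :: "nat => 'n => (('n \<Rightarrow>\<^sub>0 nat) => real) => 'n => 'n => real" where
 "jac p i0 \<xi> j k = (if j = k then sqrt (real p) * \<xi> (Poly_Mapping.single i0 p) else 0) - sqrt (real p - 1) * goe p i0 \<xi> j k"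

lemma jacobian_at_zero:
 fixes i0 :: "'n::finite"
 assumes i0: "i0 \<notin> K" and p: "p \<ge> 1" and j: "j \<in> K" and k: "k \<in> K"
 shows "(\<Sum>\<alpha>\<in>rest_exps i0 K p. \<xi> \<alpha> * (inverse (sqrt (real p)) * ((if k = j then cf p i0 i0 \<alpha> 0 else 0) -
    sqrt (multinom p \<alpha>) * (real (Poly_Mapping.lookup \<alpha> j) * dmon k (\<alpha> - unit_exp j) (axis i0 1))))) = jac p i0 \<xi> j k"
proof -
 let ?R = "rest_exps i0 K p" and ?s = "Poly_Mapping.single i0 p"
 have fin: "finite ?R" by (simp add: rest_exps_def)
 have j0: "j ~= i0" and k0: "k ~= i0" using i0 j k by auto
 have E: "\<alpha> \<in> exps p" if "\<alpha> \<in> ?R" for \<alpha> using that by (simp add: rest_exps_def)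
 have sp: "sqrt (real p) ~= 0" using p by simp
 have A: "(\<Sum>\<alpha>\<in>?R. \<xi> \<alpha> * (if k = j then cf p i0 i0 \<alpha> 0 else 0)) = (if j = k then real p * \<xi> ?s else 0)"
 proof (cases "j = k")
  case True
  have "(\<Sum>\<alpha>\<in>?R. \<xi> \<alpha> * cf p i0 i0 \<alpha> 0) = (\<Sum>\<alpha>\<in>?R. if \<alpha> = ?s then real p * \<xi> \<alpha> else 0)"
   by (rule sum.cong) (auto simp: cf_axis[OF E p])
  then show ?thesis using True fin single_rest[OF i0 p] by simp
 qed simp
 have B: "(\<Sum>\<alpha>\<in>?R. \<xi> \<alpha> * (sqrt (multinom p \<alpha>) * (real (Poly_Mapping.lookup \<alpha> j) * dmon k (\<alpha> - unit_exp j) (axis i0 1)))) =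
  sqrt (real p) * (sqrt (real p - 1) * goe p i0 \<xi> j k)"
 proof (cases "p \<ge> 2")
  case True
  have "(\<Sum>\<alpha>\<in>?R. \<xi> \<alpha> * (sqrt (multinom p \<alpha>) * (real (Poly_Mapping.lookup \<alpha> j) * dmon k (\<alpha> - unit_exp j) (axis i0 1)))) =
   (\<Sum>\<alpha>\<in>?R. if \<alpha> = qexp i0 p j k then sqrt (real p) * (sqrt (real p - 1) * goe p i0 \<xi> j k) else 0)"
   using True by (intro sum.cong) (auto simp: second_coeff[OF E j0 k0] goe_def)
  then show ?thesis using fin qexp_rest[OF i0 j k True] by simp
 next
  case False
  then have "p = 1" using p by simp
  have "(\<Sum>\<alpha>\<in>?R. \<xi> \<alpha> * (sqrt (multinom p \<alpha>) * (real (Poly_Mapping.lookup \<alpha> j) * dmon k (\<alpha> - unit_exp j) (axis i0 1)))) = 0"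
   by (intro sum.neutral ballI, subst second_coeff[OF E j0 k0]) (use False in auto)
  then show ?thesis using \<open>p = 1\<close> by simp
 qed
 have "(\<Sum>\<alpha>\<in>?R. \<xi> \<alpha> * (inverse (sqrt (real p)) * ((if k = j then cf p i0 i0 \<alpha> 0 else 0) -
    sqrt (multinom p \<alpha>) * (real (Poly_Mapping.lookup \<alpha> j) * dmon k (\<alpha> - unit_exp j) (axis i0 1))))) =
  inverse (sqrt (real p)) * ((\<Sum>\<alpha>\<in>?R. \<xi> \<alpha> * (if k = j then cf p i0 i0 \<alpha> 0 else 0)) -
   (\<Sum>\<alpha>\<in>?R. \<xi> \<alpha> * (sqrt (multinom p \<alpha>) * (real (Poly_Mapping.lookup \<alpha> j) * dmon k (\<alpha> - unit_exp j) (axis i0 1)))))"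
  unfolding sum_subtractf[symmetric] sum_distrib_left by (intro sum.cong refl) (simp only: right_diff_distrib mult_ac)
 also have "\<dots> = inverse (sqrt (real p)) * ((if j = k then real p * \<xi> ?s else 0) - sqrt (real p) * (sqrt (real p - 1) * goe p i0 \<xi> j k))"
  by (simp only: A B)
 also have "\<dots> = jac p i0 \<xi> j k"
 proof -
  have "inverse (sqrt (real p)) * (real p * x) = sqrt (real p) * x" for x
  proof -
   have "inverse (sqrt (real p)) * real p = sqrt (real p)"
    using real_div_sqrt[of "real p"] by (simp add: divide_inverse mult.commute)
   then show ?thesis by (simp only: mult.assoc[symmetric])
  qed
  then show ?thesis using sp by (auto simp: jac_def right_diff_distrib mult.assoc[symmetric])
 qed
 finally show ?thesis .
qed

section \<open>Polynomial bounds, and determinants with an identity block\<close>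

lemma nn_integral_gauss_poly: "(\<integral>\<^sup>+t. ennreal ((1 + \<bar>t\<bar>) ^ d) \<partial>gauss) < \<infinity>"
proof -
 have "(1 + \<bar>t\<bar>) ^ d \<le> 2 ^ d * (1 + \<bar>t\<bar> ^ d)" for t :: real
 proof -
  have "(1 + \<bar>t\<bar>) ^ d \<le> (2 * max 1 \<bar>t\<bar>) ^ d" by (rule power_mono) auto
  also have "\<dots> = 2 ^ d * (max 1 \<bar>t\<bar>) ^ d" by (simp add: power_mult_distrib)
  also have "(max 1 \<bar>t\<bar>) ^ d \<le> 1 + \<bar>t\<bar> ^ d" by (cases "\<bar>t\<bar> \<le> 1") (auto simp: max_def)
  finally show ?thesis by simp
 qed
 then have "(\<integral>\<^sup>+t. ennreal ((1 + \<bar>t\<bar>) ^ d) \<partial>gauss) \<le> (\<integral>\<^sup>+t. ennreal (2 ^ d) * (1 + ennreal (\<bar>t\<bar> ^ d)) \<partial>gauss)"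
 proof (intro nn_integral_mono)
  fix t :: real
  have "ennreal ((1 + \<bar>t\<bar>) ^ d) \<le> ennreal (2 ^ d * (1 + \<bar>t\<bar> ^ d))"
   by (rule ennreal_leI) fact
  then show "ennreal ((1 + \<bar>t\<bar>) ^ d) \<le> ennreal (2 ^ d) * (1 + ennreal (\<bar>t\<bar> ^ d))"
   by (simp add: ennreal_mult)
 qed
 also have "\<dots> = ennreal (2 ^ d) * (1 + (\<integral>\<^sup>+t. ennreal (\<bar>t\<bar> ^ d) \<partial>gauss))"
  by (subst nn_integral_cmult, simp, subst nn_integral_add) (simp_all add: gauss.emeasure_space_1[simplified])
 also have "\<dots> < \<infinity>" by (simp add: gauss_abs_moment ennreal_mult_less_top)
 finally show ?thesis .
qed

text \<open>A measure of polynomial growth in product form: it dominates the sum of the absolute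
  values, its powers absorb products, and it has finite Gaussian moments because the coordinates are
  independent.\<close>

definition pbd :: "'a set => ('a => real) => real" where
 "pbd A \<xi> = (\<Prod>\<alpha>\<in>A. 1 + \<bar>\<xi> \<alpha>\<bar>)"

lemma pbd_ge_1: "1 \<le> pbd A \<xi>"
 unfolding pbd_def by (rule prod_ge_1) auto

lemma pbd_sum: "finite A ==> 1 + (\<Sum>\<alpha>\<in>A. \<bar>\<xi> \<alpha>\<bar>) \<le> pbd A \<xi>"
proof (induction A rule: finite_induct)
 case (insert a A)
 have "0 \<le> (\<Sum>\<alpha>\<in>A. \<bar>\<xi> \<alpha>\<bar>) * \<bar>\<xi> a\<bar>" by (simp add: sum_nonneg)
 then have "1 + (\<Sum>\<alpha>\<in>insert a A. \<bar>\<xi> \<alpha>\<bar>) \<le> (1 + \<bar>\<xi> a\<bar>) * (1 + (\<Sum>\<alpha>\<in>A. \<bar>\<xi> \<alpha>\<bar>))"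
  using insert by (simp add: algebra_simps)
 also have "\<dots> \<le> (1 + \<bar>\<xi> a\<bar>) * pbd A \<xi>" using insert.IH by (intro mult_left_mono) auto
 finally show ?case using insert by (simp add: pbd_def)
qed (simp add: pbd_def)

lemma pbd_measurable [measurable]: "pbd A \<in> borel_measurable (PiM A (%_. lborel))"
 unfolding pbd_def[abs_def] by measurable

lemma nn_integral_pbd:
 assumes "finite A" shows "(\<integral>\<^sup>+\<xi>. ennreal (pbd A \<xi> ^ d) \<partial>PiM A (%_. gauss)) < \<infinity>"
proof -
 have "ennreal (pbd A \<xi> ^ d) = (\<Prod>\<alpha>\<in>A. ennreal ((1 + \<bar>\<xi> \<alpha>\<bar>) ^ d))" for \<xi>
  by (simp add: pbd_def prod_power_distrib[symmetric] prod_ennreal)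
 then have "(\<integral>\<^sup>+\<xi>. ennreal (pbd A \<xi> ^ d) \<partial>PiM A (%_. gauss)) = (\<Prod>\<alpha>\<in>A. \<integral>\<^sup>+t. ennreal ((1 + \<bar>t\<bar>) ^ d) \<partial>gauss)"
  using product_sigma_finite.product_nn_integral_prod[OF _ assms, of "%_. gauss" "%_ t. ennreal ((1 + \<bar>t\<bar>) ^ d)"]
  by (simp add: product_sigma_finite_def gauss.sigma_finite_measure_axioms)
 also have "\<dots> < \<infinity>" using nn_integral_gauss_poly[of d]
  by (simp add: prod_constant power_less_top_ennreal)
 finally show ?thesis .
qed

lemma det_matK_measurable:
 assumes "!!i j. i \<in> K ==> j \<in> K ==> (%x. A x i j) \<in> borel_measurable M"
 shows "(%x. det (matK K (A x))) \<in> borel_measurable M"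
proof -
 have "(%x. if i \<in> K \<and> j \<in> K then A x i j else if i = j then 1 else 0) \<in> borel_measurable M" for i j
  using assms[of i j] by (cases "i \<in> K \<and> j \<in> K") auto
 note [measurable] = this
 show ?thesis unfolding det_def matK_def by simp
qed

lemma det_matK_bound:
 fixes K :: "'n::finite set"
 assumes "!!i j. i \<in> K ==> j \<in> K ==> \<bar>A i j\<bar> \<le> B" "1 \<le> B"
 shows "\<bar>det (matK K A)\<bar> \<le> fact CARD('n) * B ^ CARD('n)"
proof -
 have "\<bar>det (matK K A)\<bar> \<le> (\<Sum>q | q permutes (UNIV :: 'n set). \<bar>of_int (sign q) * (\<Prod>i\<in>UNIV. matK K A $ i $ q i)\<bar>)"
  unfolding det_def by (rule sum_abs)
 also have "\<dots> \<le> (\<Sum>q | q permutes (UNIV :: 'n set). B ^ CARD('n))"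
 proof (rule sum_mono)
  fix q :: "'n => 'n"
  have "\<bar>matK K A $ i $ j\<bar> \<le> B" for i j using assms by (auto simp: matK_def)
  then have "(\<Prod>i\<in>UNIV. \<bar>matK K A $ i $ q i\<bar>) \<le> (\<Prod>i\<in>(UNIV :: 'n set). B)" by (intro prod_mono) auto
  moreover have "\<bar>of_int (sign q) :: real\<bar> = 1" by (cases q rule: sign_cases) auto
  ultimately show "\<bar>of_int (sign q) * (\<Prod>i\<in>UNIV. matK K A $ i $ q i)\<bar> \<le> B ^ CARD('n)"
   by (simp add: abs_mult abs_prod)
 qed
 also have "\<dots> = fact CARD('n) * B ^ CARD('n)" by (simp add: card_permutations)
 finally show ?thesis .
qed

lemma det_matK_tendsto:
 assumes "!!i j. i \<in> K ==> j \<in> K ==> ((%n. A n i j) \<longlongrightarrow> B i j) F"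
 shows "((%n. det (matK K (A n))) \<longlongrightarrow> det (matK K B)) F"
proof -
 have "((%n. matK K (A n) $ i $ j) \<longlongrightarrow> matK K B $ i $ j) F" for i j
  using assms[of i j] by (auto simp: matK_def)
 then show ?thesis unfolding det_def by (intro tendsto_sum tendsto_mult tendsto_const tendsto_prod)
qed

lemma det_matK_scale: "det (matK K (%i j. r * A i j)) = r ^ card K * det (matK K A)"
proof -
 have "matK K (%i j. r * A i j) = (\<chi> i. (if i \<in> K then r else 1) *s (matK K A $ i))"
  by (auto simp: vec_eq_iff matK_def)
 then have "det (matK K (%i j. r * A i j)) = (\<Prod>i\<in>UNIV. if i \<in> K then r else 1) * det (\<chi> i. matK K A $ i)"
  by (simp add: det_rows_mul)
 also have "(\<chi> i. matK K A $ i) = matK K A" by (simp add: vec_eq_iff)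
 also have "(\<Prod>i\<in>UNIV. if i \<in> K then r else 1) = r ^ card K"
  by (simp add: prod.If_cases)
 finally show ?thesis .
qed

definition mfD :: "nat => 'n => 'n set => 'n => ('n::finite \<Rightarrow>\<^sub>0 nat) => 'n => real^'n => real" where
 "mfD p i0 K j \<alpha> = (SOME D. has_grad (chart_dom p K) (mf p i0 K j \<alpha>) D \<and>
  (\<forall>k. D k 0 = inverse (sqrt (real p)) * ((if k = j then cf p i0 i0 \<alpha> 0 else 0) -
    sqrt (multinom p \<alpha>) * (real (Poly_Mapping.lookup \<alpha> j) * dmon k (\<alpha> - unit_exp j) (axis i0 1)))))"

lemma mfD: "has_grad (chart_dom p K) (mf p i0 K j \<alpha>) (mfD p i0 K j \<alpha>)"
 "mfD p i0 K j \<alpha> k 0 = inverse (sqrt (real p)) * ((if k = j then cf p i0 i0 \<alpha> 0 else 0) -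
    sqrt (multinom p \<alpha>) * (real (Poly_Mapping.lookup \<alpha> j) * dmon k (\<alpha> - unit_exp j) (axis i0 1)))"
proof -
 have "\<exists>D. has_grad (chart_dom p K) (mf p i0 K j \<alpha>) D \<and>
  (\<forall>k. D k 0 = inverse (sqrt (real p)) * ((if k = j then cf p i0 i0 \<alpha> 0 else 0) -
    sqrt (multinom p \<alpha>) * (real (Poly_Mapping.lookup \<alpha> j) * dmon k (\<alpha> - unit_exp j) (axis i0 1))))"
  using mf_has_grad[of p K i0 j \<alpha>] by metis
 from someI_ex[OF this, folded mfD_def]
 show "has_grad (chart_dom p K) (mf p i0 K j \<alpha>) (mfD p i0 K j \<alpha>)"
  "mfD p i0 K j \<alpha> k 0 = inverse (sqrt (real p)) * ((if k = j then cf p i0 i0 \<alpha> 0 else 0) -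
    sqrt (multinom p \<alpha>) * (real (Poly_Mapping.lookup \<alpha> j) * dmon k (\<alpha> - unit_exp j) (axis i0 1)))"
  by blast+
qed

lemma mf_zero:
 assumes "i0 \<notin> K" "p \<ge> 1" "j \<in> K" "\<alpha> \<in> rest_exps i0 K p"
 shows "mf p i0 K j \<alpha> 0 = 0"
 using cf_rest_zero[OF assms] by (simp add: mf_def qf_def)

lemma has_grad_scale:
 assumes "has_grad U F D" "!!y. y \<in> V ==> r *\<^sub>R y \<in> U"
 shows "has_grad V (%y. F (r *\<^sub>R y)) (%i y. r * D i (r *\<^sub>R y))"
proof -
 have "((%y. F (r *\<^sub>R y)) has_derivative (%w. \<Sum>i\<in>UNIV. r * D i (r *\<^sub>R y) * w $ i)) (at y)" if "y \<in> V" for y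
 proof -
  have 1: "((%y. r *\<^sub>R y) has_derivative (%w. r *\<^sub>R w)) (at y)"
   by (auto intro!: derivative_eq_intros)
  have 2: "(F has_derivative (%w. \<Sum>i\<in>UNIV. D i (r *\<^sub>R y) * w $ i)) (at (r *\<^sub>R y))"
   using assms that by (auto simp: has_grad_def)
  from has_derivative_compose[OF 1 2] show ?thesis by (simp add: mult_ac)
 qed
 moreover have "continuous_on V (%y. r * D i (r *\<^sub>R y))" for i
  using assms by (intro continuous_intros continuous_on_compose2[of U "D i" V]) (auto simp: has_grad_def)
 ultimately show ?thesis by (simp add: has_grad_def)
qed

section \<open>The averaged Kac--Rice formula\<close>

lemma psf_gauss: "product_sigma_finite (%_. gauss)"
 by (simp add: product_sigma_finite_def gauss.sigma_finite_measure_axioms)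

lemma measurable_PiM_gauss_iff:
 "f \<in> borel_measurable (PiM A (%_. gauss)) \<longleftrightarrow> f \<in> borel_measurable (PiM A (%_. lborel))"
 by (simp add: measurable_cong_sets[OF sets_PiM_gauss refl])

text \<open>\<open>G\<close> is the weight in the Kac-Rice formula: the constant 1 for the count
  itself, and a product of characteristic polynomials for p = 2. Polynomial growth supplies the
  dominating function, and continuity the pointwise limit, when the cap shrinks.\<close>

locale chart_weight =
 fixes i0 :: "'n::finite" and K :: "'n set" and p :: nat and z :: bool
  and G :: "(('n \<Rightarrow>\<^sub>0 nat) => real) => real" and C :: real and d :: nat
 assumes i0: "i0 \<notin> K" and p: "p \<ge> 1"
  and Gm: "G \<in> borel_measurable (PiM (exps p) (%_. lborel))"
  and G0: "!!\<xi>. 0 \<le> G \<xi>"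
  and Gb: "!!\<xi>. G \<xi> \<le> C * pbd (exps p) \<xi> ^ d"
  and Gc: "!!\<Xi> \<xi>. (!!\<alpha>. \<alpha> \<in> exps p ==> (%n::nat. \<Xi> n \<alpha>) \<longlonglongrightarrow> \<xi> \<alpha>) ==> (%n. G (\<Xi> n)) \<longlonglongrightarrow> G \<xi>"
begin

abbreviation "R \<equiv> rest_exps i0 K p"

lemma finite_R: "finite R" by (simp add: rest_exps_def)

text \<open>Reassembles a coefficient vector from the coordinates \<open>c\<close> that govern the
  gradient at the axis point and the remaining ones \<open>\<rho>\<close>. The two groups are
  independent, so \<open>c\<close> can be integrated first with \<open>\<rho>\<close> fixed.\<close>

definition comb :: "(('n \<Rightarrow>\<^sub>0 nat) => real) => ('n => real) => ('n \<Rightarrow>\<^sub>0 nat) => real" where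
 "comb \<rho> c = (\<lambda>\<alpha>\<in>exps p. if \<alpha> \<in> R then \<rho> \<alpha> else c (inv_into K (bexp i0 p) \<alpha>))"

lemma comb_rest: "\<alpha> \<in> R ==> comb \<rho> c \<alpha> = \<rho> \<alpha>"
 by (simp add: comb_def rest_exps_def)

lemma comb_bexp: "j \<in> K ==> comb \<rho> c (bexp i0 p j) = c j"
 using exps_bexp[OF p, of i0 j] inj_on_bexp[OF i0, of p] by (simp add: comb_def rest_exps_def)

lemma exps_cases:
 assumes "\<alpha> \<in> exps p" obtains "\<alpha> \<in> R" | j where "j \<in> K" "\<alpha> = bexp i0 p j"
 using assms by (auto simp: rest_exps_def)

lemma comb_cong: "(!!j. j \<in> K ==> c j = c' j) ==> comb \<rho> c = comb \<rho> c'"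
proof
 fix \<alpha> assume c: "!!j. j \<in> K ==> c j = c' j"
 show "comb \<rho> c \<alpha> = comb \<rho> c' \<alpha>"
 proof (cases "\<alpha> \<in> exps p")
  case True
  then show ?thesis by (cases rule: exps_cases) (auto simp: comb_rest comb_bexp c)
 qed (simp add: comb_def)
qed

lemma comb_measurable:
 assumes "!!\<alpha>. \<alpha> \<in> R ==> (%x. \<rho> x \<alpha>) \<in> borel_measurable M" "!!j. j \<in> K ==> (%x. c x j) \<in> borel_measurable M"
 shows "(%x. comb (\<rho> x) (c x)) \<in> M \<rightarrow>\<^sub>M PiM (exps p) (%_. lborel)"
 unfolding comb_def
proof (rule measurable_restrict)
 fix \<alpha> :: "'n \<Rightarrow>\<^sub>0 nat" assume "\<alpha> \<in> exps p"
 then show "(%x. if \<alpha> \<in> R then \<rho> x \<alpha> else c x (inv_into K (bexp i0 p) \<alpha>)) \<in> M \<rightarrow>\<^sub>M lborel"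
  using assms by (cases "\<alpha> \<in> R") (auto simp: rest_exps_def inv_into_into)
qed

lemma nn_integral_comb:
 assumes H: "H \<in> borel_measurable (PiM (exps p) (%_. lborel))"
 shows "(\<integral>\<^sup>+\<xi>. H \<xi> \<partial>PiM (exps p) (%_. gauss)) =
  (\<integral>\<^sup>+\<rho>. (\<integral>\<^sup>+c. H (comb \<rho> c) \<partial>PiM K (%_. gauss)) \<partial>PiM R (%_. gauss))"
proof -
 let ?B = "bexp i0 p ` K"
 have E: "exps p = R \<union> ?B" using exps_bexp[OF p] by (auto simp: rest_exps_def)
 have HE: "H \<in> borel_measurable (PiM (R \<union> ?B) (%_. gauss))"
  using H by (simp add: measurable_PiM_gauss_iff E[symmetric])
 have "(\<integral>\<^sup>+\<xi>. H \<xi> \<partial>PiM (exps p) (%_. gauss)) = (\<integral>\<^sup>+\<xi>. H \<xi> \<partial>PiM (R \<union> ?B) (%_. gauss))" by (simp only: E[symmetric])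
 also have "\<dots> = (\<integral>\<^sup>+\<rho>. (\<integral>\<^sup>+b. H (merge R ?B (\<rho>, b)) \<partial>PiM ?B (%_. gauss)) \<partial>PiM R (%_. gauss))"
  by (rule product_sigma_finite.product_nn_integral_fold[OF psf_gauss _ _ _ HE]) (auto simp: rest_exps_def)
 also have "\<dots> = (\<integral>\<^sup>+\<rho>. (\<integral>\<^sup>+c. H (comb \<rho> c) \<partial>PiM K (%_. gauss)) \<partial>PiM R (%_. gauss))"
 proof (rule nn_integral_cong)
  fix \<rho> assume \<rho>: "\<rho> \<in> space (PiM R (%_. gauss))"
  let ?r = "%\<omega>. \<lambda>j\<in>K. \<omega> (bexp i0 p j)"
  have rm: "?r \<in> PiM ?B (%_. gauss) \<rightarrow>\<^sub>M PiM K (%_. gauss)" by (rule measurable_restrict) simp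
  have "(%c. comb \<rho> c) \<in> PiM K (%_. lborel) \<rightarrow>\<^sub>M PiM (exps p) (%_. lborel)"
   by (rule comb_measurable) auto
  from measurable_compose[OF this H]
  have Hm: "(%c. H (comb \<rho> c)) \<in> borel_measurable (PiM K (%_. gauss))" by (simp add: measurable_PiM_gauss_iff)
  have "merge R ?B (\<rho>, b) = comb \<rho> (?r b)" if b: "b \<in> space (PiM ?B (%_. gauss))" for b
  proof
   fix \<alpha>
   show "merge R ?B (\<rho>, b) \<alpha> = comb \<rho> (?r b) \<alpha>"
   proof (cases "\<alpha> \<in> exps p")
    case True
    then show ?thesis
    proof (cases rule: exps_cases)
     case 1 then show ?thesis by (simp add: comb_rest merge_def)
    next
     case (2 j)
     then have "\<alpha> \<notin> R" by (auto simp: rest_exps_def)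
     then show ?thesis using 2 comb_bexp[of j \<rho> "?r b"] by (auto simp: merge_def)
    qed
   next
    case False
    then show ?thesis using E by (auto simp: merge_def comb_def)
   qed
  qed
  then have "(\<integral>\<^sup>+b. H (merge R ?B (\<rho>, b)) \<partial>PiM ?B (%_. gauss)) = (\<integral>\<^sup>+b. H (comb \<rho> (?r b)) \<partial>PiM ?B (%_. gauss))"
   by (intro nn_integral_cong) simp
  also have "\<dots> = (\<integral>\<^sup>+c. H (comb \<rho> c) \<partial>distr (PiM ?B (%_. gauss)) (PiM K (%_. gauss)) ?r)"
   by (rule nn_integral_distr[symmetric, OF rm]) (use Hm in simp)
  also have "distr (PiM ?B (%_. gauss)) (PiM K (%_. gauss)) ?r = PiM K (%_. gauss)"
   by (rule distr_PiM_reindex) (auto simp: prob_space_gauss inj_on_bexp[OF i0])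
  finally show "(\<integral>\<^sup>+b. H (merge R ?B (\<rho>, b)) \<partial>PiM ?B (%_. gauss)) = (\<integral>\<^sup>+c. H (comb \<rho> c) \<partial>PiM K (%_. gauss))" .
 qed
 finally show ?thesis .
qed

definition Mv :: "(('n \<Rightarrow>\<^sub>0 nat) => real) => 'n => real^'n => real" where
 "Mv \<rho> i y = (\<Sum>\<alpha>\<in>R. \<rho> \<alpha> * mf p i0 K i \<alpha> y)"

definition DM :: "(('n \<Rightarrow>\<^sub>0 nat) => real) => 'n => 'n => real^'n => real" where
 "DM \<rho> i k y = (\<Sum>\<alpha>\<in>R. \<rho> \<alpha> * mfD p i0 K i \<alpha> k y)"

lemma Mv_has_grad: "has_grad (chart_dom p K) (Mv \<rho> i) (DM \<rho> i)"
 unfolding Mv_def[abs_def] DM_def[abs_def] by (intro has_grad_sum has_grad_cmult mfD)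

text \<open>The condition of nonzero critical value, with the gradient coordinates replaced by the
  solution of the chart equations at y, so that for fixed \<open>\<rho>\<close> it becomes a
  condition on y alone.\<close>

definition good :: "(('n \<Rightarrow>\<^sub>0 nat) => real) => real^'n => bool" where
 "good \<rho> y \<longleftrightarrow> (z --> fld p (comb \<rho> (%i. Mv \<rho> i y)) (axis i0 1 + y) ~= 0)"

text \<open>Small enough for \<open>(p - 1) * r1^2 < 1\<close>, which keeps the closed ball inside
  \<open>chart_dom\<close>; on this compact ball the coefficient functions are bounded.\<close>

definition r1 :: real where "r1 = 1 / (real p + 1)"

lemma r1_pos: "r1 > 0" by (simp add: r1_def)

lemma cball_chart_dom: "cball 0 r1 \<subseteq> chart_dom p K"
proof
 fix y :: "real^'n" assume "y \<in> cball 0 r1"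
 then have n: "norm y \<le> r1" by simp
 have "nrmK K y \<le> (\<Sum>l\<in>UNIV. y $ l * y $ l)" unfolding nrmK_def by (rule sum_mono2) auto
 also have "\<dots> = (norm y)\<^sup>2" by (simp add: power2_norm_eq_inner inner_vec_def)
 also have "\<dots> \<le> r1\<^sup>2" using n by (rule power_mono) simp
 finally have "real (p - 1) * nrmK K y \<le> real (p - 1) * r1\<^sup>2" by (intro mult_left_mono) auto
 also have "\<dots> \<le> real (p - 1) * r1"
  by (intro mult_left_mono) (auto simp: r1_def power2_eq_square divide_simps)
 also have "\<dots> < 1" using p by (simp add: r1_def of_nat_diff divide_simps)
 finally show "y \<in> chart_dom p K" by (simp add: chart_dom_def)
qed

lemma scaled_ball: "0 < r ==> r \<le> r1 ==> norm y \<le> 1 ==> r *\<^sub>R y \<in> cball 0 r1"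
 using mult_mono[of r r1 "norm y" 1] by simp

lemma fld_comb_continuous:
 "continuous_on (chart_dom p K) (%y. fld p (comb \<rho> (%i. Mv \<rho> i y)) (axis i0 1 + y))"
 unfolding fld_def
proof (intro continuous_intros)
 fix \<alpha> :: "'n \<Rightarrow>\<^sub>0 nat" assume "\<alpha> \<in> exps p"
 then show "continuous_on (chart_dom p K) (%y. comb \<rho> (%i. Mv \<rho> i y) \<alpha>)"
 proof (cases rule: exps_cases)
  case 1 then show ?thesis by (simp add: comb_rest)
 next
  case (2 j) then show ?thesis using has_grad_continuous[OF Mv_has_grad] by (simp add: comb_bexp)
 qed
 show "continuous_on (chart_dom p K) (%y. mon \<alpha> (axis i0 1 + y))"
  by (rule continuous_on_compose2[OF continuous_mon[of UNIV]]) (auto intro!: continuous_intros)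
qed

lemma fiber_eq:
 assumes r: "0 < r" "r \<le> r1"
 shows "{y \<in> coord_space K \<inter> {y. norm y < 1 \<and> good \<rho> (r *\<^sub>R y)}. \<forall>i\<in>K. Mv \<rho> i (r *\<^sub>R y) = c i} = chart_set z i0 K p (comb \<rho> c) r"
proof -
 have "(norm y < 1 \<and> good \<rho> (r *\<^sub>R y) \<and> (\<forall>i\<in>K. Mv \<rho> i (r *\<^sub>R y) = c i)) \<longleftrightarrow>
  norm y < 1 \<and> chart_eq i0 K p (comb \<rho> c) (r *\<^sub>R y) \<and> (z --> fld p (comb \<rho> c) (axis i0 1 + r *\<^sub>R y) ~= 0)"
  if y: "y \<in> coord_space K" for y
 proof (cases "norm y < 1")
  case True
  then have "r *\<^sub>R y \<in> chart_dom p K" using scaled_ball[OF r, of y] cball_chart_dom by force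
  then have small: "real (p - 1) * nrmK K (r *\<^sub>R y) < 1" by (simp add: chart_dom_def)
  have ry: "r *\<^sub>R y \<in> coord_space K" using y by (simp add: coord_space_def)
  have ce: "chart_eq i0 K p (comb \<rho> c) (r *\<^sub>R y) \<longleftrightarrow> (\<forall>i\<in>K. Mv \<rho> i (r *\<^sub>R y) = c i)"
   using chart_solve[OF ry i0 p small, of "comb \<rho> c"] by (simp add: Mv_def comb_rest comb_bexp cong: sum.cong)
  have "comb \<rho> (%i. Mv \<rho> i (r *\<^sub>R y)) = comb \<rho> c" if "\<forall>i\<in>K. Mv \<rho> i (r *\<^sub>R y) = c i"
   by (rule comb_cong) (use that in auto)
  then show ?thesis unfolding ce good_def by auto
 qed simp
 then show ?thesis unfolding chart_set_def by blast
qed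

lemma pbd_comb_le:
 assumes "!!j. j \<in> K ==> \<bar>c j\<bar> \<le> B * pbd R \<rho>" "0 \<le> B"
 shows "pbd (exps p) (comb \<rho> c) \<le> (1 + B) ^ card K * pbd R \<rho> ^ (1 + card K)"
proof -
 have sub: "bexp i0 p ` K \<subseteq> exps p" using exps_bexp[OF p] by auto
 have "pbd (exps p) (comb \<rho> c) = (\<Prod>\<alpha>\<in>R. 1 + \<bar>comb \<rho> c \<alpha>\<bar>) * (\<Prod>\<alpha>\<in>bexp i0 p ` K. 1 + \<bar>comb \<rho> c \<alpha>\<bar>)"
  unfolding pbd_def rest_exps_def by (rule prod.subset_diff[OF sub]) simp
 also have "(\<Prod>\<alpha>\<in>R. 1 + \<bar>comb \<rho> c \<alpha>\<bar>) = pbd R \<rho>" unfolding pbd_def by (simp add: comb_rest)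
 also have "(\<Prod>\<alpha>\<in>bexp i0 p ` K. 1 + \<bar>comb \<rho> c \<alpha>\<bar>) = (\<Prod>j\<in>K. 1 + \<bar>c j\<bar>)"
  by (simp add: prod.reindex[OF inj_on_bexp[OF i0]] comb_bexp)
 also have "(\<Prod>j\<in>K. 1 + \<bar>c j\<bar>) \<le> (\<Prod>j\<in>K. (1 + B) * pbd R \<rho>)"
 proof (rule prod_mono)
  fix j assume "j \<in> K"
  then have "1 + \<bar>c j\<bar> \<le> pbd R \<rho> + B * pbd R \<rho>" using assms(1)[of j] pbd_ge_1[of R \<rho>] by simp
  then show "0 \<le> 1 + \<bar>c j\<bar> \<and> 1 + \<bar>c j\<bar> \<le> (1 + B) * pbd R \<rho>" by (simp add: algebra_simps)
 qed
 also have "\<dots> = (1 + B) ^ card K * pbd R \<rho> ^ card K" by (simp add: power_mult_distrib)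
 finally show ?thesis using pbd_ge_1[of R \<rho>] by (simp add: mult_ac)
qed

lemma G_pos_bound: "G \<xi> \<le> \<bar>C\<bar> * pbd (exps p) \<xi> ^ d"
proof -
 have "C * pbd (exps p) \<xi> ^ d \<le> \<bar>C\<bar> * pbd (exps p) \<xi> ^ d" 
  using pbd_ge_1[of "exps p" \<xi>] by (intro mult_right_mono) auto
 then show ?thesis using Gb[of \<xi>] by linarith
qed

text \<open>Cutting off outside the closed ball turns functions that are continuous near the centre
  into bounded Borel functions on the whole space, without changing them where they are
  used.\<close>

definition ind1 :: "real^'n => real" where "ind1 = indicator (cball 0 r1)"

definition Mh :: "(('n \<Rightarrow>\<^sub>0 nat) => real) => 'n => real^'n => real" where
 "Mh \<rho> i y = (\<Sum>\<alpha>\<in>R. \<rho> \<alpha> * (ind1 y * mf p i0 K i \<alpha> y))"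

definition Dh :: "(('n \<Rightarrow>\<^sub>0 nat) => real) => 'n => 'n => real^'n => real" where
 "Dh \<rho> i k y = (\<Sum>\<alpha>\<in>R. \<rho> \<alpha> * (ind1 y * mfD p i0 K i \<alpha> k y))"

lemma hat_eq: "y \<in> cball 0 r1 ==> Mh \<rho> i y = Mv \<rho> i y" "y \<in> cball 0 r1 ==> Dh \<rho> i k y = DM \<rho> i k y"
 by (simp_all add: Mh_def Mv_def Dh_def DM_def ind1_def)

lemma mf_continuous: "continuous_on (cball 0 r1) (mf p i0 K i \<alpha>)"
 "continuous_on (cball 0 r1) (mfD p i0 K i \<alpha> k)"
 by (rule continuous_on_subset[OF has_grad_continuous[OF mfD(1)] cball_chart_dom],
   rule continuous_on_subset[OF _ cball_chart_dom]) (use mfD(1)[of p K i0 i \<alpha>] in \<open>simp add: has_grad_def\<close>)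

lemma hat_measurable [measurable]:
 "(%y. ind1 y * mf p i0 K i \<alpha> y) \<in> borel_measurable borel"
 "(%y. ind1 y * mfD p i0 K i \<alpha> k y) \<in> borel_measurable borel"
 using borel_measurable_continuous_on_indicator[OF _ mf_continuous(1), of i \<alpha>]
  borel_measurable_continuous_on_indicator[OF _ mf_continuous(2), of i \<alpha> k]
 by (simp_all add: ind1_def)

definition kr_integrand :: "real => (('n \<Rightarrow>\<^sub>0 nat) => real) => real^'n => real" where
 "kr_integrand r \<rho> y = (if norm y < 1 \<and> (z --> fld p (comb \<rho> (%i. Mh \<rho> i (r *\<^sub>R y))) (axis i0 1 + r *\<^sub>R y) ~= 0) then 1 else 0) *
   (\<bar>det (matK K (%i k. Dh \<rho> i k (r *\<^sub>R y)))\<bar> *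
   ((\<Prod>i\<in>K. std_normal_density (Mh \<rho> i (r *\<^sub>R y))) * G (comb \<rho> (%i. Mh \<rho> i (r *\<^sub>R y)))))"

lemma kr_integrand_measurable:
 assumes \<rho>[measurable]: "!!\<alpha>. \<alpha> \<in> R ==> (%x. \<rho> x \<alpha>) \<in> borel_measurable M" and Y[measurable]: "Y \<in> borel_measurable M"
 shows "(%x. kr_integrand r (\<rho> x) (Y x)) \<in> borel_measurable M"
proof -
 have rY: "(%x. r *\<^sub>R Y x) \<in> borel_measurable M" by measurable
 have Mhm[measurable]: "(%x. Mh (\<rho> x) i (r *\<^sub>R Y x)) \<in> borel_measurable M" for i
  unfolding Mh_def
  by (intro borel_measurable_sum borel_measurable_times \<rho> measurable_compose[OF rY hat_measurable(1)])
 have Dhm: "(%x. Dh (\<rho> x) i k (r *\<^sub>R Y x)) \<in> borel_measurable M" for i k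
  unfolding Dh_def
  by (intro borel_measurable_sum borel_measurable_times \<rho> measurable_compose[OF rY hat_measurable(2)])
 have [measurable]: "(%x. det (matK K (%i k. Dh (\<rho> x) i k (r *\<^sub>R Y x)))) \<in> borel_measurable M"
  by (rule det_matK_measurable) (rule Dhm)
 have cm: "(%x. comb (\<rho> x) (%i. Mh (\<rho> x) i (r *\<^sub>R Y x))) \<in> M \<rightarrow>\<^sub>M PiM (exps p) (%_. lborel)"
  by (rule comb_measurable) (use \<rho> Mhm in auto)
 note [measurable] = measurable_compose[OF cm Gm]
 have [measurable]: "(%x. comb (\<rho> x) (%i. Mh (\<rho> x) i (r *\<^sub>R Y x)) \<alpha>) \<in> borel_measurable M" if "\<alpha> \<in> exps p" for \<alpha>
  using measurable_compose[OF cm measurable_component_singleton[OF that]] by simp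
 have [measurable]: "(%x. mon \<alpha> (axis i0 1 + r *\<^sub>R Y x)) \<in> borel_measurable M" for \<alpha>
  by (rule measurable_compose[OF _ borel_measurable_continuous_onI[OF continuous_mon]]) measurable
 have [measurable]: "(%x. fld p (comb (\<rho> x) (%i. Mh (\<rho> x) i (r *\<^sub>R Y x))) (axis i0 1 + r *\<^sub>R Y x)) \<in> borel_measurable M"
  unfolding fld_def by measurable
 show ?thesis unfolding kr_integrand_def by measurable
qed

text \<open>With \<open>\<rho>\<close> fixed, y solves the chart equations for \<open>c\<close>
  exactly if \<open>c\<close> is the value of the explicit map \<open>Mv \<rho>\<close> at the
  scaled point. The expected number of solutions is thus a fibre count integrated against a Gaussian
  density, and the area formula turns it into an integral over y. The power of r is the Jacobian of
  the scaling.\<close>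

lemma local_area:
 assumes r: "0 < r" "r \<le> r1"
 shows "(\<integral>\<^sup>+c. ennreal (G (comb \<rho> c)) * num_elements (chart_set z i0 K p (comb \<rho> c) r) \<partial>PiM K (%_. gauss)) =
  ennreal (r ^ card K) * (\<integral>\<^sup>+y. ennreal (kr_integrand r \<rho> (vecK K y)) \<partial>PiM K (%_. lborel))"
proof -
 let ?S = "{y. norm y < 1 \<and> good \<rho> (r *\<^sub>R y)}"
 define k where "k c = (\<Prod>i\<in>K. std_normal_density (c i)) * G (comb \<rho> c)" for c :: "'n => real"
 define F where "F i y = Mv \<rho> i (r *\<^sub>R y)" for i y
 have cm: "(%c. comb \<rho> c) \<in> PiM K (%_. lborel) \<rightarrow>\<^sub>M PiM (exps p) (%_. lborel)"
  by (rule comb_measurable) auto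
 have Gcm[measurable]: "(%c. G (comb \<rho> c)) \<in> borel_measurable (PiM K (%_. lborel))"
  by (rule measurable_compose[OF cm Gm])
 have km: "k \<in> borel_measurable (PiM K (%_. lborel))"
  unfolding k_def by measurable
 have k0: "0 \<le> k c" for c unfolding k_def by (intro mult_nonneg_nonneg prod_nonneg G0) auto
 have kfold: "(\<Prod>i\<in>K. ennreal (std_normal_density (c i))) * ennreal (G (comb \<rho> c)) = ennreal (k c)" for c
  unfolding k_def by (simp add: prod_ennreal prod_nonneg ennreal_mult G0)
 have "(\<integral>\<^sup>+c. ennreal (k c) \<partial>PiM K (%_. lborel)) = (\<integral>\<^sup>+c. ennreal (G (comb \<rho> c)) \<partial>PiM K (%_. gauss))"
  by (subst nn_integral_PiM_gauss) (simp_all add: kfold)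
 also have "\<dots> \<le> (\<integral>\<^sup>+c. ennreal (\<bar>C\<bar> * pbd R \<rho> ^ d) * ennreal (pbd K c ^ d) \<partial>PiM K (%_. gauss))"
 proof (rule nn_integral_mono)
  fix c
  have sub: "bexp i0 p ` K \<subseteq> exps p" using exps_bexp[OF p] by auto
  have "pbd (exps p) (comb \<rho> c) = (\<Prod>\<alpha>\<in>R. 1 + \<bar>comb \<rho> c \<alpha>\<bar>) * (\<Prod>\<alpha>\<in>bexp i0 p ` K. 1 + \<bar>comb \<rho> c \<alpha>\<bar>)"
   unfolding pbd_def rest_exps_def by (rule prod.subset_diff[OF sub]) simp
  also have "\<dots> = pbd R \<rho> * pbd K c"
   unfolding pbd_def by (simp add: comb_rest prod.reindex[OF inj_on_bexp[OF i0]] comb_bexp)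
  finally have "G (comb \<rho> c) \<le> (\<bar>C\<bar> * pbd R \<rho> ^ d) * pbd K c ^ d"
   using G_pos_bound[of "comb \<rho> c"] by (simp add: power_mult_distrib mult_ac)
  then have "ennreal (G (comb \<rho> c)) \<le> ennreal ((\<bar>C\<bar> * pbd R \<rho> ^ d) * pbd K c ^ d)" by (rule ennreal_leI)
  also have "\<dots> = ennreal (\<bar>C\<bar> * pbd R \<rho> ^ d) * ennreal (pbd K c ^ d)"
   using pbd_ge_1[of R \<rho>] pbd_ge_1[of K c] by (intro ennreal_mult) auto
  finally show "ennreal (G (comb \<rho> c)) \<le> ennreal (\<bar>C\<bar> * pbd R \<rho> ^ d) * ennreal (pbd K c ^ d)" .
 qed
 also have "\<dots> = ennreal (\<bar>C\<bar> * pbd R \<rho> ^ d) * (\<integral>\<^sup>+c. ennreal (pbd K c ^ d) \<partial>PiM K (%_. gauss))"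
  by (rule nn_integral_cmult) (simp add: measurable_PiM_gauss_iff)
 also have "\<dots> < \<infinity>" using nn_integral_pbd[of K d] by (simp add: ennreal_mult_less_top)
 finally have kfin: "(\<integral>\<^sup>+c. ennreal (k c) \<partial>PiM K (%_. lborel)) < \<infinity>" .
 have grad: "has_grad (ball 0 1) (F i) (%j y. r * DM \<rho> i j (r *\<^sub>R y))" for i
  unfolding F_def
 proof (rule has_grad_scale[OF Mv_has_grad])
  fix y :: "real^'n" assume "y \<in> ball 0 1"
  then show "r *\<^sub>R y \<in> chart_dom p K" using scaled_ball[OF r, of y] cball_chart_dom by force
 qed
 have "open (ball 0 1 \<inter> {y. good \<rho> (r *\<^sub>R y)})"
 proof (cases z)
  case True
  have "continuous_on (ball 0 1) (%y. fld p (comb \<rho> (%i. Mv \<rho> i (r *\<^sub>R y))) (axis i0 1 + r *\<^sub>R y))"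
  proof (rule continuous_on_compose2[OF fld_comb_continuous, where f="%y. r *\<^sub>R y"])
   show "(%y. r *\<^sub>R y) ` ball 0 1 \<subseteq> chart_dom p K"
   proof safe
    fix y :: "real^'n" assume "y \<in> ball 0 1"
    then show "r *\<^sub>R y \<in> chart_dom p K" using scaled_ball[OF r, of y] cball_chart_dom by force
   qed
  qed (intro continuous_intros)
  from continuous_open_preimage[OF this open_ball, of "-{0}"]
  have "open (ball 0 1 \<inter> (%y. fld p (comb \<rho> (%i. Mv \<rho> i (r *\<^sub>R y))) (axis i0 1 + r *\<^sub>R y)) -` (-{0}))" by auto
  also have "ball 0 1 \<inter> (%y. fld p (comb \<rho> (%i. Mv \<rho> i (r *\<^sub>R y))) (axis i0 1 + r *\<^sub>R y)) -` (-{0}) =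
   ball 0 1 \<inter> {y. good \<rho> (r *\<^sub>R y)}"
   using True unfolding good_def by auto
  finally show ?thesis .
 next
  case False
  then show ?thesis unfolding good_def by simp
 qed
 moreover have S: "?S = ball 0 1 \<inter> {y. good \<rho> (r *\<^sub>R y)}" by auto
 ultimately have Sm: "?S \<in> sets borel" "?S \<subseteq> ball 0 1" by auto
 have fib: "{y \<in> coord_space K \<inter> ?S. \<forall>i\<in>K. F i y = c i} = chart_set z i0 K p (comb \<rho> c) r" for c
  unfolding F_def by (rule fiber_eq[OF r])
 \<comment> \<open>The chart count is half of a cap count, whose measurability is known.\<close>
 have nm: "(%c. num_elements (chart_set z i0 K p (comb \<rho> c) r)) \<in> borel_measurable (PiM K (%_. lborel))"
 proof -
  have K: "insert i0 K - {i0} = K" using i0 by auto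
  have "(%c. num_elements {s \<in> crit z (insert i0 K) p (comb \<rho> c). cap r (axis i0 1) s}) \<in> borel_measurable (PiM K (%_. lborel))"
  proof (rule measurable_num_crit(1))
   fix \<alpha> :: "'n \<Rightarrow>\<^sub>0 nat" assume "\<alpha> \<in> exps p"
   from measurable_compose[OF cm measurable_component_singleton[OF this]]
   show "(%c. comb \<rho> c \<alpha>) \<in> borel_measurable (PiM K (%_. lborel))" by simp
  qed simp
  then have "(%c. 2 * num_elements (chart_set z i0 K p (comb \<rho> c) r)) \<in> borel_measurable (PiM K (%_. lborel))"
   using num_cap_eq_chart[OF p, of i0 "insert i0 K" r z] r by (simp add: K)
  then have "(%c. 2 * num_elements (chart_set z i0 K p (comb \<rho> c) r) / 2) \<in> borel_measurable (PiM K (%_. lborel))"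
   by measurable
  moreover have "2 * x / 2 = x" for x :: ennreal
   by (simp add: mult.commute[of 2] ennreal_mult_divide_eq)
  ultimately show ?thesis by simp
 qed
 have "(\<integral>\<^sup>+c. ennreal (G (comb \<rho> c)) * num_elements (chart_set z i0 K p (comb \<rho> c) r) \<partial>PiM K (%_. gauss)) =
  (\<integral>\<^sup>+c. ennreal (k c) * num_elements (chart_set z i0 K p (comb \<rho> c) r) \<partial>PiM K (%_. lborel))"
  by (subst nn_integral_PiM_gauss) (use nm in \<open>simp_all add: kfold[symmetric] mult.assoc\<close>)
 also have "\<dots> = (\<integral>\<^sup>+c. ennreal (k c) * num_elements {y \<in> coord_space K \<inter> ?S. \<forall>i\<in>K. F i y = c i} \<partial>PiM K (%_. lborel))"
  by (simp only: fib)
 also have "\<dots> = (\<integral>\<^sup>+y. indicator ?S (vecK K y) * (ennreal \<bar>det (matK K (%i j. r * DM \<rho> i j (r *\<^sub>R vecK K y)))\<bar> *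
    ennreal (k (\<lambda>i\<in>K. F i (vecK K y)))) \<partial>PiM K (%_. lborel))"
  by (rule area_formula_K[OF open_ball grad Sm km k0 kfin]) (use nm in \<open>simp only: fib\<close>)
 also have "\<dots> = (\<integral>\<^sup>+y. ennreal (r ^ card K) * ennreal (kr_integrand r \<rho> (vecK K y)) \<partial>PiM K (%_. lborel))"
 proof (rule nn_integral_cong)
  fix y
  let ?y = "r *\<^sub>R vecK K y"
  show "indicator ?S (vecK K y) * (ennreal \<bar>det (matK K (%i j. r * DM \<rho> i j ?y))\<bar> *
    ennreal (k (\<lambda>i\<in>K. F i (vecK K y)))) = ennreal (r ^ card K) * ennreal (kr_integrand r \<rho> (vecK K y))"
  proof (cases "norm (vecK K y) < 1")
   case True
   then have y: "?y \<in> cball 0 r1" using scaled_ball[OF r, of "vecK K y"] by simp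
   have kk: "k (\<lambda>i\<in>K. F i (vecK K y)) = (\<Prod>i\<in>K. std_normal_density (Mv \<rho> i ?y)) * G (comb \<rho> (%i. Mv \<rho> i ?y))"
   proof -
    have "comb \<rho> (\<lambda>i\<in>K. F i (vecK K y)) = comb \<rho> (%i. Mv \<rho> i ?y)"
     by (rule comb_cong) (simp add: F_def)
    moreover have "(\<Prod>i\<in>K. std_normal_density ((\<lambda>i\<in>K. F i (vecK K y)) i)) = (\<Prod>i\<in>K. std_normal_density (Mv \<rho> i ?y))"
     by (rule prod.cong) (simp_all add: F_def)
    ultimately show ?thesis unfolding k_def by simp
   qed
   have dd: "ennreal \<bar>det (matK K (%i j. r * DM \<rho> i j ?y))\<bar> =
    ennreal (r ^ card K) * ennreal \<bar>det (matK K (%i k. DM \<rho> i k ?y))\<bar>"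
    unfolding det_matK_scale using r by (simp add: abs_mult ennreal_mult)
   have "ennreal (kr_integrand r \<rho> (vecK K y)) = indicator ?S (vecK K y) * (ennreal \<bar>det (matK K (%i k. DM \<rho> i k ?y))\<bar> *
    ennreal (k (\<lambda>i\<in>K. F i (vecK K y))))"
    unfolding kk kr_integrand_def hat_eq[OF y] good_def using True
    by (auto simp: indicator_def ennreal_mult G0 prod_nonneg)
   then show ?thesis unfolding dd by (simp only: mult_ac)
  next
   case False
   then show ?thesis by (simp add: kr_integrand_def)
  qed
 qed
 also have "\<dots> = ennreal (r ^ card K) * (\<integral>\<^sup>+y. ennreal (kr_integrand r \<rho> (vecK K y)) \<partial>PiM K (%_. lborel))"
  by (rule nn_integral_cmult) (intro measurable_compose[OF _ measurable_ennreal] kr_integrand_measurable vecK_measurable; simp)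
 finally show ?thesis .
qed

end

lemma fld_axis:
 assumes p: "p \<ge> 1" shows "fld p \<xi> (axis i0 1) = \<xi> (Poly_Mapping.single i0 p)"
proof -
 have m: "sqrt (multinom p \<alpha>) * mon \<alpha> (axis i0 1) = (if \<alpha> = Poly_Mapping.single i0 p then 1 else 0)"
  if \<alpha>: "\<alpha> \<in> exps p" for \<alpha>
 proof (cases "\<alpha> = Poly_Mapping.single i0 p")
  case True
  have "(\<Prod>i\<in>UNIV. fact (Poly_Mapping.lookup (Poly_Mapping.single i0 p) i) :: real) = (\<Prod>i\<in>UNIV. if i = i0 then fact p else 1)"
   by (rule prod.cong) (auto simp: lookup_single when_def)
  then show ?thesis using True by (simp add: multinom_def mon_single)
 next
  case False
  have "mon \<alpha> (axis i0 1) = 0"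
  proof (rule ccontr)
   assume "mon \<alpha> (axis i0 1) ~= 0"
   then have 0: "\<forall>i. i ~= i0 --> Poly_Mapping.lookup \<alpha> i = 0" by (auto simp: mon_axis split: if_splits)
   have "\<alpha> = Poly_Mapping.single i0 p"
   proof (rule exps_eqI[OF \<alpha> exps_single])
    fix i assume "i ~= i0"
    then show "Poly_Mapping.lookup \<alpha> i = Poly_Mapping.lookup (Poly_Mapping.single i0 p) i"
     using 0 by (simp add: lookup_single when_def)
   qed
   then show False using False by simp
  qed
  then show ?thesis using False by simp
 qed
 have "fld p \<xi> (axis i0 1) = (\<Sum>\<alpha>\<in>exps p. if \<alpha> = Poly_Mapping.single i0 p then \<xi> \<alpha> else 0)"
  unfolding fld_def by (rule sum.cong) (auto simp: m)
 then show ?thesis by (simp add: exps_single)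
qed

lemma gauss_component_measurable:
 "\<alpha> \<in> A ==> (%\<rho>. \<rho> \<alpha>) \<in> borel_measurable (PiM A (%_. gauss))"
 by (subst measurable_PiM_gauss_iff) simp

lemma std_normal_density_le_1: "std_normal_density x \<le> 1"
proof -
 have "1 \<le> 2 * pi" using pi_ge_two by linarith
 then have "1 \<le> sqrt (2 * pi)" by simp
 then have "1 / sqrt (2 * pi) \<le> 1" by simp
 moreover have "exp (- x\<^sup>2 / 2) \<le> 1" by simp
 ultimately have "1 / sqrt (2 * pi) * exp (- x\<^sup>2 / 2) \<le> 1 * 1" by (intro mult_mono) auto
 then show ?thesis by (simp add: std_normal_density_def)
qed

lemma continuous_std_normal_density: "continuous_on A std_normal_density"
 unfolding std_normal_density_def by (intro continuous_intros) auto

lemma std_normal_density_0: "std_normal_density 0 = 1 / sqrt (2 * pi)"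
 by (simp add: std_normal_density_def)

context chart_weight
begin

lemma hat_bound:
 obtains B where "1 \<le> B" "!!i \<rho> y. \<bar>Mh \<rho> i y\<bar> \<le> B * pbd R \<rho>" "!!i k \<rho> y. \<bar>Dh \<rho> i k y\<bar> \<le> B * pbd R \<rho>"
proof -
 have ex: "\<exists>b. \<forall>y. \<bar>ind1 y * f y\<bar> \<le> b" if "continuous_on (cball 0 r1) f" for f :: "real^'n => real"
 proof -
  have "bounded (f ` cball 0 r1)" by (intro compact_imp_bounded compact_continuous_image that) auto
  then obtain b where b: "\<forall>y\<in>cball 0 r1. \<bar>f y\<bar> \<le> b" by (auto simp: bounded_iff simp del: mem_cball)
  have "\<bar>ind1 y * f y\<bar> \<le> max b 0" for y
  proof (cases "y \<in> cball 0 r1")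
   case True
   then have "\<bar>f y\<bar> \<le> b" using b by blast
   then show ?thesis using True by (simp add: ind1_def)
  qed (simp add: ind1_def)
  then show ?thesis by blast
 qed
 obtain b1 where b1: "!!i \<alpha> y. \<bar>ind1 y * mf p i0 K i \<alpha> y\<bar> \<le> b1 i \<alpha>" using ex[OF mf_continuous(1)] by metis
 obtain b2 where b2: "!!i \<alpha> k y. \<bar>ind1 y * mfD p i0 K i \<alpha> k y\<bar> \<le> b2 i \<alpha> k" using ex[OF mf_continuous(2)] by metis
 have b10: "0 \<le> b1 i \<alpha>" for i \<alpha> using b1[of 0 i \<alpha>] by linarith
 have b20: "0 \<le> b2 i \<alpha> k" for i \<alpha> k using b2[of 0 i \<alpha> k] by linarith
 define B where "B = 1 + (\<Sum>i\<in>UNIV. \<Sum>\<alpha>\<in>R. b1 i \<alpha> + (\<Sum>k\<in>UNIV. b2 i \<alpha> k))"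
 have le: "b1 i \<alpha> + (\<Sum>k\<in>UNIV. b2 i \<alpha> k) \<le> B" if "\<alpha> \<in> R" for i \<alpha>
 proof -
  have "b1 i \<alpha> + (\<Sum>k\<in>UNIV. b2 i \<alpha> k) \<le> (\<Sum>\<alpha>\<in>R. b1 i \<alpha> + (\<Sum>k\<in>UNIV. b2 i \<alpha> k))"
   by (rule member_le_sum[OF that]) (auto intro!: add_nonneg_nonneg sum_nonneg b10 b20 simp: finite_R)
  also have "\<dots> \<le> (\<Sum>i\<in>UNIV. \<Sum>\<alpha>\<in>R. b1 i \<alpha> + (\<Sum>k\<in>UNIV. b2 i \<alpha> k))"
   by (rule member_le_sum) (auto intro!: add_nonneg_nonneg sum_nonneg b10 b20)
  finally show ?thesis by (simp add: B_def)
 qed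
 have B1: "1 \<le> B" unfolding B_def by (simp add: sum_nonneg b10 b20)
 have le1: "b1 i \<alpha> \<le> B" "b2 i \<alpha> k \<le> B" if "\<alpha> \<in> R" for i \<alpha> k
  using le[OF that, of i] member_le_sum[of k UNIV "b2 i \<alpha>"] sum_nonneg[of UNIV "b2 i \<alpha>"] b10[of i \<alpha>] b20[of i \<alpha>] by auto
 have key: "\<bar>\<Sum>\<alpha>\<in>R. \<rho> \<alpha> * h \<alpha>\<bar> \<le> B * pbd R \<rho>" if "!!\<alpha>. \<alpha> \<in> R ==> \<bar>h \<alpha>\<bar> \<le> B" for \<rho> h
 proof -
  have "\<bar>\<Sum>\<alpha>\<in>R. \<rho> \<alpha> * h \<alpha>\<bar> \<le> (\<Sum>\<alpha>\<in>R. \<bar>\<rho> \<alpha> * h \<alpha>\<bar>)" by (rule sum_abs)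
  also have "\<dots> \<le> (\<Sum>\<alpha>\<in>R. \<bar>\<rho> \<alpha>\<bar> * B)"
   by (rule sum_mono) (use that in \<open>auto simp: abs_mult intro!: mult_left_mono\<close>)
  also have "\<dots> = B * (\<Sum>\<alpha>\<in>R. \<bar>\<rho> \<alpha>\<bar>)" by (simp add: sum_distrib_left mult.commute)
  also have "\<dots> \<le> B * pbd R \<rho>"
   using pbd_sum[OF finite_R, of \<rho>] B1 by (intro mult_left_mono) auto
  finally show ?thesis .
 qed
 show ?thesis
 proof (rule that[OF B1])
  show "\<bar>Mh \<rho> i y\<bar> \<le> B * pbd R \<rho>" for \<rho> i y
   unfolding Mh_def by (rule key) (use b1 le1(1) order_trans in blast)
  show "\<bar>Dh \<rho> i k y\<bar> \<le> B * pbd R \<rho>" for \<rho> i k y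
   unfolding Dh_def by (rule key) (use b2 le1(2) order_trans in blast)
 qed
qed

text \<open>Each factor is bounded by a power of \<open>pbd R \<rho>\<close>, up to a constant,
  uniformly in r and y: the determinant by its Leibniz sum, the densities by 1, and \<open>G\<close>
  by its growth condition.\<close>

lemma kr_integrand_bound:
 obtains W D where "0 \<le> W" "!!r \<rho> y. kr_integrand r \<rho> y \<le> (W * pbd R \<rho> ^ D) * indicator {y. norm y < 1} y"
proof -
 obtain B where B: "1 \<le> B" "!!i \<rho> y. \<bar>Mh \<rho> i y\<bar> \<le> B * pbd R \<rho>" "!!i k \<rho> y. \<bar>Dh \<rho> i k y\<bar> \<le> B * pbd R \<rho>"
  using hat_bound by blast
 let ?n = "CARD('n)" and ?k = "card K"
 define W where "W = fact ?n * B ^ ?n * (\<bar>C\<bar> * ((1 + B) ^ ?k) ^ d)"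
 have W: "0 \<le> W" using B(1) by (simp add: W_def)
 have "kr_integrand r \<rho> y \<le> (W * pbd R \<rho> ^ (?n + (1 + ?k) * d)) * indicator {y. norm y < 1} y" for r \<rho> y
 proof -
  let ?P = "pbd R \<rho>"
  have P: "1 \<le> ?P" by (rule pbd_ge_1)
  have "1 * 1 \<le> B * ?P" using P B(1) by (intro mult_mono) auto
  then have a: "\<bar>det (matK K (%i k. Dh \<rho> i k (r *\<^sub>R y)))\<bar> \<le> fact ?n * (B * ?P) ^ ?n"
   using B(3) by (intro det_matK_bound) auto
  have b: "(\<Prod>i\<in>K. std_normal_density (Mh \<rho> i (r *\<^sub>R y))) \<le> 1"
   by (rule prod_le_1) (simp add: std_normal_density_le_1)
  have "pbd (exps p) (comb \<rho> (%i. Mh \<rho> i (r *\<^sub>R y))) \<le> (1 + B) ^ ?k * ?P ^ (1 + ?k)"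
   using B by (intro pbd_comb_le) auto
  then have "pbd (exps p) (comb \<rho> (%i. Mh \<rho> i (r *\<^sub>R y))) ^ d \<le> ((1 + B) ^ ?k * ?P ^ (1 + ?k)) ^ d"
   using pbd_ge_1[of "exps p"] by (intro power_mono) (auto intro: order_trans[OF zero_le_one])
  then have c: "G (comb \<rho> (%i. Mh \<rho> i (r *\<^sub>R y))) \<le> \<bar>C\<bar> * ((1 + B) ^ ?k * ?P ^ (1 + ?k)) ^ d"
   by (intro order_trans[OF G_pos_bound] mult_left_mono) auto
  have bc: "(\<Prod>i\<in>K. std_normal_density (Mh \<rho> i (r *\<^sub>R y))) * G (comb \<rho> (%i. Mh \<rho> i (r *\<^sub>R y))) \<le>
   1 * (\<bar>C\<bar> * ((1 + B) ^ ?k * ?P ^ (1 + ?k)) ^ d)"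
   by (rule mult_mono[OF b c]) (auto intro: G0)
  have "\<bar>det (matK K (%i k. Dh \<rho> i k (r *\<^sub>R y)))\<bar> *
   ((\<Prod>i\<in>K. std_normal_density (Mh \<rho> i (r *\<^sub>R y))) * G (comb \<rho> (%i. Mh \<rho> i (r *\<^sub>R y)))) \<le>
   (fact ?n * (B * ?P) ^ ?n) * (1 * (\<bar>C\<bar> * ((1 + B) ^ ?k * ?P ^ (1 + ?k)) ^ d))"
   using B(1) P by (intro mult_mono[OF a bc] mult_nonneg_nonneg prod_nonneg G0) auto
  also have "\<dots> = W * ?P ^ (?n + (1 + ?k) * d)"
   by (simp add: W_def power_mult_distrib power_add power_mult)
  finally have "\<bar>det (matK K (%i k. Dh \<rho> i k (r *\<^sub>R y)))\<bar> *
   ((\<Prod>i\<in>K. std_normal_density (Mh \<rho> i (r *\<^sub>R y))) * G (comb \<rho> (%i. Mh \<rho> i (r *\<^sub>R y)))) \<le> W * ?P ^ (?n + (1 + ?k) * d)" .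
  then show ?thesis using W P unfolding kr_integrand_def by (auto simp: indicator_def)
 qed
 then show ?thesis using that W by blast
qed

text \<open>The limit of the integrand up to the constant Gaussian density at 0. The gradient
  coordinates of the coefficient vector are set to 0, as if conditioned on a critical point at the
  axis.\<close>

definition limD :: "(('n \<Rightarrow>\<^sub>0 nat) => real) => real" where
 "limD \<rho> = \<bar>det (matK K (jac p i0 \<rho>))\<bar> * G (comb \<rho> (%_. 0))"

text \<open>At the centre the solution map vanishes and its Jacobian is \<open>jac\<close>. The
  value of the polynomial there is the coefficient of \<open>x_i0^p\<close>; where this is nonzero,
  the condition on the critical value holds for all late n and drops out of the limit.\<close>

lemma kr_integrand_limit:
 assumes rn: "!!n. 0 < rn n" "!!n. rn n \<le> r1" "rn \<longlonglongrightarrow> 0" and nz: "\<rho> (Poly_Mapping.single i0 p) ~= 0"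
 shows "(%n. kr_integrand (rn n) \<rho> y) \<longlonglongrightarrow> indicator {y. norm y < 1} y * ((1 / sqrt (2 * pi)) ^ card K * limD \<rho>)"
proof (cases "norm y < 1")
 case False
 then show ?thesis by (simp add: kr_integrand_def)
next
 case True
 have cb: "rn n *\<^sub>R y \<in> cball 0 r1" for n using scaled_ball[OF rn(1,2), of y] True by simp
 have ry: "(%n. rn n *\<^sub>R y) \<longlonglongrightarrow> 0" using tendsto_scaleR[OF rn(3) tendsto_const[of y]] by simp
 have lim: "(%n. f (rn n *\<^sub>R y)) \<longlonglongrightarrow> f 0" if "continuous_on (chart_dom p K) f" for f :: "real^'n => real"
  using that open_chart_dom zero_chart_dom ry continuous_on_eq_continuous_at isCont_tendsto_compose by metis
 have M: "(%n. Mh \<rho> i (rn n *\<^sub>R y)) \<longlonglongrightarrow> 0" if "i \<in> K" for i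
 proof -
  have "Mv \<rho> i 0 = 0" unfolding Mv_def by (rule sum.neutral) (use mf_zero[OF i0 p that] in auto)
  then show ?thesis using lim[OF has_grad_continuous[OF Mv_has_grad], of \<rho> i] by (simp add: hat_eq[OF cb])
 qed
 have Dl: "(%n. Dh \<rho> i k (rn n *\<^sub>R y)) \<longlonglongrightarrow> jac p i0 \<rho> i k" if "i \<in> K" "k \<in> K" for i k
 proof -
  have "DM \<rho> i k 0 = jac p i0 \<rho> i k"
   unfolding DM_def mfD(2) by (rule jacobian_at_zero[OF i0 p that])
  then show ?thesis using lim[of "DM \<rho> i k"] Mv_has_grad[of \<rho> i] by (simp add: hat_eq[OF cb] has_grad_def)
 qed
 let ?c = "%n. comb \<rho> (%i. Mh \<rho> i (rn n *\<^sub>R y))"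
 have cl: "(%n. ?c n \<alpha>) \<longlonglongrightarrow> comb \<rho> (%_. 0) \<alpha>" if "\<alpha> \<in> exps p" for \<alpha>
  using that
 proof (cases rule: exps_cases)
  case 1 then show ?thesis by (simp add: comb_rest)
 next
  case (2 j) then show ?thesis using M[of j] by (simp add: comb_bexp)
 qed
 have Gl: "(%n. G (?c n)) \<longlonglongrightarrow> G (comb \<rho> (%_. 0))" by (rule Gc) (rule cl)
 have "(%n. axis i0 1 + rn n *\<^sub>R y) \<longlonglongrightarrow> axis i0 1 + 0" by (intro tendsto_intros ry)
 then have ml: "(%n. mon \<alpha> (axis i0 1 + rn n *\<^sub>R y)) \<longlonglongrightarrow> mon \<alpha> (axis i0 1)" for \<alpha>
  using continuous_mon[of UNIV \<alpha>] by (auto simp: continuous_on_eq_continuous_at intro: isCont_tendsto_compose)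
 have "(%n. fld p (?c n) (axis i0 1 + rn n *\<^sub>R y)) \<longlonglongrightarrow> fld p (comb \<rho> (%_. 0)) (axis i0 1)"
  unfolding fld_def by (intro tendsto_sum tendsto_mult tendsto_const ml cl)
 moreover have "fld p (comb \<rho> (%_. 0)) (axis i0 1) ~= 0"
  using nz single_rest[OF i0 p] by (simp add: fld_axis[OF p] comb_rest)
 ultimately have ev: "\<forall>\<^sub>F n in sequentially. fld p (?c n) (axis i0 1 + rn n *\<^sub>R y) ~= 0"
  by (rule tendsto_imp_eventually_ne)
 have sl: "(%n. std_normal_density (Mh \<rho> i (rn n *\<^sub>R y))) \<longlonglongrightarrow> 1 / sqrt (2 * pi)" if "i \<in> K" for i
  using isCont_tendsto_compose[OF _ M[OF that], of std_normal_density] continuous_std_normal_density[of UNIV]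
  by (simp add: continuous_on_eq_continuous_at std_normal_density_0)
 have "(%n. \<bar>det (matK K (%i k. Dh \<rho> i k (rn n *\<^sub>R y)))\<bar> *
   ((\<Prod>i\<in>K. std_normal_density (Mh \<rho> i (rn n *\<^sub>R y))) * G (?c n))) \<longlonglongrightarrow>
  \<bar>det (matK K (%i k. jac p i0 \<rho> i k))\<bar> * ((\<Prod>i\<in>K. 1 / sqrt (2 * pi)) * G (comb \<rho> (%_. 0)))"
  by (intro tendsto_mult tendsto_rabs tendsto_prod Gl sl det_matK_tendsto Dl) auto
 then have "(%n. kr_integrand (rn n) \<rho> y) \<longlonglongrightarrow> \<bar>det (matK K (%i k. jac p i0 \<rho> i k))\<bar> * ((\<Prod>i\<in>K. 1 / sqrt (2 * pi)) * G (comb \<rho> (%_. 0)))"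
  by (rule Lim_transform_eventually) (use ev in eventually_elim, simp add: kr_integrand_def True)
 then show ?thesis using True by (simp add: limD_def mult_ac)
qed

definition nu :: "real => ennreal" where
 "nu r = (\<integral>\<^sup>+\<xi>. ennreal (G \<xi>) * num_elements {s \<in> crit z (insert i0 K) p \<xi>. cap r (axis i0 1) s} \<partial>PiM (exps p) (%_. gauss))"

text \<open>The volume of the unit ball. It enters the limits of both sides of the averaging
  identity and cancels, which takes only its positivity and finiteness.\<close>

definition volK :: ennreal where
 "volK = (\<integral>\<^sup>+y. indicator {y. norm y < 1} (vecK K y) \<partial>PiM K (%_. lborel))"

lemma limD_measurable: "(%\<rho>. limD \<rho>) \<in> borel_measurable (PiM R (%_. gauss))"
proof -
 have sm: "(%\<rho>. \<rho> (Poly_Mapping.single i0 p)) \<in> borel_measurable (PiM R (%_. gauss))"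
  by (rule gauss_component_measurable[OF single_rest[OF i0 p]])
 have "(%\<rho>. jac p i0 \<rho> j k) \<in> borel_measurable (PiM R (%_. gauss))" if "j \<in> K" "k \<in> K" for j k
 proof (cases "p \<ge> 2")
  case True
  have "(%\<rho>. \<rho> (qexp i0 p j k)) \<in> borel_measurable (PiM R (%_. gauss))"
   by (rule gauss_component_measurable[OF qexp_rest[OF i0 that True]])
  with sm show ?thesis unfolding jac_def goe_def by (cases "j = k") simp_all
 next
  case False
  then have "p = 1" using p by simp
  with sm show ?thesis unfolding jac_def by (cases "j = k") simp_all
 qed
 then have [measurable]: "(%\<rho>. det (matK K (jac p i0 \<rho>))) \<in> borel_measurable (PiM R (%_. gauss))"
  by (rule det_matK_measurable)
 have "(%\<rho>. comb \<rho> (%_. 0)) \<in> PiM R (%_. gauss) \<rightarrow>\<^sub>M PiM (exps p) (%_. lborel)"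
  by (rule comb_measurable) simp_all
 note [measurable] = measurable_compose[OF this Gm]
 show ?thesis unfolding limD_def by measurable
qed

lemma volK_finite: "volK < \<infinity>" and volK_pos: "volK > 0"
proof -
 let ?n = "real CARD('n)"
 have box: "(\<lambda>i\<in>K. y i) = y" if "y \<in> PiE K S" for y S using that by (auto simp: fun_eq_iff PiE_def extensional_def)
 have "volK \<le> (\<integral>\<^sup>+y. indicator (PiE K (%_. {-1..1::real})) y \<partial>PiM K (%_. lborel))"
  unfolding volK_def
 proof (rule nn_integral_mono)
  fix y assume y: "y \<in> space (PiM K (%_. lborel :: real measure))"
  show "indicator {y. norm y < 1} (vecK K y) \<le> (indicator (PiE K (%_. {-1..1::real})) y :: ennreal)"
  proof (cases "norm (vecK K y) < 1")
   case True
   have "y i \<in> {-1..1}" if "i \<in> K" for i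
    using component_le_norm_cart[of "vecK K y" i] True that by (auto simp: abs_le_iff)
   then show ?thesis using y by (auto simp: indicator_def space_PiM PiE_def)
  qed (simp add: indicator_def)
 qed
 also have "\<dots> = emeasure (PiM K (%_. lborel)) (PiE K (%_. {-1..1::real}))"
  by (rule nn_integral_indicator) (intro sets_PiM_I_finite; simp)
 also have "\<dots> < \<infinity>"
  by (subst lborelP.emeasure_PiM) (auto simp: prod_constant power_less_top_ennreal)
 finally show "volK < \<infinity>" .
 \<comment> \<open>With this half-width the points of the cube have l1-norm at most 1/2, hence lie
   in the unit ball.\<close>
 define e where "e = 1 / (2 * ?n)"
 have e: "e > 0" by (simp add: e_def)
 have "0 < (\<Prod>i\<in>K. ennreal (2 * e))" using e by (simp add: ennreal_power)
 also have "(\<Prod>i\<in>K. ennreal (2 * e)) = emeasure (PiM K (%_. lborel)) (PiE K (%_. {-e..e}))"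
  using e by (subst lborelP.emeasure_PiM) auto
 also have "\<dots> = (\<integral>\<^sup>+y. indicator (PiE K (%_. {-e..e})) y \<partial>PiM K (%_. lborel))"
  by (rule nn_integral_indicator[symmetric]) (intro sets_PiM_I_finite; simp)
 also have "\<dots> \<le> volK"
  unfolding volK_def
 proof (rule nn_integral_mono)
  fix y :: "'n => real"
  show "(indicator (PiE K (%_. {-e..e})) y :: ennreal) \<le> indicator {y. norm y < 1} (vecK K y)"
  proof (cases "y \<in> PiE K (%_. {-e..e})")
   case True
   have "norm (vecK K y) \<le> (\<Sum>i\<in>UNIV. \<bar>vecK K y $ i\<bar>)" by (rule norm_le_l1_cart)
   also have "\<dots> \<le> (\<Sum>i\<in>(UNIV :: 'n set). e)"
    by (rule sum_mono) (use True e in \<open>auto simp: PiE_def Pi_def abs_le_iff\<close>)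
   also have "\<dots> < 1" by (simp add: e_def)
   finally show ?thesis by (simp add: indicator_def)
  qed simp
 qed
 finally show "volK > 0" .
qed

lemma nu_eq:
 assumes r: "0 < r" "r \<le> r1"
 shows "nu r = 2 * (ennreal (r ^ card K) * (\<integral>\<^sup>+x. ennreal (kr_integrand r (fst x) (vecK K (snd x))) \<partial>(PiM R (%_. gauss) \<Otimes>\<^sub>M PiM K (%_. lborel))))"
proof -
 let ?R = "PiM R (%_. gauss)" and ?K = "PiM K (%_. lborel :: real measure)"
 interpret K: sigma_finite_measure ?K by (rule lborelP.sigma_finite) simp
 have Ki: "insert i0 K - {i0} = K" using i0 by auto
 have m: "(%\<xi>. num_elements {s \<in> crit z (insert i0 K) p \<xi>. cap r (axis i0 1) s}) \<in> borel_measurable (PiM (exps p) (%_. lborel))"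
  by (rule measurable_num_crit(1)) measurable
 have km: "(%x. kr_integrand r (fst x) (vecK K (snd x))) \<in> borel_measurable (?R \<Otimes>\<^sub>M ?K)"
  by (rule kr_integrand_measurable) measurable
 have cm: "(%c. comb \<rho> c) \<in> PiM K (%_. lborel) \<rightarrow>\<^sub>M PiM (exps p) (%_. lborel)" for \<rho>
  by (rule comb_measurable) auto
 have "nu r = (\<integral>\<^sup>+\<rho>. (\<integral>\<^sup>+c. ennreal (G (comb \<rho> c)) * num_elements {s \<in> crit z (insert i0 K) p (comb \<rho> c). cap r (axis i0 1) s} \<partial>PiM K (%_. gauss)) \<partial>?R)"
  unfolding nu_def by (rule nn_integral_comb) (use m Gm in measurable)
 also have "\<dots> = (\<integral>\<^sup>+\<rho>. 2 * (ennreal (r ^ card K) * (\<integral>\<^sup>+y. ennreal (kr_integrand r \<rho> (vecK K y)) \<partial>?K)) \<partial>?R)"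
 proof (rule nn_integral_cong)
  fix \<rho>
  have "(\<integral>\<^sup>+c. ennreal (G (comb \<rho> c)) * num_elements {s \<in> crit z (insert i0 K) p (comb \<rho> c). cap r (axis i0 1) s} \<partial>PiM K (%_. gauss)) =
   (\<integral>\<^sup>+c. ennreal (G (comb \<rho> c)) * num_elements (chart_set z i0 K p (comb \<rho> c) r) + ennreal (G (comb \<rho> c)) * num_elements (chart_set z i0 K p (comb \<rho> c) r) \<partial>PiM K (%_. gauss))"
   using num_cap_eq_chart[OF p, of i0 "insert i0 K" r z] r by (simp add: Ki mult_2 distrib_left)
  also have "\<dots> = 2 * (\<integral>\<^sup>+c. ennreal (G (comb \<rho> c)) * num_elements (chart_set z i0 K p (comb \<rho> c) r) \<partial>PiM K (%_. gauss))"
  proof -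
   have "(%c. ennreal (G (comb \<rho> c)) * (2 * num_elements (chart_set z i0 K p (comb \<rho> c) r)) / 2) \<in> borel_measurable (PiM K (%_. lborel))"
    using measurable_compose[OF cm m, of \<rho>] measurable_compose[OF cm Gm, of \<rho>]
     num_cap_eq_chart[OF p, of i0 "insert i0 K" r z] r by (simp add: Ki)
   moreover have "a * (2 * x) / 2 = a * x" for a x :: ennreal
   proof -
    have "a * (2 * x) / 2 = (a * x) * 2 / 2" by (simp only: mult_ac)
    also have "\<dots> = a * x" by (rule ennreal_mult_divide_eq) simp_all
    finally show ?thesis .
   qed
   ultimately show ?thesis
    by (subst nn_integral_add) (simp_all add: measurable_PiM_gauss_iff mult_2)
  qed
  finally show "(\<integral>\<^sup>+c. ennreal (G (comb \<rho> c)) * num_elements {s \<in> crit z (insert i0 K) p (comb \<rho> c). cap r (axis i0 1) s} \<partial>PiM K (%_. gauss)) =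
   2 * (ennreal (r ^ card K) * (\<integral>\<^sup>+y. ennreal (kr_integrand r \<rho> (vecK K y)) \<partial>?K))"
   by (simp only: local_area[OF r])
 qed
 also have "\<dots> = 2 * (ennreal (r ^ card K) * (\<integral>\<^sup>+\<rho>. (\<integral>\<^sup>+y. ennreal (kr_integrand r \<rho> (vecK K y)) \<partial>?K) \<partial>?R))"
 proof -
  have mm[measurable]: "(%\<rho>. \<integral>\<^sup>+y. ennreal (kr_integrand r \<rho> (vecK K y)) \<partial>?K) \<in> borel_measurable ?R"
   using K.borel_measurable_nn_integral[of "%\<rho> y. ennreal (kr_integrand r \<rho> (vecK K y))" ?R] km
   by (simp add: split_beta')
  show ?thesis by (simp add: nn_integral_cmult)
 qed
 also have "(\<integral>\<^sup>+\<rho>. (\<integral>\<^sup>+y. ennreal (kr_integrand r \<rho> (vecK K y)) \<partial>?K) \<partial>?R) =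
  (\<integral>\<^sup>+x. ennreal (kr_integrand r (fst x) (vecK K (snd x))) \<partial>(?R \<Otimes>\<^sub>M ?K))"
  using K.nn_integral_fst[of "%x. ennreal (kr_integrand r (fst x) (vecK K (snd x)))" ?R] km by simp
 finally show ?thesis .
qed

text \<open>Dominated convergence: the dominating function is a power of \<open>pbd R \<rho>\<close>
  times the indicator of the unit ball, and the coefficient of \<open>x_i0^p\<close> is almost
  surely nonzero.\<close>

lemma nu_limit:
 assumes rn: "!!n. 0 < rn n" "!!n. rn n \<le> r1" "rn \<longlonglongrightarrow> 0"
 shows "(%n. \<integral>\<^sup>+x. ennreal (kr_integrand (rn n) (fst x) (vecK K (snd x))) \<partial>(PiM R (%_. gauss) \<Otimes>\<^sub>M PiM K (%_. lborel)))
  \<longlonglongrightarrow> ennreal ((1 / sqrt (2 * pi)) ^ card K) * volK * (\<integral>\<^sup>+\<rho>. ennreal (limD \<rho>) \<partial>PiM R (%_. gauss))"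
proof -
 let ?R = "PiM R (%_. gauss)" and ?K = "PiM K (%_. lborel :: real measure)"
 let ?i = "%y. indicator {y. norm y < 1} (vecK K y) :: real"
 let ?c = "(1 / sqrt (2 * pi)) ^ card K"
 interpret K: sigma_finite_measure ?K by (rule lborelP.sigma_finite) simp
 interpret RP: prob_space ?R by (rule prob_space_PiM) (rule prob_space_gauss)
 interpret P: pair_sigma_finite ?R ?K by unfold_locales
 obtain W D where W: "0 \<le> W" "!!r \<rho> y. kr_integrand r \<rho> y \<le> (W * pbd R \<rho> ^ D) * indicator {y. norm y < 1} y"
  using kr_integrand_bound by blast
 have km: "(%x. kr_integrand r (fst x) (vecK K (snd x))) \<in> borel_measurable (?R \<Otimes>\<^sub>M ?K)" for r
  by (rule kr_integrand_measurable) measurable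
 note [measurable] = limD_measurable
 have [measurable]: "pbd R \<in> borel_measurable ?R" by (simp add: measurable_PiM_gauss_iff)
 have iK: "(\<integral>\<^sup>+y. ennreal (?i y) \<partial>?K) = volK" unfolding volK_def by (simp add: ennreal_indicator)
 have prodint: "(\<integral>\<^sup>+x. ennreal (f (fst x) * ?i (snd x)) \<partial>(?R \<Otimes>\<^sub>M ?K)) = (\<integral>\<^sup>+\<rho>. ennreal (f \<rho>) \<partial>?R) * volK"
  if [measurable]: "f \<in> borel_measurable ?R" and f0: "!!\<rho>. 0 \<le> f \<rho>" for f
 proof -
  have "(\<integral>\<^sup>+x. ennreal (f (fst x) * ?i (snd x)) \<partial>(?R \<Otimes>\<^sub>M ?K)) = (\<integral>\<^sup>+\<rho>. (\<integral>\<^sup>+y. ennreal (f \<rho> * ?i y) \<partial>?K) \<partial>?R)"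
   by (subst K.nn_integral_fst[symmetric]) simp_all
  also have "\<dots> = (\<integral>\<^sup>+\<rho>. ennreal (f \<rho>) * volK \<partial>?R)"
   by (simp add: ennreal_mult f0 nn_integral_cmult iK)
  also have "\<dots> = (\<integral>\<^sup>+\<rho>. ennreal (f \<rho>) \<partial>?R) * volK" by (rule nn_integral_multc) simp
  finally show ?thesis .
 qed
 have limD0: "0 \<le> limD \<rho>" for \<rho> by (simp add: limD_def G0)
 have AEr: "AE \<rho> in ?R. \<rho> (Poly_Mapping.single i0 p) ~= 0"
  by (rule AE_PiM_component[OF prob_space_gauss single_rest[OF i0 p] AE_gauss_nonzero])
 have "(%n. \<integral>\<^sup>+x. ennreal (kr_integrand (rn n) (fst x) (vecK K (snd x))) \<partial>(?R \<Otimes>\<^sub>M ?K)) \<longlonglongrightarrow>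
  (\<integral>\<^sup>+x. ennreal ((?c * limD (fst x)) * ?i (snd x)) \<partial>(?R \<Otimes>\<^sub>M ?K))"
 proof (rule nn_integral_dominated_convergence[where w="%x. ennreal ((W * pbd R (fst x) ^ D) * ?i (snd x))"])
  show "(%x. ennreal (kr_integrand (rn n) (fst x) (vecK K (snd x)))) \<in> borel_measurable (?R \<Otimes>\<^sub>M ?K)" for n
   using km by simp
  show "AE x in ?R \<Otimes>\<^sub>M ?K. ennreal (kr_integrand (rn n) (fst x) (vecK K (snd x))) \<le> ennreal ((W * pbd R (fst x) ^ D) * ?i (snd x))" for n
   by (intro AE_I2 ennreal_leI W(2))
  have "(\<integral>\<^sup>+\<rho>. ennreal (W * pbd R \<rho> ^ D) \<partial>?R) = ennreal W * (\<integral>\<^sup>+\<rho>. ennreal (pbd R \<rho> ^ D) \<partial>?R)"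
   using W(1) pbd_ge_1[of R] by (simp add: ennreal_mult nn_integral_cmult order_trans[OF zero_le_one])
  then have "(\<integral>\<^sup>+\<rho>. ennreal (W * pbd R \<rho> ^ D) \<partial>?R) < \<infinity>"
   using nn_integral_pbd[OF finite_R, of D] by (simp add: ennreal_mult_less_top)
  then show "(\<integral>\<^sup>+x. ennreal ((W * pbd R (fst x) ^ D) * ?i (snd x)) \<partial>(?R \<Otimes>\<^sub>M ?K)) < \<infinity>"
   using volK_finite W(1) pbd_ge_1[of R] by (subst prodint) (auto simp: ennreal_mult_less_top order_trans[OF zero_le_one])
  have "AE x in ?R \<Otimes>\<^sub>M ?K. fst x (Poly_Mapping.single i0 p) ~= 0"
  proof (rule P.AE_pair_measure)
   have [measurable]: "(%\<rho>. \<rho> (Poly_Mapping.single i0 p)) \<in> borel_measurable ?R"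
    by (rule gauss_component_measurable[OF single_rest[OF i0 p]])
   show "{x \<in> space (?R \<Otimes>\<^sub>M ?K). fst x (Poly_Mapping.single i0 p) ~= 0} \<in> sets (?R \<Otimes>\<^sub>M ?K)" by measurable
   show "AE \<rho> in ?R. AE y in ?K. fst (\<rho>, y) (Poly_Mapping.single i0 p) ~= 0"
    using AEr by eventually_elim simp
  qed
  then show "AE x in ?R \<Otimes>\<^sub>M ?K. (%n. ennreal (kr_integrand (rn n) (fst x) (vecK K (snd x)))) \<longlonglongrightarrow>
   ennreal ((?c * limD (fst x)) * ?i (snd x))"
  proof eventually_elim
   case (elim x)
   from kr_integrand_limit[of rn "fst x" "vecK K (snd x)", OF rn elim]
   show ?case by (intro tendsto_ennrealI) (simp add: mult_ac)
  qed
 qed measurable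
 also have "(\<integral>\<^sup>+x. ennreal ((?c * limD (fst x)) * ?i (snd x)) \<partial>(?R \<Otimes>\<^sub>M ?K)) = (\<integral>\<^sup>+\<rho>. ennreal (?c * limD \<rho>) \<partial>?R) * volK"
  by (rule prodint) (simp_all add: limD0)
 also have "(\<integral>\<^sup>+\<rho>. ennreal (?c * limD \<rho>) \<partial>?R) = ennreal ?c * (\<integral>\<^sup>+\<rho>. ennreal (limD \<rho>) \<partial>?R)"
  by (simp add: ennreal_mult limD0 nn_integral_cmult)
 finally show ?thesis by (simp only: mult_ac)
qed

end

section \<open>Probability of a small cap and the Kac-Rice identity\<close>

lemma norm_vecK_less_1: "norm (vecK K y) < 1 \<longleftrightarrow> (\<Sum>i\<in>K. (y i)\<^sup>2) < 1"
proof -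
 have "(norm (vecK K y))\<^sup>2 = (\<Sum>i\<in>UNIV. if i \<in> K then (y i)\<^sup>2 else 0)"
  unfolding power2_norm_eq_inner inner_vec_def by (rule sum.cong) (auto simp: power2_eq_square)
 also have "\<dots> = (\<Sum>i\<in>K. (y i)\<^sup>2)" by (simp add: sum.If_cases)
 finally have "(norm (vecK K y))\<^sup>2 = (\<Sum>i\<in>K. (y i)\<^sup>2)" .
 then show ?thesis using abs_square_less_1[of "norm (vecK K y)"] by simp
qed

definition absmom :: "nat => ennreal" where
 "absmom k = (\<integral>\<^sup>+t. ennreal (\<bar>t\<bar> ^ k) \<partial>gauss)"

lemma absmom_eq: "absmom k = ennreal (2 powr (real k / 2) * Gamma ((real k + 1) / 2) / sqrt pi)"
 unfolding absmom_def by (rule gauss_abs_moment)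

lemma absmom_pos: "0 < absmom k" and absmom_finite: "absmom k < \<infinity>"
proof -
 have "0 < 2 powr (real k / 2) * Gamma ((real k + 1) / 2) / sqrt pi"
  by (intro divide_pos_pos mult_pos_pos Gamma_real_pos) auto
 then show "0 < absmom k" "absmom k < \<infinity>" unfolding absmom_eq by simp_all
qed

context chart_weight
begin

definition cap_integrand :: "real => real => ('n => real) => real" where
 "cap_integrand r t y = (\<bar>t\<bar> ^ card K * (\<Prod>i\<in>K. std_normal_density (r * \<bar>t\<bar> * y i))) * indicator {y. norm y < 1} (vecK K y)"

lemma cap_integrand_measurable: "(%x. cap_integrand r (fst x) (snd x)) \<in> borel_measurable (gauss \<Otimes>\<^sub>M PiM K (%_. lborel))"
 unfolding cap_integrand_def by measurable

text \<open>Given the \<open>i0\<close>-coordinate t of the Gaussian centre, the cap condition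
  confines the other coordinates to a ball of radius r |t|. Scaling it to the unit ball yields the
  factor \<open>\<bar>t\<bar> ^ card K\<close>, the origin of the absolute moment.\<close>

lemma cap_prob_scaled:
 assumes r: "0 < r"
 shows "cap_prob r (insert i0 K) (axis i0 1) =
  ennreal (r ^ card K) * (\<integral>\<^sup>+x. ennreal (cap_integrand r (fst x) (snd x)) \<partial>(gauss \<Otimes>\<^sub>M PiM K (%_. lborel)))"
proof -
 let ?K = "PiM K (%_. lborel :: real measure)" and ?J = "insert i0 K"
 interpret K: sigma_finite_measure ?K by (rule lborelP.sigma_finite) simp
 interpret P: pair_sigma_finite gauss ?K by unfold_locales
 have cap: "cap r (vecK ?J g) (axis i0 1) \<longleftrightarrow> (\<Sum>i\<in>K. (g i)\<^sup>2) < r\<^sup>2 * (g i0)\<^sup>2" for g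
 proof -
  have "vecK ?J g \<bullet> vecK ?J g = (\<Sum>i\<in>UNIV. if i \<in> ?J then (g i)\<^sup>2 else 0)"
   unfolding inner_vec_def by (rule sum.cong) (auto simp: power2_eq_square)
  also have "\<dots> = (\<Sum>i\<in>?J. (g i)\<^sup>2)" by (rule sum.mono_neutral_cong_right) auto
  also have "\<dots> = (g i0)\<^sup>2 + (\<Sum>i\<in>K. (g i)\<^sup>2)" using i0 by simp
  finally show ?thesis by (simp add: cap_def inner_axis' algebra_simps)
 qed
 let ?ind = "%g. indicator {g. (\<Sum>i\<in>K. (g i)\<^sup>2) < r\<^sup>2 * (g i0)\<^sup>2} g :: ennreal"
 have "cap_prob r ?J (axis i0 1) = (\<integral>\<^sup>+g. ?ind g \<partial>PiM ?J (%_. gauss))"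
  by (simp add: cap_prob_def cap)
 also have "\<dots> = (\<integral>\<^sup>+t. (\<integral>\<^sup>+x. ?ind (x(i0 := t)) \<partial>PiM K (%_. gauss)) \<partial>gauss)"
 proof (rule product_sigma_finite.product_nn_integral_insert_rev[OF psf_gauss _ i0])
  note [measurable] = gauss_component_measurable
  show "?ind \<in> borel_measurable (PiM ?J (%_. gauss))" by measurable
 qed simp
 also have "\<dots> = (\<integral>\<^sup>+t. ennreal (r ^ card K) * (\<integral>\<^sup>+y. ennreal (cap_integrand r t y) \<partial>?K) \<partial>gauss)"
 proof (rule nn_integral_cong_AE)
  show "AE t in gauss. (\<integral>\<^sup>+x. ?ind (x(i0 := t)) \<partial>PiM K (%_. gauss)) = ennreal (r ^ card K) * (\<integral>\<^sup>+y. ennreal (cap_integrand r t y) \<partial>?K)"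
   using AE_gauss_nonzero
  proof eventually_elim
   case (elim t)
   let ?c = "r * \<bar>t\<bar>"
   have c: "?c ~= 0" "?c > 0" using r elim by auto
   have ind: "?ind (x(i0 := t)) = indicator {x. (\<Sum>i\<in>K. (x i)\<^sup>2) < r\<^sup>2 * t\<^sup>2} x" for x
   proof -
    have "(\<Sum>i\<in>K. ((x(i0 := t)) i)\<^sup>2) = (\<Sum>i\<in>K. (x i)\<^sup>2)" using i0 by (intro sum.cong) auto
    then show ?thesis by (simp add: indicator_def)
   qed
   let ?h = "%x. (\<Prod>i\<in>K. ennreal (std_normal_density (x i))) * indicator {x. (\<Sum>i\<in>K. (x i)\<^sup>2) < r\<^sup>2 * t\<^sup>2} x :: ennreal"
   have hm: "?h \<in> borel_measurable ?K" by measurable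
   have "(\<integral>\<^sup>+x. ?ind (x(i0 := t)) \<partial>PiM K (%_. gauss)) = (\<integral>\<^sup>+x. ?h x \<partial>?K)"
    unfolding ind by (rule nn_integral_PiM_gauss) (simp, measurable)
   also have "\<dots> = ennreal (\<bar>?c\<bar> ^ card K) * (\<integral>\<^sup>+y. ?h (\<lambda>i\<in>K. ?c * y i) \<partial>?K)"
    by (rule nn_integral_PiM_lborel_scale[OF _ hm c(1)]) simp
   also have "(\<integral>\<^sup>+y. ?h (\<lambda>i\<in>K. ?c * y i) \<partial>?K) =
    (\<integral>\<^sup>+y. ennreal ((\<Prod>i\<in>K. std_normal_density (r * \<bar>t\<bar> * y i)) * indicator {y. norm y < 1} (vecK K y)) \<partial>?K)"
   proof (rule nn_integral_cong)
    fix y :: "'n => real"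
    have "(\<Sum>i\<in>K. ((\<lambda>i\<in>K. ?c * y i) i)\<^sup>2) = (\<Sum>i\<in>K. (r\<^sup>2 * t\<^sup>2) * (y i)\<^sup>2)"
     by (intro sum.cong) (auto simp: power_mult_distrib)
    also have "\<dots> = (r\<^sup>2 * t\<^sup>2) * (\<Sum>i\<in>K. (y i)\<^sup>2)" by (simp add: sum_distrib_left)
    also have "\<dots> < r\<^sup>2 * t\<^sup>2 \<longleftrightarrow> (\<Sum>i\<in>K. (y i)\<^sup>2) < 1" using r elim by simp
    finally have "(\<Sum>i\<in>K. ((\<lambda>i\<in>K. ?c * y i) i)\<^sup>2) < r\<^sup>2 * t\<^sup>2 \<longleftrightarrow> norm (vecK K y) < 1"
     by (simp add: norm_vecK_less_1)
    moreover have "(\<Prod>i\<in>K. ennreal (std_normal_density ((\<lambda>i\<in>K. ?c * y i) i))) = ennreal (\<Prod>i\<in>K. std_normal_density (r * \<bar>t\<bar> * y i))"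
     by (subst prod_ennreal[symmetric]) (auto intro!: prod.cong)
    ultimately show "?h (\<lambda>i\<in>K. ?c * y i) = ennreal ((\<Prod>i\<in>K. std_normal_density (r * \<bar>t\<bar> * y i)) * indicator {y. norm y < 1} (vecK K y))"
     by (simp add: indicator_def)
   qed
   also have "ennreal (\<bar>?c\<bar> ^ card K) * \<dots> = ennreal (r ^ card K) * (ennreal (\<bar>t\<bar> ^ card K) * \<dots>)"
    using r by (simp add: power_mult_distrib ennreal_mult abs_mult mult.assoc)
   also have "ennreal (\<bar>t\<bar> ^ card K) * (\<integral>\<^sup>+y. ennreal ((\<Prod>i\<in>K. std_normal_density (r * \<bar>t\<bar> * y i)) * indicator {y. norm y < 1} (vecK K y)) \<partial>?K) =
    (\<integral>\<^sup>+y. ennreal (cap_integrand r t y) \<partial>?K)"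
    unfolding cap_integrand_def
    by (subst nn_integral_cmult[symmetric], measurable) (simp add: ennreal_mult[symmetric] prod_nonneg mult.assoc)
   finally show ?case .
  qed
 qed
 also have "\<dots> = ennreal (r ^ card K) * (\<integral>\<^sup>+t. (\<integral>\<^sup>+y. ennreal (cap_integrand r t y) \<partial>?K) \<partial>gauss)"
 proof -
  have [measurable]: "(%t. \<integral>\<^sup>+y. ennreal (cap_integrand r t y) \<partial>?K) \<in> borel_measurable gauss"
   using K.borel_measurable_nn_integral[of "%t y. ennreal (cap_integrand r t y)" gauss] cap_integrand_measurable
   by (simp add: split_beta')
  show ?thesis by (rule nn_integral_cmult) simp
 qed
 also have "(\<integral>\<^sup>+t. (\<integral>\<^sup>+y. ennreal (cap_integrand r t y) \<partial>?K) \<partial>gauss) =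
  (\<integral>\<^sup>+x. ennreal (cap_integrand r (fst x) (snd x)) \<partial>(gauss \<Otimes>\<^sub>M ?K))"
  using K.nn_integral_fst[of "%x. ennreal (cap_integrand r (fst x) (snd x))" gauss] cap_integrand_measurable by simp
 finally show ?thesis .
qed

lemma cap_limit:
 assumes rn: "rn \<longlonglongrightarrow> 0"
 shows "(%n. \<integral>\<^sup>+x. ennreal (cap_integrand (rn n) (fst x) (snd x)) \<partial>(gauss \<Otimes>\<^sub>M PiM K (%_. lborel)))
  \<longlonglongrightarrow> ennreal ((1 / sqrt (2 * pi)) ^ card K) * volK * absmom (card K)"
proof -
 let ?K = "PiM K (%_. lborel :: real measure)"
 let ?i = "%y. indicator {y. norm y < 1} (vecK K y) :: real"
 let ?c = "(1 / sqrt (2 * pi)) ^ card K"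
 interpret K: sigma_finite_measure ?K by (rule lborelP.sigma_finite) simp
 have iK: "(\<integral>\<^sup>+y. ennreal (?i y) \<partial>?K) = volK" unfolding volK_def by (simp add: ennreal_indicator)
 have prodint: "(\<integral>\<^sup>+x. ennreal ((a * \<bar>fst x\<bar> ^ card K) * ?i (snd x)) \<partial>(gauss \<Otimes>\<^sub>M ?K)) = ennreal a * (absmom (card K) * volK)"
  if a: "0 \<le> a" for a
 proof -
  have "(\<integral>\<^sup>+x. ennreal ((a * \<bar>fst x\<bar> ^ card K) * ?i (snd x)) \<partial>(gauss \<Otimes>\<^sub>M ?K)) =
   (\<integral>\<^sup>+t. (\<integral>\<^sup>+y. ennreal ((a * \<bar>t\<bar> ^ card K) * ?i y) \<partial>?K) \<partial>gauss)"
   by (subst K.nn_integral_fst[symmetric]) simp_all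
  also have "\<dots> = (\<integral>\<^sup>+t. ennreal a * (ennreal (\<bar>t\<bar> ^ card K) * volK) \<partial>gauss)"
   by (simp add: ennreal_mult a nn_integral_cmult iK mult.assoc)
  also have "\<dots> = ennreal a * (absmom (card K) * volK)"
   unfolding absmom_def by (simp add: nn_integral_cmult nn_integral_multc)
  finally show ?thesis .
 qed
 have "(%n. \<integral>\<^sup>+x. ennreal (cap_integrand (rn n) (fst x) (snd x)) \<partial>(gauss \<Otimes>\<^sub>M ?K)) \<longlonglongrightarrow>
  (\<integral>\<^sup>+x. ennreal ((?c * \<bar>fst x\<bar> ^ card K) * ?i (snd x)) \<partial>(gauss \<Otimes>\<^sub>M ?K))"
 proof (rule nn_integral_dominated_convergence[where w="%x. ennreal ((1 * \<bar>fst x\<bar> ^ card K) * ?i (snd x))"])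
  show "(%x. ennreal (cap_integrand (rn n) (fst x) (snd x))) \<in> borel_measurable (gauss \<Otimes>\<^sub>M ?K)" for n
   using cap_integrand_measurable by simp
  have "cap_integrand r t y \<le> (1 * \<bar>t\<bar> ^ card K) * ?i y" for r t y
  proof -
   have "(\<Prod>i\<in>K. std_normal_density (r * \<bar>t\<bar> * y i)) \<le> 1"
    by (rule prod_le_1) (simp add: std_normal_density_le_1)
   then have "\<bar>t\<bar> ^ card K * (\<Prod>i\<in>K. std_normal_density (r * \<bar>t\<bar> * y i)) \<le> \<bar>t\<bar> ^ card K * 1"
    by (intro mult_left_mono) auto
   then show ?thesis unfolding cap_integrand_def by (auto simp: indicator_def)
  qed
  then show "AE x in gauss \<Otimes>\<^sub>M ?K. ennreal (cap_integrand (rn n) (fst x) (snd x)) \<le> ennreal ((1 * \<bar>fst x\<bar> ^ card K) * ?i (snd x))" for n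
   by (intro AE_I2 ennreal_leI)
  show "(\<integral>\<^sup>+x. ennreal ((1 * \<bar>fst x\<bar> ^ card K) * ?i (snd x)) \<partial>(gauss \<Otimes>\<^sub>M ?K)) < \<infinity>"
   using volK_finite absmom_finite[of "card K"] by (subst prodint) (simp_all add: ennreal_mult_less_top)
  have "(%n. cap_integrand (rn n) t y) \<longlonglongrightarrow> (?c * \<bar>t\<bar> ^ card K) * ?i y" for t y
  proof -
   have "(%n. rn n * \<bar>t\<bar> * y i) \<longlonglongrightarrow> 0 * \<bar>t\<bar> * y i" for i by (intro tendsto_intros rn)
   then have "(%n. std_normal_density (rn n * \<bar>t\<bar> * y i)) \<longlonglongrightarrow> 1 / sqrt (2 * pi)" for i
    using isCont_tendsto_compose[of 0 std_normal_density "%n. rn n * \<bar>t\<bar> * y i"] continuous_std_normal_density[of UNIV]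
    by (simp add: continuous_on_eq_continuous_at std_normal_density_0)
   then have "(%n. cap_integrand (rn n) t y) \<longlonglongrightarrow> (\<bar>t\<bar> ^ card K * (\<Prod>i\<in>K. 1 / sqrt (2 * pi))) * ?i y"
    unfolding cap_integrand_def by (intro tendsto_mult tendsto_prod tendsto_const)
   then show ?thesis by (simp add: mult_ac)
  qed
  then show "AE x in gauss \<Otimes>\<^sub>M ?K. (%n. ennreal (cap_integrand (rn n) (fst x) (snd x))) \<longlonglongrightarrow> ennreal ((?c * \<bar>fst x\<bar> ^ card K) * ?i (snd x))"
   by (intro AE_I2 tendsto_ennrealI)
 qed measurable
 also have "(\<integral>\<^sup>+x. ennreal ((?c * \<bar>fst x\<bar> ^ card K) * ?i (snd x)) \<partial>(gauss \<Otimes>\<^sub>M ?K)) = ennreal ?c * (absmom (card K) * volK)"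
  by (rule prodint) simp
 finally show ?thesis by (simp only: mult_ac)
qed

lemma limD_cong:
 assumes "!!\<alpha>. \<alpha> \<in> R ==> \<rho> \<alpha> = \<rho>' \<alpha>" shows "limD \<rho> = limD \<rho>'"
proof -
 have "comb \<rho> (%_. 0) = comb \<rho>' (%_. 0)" using assms by (auto simp: comb_def fun_eq_iff)
 moreover have "jac p i0 \<rho> j k = jac p i0 \<rho>' j k" if "j \<in> K" "k \<in> K" for j k
 proof (cases "p \<ge> 2")
  case True
  then show ?thesis using assms single_rest[OF i0 p] qexp_rest[OF i0 that True] by (simp add: jac_def goe_def)
 next
  case False
  then have "p = 1" using p by simp
  then show ?thesis using assms single_rest[OF i0 p] by (simp add: jac_def)
 qed
 then have "matK K (jac p i0 \<rho>) = matK K (jac p i0 \<rho>')" by (auto simp: matK_def vec_eq_iff)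
 ultimately show ?thesis by (simp add: limD_def)
qed

text \<open>For each small radius the averaging identity equates the cap probability times the
  expected count with the expected count in one cap. Both contain \<open>r ^ card K\<close>, which
  is cancelled before the limit, and both limits contain the same Gaussian constant and ball volume,
  which are cancelled after it.\<close>

theorem kac_rice:
 assumes inv: "!!R \<xi> \<xi>'. rotJ (insert i0 K) R ==> (!!x. fld p \<xi>' x = fld p \<xi> (R x)) ==> G \<xi>' = G \<xi>"
 shows "absmom (card K) * (\<integral>\<^sup>+\<xi>. ennreal (G \<xi>) * num_elements (crit z (insert i0 K) p \<xi>) \<partial>PiM (exps p) (%_. gauss)) =
  2 * (\<integral>\<^sup>+\<xi>. ennreal (limD \<xi>) \<partial>PiM (exps p) (%_. gauss))"
proof -
 let ?X = "\<integral>\<^sup>+\<xi>. ennreal (G \<xi>) * num_elements (crit z (insert i0 K) p \<xi>) \<partial>PiM (exps p) (%_. gauss)"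
 let ?L = "\<integral>\<^sup>+\<rho>. ennreal (limD \<rho>) \<partial>PiM R (%_. gauss)"
 let ?c = "ennreal ((1 / sqrt (2 * pi)) ^ card K) * volK"
 define rn where "rn n = r1 / real (Suc n)" for n
 have rn: "0 < rn n" "rn n \<le> r1" for n using r1_pos by (auto simp: rn_def divide_simps)
 have rn0: "rn \<longlonglongrightarrow> 0" unfolding rn_def
  using tendsto_mult[OF tendsto_const[of r1] LIMSEQ_inverse_real_of_nat] by (simp add: divide_inverse)
 define a where "a n = (\<integral>\<^sup>+x. ennreal (cap_integrand (rn n) (fst x) (snd x)) \<partial>(gauss \<Otimes>\<^sub>M PiM K (%_. lborel)))" for n
 define b where "b n = (\<integral>\<^sup>+x. ennreal (kr_integrand (rn n) (fst x) (vecK K (snd x))) \<partial>(PiM R (%_. gauss) \<Otimes>\<^sub>M PiM K (%_. lborel)))" for n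
 have al: "a \<longlonglongrightarrow> ?c * absmom (card K)" unfolding a_def by (rule cap_limit[OF rn0])
 have bl: "b \<longlonglongrightarrow> ?c * ?L" unfolding b_def by (rule nu_limit[OF rn rn0])
 have "0 < (1 / sqrt (2 * pi)) ^ card K" by simp
 then have cpos: "?c ~= 0" "?c ~= \<top>"
  using volK_pos volK_finite by (auto simp: ennreal_mult_eq_top_iff)
 have l0: "?c * absmom (card K) ~= 0" "?c * absmom (card K) ~= \<top>"
  using cpos absmom_pos[of "card K"] absmom_finite[of "card K"] by (auto simp: ennreal_mult_eq_top_iff)
 have "\<forall>\<^sub>F n in sequentially. 0 < a n"
  using order_tendstoD(1)[OF al, of 0] l0(1) by (simp add: zero_less_iff_neq_zero)
 then have ev: "\<forall>\<^sub>F n in sequentially. a n * ?X = 2 * b n"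
 proof eventually_elim
  case (elim n)
  have rk: "0 < ennreal (rn n ^ card K)" "ennreal (rn n ^ card K) < \<top>" using rn(1)[of n] by auto
  have s: "cap_prob (rn n) (insert i0 K) (axis i0 1) = ennreal (rn n ^ card K) * a n"
   unfolding a_def by (rule cap_prob_scaled[OF rn(1)])
  have pos: "0 < cap_prob (rn n) (insert i0 K) (axis i0 1)" unfolding s using rk(1) elim by (simp add: ennreal_zero_less_mult_iff)
  have "ennreal (rn n ^ card K) * a n * ?X = nu (rn n)"
   unfolding s[symmetric] nu_def
   by (rule nn_integral_cap_average[OF _ pos]) (use inv Gm in auto)
  also have "\<dots> = ennreal (rn n ^ card K) * (2 * b n)"
   unfolding nu_eq[OF rn] b_def by (simp only: mult_ac)
  finally show ?case using rk rn(1)[of n] by (auto simp: mult.assoc ennreal_mult_cancel_left)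
 qed
 have "(%n. a n * ?X) \<longlonglongrightarrow> ?c * absmom (card K) * ?X"
  by (intro tendsto_mult_ennreal al tendsto_const) (use l0 in auto)
 moreover have "(%n. 2 * b n) \<longlonglongrightarrow> 2 * (?c * ?L)"
  by (intro ennreal_tendsto_cmult bl) simp
 then have "(%n. a n * ?X) \<longlonglongrightarrow> 2 * (?c * ?L)"
  by (rule Lim_transform_eventually) (use ev in eventually_elim, simp)
 ultimately have "?c * absmom (card K) * ?X = 2 * (?c * ?L)" by (rule LIMSEQ_unique)
 then have "?c * (absmom (card K) * ?X) = ?c * (2 * ?L)" by (simp only: mult_ac)
 then have "absmom (card K) * ?X = 2 * ?L" using cpos by (auto simp: ennreal_mult_cancel_left)
 \<comment> \<open>\<open>limD\<close> depends on the coordinates in \<open>R\<close> only, so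
   averaging over the gradient coordinates changes nothing and the integral extends to the full
   coefficient vector.\<close>
 also have "?L = (\<integral>\<^sup>+\<rho>. (\<integral>\<^sup>+c. ennreal (limD (comb \<rho> c)) \<partial>PiM K (%_. gauss)) \<partial>PiM R (%_. gauss))"
 proof (rule nn_integral_cong)
  fix \<rho>
  interpret Kp: prob_space "PiM K (%_. gauss)" by (rule prob_space_PiM) (rule prob_space_gauss)
  have "limD (comb \<rho> c) = limD \<rho>" for c by (rule limD_cong) (simp add: comb_rest)
  then show "ennreal (limD \<rho>) = (\<integral>\<^sup>+c. ennreal (limD (comb \<rho> c)) \<partial>PiM K (%_. gauss))"
   by (simp add: Kp.emeasure_space_1)
 qed
 also have "\<dots> = (\<integral>\<^sup>+\<xi>. ennreal (limD \<xi>) \<partial>PiM (exps p) (%_. gauss))"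
 proof (rule nn_integral_comb[symmetric])
  have "R \<subseteq> exps p" by (auto simp: rest_exps_def)
  then have m: "(%\<xi>. restrict \<xi> R) \<in> PiM (exps p) (%_. gauss) \<rightarrow>\<^sub>M PiM R (%_. gauss)"
   by (rule measurable_restrict_subset)
  have "limD (restrict \<xi> R) = limD \<xi>" for \<xi> by (rule limD_cong) simp
  then have "(%\<xi>. limD \<xi>) \<in> borel_measurable (PiM (exps p) (%_. gauss))"
   using measurable_compose[OF m limD_measurable] by simp
  then show "(%\<xi>. ennreal (limD \<xi>)) \<in> borel_measurable (PiM (exps p) (%_. lborel))"
   by (simp add: measurable_PiM_gauss_iff)
 qed
 finally show ?thesis .
qed

end

section \<open>Quadratic forms and eigenvectors\<close>

text \<open>A maximiser of the Rayleigh quotient on the unit sphere of \<open>S\<close> is an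
  eigenvector, and its orthogonal complement in \<open>S\<close> is invariant. The hypotheses on
  \<open>S\<close> stand inside the implication so that the induction on the dimension can change
  \<open>S\<close>.\<close>

lemma spectral_basis:
 fixes T :: "real^'n::finite => real^'n"
 assumes lin: "linear T"
 shows "subspace S ==> (!!x. x \<in> S ==> T x \<in> S) ==> (!!x y. x \<in> S ==> y \<in> S ==> T x \<bullet> y = x \<bullet> T y) ==> dim S = m ==>
  \<exists>B. B \<subseteq> S \<and> finite B \<and> card B = m \<and> pairwise orthogonal B \<and> (\<forall>b\<in>B. norm b = 1 \<and> (\<exists>\<mu>. T b = \<mu> *\<^sub>R b))"
proof (induction m arbitrary: S)
 case 0
 show ?case by (rule exI[of _ "{}"]) auto
next
 case (Suc m)
 have "compact (S \<inter> sphere 0 1)" using closed_subspace[OF Suc.prems(1)] by (simp add: closed_Int_compact)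
 moreover have "S \<inter> sphere 0 1 ~= {}"
 proof -
  have "\<not> S \<subseteq> {0}" using Suc.prems(4) dim_eq_0[of S] by auto
  then obtain x where "x \<in> S" "x ~= 0" by auto
  then have "(1 / norm x) *\<^sub>R x \<in> S \<inter> sphere 0 1" using subspace_scale[OF Suc.prems(1)] by auto
  then show ?thesis by blast
 qed
 moreover have "continuous_on (S \<inter> sphere 0 1) (%x. x \<bullet> T x)"
  using lin by (intro continuous_intros linear_continuous_on) (simp add: linear_conv_bounded_linear)
 ultimately obtain s where "s \<in> S \<inter> sphere 0 1" "\<forall>x\<in>S \<inter> sphere 0 1. x \<bullet> T x \<le> s \<bullet> T s"
  using continuous_attains_sup[of "S \<inter> sphere 0 1" "%x. x \<bullet> T x"] by blast
 then have s: "s \<in> S" "norm s = 1" and max: "!!x. x \<in> S ==> norm x = 1 ==> x \<bullet> T x \<le> s \<bullet> T s"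
  by simp_all
 define \<mu> where "\<mu> = s \<bullet> T s"
 have ss: "s \<bullet> s = 1" using s(2) by (simp add: norm_eq_1)
 have quad: "x \<bullet> T x \<le> \<mu> * (x \<bullet> x)" if x: "x \<in> S" for x
 proof (cases "x = 0")
  case False
  let ?y = "(1 / norm x) *\<^sub>R x"
  have "?y \<bullet> T ?y \<le> \<mu>" unfolding \<mu>_def
   by (rule max) (use False subspace_scale[OF Suc.prems(1) x] in auto)
  moreover have "?y \<bullet> T ?y = (x \<bullet> T x) / (norm x)\<^sup>2"
   by (simp add: linear_scale[OF lin] power2_eq_square)
  ultimately have "(x \<bullet> T x) / (norm x)\<^sup>2 \<le> \<mu>" by simp
  moreover have "(norm x)\<^sup>2 > 0" using False by simp
  ultimately show ?thesis by (simp only: pos_divide_le_eq power2_norm_eq_inner)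
 qed (simp add: linear_0[OF lin])
 have orth: "w \<bullet> T s = 0" if w: "w \<in> S" "w \<bullet> s = 0" for w
 proof -
  define a where "a = w \<bullet> T s"
  define q where "q = \<mu> * (w \<bullet> w) - w \<bullet> T w"
  have le: "2 * t * a \<le> t\<^sup>2 * q" for t
  proof -
   have "s + t *\<^sub>R w \<in> S" by (intro subspace_add subspace_scale Suc.prems(1) s w)
   from quad[OF this] have "(s + t *\<^sub>R w) \<bullet> T (s + t *\<^sub>R w) \<le> \<mu> * ((s + t *\<^sub>R w) \<bullet> (s + t *\<^sub>R w))" .
   moreover have "(s + t *\<^sub>R w) \<bullet> T (s + t *\<^sub>R w) = \<mu> + 2 * t * a + t\<^sup>2 * (w \<bullet> T w)"
    using Suc.prems(3)[OF s(1) w(1)]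
    by (simp add: linear_add[OF lin] linear_scale[OF lin] inner_simps \<mu>_def a_def power2_eq_square inner_commute algebra_simps)
   moreover have "(s + t *\<^sub>R w) \<bullet> (s + t *\<^sub>R w) = 1 + t\<^sup>2 * (w \<bullet> w)"
    using w(2) ss by (simp add: inner_simps inner_commute power2_eq_square)
   ultimately have "\<mu> + 2 * t * a + t\<^sup>2 * (w \<bullet> T w) \<le> \<mu> * (1 + t\<^sup>2 * (w \<bullet> w))" by metis
   then show ?thesis by (simp add: q_def algebra_simps)
  qed
  have "a = 0"
  proof (rule ccontr)
   assume "a ~= 0"
   \<comment> \<open>For this step the linear term \<open>2 * t * a\<close> exceeds
     \<open>t^2 * q\<close>, against maximality.\<close>
   define t where "t = a / (\<bar>q\<bar> + 1)"
   have p: "\<bar>q\<bar> + 1 > 0" by linarith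
   have "2 * t * a = 2 * a\<^sup>2 / (\<bar>q\<bar> + 1)" by (simp add: t_def power2_eq_square)
   moreover have "t\<^sup>2 * q \<le> t\<^sup>2 * (\<bar>q\<bar> + 1)" by (intro mult_left_mono) auto
   moreover have "t\<^sup>2 * (\<bar>q\<bar> + 1) = a\<^sup>2 / (\<bar>q\<bar> + 1)" using p by (simp add: t_def power2_eq_square)
   moreover have "a\<^sup>2 / (\<bar>q\<bar> + 1) > 0" using \<open>a ~= 0\<close> p by simp
   ultimately show False using le[of t] by simp
  qed
  then show ?thesis by (simp add: a_def)
 qed
 have eig: "T s = \<mu> *\<^sub>R s"
 proof -
  let ?w = "T s - \<mu> *\<^sub>R s"
  have w: "?w \<in> S" by (intro subspace_diff subspace_scale Suc.prems(1,2) s)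
  have ws: "?w \<bullet> s = 0" using ss by (simp add: inner_simps \<mu>_def inner_commute)
  have "?w \<bullet> ?w = ?w \<bullet> T s - \<mu> * (?w \<bullet> s)" by (simp add: inner_simps)
  then have "?w \<bullet> ?w = 0" using orth[OF w ws] ws by simp
  then show ?thesis by simp
 qed
 define S' where "S' = {x \<in> S. \<forall>y\<in>span {s}. orthogonal y x}"
 have s0: "s ~= 0" using s(2) by auto
 have S'_eq: "S' = {x \<in> S. x \<bullet> s = 0}"
  by (auto simp: S'_def orthogonal_def span_singleton inner_commute)
 have sub': "subspace S'" using Suc.prems(1) unfolding S'_eq subspace_def by (auto simp: inner_simps)
 have "span {s} \<subseteq> S" using s(1) Suc.prems(1) by (intro span_minimal) auto
 then have "dim S' + dim (span {s}) = dim S"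
  unfolding S'_def using Suc.prems(1) by (intro dim_subspace_orthogonal_to_vectors) auto
 moreover have "dim (span {s}) = 1" using s0 by (simp add: dim_span)
 ultimately have dimS': "dim S' = m" using Suc.prems(4) by simp
 have "\<exists>B. B \<subseteq> S' \<and> finite B \<and> card B = m \<and> pairwise orthogonal B \<and> (\<forall>b\<in>B. norm b = 1 \<and> (\<exists>\<mu>. T b = \<mu> *\<^sub>R b))"
 proof (rule Suc.IH[OF sub' _ _ dimS'])
  show "T x \<in> S'" if "x \<in> S'" for x
   using that Suc.prems(2)[of x] Suc.prems(3)[of x s] s(1) by (auto simp: S'_eq eig)
  show "T x \<bullet> y = x \<bullet> T y" if "x \<in> S'" "y \<in> S'" for x y using that Suc.prems(3) by (auto simp: S'_eq)
 qed
 then obtain B where B: "B \<subseteq> S'" "finite B" "card B = m" "pairwise orthogonal B" "\<forall>b\<in>B. norm b = 1 \<and> (\<exists>\<mu>. T b = \<mu> *\<^sub>R b)"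
  by blast
 have "s \<notin> B" using B(1) ss by (auto simp: S'_eq)
 then have "card (insert s B) = Suc m" using B by simp
 moreover have "pairwise orthogonal (insert s B)"
  using B(1,4) by (auto simp: pairwise_insert S'_eq orthogonal_def inner_commute)
 ultimately show ?case
  using B s eig by (intro exI[of _ "insert s B"]) (auto simp: S'_eq)
qed

text \<open>A repeated eigenvalue produces a circle of unit eigenvectors.\<close>

lemma card_unit_eigenvectors:
 fixes T :: "real^'n::finite => real^'n"
 assumes lin: "linear T" and S: "subspace S" "!!x. x \<in> S ==> T x \<in> S"
  and sa: "!!x y. x \<in> S ==> y \<in> S ==> T x \<bullet> y = x \<bullet> T y"
  and fin: "finite {s\<in>S. norm s = 1 \<and> (\<exists>\<mu>. T s = \<mu> *\<^sub>R s)}"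
 shows "card {s\<in>S. norm s = 1 \<and> (\<exists>\<mu>. T s = \<mu> *\<^sub>R s)} = 2 * dim S"
proof -
 let ?E = "{s\<in>S. norm s = 1 \<and> (\<exists>\<mu>. T s = \<mu> *\<^sub>R s)}"
 obtain B where B: "B \<subseteq> S" "finite B" "card B = dim S" "pairwise orthogonal B" "!!b. b \<in> B ==> norm b = 1" "\<forall>b\<in>B. \<exists>\<mu>. T b = \<mu> *\<^sub>R b"
  using spectral_basis[OF lin S sa refl] by blast
 obtain \<mu> where \<mu>: "!!b. b \<in> B ==> T b = \<mu> b *\<^sub>R b" using B(6) by metis
 have bb: "b \<bullet> b' = (if b = b' then 1 else 0)" if "b \<in> B" "b' \<in> B" for b b'
  using B(4,5) that by (auto simp: pairwise_def orthogonal_def norm_eq_1)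
 have "0 \<notin> B" using B(5) by force
 then have "independent B" using pairwise_orthogonal_independent[OF B(4)] by blast
 then have span: "S \<subseteq> span B" using card_ge_dim_independent[OF B(1)] B(3) by simp
 have zero: "x = 0" if "x \<in> S" "!!b. b \<in> B ==> x \<bullet> b = 0" for x
 proof -
  have "orthogonal x x" by (rule orthogonal_to_span[of x B]) (use that span in \<open>auto simp: orthogonal_def\<close>)
  then show ?thesis by (simp add: orthogonal_self)
 qed
 have distinct: "b = b'" if b: "b \<in> B" "b' \<in> B" "\<mu> b = \<mu> b'" for b b'
 proof (rule ccontr)
  assume ne: "b ~= b'"
  define c where "c t = (1 / sqrt (1 + t\<^sup>2)) *\<^sub>R (b + t *\<^sub>R b')" for t :: real
  have pos: "sqrt (1 + t\<^sup>2) > 0" for t :: real by (simp add: add_pos_nonneg)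
  have "c t \<in> ?E" for t
  proof -
   have "(b + t *\<^sub>R b') \<bullet> (b + t *\<^sub>R b') = 1 + t\<^sup>2"
    using bb b ne by (simp add: inner_simps power2_eq_square)
   then have "norm (b + t *\<^sub>R b') = sqrt (1 + t\<^sup>2)" by (simp add: norm_eq_sqrt_inner)
   then have "norm (c t) = 1" using pos[of t] by (simp add: c_def)
   moreover have "c t \<in> S" unfolding c_def using B(1) b by (intro subspace_scale subspace_add S(1)) auto
   moreover have "T (c t) = \<mu> b *\<^sub>R c t"
    using b by (simp add: c_def linear_scale[OF lin] linear_add[OF lin] \<mu> scaleR_add_right mult.commute)
   ultimately show ?thesis by blast
  qed
  moreover have "inj c"
  proof (rule injI)
   fix t u assume "c t = c u"
   then have "c t \<bullet> b = c u \<bullet> b" "c t \<bullet> b' = c u \<bullet> b'" by simp_all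
   then have "1 / sqrt (1 + t\<^sup>2) = 1 / sqrt (1 + u\<^sup>2)" "t / sqrt (1 + t\<^sup>2) = u / sqrt (1 + u\<^sup>2)"
    using bb b ne by (simp_all add: c_def inner_simps)
   then show "t = u" using pos[of t] by (metis less_irrefl nonzero_mult_div_cancel_right divide_inverse inverse_eq_divide mult_cancel_right zero_less_divide_1_iff)
  qed
  ultimately have "infinite ?E"
   using infinite_UNIV_char_0[where 'a=real] by (metis (no_types, lifting) finite_imageD finite_subset image_subsetI)
  then show False using fin by simp
 qed
 have "?E = B \<union> uminus ` B"
 proof (intro equalityI subsetI)
  fix s assume s: "s \<in> ?E"
  then obtain \<nu> where \<nu>: "T s = \<nu> *\<^sub>R s" by blast
  have sS: "s \<in> S" "norm s = 1" using s by auto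
  \<comment> \<open>A unit eigenvector \<open>s\<close> meets some basis vector \<open>b\<close>;
    distinctness of the eigenvalues makes it orthogonal to all others, so \<open>s\<close> is
    \<open>b\<close> or its negative.\<close>
  obtain b where b: "b \<in> B" "s \<bullet> b ~= 0" using zero[OF sS(1)] sS(2) by force
  have e: "\<nu> * (s \<bullet> b') = \<mu> b' * (s \<bullet> b')" if "b' \<in> B" for b'
   using sa[OF sS(1), of b'] B(1) that by (auto simp: \<nu> \<mu>[OF that])
  have "s - (s \<bullet> b) *\<^sub>R b = 0"
  proof (rule zero)
   show "s - (s \<bullet> b) *\<^sub>R b \<in> S" using B(1) b(1) by (intro subspace_diff subspace_scale S(1) sS) auto
   fix b' assume b': "b' \<in> B"
   show "(s - (s \<bullet> b) *\<^sub>R b) \<bullet> b' = 0"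
   proof (cases "b' = b")
    case True then show ?thesis using bb[OF b(1) b(1)] by (simp add: inner_simps)
   next
    case False
    then have "s \<bullet> b' = 0" using e[OF b'] e[OF b(1)] b(2) distinct[OF b' b(1)] by auto
    then show ?thesis using bb[OF b(1) b'] False by (auto simp: inner_simps)
   qed
  qed
  then have sb: "s = (s \<bullet> b) *\<^sub>R b" by simp
  then have "norm s = \<bar>s \<bullet> b\<bar> * norm b" by (metis norm_scaleR)
  then have "\<bar>s \<bullet> b\<bar> = 1" using sS B(5)[OF b(1)] by simp
  then have "s = b \<or> s = - b" using sb by (metis abs_1 abs_eq_iff scaleR_minus1_left scaleR_one)
  then show "s \<in> B \<union> uminus ` B" using b(1) by auto
 next
  fix s assume "s \<in> B \<union> uminus ` B"
  then obtain b where b: "b \<in> B" "s = b \<or> s = - b" by auto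
  then have "T s = \<mu> b *\<^sub>R s" using \<mu>[OF b(1)] linear_neg[OF lin] by auto
  then show "s \<in> ?E" using b B(1,5) subspace_neg[OF S(1)] by auto
 qed
 moreover have "B \<inter> uminus ` B = {}"
 proof (rule ccontr)
  assume "B \<inter> uminus ` B ~= {}"
  then obtain b b' where b: "b \<in> B" "b' \<in> B" "b = - b'" by auto
  then have "b \<bullet> b' = -1" using bb[OF b(2) b(2)] by simp
  then show False using bb[OF b(1,2)] by (simp split: if_splits)
 qed
 moreover have "card (uminus ` B) = card B" by (rule card_image) simp
 ultimately show ?thesis using B(2,3) by (simp add: card_Un_disjoint)
qed

text \<open>The symmetric matrix of the quadratic form \<open>sqrt 2 * fld 2 \<xi>\<close>. For
  standard Gaussian \<open>\<xi>\<close> it belongs to the Gaussian orthogonal ensemble: entries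
  independent up to symmetry, of variance 2 on the diagonal and 1 off it.\<close>

definition C2 :: "(('n \<Rightarrow>\<^sub>0 nat) => real) => 'n => 'n => real" where
 "C2 \<xi> j k = (if j = k then sqrt 2 else 1) * \<xi> (unit_exp j + unit_exp k)"

lemma C2_sym: "C2 \<xi> j k = C2 \<xi> k j"
 by (simp add: C2_def add.commute)

lemma unit_exp_exps2: "unit_exp j + unit_exp k \<in> (exps 2 :: ('n::finite \<Rightarrow>\<^sub>0 nat) set)"
 by (simp add: exps_def lookup_add sum.distrib)

lemma qexp_2: "qexp i0 2 j k = unit_exp j + unit_exp k"
 by (simp add: qexp_def)

lemma multinom_2: "multinom 2 (unit_exp j + unit_exp k :: 'n::finite \<Rightarrow>\<^sub>0 nat) = (if j = k then 1 else 2)"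
proof -
 have "(\<Prod>i\<in>UNIV. fact (Poly_Mapping.lookup (unit_exp j + unit_exp k) i) :: real) = (\<Prod>i\<in>UNIV. if i = j then (if j = k then 2 else 1) else 1)"
  by (rule prod.cong) (auto simp: lookup_add)
 then show ?thesis by (simp add: multinom_def)
qed

text \<open>Two applications of \<open>multinomial_step\<close> unfold the sum over exponents of
  degree 2 into a sum over ordered pairs of variables, which absorbs the factor 2 of the mixed
  terms.\<close>

lemma fld_2: "fld 2 \<xi> x = (\<Sum>j\<in>UNIV. \<Sum>k\<in>UNIV. C2 \<xi> j k * x $ j * x $ k) / sqrt 2"
proof -
 define F where "F \<beta> = \<xi> \<beta> * mon \<beta> x / sqrt (multinom 2 \<beta>)" for \<beta>
 have "fld 2 \<xi> x = (\<Sum>\<beta>\<in>exps 2. multinom 2 \<beta> * F \<beta>)"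
  unfolding fld_def F_def
 proof (rule sum.cong[OF refl])
  fix \<beta> :: "'a \<Rightarrow>\<^sub>0 nat"
  have "multinom 2 \<beta> = sqrt (multinom 2 \<beta>) * sqrt (multinom 2 \<beta>)" using multinom_pos[of 2 \<beta>] by simp
  moreover have "sqrt (multinom 2 \<beta>) ~= 0" using multinom_pos[of 2 \<beta>] by simp
  ultimately show "\<xi> \<beta> * (sqrt (multinom 2 \<beta>) * mon \<beta> x) = multinom 2 \<beta> * (\<xi> \<beta> * mon \<beta> x / sqrt (multinom 2 \<beta>))"
   by (metis (no_types, lifting) mult.assoc mult.commute nonzero_mult_div_cancel_left times_divide_eq_right)
 qed
 also have "\<dots> = (\<Sum>i\<in>UNIV. \<Sum>\<alpha>\<in>exps (Suc 0). multinom (Suc 0) \<alpha> * F (\<alpha> + unit_exp i))"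
  using multinomial_step[of "Suc 0" F] by (simp add: numeral_2_eq_2)
 also have "\<dots> = (\<Sum>i\<in>UNIV. \<Sum>j\<in>UNIV. F (unit_exp j + unit_exp i))"
 proof (rule sum.cong[OF refl])
  fix i :: 'a
  have "(\<Sum>\<alpha>\<in>exps (Suc 0). multinom (Suc 0) \<alpha> * F (\<alpha> + unit_exp i)) = (\<Sum>j\<in>UNIV. \<Sum>\<alpha>\<in>exps 0. multinom 0 \<alpha> * F ((\<alpha> + unit_exp j) + unit_exp i))"
   by (rule multinomial_step[symmetric])
  then show "(\<Sum>\<alpha>\<in>exps (Suc 0). multinom (Suc 0) \<alpha> * F (\<alpha> + unit_exp i)) = (\<Sum>j\<in>UNIV. F (unit_exp j + unit_exp i))"
   by (simp add: exps_0 multinom_def)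
 qed
 also have "\<dots> = (\<Sum>j\<in>UNIV. \<Sum>k\<in>UNIV. C2 \<xi> j k * x $ j * x $ k / sqrt 2)"
 proof (intro sum.cong refl)
  fix i j :: 'a
  show "F (unit_exp j + unit_exp i) = C2 \<xi> i j * x $ i * x $ j / sqrt 2"
   unfolding F_def C2_def multinom_2 mon_add mon_unit by (auto simp: add.commute)
 qed
 finally show ?thesis by (simp add: sum_divide_distrib)
qed

definition TJ :: "'n set => (('n::finite \<Rightarrow>\<^sub>0 nat) => real) => real^'n => real^'n" where
 "TJ J \<xi> x = (\<chi> i. if i \<in> J then \<Sum>k\<in>UNIV. C2 \<xi> i k * x $ k else 0)"

lemma dfld_2: "dfld i 2 \<xi> x = sqrt 2 * (\<Sum>k\<in>UNIV. C2 \<xi> i k * x $ k)"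
proof -
 have 1: "(fld 2 \<xi> has_derivative (%w. \<Sum>i\<in>UNIV. dfld i 2 \<xi> x * w $ i)) (at x)" by (rule fld_has_derivative)
 have 2: "(fld 2 \<xi> has_derivative (%w. (\<Sum>j\<in>UNIV. \<Sum>k\<in>UNIV. C2 \<xi> j k * (x $ j * w $ k + w $ j * x $ k)) / sqrt 2)) (at x)"
  unfolding fld_2[abs_def] divide_inverse
  by (auto intro!: derivative_eq_intros bounded_linear_imp_has_derivative bounded_linear_vec_nth sum.cong simp: fun_eq_iff algebra_simps)
 have "(\<Sum>j\<in>UNIV. dfld j 2 \<xi> x * (axis i 1 :: real^'a) $ j) = (\<Sum>j\<in>UNIV. \<Sum>k\<in>UNIV. C2 \<xi> j k * (x $ j * (axis i 1 :: real^'a) $ k + (axis i 1 :: real^'a) $ j * x $ k)) / sqrt 2"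
  using has_derivative_unique[OF 1 2] by meson
 moreover have "(\<Sum>j\<in>UNIV. dfld j 2 \<xi> x * (axis i 1 :: real^'a) $ j) = dfld i 2 \<xi> x"
  by (simp add: axis_def if_distrib[of "%c. _ * c"] cong: if_cong)
 moreover have "(\<Sum>j\<in>UNIV. \<Sum>k\<in>UNIV. C2 \<xi> j k * (x $ j * (axis i 1 :: real^'a) $ k + (axis i 1 :: real^'a) $ j * x $ k)) = 2 * (\<Sum>k\<in>UNIV. C2 \<xi> i k * x $ k)"
 proof -
  have "(\<Sum>k\<in>UNIV. C2 \<xi> j k * (x $ j * (axis i 1 :: real^'a) $ k)) = C2 \<xi> j i * x $ j" for j
   by (simp add: axis_def if_distrib[of "%c. _ * c"] cong: if_cong)
  moreover have "(\<Sum>j\<in>UNIV. \<Sum>k\<in>UNIV. C2 \<xi> j k * ((axis i 1 :: real^'a) $ j * x $ k)) = (\<Sum>k\<in>UNIV. C2 \<xi> i k * x $ k)"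
   by (subst sum.swap) (simp add: axis_def if_distrib[of "%c. c * _"] if_distrib[of "%c. _ * c"] cong: if_cong)
  ultimately show ?thesis by (simp add: distrib_left sum.distrib C2_sym[of \<xi> _ i])
 qed
 moreover have "2 * y / sqrt 2 = sqrt 2 * y" for y :: real
  by (metis mult.commute mult.left_commute real_div_sqrt times_divide_eq_left zero_le_numeral)
 ultimately show ?thesis by simp
qed

text \<open>At a unit vector s the multiplier is the Rayleigh quotient of s, so the critical
  equations on \<open>J\<close> express that s is an eigenvector of the matrix restricted to
  \<open>J\<close>.\<close>

lemma crit_2_eq: "crit False J 2 \<xi> = {s \<in> coord_space J. norm s = 1 \<and> (\<exists>\<mu>. TJ J \<xi> s = \<mu> *\<^sub>R s)}"
proof -
 have "crit_eq J 2 \<xi> s \<longleftrightarrow> (\<exists>\<mu>. TJ J \<xi> s = \<mu> *\<^sub>R s)" if s: "s \<in> coord_space J" "norm s = 1" for s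
 proof -
  have ss: "s \<bullet> s = 1" using s(2) by (simp add: norm_eq_1)
  have f: "sqrt 2 * fld 2 \<xi> s = TJ J \<xi> s \<bullet> s"
  proof -
   have "sqrt 2 * fld 2 \<xi> s = (\<Sum>j\<in>UNIV. (\<Sum>k\<in>UNIV. C2 \<xi> j k * s $ k) * s $ j)"
   proof -
    have "sqrt 2 * fld 2 \<xi> s = (\<Sum>j\<in>UNIV. \<Sum>k\<in>UNIV. C2 \<xi> j k * s $ j * s $ k)" unfolding fld_2 by simp
    also have "\<dots> = (\<Sum>j\<in>UNIV. (\<Sum>k\<in>UNIV. C2 \<xi> j k * s $ k) * s $ j)"
     unfolding sum_distrib_right by (intro sum.cong refl) (simp only: mult_ac)
    finally show ?thesis .
   qed
   also have "\<dots> = (\<Sum>j\<in>UNIV. TJ J \<xi> s $ j * s $ j)"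
    using s(1) by (intro sum.cong) (auto simp: TJ_def coord_space_def)
   finally show ?thesis by (simp add: inner_vec_def)
  qed
  have c: "crit_eq J 2 \<xi> s \<longleftrightarrow> (\<forall>i\<in>J. TJ J \<xi> s $ i = (TJ J \<xi> s \<bullet> s) * s $ i)"
  proof -
   have "(sqrt 2 * y = 2 * fld 2 \<xi> s * u) \<longleftrightarrow> y = (sqrt 2 * fld 2 \<xi> s) * u" for y u
   proof -
    have "2 * fld 2 \<xi> s * u = sqrt 2 * ((sqrt 2 * fld 2 \<xi> s) * u)" by simp
    then show ?thesis by (metis mult_cancel_left real_sqrt_eq_zero_cancel_iff zero_neq_numeral)
   qed
   then show ?thesis unfolding crit_eq_def ss dfld_2 f[symmetric] by (auto simp: TJ_def)
  qed
  show ?thesis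
  proof
   assume "crit_eq J 2 \<xi> s"
   then have "TJ J \<xi> s = (TJ J \<xi> s \<bullet> s) *\<^sub>R s"
    unfolding c using s(1) by (auto simp: vec_eq_iff coord_space_def TJ_def)
   then show "\<exists>\<mu>. TJ J \<xi> s = \<mu> *\<^sub>R s" by blast
  next
   assume "\<exists>\<mu>. TJ J \<xi> s = \<mu> *\<^sub>R s"
   then obtain \<mu> where \<mu>: "TJ J \<xi> s = \<mu> *\<^sub>R s" by blast
   then show "crit_eq J 2 \<xi> s" unfolding c using ss by simp
  qed
 qed
 then show ?thesis unfolding crit_def by auto
qed

lemma subspace_coord_space: "subspace (coord_space J)"
 by (auto simp: subspace_def coord_space_def)

lemma dim_coord_space: "dim (coord_space (J :: 'n::finite set)) = card J"
proof -
 let ?B = "(%i. axis i (1::real)) ` J"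
 have ind: "independent ?B"
  by (rule independent_mono[OF independent_Basis]) (auto simp: Basis_vec_def)
 have sp: "span ?B = coord_space J"
 proof
  show "span ?B \<subseteq> coord_space J"
   by (rule span_minimal[OF _ subspace_coord_space]) (auto simp: coord_space_def axis_def)
  show "coord_space J \<subseteq> span ?B"
  proof
   fix x :: "real^'n" assume x: "x \<in> coord_space J"
   have "x = (\<Sum>i\<in>J. x $ i *\<^sub>R axis i 1)"
    using x by (auto simp: vec_eq_iff coord_space_def axis_def if_distrib[of "%c. _ * c"] cong: if_cong)
   moreover have "(\<Sum>i\<in>J. x $ i *\<^sub>R axis i 1) \<in> span ?B"
    by (intro span_sum span_scale span_base) auto
   ultimately show "x \<in> span ?B" by simp
  qed
 qed
 have "dim (coord_space J) = card ?B" using sp ind by (metis dim_eq_card_independent dim_span)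
 also have "\<dots> = card J" by (rule card_image) (auto simp: inj_on_def axis_eq_axis)
 finally show ?thesis .
qed

text \<open>Finiteness forces simple eigenvalues, and each of them has exactly two unit
  eigenvectors.\<close>

lemma num_crit_2:
 assumes "num_elements (crit False J 2 \<xi>) ~= \<top>"
 shows "num_elements (crit False J 2 \<xi>) = of_nat (2 * card J)"
proof -
 have fin: "finite (crit False J 2 \<xi>)"
  using assms by (cases "finite (crit False J 2 \<xi>)") (auto simp: num_elements_def)
 have lin: "linear (TJ J \<xi>)"
  by (rule linearI) (auto simp: TJ_def vec_eq_iff algebra_simps sum.distrib sum_distrib_left)
 have "card (crit False J 2 \<xi>) = 2 * dim (coord_space J)"
  unfolding crit_2_eq
 proof (rule card_unit_eigenvectors[OF lin subspace_coord_space])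
  show "TJ J \<xi> x \<in> coord_space J" for x by (simp add: TJ_def coord_space_def)
  show "TJ J \<xi> x \<bullet> y = x \<bullet> TJ J \<xi> y" if x: "x \<in> coord_space J" and y: "y \<in> coord_space J" for x y
  proof -
   have "TJ J \<xi> x \<bullet> y = (\<Sum>i\<in>UNIV. \<Sum>k\<in>UNIV. C2 \<xi> i k * x $ k * y $ i)"
    unfolding inner_vec_def using y by (intro sum.cong) (auto simp: TJ_def coord_space_def sum_distrib_right)
   also have "\<dots> = (\<Sum>k\<in>UNIV. \<Sum>i\<in>UNIV. C2 \<xi> k i * x $ k * y $ i)"
    by (subst sum.swap) (simp add: C2_sym)
   also have "\<dots> = x \<bullet> TJ J \<xi> y"
    unfolding inner_vec_def using x by (intro sum.cong) (auto simp: TJ_def coord_space_def sum_distrib_left mult_ac)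
   finally show ?thesis .
  qed
  show "finite {s \<in> coord_space J. norm s = 1 \<and> (\<exists>\<mu>. TJ J \<xi> s = \<mu> *\<^sub>R s)}" using fin unfolding crit_2_eq .
 qed
 then show ?thesis using fin by (simp add: num_elements_def dim_coord_space)
qed

section \<open>Weights made of characteristic polynomials\<close>

definition chr :: "('n => 'n => real) => real => real => 'n => 'n => real" where
 "chr c a b j k = (if j = k then a else 0) - b * c j k"

text \<open>A product over a list, because each step of the recursion contributes one more factor,
  whose first parameter is a new Gaussian variable. Pairs (a, b) cover both the factor of the
  theorem, with b = sqrt (p - 1), and the factors |det(a - C)| of the recursion.\<close>

definition Gdet :: "'n set => (real \<times> real) list => (('n::finite \<Rightarrow>\<^sub>0 nat) => real) => real" where
 "Gdet J L \<xi> = prod_list (map (%(a, b). \<bar>det (matK J (chr (C2 \<xi>) a b))\<bar>) L)"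

lemma Gdet_Nil: "Gdet J [] \<xi> = 1"
 and Gdet_Cons: "Gdet J ((a, b) # L) \<xi> = \<bar>det (matK J (chr (C2 \<xi>) a b))\<bar> * Gdet J L \<xi>"
 by (simp_all add: Gdet_def)

lemma Gdet_nonneg: "0 \<le> Gdet J L \<xi>"
 by (induction L) (auto simp: Gdet_Nil Gdet_Cons split: prod.splits)

lemma Gdet_measurable_gen:
 assumes "!!j k. (%x. \<Xi> x (unit_exp j + unit_exp k)) \<in> borel_measurable M"
 shows "(%x. Gdet J L (\<Xi> x)) \<in> borel_measurable M"
proof (induction L)
 case (Cons ab L)
 obtain a b where ab: "ab = (a, b)" by force
 have "(%x. det (matK J (chr (C2 (\<Xi> x)) a b))) \<in> borel_measurable M"
  by (rule det_matK_measurable) (use assms in \<open>simp add: chr_def C2_def\<close>)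
 then show ?case using Cons unfolding ab Gdet_Cons by measurable
qed (simp add: Gdet_Nil)

lemma Gdet_measurable: "Gdet J L \<in> borel_measurable (PiM (exps 2) (%_. lborel))"
 by (rule Gdet_measurable_gen[of "%x. x", simplified])
   (use measurable_component_singleton[OF unit_exp_exps2, where M = "%_. lborel :: real measure"] in simp)

lemma Gdet_bound: "\<exists>C d. 0 \<le> C \<and> (\<forall>\<xi>. Gdet (J :: 'n::finite set) L \<xi> \<le> C * pbd (exps 2) \<xi> ^ d)"
proof (induction L)
 case Nil
 show ?case by (intro exI[of _ 1] exI[of _ 0]) (simp add: Gdet_Nil)
next
 case (Cons ab L)
 obtain a b where ab: "ab = (a, b)" by force
 obtain C d where C: "0 \<le> C" "!!\<xi>. Gdet J L \<xi> \<le> C * pbd (exps 2) \<xi> ^ d" using Cons by blast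
 define B where "B = 1 + \<bar>a\<bar> + 2 * \<bar>b\<bar>"
 let ?n = "CARD('n)"
 have "Gdet J ((a, b) # L) \<xi> \<le> (fact ?n * B ^ ?n * C) * pbd (exps 2) \<xi> ^ (?n + d)" for \<xi> :: "('n \<Rightarrow>\<^sub>0 nat) => real"
 proof -
  let ?P = "pbd (exps 2) \<xi>"
  have P: "1 \<le> ?P" by (rule pbd_ge_1)
  have e: "\<bar>\<xi> (unit_exp j + unit_exp k)\<bar> \<le> ?P" for j k
  proof -
   have "\<bar>\<xi> (unit_exp j + unit_exp k)\<bar> \<le> (\<Sum>\<alpha>\<in>exps 2. \<bar>\<xi> \<alpha>\<bar>)"
    by (rule member_le_sum[OF unit_exp_exps2]) auto
   also have "\<dots> \<le> ?P" using pbd_sum[of "exps 2" \<xi>] by simp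
   finally show ?thesis .
  qed
  have s2: "sqrt 2 \<le> (2::real)" by (rule real_le_lsqrt) auto
  have "\<bar>chr (C2 \<xi>) a b j k\<bar> \<le> B * ?P" for j k
  proof -
   have "\<bar>C2 \<xi> j k\<bar> \<le> 2 * ?P"
    unfolding C2_def abs_mult using e[of j k] s2 P by (intro mult_mono) auto
   then have "\<bar>b * C2 \<xi> j k\<bar> \<le> \<bar>b\<bar> * (2 * ?P)" by (simp add: abs_mult mult_left_mono)
   moreover have "\<bar>a\<bar> \<le> \<bar>a\<bar> * ?P" using P by (simp add: mult_le_cancel_left1)
   ultimately have "\<bar>chr (C2 \<xi>) a b j k\<bar> \<le> \<bar>a\<bar> * ?P + \<bar>b\<bar> * (2 * ?P)"
   proof -
    have "\<bar>chr (C2 \<xi>) a b j k\<bar> \<le> \<bar>a\<bar> + \<bar>b * C2 \<xi> j k\<bar>" by (auto simp: chr_def)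
    then show ?thesis if "\<bar>b * C2 \<xi> j k\<bar> \<le> \<bar>b\<bar> * (2 * ?P)" "\<bar>a\<bar> \<le> \<bar>a\<bar> * ?P" using that by linarith
   qed
   also have "\<dots> \<le> B * ?P" using P by (simp add: B_def algebra_simps)
   finally show ?thesis .
  qed
  moreover have "1 * 1 \<le> B * ?P" unfolding B_def using P by (intro mult_mono) auto
  ultimately have "\<bar>det (matK J (chr (C2 \<xi>) a b))\<bar> \<le> fact ?n * (B * ?P) ^ ?n"
   by (intro det_matK_bound) auto
  then have "Gdet J ((a, b) # L) \<xi> \<le> (fact ?n * (B * ?P) ^ ?n) * (C * ?P ^ d)"
   unfolding Gdet_Cons using C(2)[of \<xi>] Gdet_nonneg[of J L \<xi>] by (intro mult_mono) (auto simp: B_def)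
  then show ?thesis by (simp add: power_mult_distrib power_add mult_ac)
 qed
 then show ?case unfolding ab using C(1)
  by (intro exI[of _ "fact ?n * B ^ ?n * C"] exI[of _ "?n + d"]) (auto simp: B_def)
qed

lemma Gdet_tendsto:
 fixes \<Xi> :: "nat => ('n::finite \<Rightarrow>\<^sub>0 nat) => real"
 assumes "!!\<alpha>. \<alpha> \<in> exps 2 ==> (%n. \<Xi> n \<alpha>) \<longlonglongrightarrow> \<xi> \<alpha>"
 shows "(%n. Gdet J L (\<Xi> n)) \<longlonglongrightarrow> Gdet J L \<xi>"
proof (induction L)
 case (Cons ab L)
 obtain a b where ab: "ab = (a, b)" by force
 have "(%n. det (matK J (chr (C2 (\<Xi> n)) a b))) \<longlonglongrightarrow> det (matK J (chr (C2 \<xi>) a b))"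
  unfolding chr_def C2_def
  by (intro det_matK_tendsto tendsto_diff tendsto_mult tendsto_const assms unit_exp_exps2)
 then show ?case unfolding ab Gdet_Cons by (intro tendsto_mult tendsto_rabs Cons)
qed (simp add: Gdet_Nil)

definition projJ :: "'n set => real^'n::finite => real^'n" where
 "projJ J x = (\<chi> i. if i \<in> J then x $ i else 0)"

text \<open>Polarisation: the bilinear form on \<open>J\<close> is recovered from values of the
  polynomial, whose behaviour under rotations is what is given.\<close>

lemma C2_form: "(\<Sum>i\<in>J. \<Sum>j\<in>J. C2 \<xi> i j * x $ i * y $ j) =
 (fld 2 \<xi> (projJ J x + projJ J y) - fld 2 \<xi> (projJ J x) - fld 2 \<xi> (projJ J y)) / sqrt 2"
proof -
 define \<beta> where "\<beta> u v = (\<Sum>i\<in>UNIV. \<Sum>j\<in>UNIV. C2 \<xi> i j * u $ i * v $ j)" for u v :: "real^'a"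
 have f: "fld 2 \<xi> u = \<beta> u u / sqrt 2" for u by (simp add: fld_2 \<beta>_def)
 have add: "\<beta> (u + v) (u + v) = \<beta> u u + \<beta> u v + (\<beta> v u + \<beta> v v)" for u v
  by (simp add: \<beta>_def algebra_simps sum.distrib)
 have sym: "\<beta> u v = \<beta> v u" for u v
  unfolding \<beta>_def by (subst sum.swap) (simp add: C2_sym mult_ac)
 have J: "\<beta> (projJ J x) (projJ J y) = (\<Sum>i\<in>J. \<Sum>j\<in>J. C2 \<xi> i j * x $ i * y $ j)"
 proof -
  have "(\<Sum>j\<in>UNIV. C2 \<xi> i j * projJ J x $ i * projJ J y $ j) = (\<Sum>j\<in>J. C2 \<xi> i j * projJ J x $ i * y $ j)" for i
   by (rule sum.mono_neutral_cong_right) (auto simp: projJ_def)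
  then have "\<beta> (projJ J x) (projJ J y) = (\<Sum>i\<in>UNIV. \<Sum>j\<in>J. C2 \<xi> i j * projJ J x $ i * y $ j)" by (simp add: \<beta>_def)
  also have "\<dots> = (\<Sum>i\<in>J. \<Sum>j\<in>J. C2 \<xi> i j * x $ i * y $ j)"
   by (rule sum.mono_neutral_cong_right) (auto simp: projJ_def)
  finally show ?thesis .
 qed
 have "fld 2 \<xi> (projJ J x + projJ J y) - fld 2 \<xi> (projJ J x) - fld 2 \<xi> (projJ J y) = 2 * \<beta> (projJ J x) (projJ J y) / sqrt 2"
  unfolding f add sym[of "projJ J y" "projJ J x"] by (simp add: add_divide_distrib)
 then have "(fld 2 \<xi> (projJ J x + projJ J y) - fld 2 \<xi> (projJ J x) - fld 2 \<xi> (projJ J y)) / sqrt 2 = \<beta> (projJ J x) (projJ J y)"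
  by simp
 then show ?thesis unfolding J by simp
qed

text \<open>The matrix padded with the identity outside \<open>J\<close> defines a bilinear form
  that can be written through inner products, the projection to \<open>J\<close> and values of
  \<open>fld 2\<close>. All of these are compatible with \<open>R\<close>, so rotating conjugates
  the matrix by an orthogonal one and keeps the determinant.\<close>

lemma det_chr_rotate:
 fixes R :: "real^'n::finite => real^'n"
 assumes R: "rotJ J R" and f: "!!x. fld 2 \<xi>' x = fld 2 \<xi> (R x)"
 shows "det (matK J (chr (C2 \<xi>') a b)) = det (matK J (chr (C2 \<xi>) a b))"
proof -
 have o: "orthogonal_transformation R" using R by (simp add: rotJ_def)
 have lin: "linear R" using o by (rule orthogonal_transformation_linear)
 have inn: "R x \<bullet> R y = x \<bullet> y" for x y using o by (simp add: orthogonal_transformation_def)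
 \<comment> \<open>A vector supported outside \<open>J\<close> keeps those coordinates under
   \<open>R\<close>; as its norm is preserved too, it is fixed. Hence \<open>R\<close> commutes with
   the projection.\<close>
 have proj: "projJ J (R x) = R (projJ J x)" for x
 proof -
  have "R (x - projJ J x) = x - projJ J x"
  proof -
   let ?u = "x - projJ J x"
   have 1: "R ?u $ i = ?u $ i" if "i \<notin> J" for i using R that by (simp add: rotJ_def)
   have "R ?u \<bullet> ?u = (\<Sum>i\<in>UNIV. ?u $ i * ?u $ i)"
    unfolding inner_vec_def
   proof (rule sum.cong[OF refl])
    fix i show "R ?u $ i \<bullet> ?u $ i = ?u $ i * ?u $ i" using 1[of i] by (cases "i \<in> J") (auto simp: projJ_def)
   qed
   then have "R ?u \<bullet> ?u = ?u \<bullet> ?u" by (simp add: inner_vec_def)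
   then have "(R ?u - ?u) \<bullet> (R ?u - ?u) = 0" using inn[of ?u ?u] by (simp add: inner_diff inner_commute)
   then show ?thesis by simp
  qed
  moreover have "R x = R (projJ J x) + R (x - projJ J x)" by (simp add: linear_diff[OF lin])
  ultimately have e: "R x = R (projJ J x) + (x - projJ J x)" by simp
  have "R (projJ J x) $ i = 0" if "i \<notin> J" for i using R that by (simp add: rotJ_def projJ_def)
  then show ?thesis using arg_cong[OF e, of "%v. projJ J v"] by (auto simp: vec_eq_iff projJ_def)
 qed
 define \<beta> where "\<beta> \<xi> x y = (\<Sum>i\<in>UNIV. \<Sum>j\<in>UNIV. x $ i * matK J (chr (C2 \<xi>) a b) $ i $ j * y $ j)" for \<xi> and x y :: "real^'n"
 have \<beta>: "\<beta> \<xi> x y = (x \<bullet> y - projJ J x \<bullet> projJ J y) + a * (projJ J x \<bullet> projJ J y) -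
  b * ((fld 2 \<xi> (projJ J x + projJ J y) - fld 2 \<xi> (projJ J x) - fld 2 \<xi> (projJ J y)) / sqrt 2)" for \<xi> x y
 proof -
  have "(\<Sum>j\<in>UNIV. x $ i * matK J (chr (C2 \<xi>) a b) $ i $ j * y $ j) =
   (if i \<in> J then a * (x $ i * y $ i) - b * (\<Sum>j\<in>J. C2 \<xi> i j * x $ i * y $ j) else x $ i * y $ i)" for i
  proof (cases "i \<in> J")
   case True
   have "(\<Sum>j\<in>UNIV. x $ i * matK J (chr (C2 \<xi>) a b) $ i $ j * y $ j) = (\<Sum>j\<in>J. x $ i * chr (C2 \<xi>) a b i j * y $ j)"
    using True by (intro sum.mono_neutral_cong_right) (auto simp: matK_def)
   also have "\<dots> = (\<Sum>j\<in>J. (if i = j then a * (x $ i * y $ j) else 0) - b * (C2 \<xi> i j * x $ i * y $ j))"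
    by (rule sum.cong) (auto simp: chr_def algebra_simps)
   finally show ?thesis using True by (simp add: sum_subtractf sum_distrib_left)
  next
   case False
   then have "(\<Sum>j\<in>UNIV. x $ i * matK J (chr (C2 \<xi>) a b) $ i $ j * y $ j) = (\<Sum>j\<in>UNIV. if i = j then x $ i * y $ j else 0)"
    by (intro sum.cong) (auto simp: matK_def)
   then show ?thesis using False by simp
  qed
  then have "\<beta> \<xi> x y = (\<Sum>i\<in>UNIV. if i \<in> J then a * (x $ i * y $ i) - b * (\<Sum>j\<in>J. C2 \<xi> i j * x $ i * y $ j) else x $ i * y $ i)"
   by (simp add: \<beta>_def)
  also have "\<dots> = (\<Sum>i\<in>J. a * (x $ i * y $ i) - b * (\<Sum>j\<in>J. C2 \<xi> i j * x $ i * y $ j)) + (\<Sum>i\<in>-J. x $ i * y $ i)"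
   by (simp add: sum.If_cases)
  also have "\<dots> = a * (\<Sum>i\<in>J. x $ i * y $ i) - b * (\<Sum>i\<in>J. \<Sum>j\<in>J. C2 \<xi> i j * x $ i * y $ j) + (\<Sum>i\<in>-J. x $ i * y $ i)"
   by (simp add: sum_subtractf sum_distrib_left)
  also have "(\<Sum>i\<in>J. x $ i * y $ i) = projJ J x \<bullet> projJ J y"
   unfolding inner_vec_def by (rule sum.mono_neutral_cong_left) (auto simp: projJ_def)
  also have "(\<Sum>i\<in>-J. x $ i * y $ i) = x \<bullet> y - projJ J x \<bullet> projJ J y"
  proof -
   have "x \<bullet> y - projJ J x \<bullet> projJ J y = (\<Sum>i\<in>UNIV. if i \<in> J then 0 else x $ i * y $ i)"
    unfolding inner_vec_def sum_subtractf[symmetric] by (rule sum.cong) (auto simp: projJ_def)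
   also have "\<dots> = (\<Sum>i\<in>-J. x $ i * y $ i)" by (simp add: sum.If_cases)
   finally show ?thesis by simp
  qed
  finally show ?thesis unfolding C2_form by simp
 qed
 have \<beta>R: "\<beta> \<xi>' x y = \<beta> \<xi> (R x) (R y)" for x y
  unfolding \<beta> proj inn f by (simp add: linear_add[OF lin])
 define P :: "real^'n^'n" where "P = (\<chi> i j. R (axis j 1) $ i)"
 have ax: "\<beta> \<xi> (axis j 1) (axis k 1) = matK J (chr (C2 \<xi>) a b) $ j $ k" for \<xi> j k
  unfolding \<beta>_def by (simp add: axis_def if_distrib[of "%c. c * _"] if_distrib[of "%c. _ * c"] cong: if_cong)
 have M': "matK J (chr (C2 \<xi>') a b) = transpose P ** matK J (chr (C2 \<xi>) a b) ** P"
 proof -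
  have "(transpose P ** matK J (chr (C2 \<xi>) a b) ** P) $ j $ k = \<beta> \<xi> (R (axis j 1)) (R (axis k 1))" for j k
   unfolding \<beta>_def matrix_matrix_mult_def transpose_def P_def
   by (simp only: vec_lambda_beta sum_distrib_right) (rule sum.swap)
  then show ?thesis using \<beta>R ax[of \<xi>'] by (simp add: vec_eq_iff)
 qed
 have "transpose P ** P = mat 1"
 proof -
  have "(transpose P ** P) $ j $ k = R (axis j 1) \<bullet> R (axis k 1)" for j k
   unfolding matrix_matrix_mult_def transpose_def P_def inner_vec_def by simp
  then show ?thesis by (simp add: vec_eq_iff inn inner_axis_axis mat_def)
 qed
 then have "det P * det P = 1" by (metis det_I det_mul det_transpose)
 then show ?thesis unfolding M' det_mul det_transpose by (simp add: mult.left_commute mult.assoc[symmetric])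
qed

lemma Gdet_rotate:
 assumes "rotJ J R" "!!x. fld 2 \<xi>' x = fld 2 \<xi> (R x)"
 shows "Gdet J L \<xi>' = Gdet J L \<xi>"
 using det_chr_rotate[OF assms] by (simp add: Gdet_def)

lemma det_matK_block:
 assumes i0: "i0 \<notin> K" and A: "!!j. j \<in> K ==> A i0 j = 0" "!!j. j \<in> K ==> A j i0 = 0"
 shows "det (matK (insert i0 K) A) = A i0 i0 * det (matK K A)"
proof -
 have "matK (insert i0 K) A = (\<chi> i. (if i = i0 then A i0 i0 else 1) *s (matK K A $ i))"
  using i0 A by (auto simp: vec_eq_iff matK_def)
 then have "det (matK (insert i0 K) A) = (\<Prod>i\<in>UNIV. if i = i0 then A i0 i0 else 1) * det (\<chi> i. matK K A $ i)"
  by (simp add: det_rows_mul)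
 also have "(\<chi> i. matK K A $ i) = matK K A" by (simp add: vec_eq_iff)
 finally show ?thesis by simp
qed

section \<open>Recursion in the size of a Gaussian symmetric matrix\<close>

definition Dex :: "'n::finite set => (real \<times> real) list => ennreal" where
 "Dex J L = (\<integral>\<^sup>+\<xi>. ennreal (Gdet J L \<xi>) \<partial>PiM (exps 2) (%_. gauss))"

lemma matK_cong: "(!!i j. i \<in> K ==> j \<in> K ==> A i j = B i j) ==> matK K A = matK K B"
 by (auto simp: matK_def vec_eq_iff)

lemma Gdet_cong:
 assumes "!!j k. j \<in> K ==> k \<in> K ==> \<xi> (unit_exp j + unit_exp k) = \<xi>' (unit_exp j + unit_exp k)"
 shows "Gdet K L \<xi> = Gdet K L \<xi>'"
proof -
 have "matK K (chr (C2 \<xi>) a b) = matK K (chr (C2 \<xi>') a b)" for a b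
  by (rule matK_cong) (simp add: chr_def C2_def assms)
 then show ?thesis by (simp add: Gdet_def)
qed

lemma unit_exp_ne: "i0 \<notin> K ==> j \<in> K ==> unit_exp j + unit_exp k ~= unit_exp i0 + unit_exp i0"
proof
 assume "i0 \<notin> K" "j \<in> K" "unit_exp j + unit_exp k = unit_exp i0 + unit_exp i0"
 then have "Poly_Mapping.lookup (unit_exp j + unit_exp k) j = Poly_Mapping.lookup (unit_exp i0 + unit_exp i0) j" "i0 ~= j" by auto
 then show False by (simp add: lookup_add)
qed

text \<open>The diagonal coefficient at \<open>i0\<close> does not occur in the block on
  \<open>K\<close> and is independent of it, so parameters of the weight that depend on this
  coefficient can be frozen and integrated last.\<close>

lemma Gdet_integrand_split:
 fixes i0 :: "'n::finite"
 assumes i0: "i0 \<notin> K" and h: "h \<in> borel_measurable gauss"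
  and m: "(%x. h (x (unit_exp i0 + unit_exp i0)) * ennreal (Gdet K (L (x (unit_exp i0 + unit_exp i0))) x)) \<in> borel_measurable (PiM (exps 2) (%_. lborel))"
 shows "(\<integral>\<^sup>+x. h (x (unit_exp i0 + unit_exp i0)) * ennreal (Gdet K (L (x (unit_exp i0 + unit_exp i0))) x) \<partial>PiM (exps 2) (%_. gauss)) =
  (\<integral>\<^sup>+t. h t * Dex K (L t) \<partial>gauss)"
proof -
 let ?\<sigma> = "unit_exp i0 + unit_exp i0"
 define E where "E = exps 2 - {?\<sigma>}"
 have E: "exps 2 = insert ?\<sigma> E" "?\<sigma> \<notin> E" "finite E" using unit_exp_exps2[of i0 i0] by (auto simp: E_def)
 have G: "Gdet K M (x(?\<sigma> := t)) = Gdet K M (x(?\<sigma> := u))" for M x t u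
  by (rule Gdet_cong) (use unit_exp_ne[OF i0] in auto)
 have Dx: "Dex K M = (\<integral>\<^sup>+x. ennreal (Gdet K M (x(?\<sigma> := t))) \<partial>PiM E (%_. gauss))" for M t
 proof -
  have "Dex K M = (\<integral>\<^sup>+u. (\<integral>\<^sup>+x. ennreal (Gdet K M (x(?\<sigma> := u))) \<partial>PiM E (%_. gauss)) \<partial>gauss)"
   unfolding Dex_def E(1)
   by (rule product_sigma_finite.product_nn_integral_insert_rev[OF psf_gauss E(3,2)])
     (use Gdet_measurable[of K M] in \<open>simp add: measurable_PiM_gauss_iff E(1)\<close>)
  also have "\<dots> = (\<integral>\<^sup>+u. (\<integral>\<^sup>+x. ennreal (Gdet K M (x(?\<sigma> := t))) \<partial>PiM E (%_. gauss)) \<partial>gauss)"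
   by (intro nn_integral_cong) (rule arg_cong[where f = ennreal, OF G])
  finally show ?thesis by (simp add: gauss.emeasure_space_1[simplified])
 qed
 have "(\<integral>\<^sup>+x. h (x ?\<sigma>) * ennreal (Gdet K (L (x ?\<sigma>)) x) \<partial>PiM (exps 2) (%_. gauss)) =
  (\<integral>\<^sup>+t. (\<integral>\<^sup>+x. h ((x(?\<sigma> := t)) ?\<sigma>) * ennreal (Gdet K (L ((x(?\<sigma> := t)) ?\<sigma>)) (x(?\<sigma> := t))) \<partial>PiM E (%_. gauss)) \<partial>gauss)"
  unfolding E(1)
  by (rule product_sigma_finite.product_nn_integral_insert_rev[OF psf_gauss E(3,2)])
    (use m in \<open>simp add: measurable_PiM_gauss_iff E(1)\<close>)
 also have "\<dots> = (\<integral>\<^sup>+t. h t * Dex K (L t) \<partial>gauss)"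
 proof (rule nn_integral_cong)
  fix t
  have mm: "(%x. ennreal (Gdet K (L t) (x(?\<sigma> := t)))) \<in> borel_measurable (PiM E (%_. gauss))"
  proof -
   have "(%x. Gdet K (L t) (x(?\<sigma> := t))) \<in> borel_measurable (PiM E (%_. gauss))"
   proof (rule Gdet_measurable_gen)
    fix j k
    show "(%x. (x(?\<sigma> := t)) (unit_exp j + unit_exp k)) \<in> borel_measurable (PiM E (%_. gauss))"
     using gauss_component_measurable[of "unit_exp j + unit_exp k" E] unit_exp_exps2[of j k]
     by (cases "unit_exp j + unit_exp k = ?\<sigma>") (auto simp: E_def)
   qed
   then show ?thesis by simp
  qed
  show "(\<integral>\<^sup>+x. h ((x(?\<sigma> := t)) ?\<sigma>) * ennreal (Gdet K (L ((x(?\<sigma> := t)) ?\<sigma>)) (x(?\<sigma> := t))) \<partial>PiM E (%_. gauss)) = h t * Dex K (L t)"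
   unfolding Dx[of "L t" t] by (simp add: nn_integral_cmult[OF mm])
 qed
 finally show ?thesis .
qed

lemma single_two: "Poly_Mapping.single i (2::nat) = unit_exp i + unit_exp i"
 by (simp add: single_add[symmetric] numeral_2_eq_2)

lemma exps2_component_measurable: "(%x. x (unit_exp j + unit_exp k)) \<in> borel_measurable (PiM (exps 2) (%_. lborel :: real measure))"
 using measurable_component_singleton[OF unit_exp_exps2, where M = "%_. lborel :: real measure"] by simp

lemma Gdet_Cons_measurable_gen:
 assumes "a \<in> borel_measurable M" "!!j k. (%x. \<Xi> x (unit_exp j + unit_exp k)) \<in> borel_measurable M"
 shows "(%x. Gdet K ((a x, b) # L) (\<Xi> x)) \<in> borel_measurable M"
proof -
 have "(%x. det (matK K (chr (C2 (\<Xi> x)) (a x) b))) \<in> borel_measurable M"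
  by (rule det_matK_measurable)
    (use assms in \<open>auto simp: chr_def C2_def intro!: borel_measurable_diff borel_measurable_times\<close>)
 then show ?thesis unfolding Gdet_Cons using Gdet_measurable_gen[of \<Xi> M K L, OF assms(2)] by measurable
qed

lemma Gdet_Cons_measurable:
 assumes "a \<in> borel_measurable (PiM (exps 2) (%_. lborel))"
 shows "(%x. Gdet K ((a x, b) # L) x) \<in> borel_measurable (PiM (exps 2) (%_. lborel))"
 by (rule Gdet_Cons_measurable_gen[where \<Xi> = "%x. x", OF assms exps2_component_measurable])

lemma Dex_measurable:
 assumes a: "a \<in> borel_measurable gauss"
 shows "(%t. Dex K ((a t, b) # L)) \<in> borel_measurable gauss"
 unfolding Dex_def
proof -
 interpret prob_space "PiM (exps 2 :: ('a \<Rightarrow>\<^sub>0 nat) set) (%_. gauss)" by (rule prob_space_PiM) (rule prob_space_gauss)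
 have "(%x. Gdet K ((a (fst x), b) # L) (snd x)) \<in> borel_measurable (gauss \<Otimes>\<^sub>M PiM (exps 2) (%_. gauss))"
  by (rule Gdet_Cons_measurable_gen[where \<Xi> = snd, OF measurable_compose[OF measurable_fst a]
     measurable_compose[OF measurable_snd gauss_component_measurable[OF unit_exp_exps2]]])
 then have "(%(t, \<xi>). ennreal (Gdet K ((a t, b) # L) \<xi>)) \<in> borel_measurable (gauss \<Otimes>\<^sub>M PiM (exps 2) (%_. gauss))"
  by (simp add: case_prod_beta')
 then show "(%t. \<integral>\<^sup>+\<xi>. ennreal (Gdet K ((a t, b) # L) \<xi>) \<partial>PiM (exps 2) (%_. gauss)) \<in> borel_measurable gauss"
  by (rule borel_measurable_nn_integral)
qed

text \<open>The factor that \<open>Gdet\<close> gains from a 1 by 1 block with entry x.\<close>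

definition lin :: "(real \<times> real) list => real => real" where
 "lin L x = prod_list (map (%(a, b). \<bar>a - b * x\<bar>) L)"

lemma lin_Nil: "lin [] x = 1" and lin_Cons: "lin ((a, b) # L) x = \<bar>a - b * x\<bar> * lin L x"
 by (simp_all add: lin_def)

lemma lin_nonneg: "0 \<le> lin L x"
 by (induction L) (auto simp: lin_Nil lin_Cons split: prod.splits)

lemma lin_measurable [measurable]: "lin L \<in> borel_measurable borel"
proof (induction L)
 case (Cons ab L)
 obtain a b where ab: "ab = (a, b)" by force
 note [measurable] = Cons
 have "(%x. lin ((a, b) # L) x) \<in> borel_measurable borel" unfolding lin_Cons by measurable
 then show ?case by (simp add: ab)
qed (simp add: lin_Nil[abs_def])

lemma Gdet_insert:
 assumes i0: "i0 \<notin> K"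
  and A: "!!j. j \<in> K ==> C2 \<xi> i0 j = 0"
 shows "Gdet (insert i0 K) L \<xi> = lin L (C2 \<xi> i0 i0) * Gdet K L \<xi>"
proof (induction L)
 case (Cons ab L)
 obtain a b where ab: "ab = (a, b)" by force
 have "det (matK (insert i0 K) (chr (C2 \<xi>) a b)) = chr (C2 \<xi>) a b i0 i0 * det (matK K (chr (C2 \<xi>) a b))"
  by (rule det_matK_block[OF i0]) (use A i0 C2_sym[of \<xi> _ i0] in \<open>auto simp: chr_def\<close>)
 then show ?case unfolding ab Gdet_Cons lin_Cons Cons by (simp add: chr_def abs_mult)
qed (simp add: Gdet_Nil lin_Nil)

text \<open>The Kac-Rice formula for p = 2 counts unit eigenvectors of a matrix of size
  \<open>Suc (card K)\<close>. Unweighted, its right side is finite, so the number is almost surely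
  finite and then equals \<open>2 * Suc (card K)\<close>; this constant leaves the weighted
  integral. On the other side, a vanishing gradient splits the matrix into the entry
  \<open>sqrt 2 * t\<close> at \<open>i0\<close> and the block C on \<open>K\<close>, and the
  Jacobian factor is |det(sqrt 2 t - C)|.\<close>

lemma goe_recursion:
 fixes i0 :: "'n::finite"
 assumes i0: "i0 \<notin> K"
 shows "absmom (card K) * (of_nat (Suc (card K)) * Dex (insert i0 K) L) =
  (\<integral>\<^sup>+t. ennreal (lin L (sqrt 2 * t)) * Dex K ((sqrt 2 * t, 1) # L) \<partial>gauss)"
proof -
 let ?J = "insert i0 K" and ?\<sigma> = "unit_exp i0 + unit_exp i0"
 let ?P = "PiM (exps 2 :: ('n \<Rightarrow>\<^sub>0 nat) set) (%_. gauss)"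
 define D where "D M \<xi> = lin M (sqrt 2 * \<xi> ?\<sigma>) * Gdet K ((sqrt 2 * \<xi> ?\<sigma>, 1) # M) \<xi>" for M \<xi>
 have rice: "absmom (card K) * (\<integral>\<^sup>+\<xi>. ennreal (Gdet ?J M \<xi>) * num_elements (crit False ?J 2 \<xi>) \<partial>?P) = 2 * (\<integral>\<^sup>+\<xi>. ennreal (D M \<xi>) \<partial>?P)" for M
 proof -
  obtain C d where C: "!!\<xi>. Gdet ?J M \<xi> \<le> C * pbd (exps 2) \<xi> ^ d" using Gdet_bound[of ?J M] by blast
  interpret W: chart_weight i0 K 2 False "Gdet ?J M" C d
   by (rule chart_weight.intro[OF i0 _ Gdet_measurable Gdet_nonneg C]) (simp, rule Gdet_tendsto, simp)
  have "W.limD \<xi> = D M \<xi>" for \<xi>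
  proof -
   let ?c = "W.comb \<xi> (%_. 0)"
   have s: "?c ?\<sigma> = \<xi> ?\<sigma>"
    using W.comb_rest[OF single_rest[OF i0, of 2], of \<xi> "%_. 0"] by (simp add: single_two)
   have "?c (unit_exp i0 + unit_exp j) = 0" if "j \<in> K" for j
    using W.comb_bexp[OF that, of \<xi> "%_. 0"] by (simp add: bexp_def)
   then have "C2 ?c i0 j = 0" if "j \<in> K" for j using that by (simp add: C2_def)
   then have 1: "Gdet ?J M ?c = lin M (C2 ?c i0 i0) * Gdet K M ?c" by (rule Gdet_insert[OF i0])
   have "Gdet K M ?c = Gdet K M \<xi>"
    by (rule Gdet_cong) (use W.comb_rest[OF qexp_rest[OF i0], of _ _ \<xi> "%_. 0"] in \<open>simp add: qexp_2\<close>)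
   moreover have "jac 2 i0 \<xi> = chr (C2 \<xi>) (sqrt 2 * \<xi> ?\<sigma>) 1"
    by (auto simp: fun_eq_iff jac_def goe_def chr_def C2_def qexp_2 single_two)
   ultimately show ?thesis unfolding W.limD_def 1 D_def Gdet_Cons using s by (simp add: C2_def mult_ac)
  qed
  moreover have "Gdet ?J M \<xi>' = Gdet ?J M \<xi>" if "rotJ ?J R" "!!x. fld 2 \<xi>' x = fld 2 \<xi> (R x)" for R \<xi> \<xi>'
   by (rule Gdet_rotate[OF that])
  ultimately show ?thesis using W.kac_rice by simp
 qed
 have Dm: "(%\<xi>. ennreal (lin M (sqrt 2 * \<xi> ?\<sigma>)) * ennreal (Gdet K ((sqrt 2 * \<xi> ?\<sigma>, 1) # M) \<xi>)) \<in> borel_measurable (PiM (exps 2) (%_. lborel))" for M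
 proof -
  note [measurable] = exps2_component_measurable[of i0 i0]
  have [measurable]: "(%\<xi>. Gdet K ((sqrt 2 * \<xi> ?\<sigma>, 1) # M) \<xi>) \<in> borel_measurable (PiM (exps 2) (%_. lborel))"
   by (rule Gdet_Cons_measurable) measurable
  show ?thesis by measurable
 qed
 have De: "ennreal (D M \<xi>) = ennreal (lin M (sqrt 2 * \<xi> ?\<sigma>)) * ennreal (Gdet K ((sqrt 2 * \<xi> ?\<sigma>, 1) # M) \<xi>)" for M \<xi>
  unfolding D_def by (intro ennreal_mult lin_nonneg Gdet_nonneg)
 have fin: "(\<integral>\<^sup>+\<xi>. ennreal (D [] \<xi>) \<partial>?P) < \<infinity>"
 proof -
  let ?n = "CARD('n)"
  have dle: "D [] \<xi> \<le> fact ?n * 4 ^ ?n * pbd (exps 2) \<xi> ^ ?n" for \<xi>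
  proof -
   let ?p = "pbd (exps 2) \<xi>"
   have e: "sqrt 2 * \<bar>\<xi> (unit_exp j + unit_exp k)\<bar> \<le> 2 * ?p" for j k
   proof -
    have "\<bar>\<xi> (unit_exp j + unit_exp k)\<bar> \<le> (\<Sum>\<alpha>\<in>exps 2. \<bar>\<xi> \<alpha>\<bar>)" by (rule member_le_sum[OF unit_exp_exps2]) auto
    also have "\<dots> \<le> ?p" using pbd_sum[of "exps 2" \<xi>] by simp
    finally show ?thesis using pbd_ge_1[of "exps 2" \<xi>] by (intro mult_mono) (auto intro: real_le_lsqrt)
   qed
   have e': "\<bar>C2 \<xi> j k\<bar> \<le> 2 * ?p" for j k
   proof -
    have "1 * \<bar>\<xi> (unit_exp j + unit_exp k)\<bar> \<le> sqrt 2 * \<bar>\<xi> (unit_exp j + unit_exp k)\<bar>" by (rule mult_right_mono) auto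
    then show ?thesis using e[of j k] by (auto simp: C2_def abs_mult)
   qed
   have "\<bar>chr (C2 \<xi>) (sqrt 2 * \<xi> ?\<sigma>) 1 j k\<bar> \<le> 4 * ?p" for j k
    using e'[of j k] e[of i0 i0] pbd_ge_1[of "exps 2" \<xi>]
     abs_triangle_ineq4[of "sqrt 2 * \<xi> ?\<sigma>" "C2 \<xi> j k"] by (auto simp: chr_def abs_mult)
   then have "\<bar>det (matK K (chr (C2 \<xi>) (sqrt 2 * \<xi> ?\<sigma>) 1))\<bar> \<le> fact ?n * (4 * ?p) ^ ?n"
    using pbd_ge_1[of "exps 2" \<xi>] by (intro det_matK_bound) auto
   then show ?thesis by (simp add: D_def lin_Nil Gdet_Cons Gdet_Nil power_mult_distrib mult.assoc)
  qed
  have "integral\<^sup>N ?P (%\<xi>. ennreal (D [] \<xi>)) \<le> (\<integral>\<^sup>+\<xi>. ennreal (fact ?n * 4 ^ ?n) * ennreal (pbd (exps 2) \<xi> ^ ?n) \<partial>?P)"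
   by (rule nn_integral_mono) (simp add: ennreal_mult'[symmetric] ennreal_leI dle)
  also have "\<dots> = ennreal (fact ?n * 4 ^ ?n) * (\<integral>\<^sup>+\<xi>. ennreal (pbd (exps 2) \<xi> ^ ?n) \<partial>?P)"
   by (rule nn_integral_cmult) (simp add: measurable_PiM_gauss_iff)
  also have "\<dots> < \<infinity>" using nn_integral_pbd[of "exps 2 :: ('n \<Rightarrow>\<^sub>0 nat) set" ?n] by (simp add: ennreal_mult_less_top)
  finally show ?thesis .
 qed
 have mn: "(%\<xi>. num_elements (crit False ?J 2 \<xi>)) \<in> borel_measurable ?P"
  by (rule measurable_num_crit(2)[where \<Gamma> = "%_. 0"]) (auto intro: gauss_component_measurable)
 have "absmom (card K) * (\<integral>\<^sup>+\<xi>. num_elements (crit False ?J 2 \<xi>) \<partial>?P) < \<top>"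
  using rice[of "[]"] fin by (simp add: Gdet_Nil ennreal_mult_less_top)
 then have "(\<integral>\<^sup>+\<xi>. num_elements (crit False ?J 2 \<xi>) \<partial>?P) ~= \<infinity>"
  using absmom_pos[of "card K"] by (auto simp: ennreal_mult_less_top)
 then have "AE \<xi> in ?P. num_elements (crit False ?J 2 \<xi>) ~= \<infinity>" by (rule nn_integral_PInf_AE[OF mn])
 then have "AE \<xi> in ?P. num_elements (crit False ?J 2 \<xi>) = of_nat (2 * card ?J)"
  by eventually_elim (rule num_crit_2, simp)
 then have "AE \<xi> in ?P. ennreal (Gdet ?J L \<xi>) * num_elements (crit False ?J 2 \<xi>) = ennreal (Gdet ?J L \<xi>) * of_nat (2 * card ?J)"
  by eventually_elim simp
 then have "(\<integral>\<^sup>+\<xi>. ennreal (Gdet ?J L \<xi>) * num_elements (crit False ?J 2 \<xi>) \<partial>?P) = Dex ?J L * of_nat (2 * card ?J)"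
  unfolding Dex_def
  by (subst nn_integral_multc[symmetric]) (auto intro!: nn_integral_cong_AE simp: measurable_PiM_gauss_iff measurable_compose[OF Gdet_measurable measurable_ennreal])
 moreover have "of_nat (2 * card ?J) = (2::ennreal) * of_nat (Suc (card K))" using i0 by simp
 ultimately have "2 * (absmom (card K) * (of_nat (Suc (card K)) * Dex ?J L)) = 2 * (\<integral>\<^sup>+\<xi>. ennreal (D L \<xi>) \<partial>?P)"
  using rice[of L] by (simp only: mult_ac)
 then have "absmom (card K) * (of_nat (Suc (card K)) * Dex ?J L) = (\<integral>\<^sup>+\<xi>. ennreal (D L \<xi>) \<partial>?P)"
  by (simp add: ennreal_mult_cancel_left)
 also have "\<dots> = (\<integral>\<^sup>+t. ennreal (lin L (sqrt 2 * t)) * Dex K ((sqrt 2 * t, 1) # L) \<partial>gauss)"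
  unfolding De by (rule Gdet_integrand_split[where L = "%t. (sqrt 2 * t, 1) # L", OF i0 _ Dm]) (simp add: gauss_def)
 finally show ?thesis .
qed

lemma Dex_empty: "Dex {} L = 1"
proof -
 interpret prob_space "PiM (exps 2) (%_. gauss)" by (rule prob_space_PiM) (rule prob_space_gauss)
 have "matK {} A = mat 1" for A :: "'a => 'a => real" by (auto simp: matK_def mat_def vec_eq_iff)
 then have "Gdet ({} :: 'a set) L \<xi> = 1" for \<xi> :: "('a \<Rightarrow>\<^sub>0 nat) => real"
  by (induction L) (auto simp: Gdet_Nil Gdet_Cons)
 then show ?thesis by (simp add: Dex_def emeasure_space_1)
qed

text \<open>On \<open>K\<close>, \<open>jac\<close> involves only the coefficients of
  \<open>x_i0^p\<close> and at \<open>qexp\<close>. For p at least 2, multiplication by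
  \<open>x_i0^(p-2)\<close> identifies these with the coefficients of a quadratic form, and the
  determinant becomes an instance of \<open>Gdet\<close>. For p = 1 the matrix is a multiple of the
  identity.\<close>

lemma expected_crit:
 fixes i0 :: "'n::finite"
 assumes p: "p \<ge> 1"
 defines "K \<equiv> UNIV - {i0}"
 shows "absmom (card K) * (\<integral>\<^sup>+\<xi>. num_elements (crit True (UNIV :: 'n set) p \<xi>) \<partial>PiM (exps p) (%_. gauss)) =
  2 * (\<integral>\<^sup>+t. Dex K [(sqrt (real p) * t, sqrt (real p - 1))] \<partial>gauss)"
proof -
 have i0: "i0 \<notin> K" and J: "insert i0 K = UNIV" by (auto simp: K_def)
 interpret W: chart_weight i0 K p True "%_. 1" 1 0
  by unfold_locales (use i0 p in auto)
 have rice: "absmom (card K) * (\<integral>\<^sup>+\<xi>. num_elements (crit True (UNIV :: 'n set) p \<xi>) \<partial>PiM (exps p) (%_. gauss)) =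
  2 * (\<integral>\<^sup>+\<xi>. ennreal \<bar>det (matK K (jac p i0 \<xi>))\<bar> \<partial>PiM (exps p) (%_. gauss))"
  using W.kac_rice by (simp add: J W.limD_def)
 show ?thesis unfolding rice
 proof (rule arg_cong[of _ _ "(*) 2"], cases "p \<ge> 2")
  case True
  define \<phi> :: "('n \<Rightarrow>\<^sub>0 nat) => ('n \<Rightarrow>\<^sub>0 nat)" where "\<phi> \<alpha> = Poly_Mapping.single i0 (p - 2) + \<alpha>" for \<alpha>
  define H where "H \<xi> = ennreal (Gdet K [(sqrt (real p) * \<xi> (unit_exp i0 + unit_exp i0), sqrt (real p - 1))] \<xi>)" for \<xi>
  let ?r = "%\<xi> :: ('n \<Rightarrow>\<^sub>0 nat) => real. \<lambda>\<alpha>\<in>exps 2. \<xi> (\<phi> \<alpha>)"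
  have \<phi>: "\<phi> \<alpha> \<in> exps p" if "\<alpha> \<in> exps 2" for \<alpha>
   using that True by (simp add: \<phi>_def exps_def lookup_add sum.distrib lookup_single when_def)
  have "\<phi> (unit_exp i0 + unit_exp i0) = Poly_Mapping.single i0 p"
   unfolding \<phi>_def single_two[symmetric] single_add[symmetric] using True by (intro arg_cong[of _ _ "Poly_Mapping.single i0"]) simp
  moreover have "\<phi> (unit_exp j + unit_exp k) = qexp i0 p j k" for j k by (simp add: \<phi>_def qexp_def add.assoc)
  ultimately have e: "ennreal \<bar>det (matK K (jac p i0 \<xi>))\<bar> = H (?r \<xi>)" for \<xi>
  proof -
   assume a: "\<phi> (unit_exp i0 + unit_exp i0) = Poly_Mapping.single i0 p" "!!j k. \<phi> (unit_exp j + unit_exp k) = qexp i0 p j k"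
   have "jac p i0 \<xi> = chr (C2 (?r \<xi>)) (sqrt (real p) * \<xi> (Poly_Mapping.single i0 p)) (sqrt (real p - 1))"
    by (auto simp: fun_eq_iff jac_def goe_def chr_def C2_def unit_exp_exps2 a(2))
   then show ?thesis by (simp add: H_def Gdet_Cons Gdet_Nil unit_exp_exps2 a(1))
  qed
  have Hm: "H \<in> borel_measurable (PiM (exps 2) (%_. lborel))"
   unfolding H_def using exps2_component_measurable[of i0 i0]
   by (intro measurable_compose[OF _ measurable_ennreal] Gdet_Cons_measurable) auto
  have inj: "inj_on \<phi> (exps 2)" by (auto simp: inj_on_def \<phi>_def)
  have rm: "?r \<in> PiM (exps p) (%_. gauss) \<rightarrow>\<^sub>M PiM (exps 2) (%_. gauss)"
   by (rule measurable_restrict, rule measurable_component_singleton[OF \<phi>])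
  have "(\<integral>\<^sup>+\<xi>. ennreal \<bar>det (matK K (jac p i0 \<xi>))\<bar> \<partial>PiM (exps p) (%_. gauss)) =
    (\<integral>\<^sup>+\<xi>. H \<xi> \<partial>distr (PiM (exps p) (%_. gauss)) (PiM (exps 2) (%_. gauss)) ?r)"
   unfolding e by (rule nn_integral_distr[symmetric, OF rm]) (simp add: measurable_PiM_gauss_iff Hm)
  also have "distr (PiM (exps p) (%_. gauss)) (PiM (exps 2) (%_. gauss)) ?r = PiM (exps 2) (%_. gauss)"
   by (rule distr_PiM_reindex) (use inj in \<open>auto simp: prob_space_gauss \<phi>\<close>)
  also have "(\<integral>\<^sup>+\<xi>. H \<xi> \<partial>PiM (exps 2) (%_. gauss)) = (\<integral>\<^sup>+t. Dex K [(sqrt (real p) * t, sqrt (real p - 1))] \<partial>gauss)"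
   using Gdet_integrand_split[OF i0, of "%_. 1" "%t. [(sqrt (real p) * t, sqrt (real p - 1))]"] Hm
   by (simp add: H_def[abs_def])
  finally show "(\<integral>\<^sup>+\<xi>. ennreal \<bar>det (matK K (jac p i0 \<xi>))\<bar> \<partial>PiM (exps p) (%_. gauss)) =
   (\<integral>\<^sup>+t. Dex K [(sqrt (real p) * t, sqrt (real p - 1))] \<partial>gauss)" .
 next
  case False
  then have p1: "p = 1" using p by simp
  let ?s = "Poly_Mapping.single i0 (1::nat)"
  define f where "f t = ennreal \<bar>det (matK K (%j k. if j = k then t else (0::real)))\<bar>" for t
  have fm: "f \<in> borel_measurable borel"
   unfolding f_def by (intro measurable_compose[OF _ measurable_ennreal] borel_measurable_abs det_matK_measurable) auto
  interpret P2: prob_space "PiM (exps 2 :: ('n \<Rightarrow>\<^sub>0 nat) set) (%_. gauss)" by (rule prob_space_PiM) (rule prob_space_gauss)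
  have "Dex K [(sqrt (real p) * t, sqrt (real p - 1))] = f t" for t
  proof -
   have "chr c t 0 = (%j k. if j = k then t else 0)" for c :: "'n => 'n => real" by (auto simp: chr_def fun_eq_iff)
   then show ?thesis by (simp add: p1 Dex_def Gdet_Cons Gdet_Nil f_def P2.emeasure_space_1)
  qed
  moreover have "ennreal \<bar>det (matK K (jac p i0 \<xi>))\<bar> = f (\<xi> ?s)" for \<xi>
  proof -
   have "jac p i0 \<xi> = (%j k. if j = k then \<xi> ?s else 0)" by (auto simp: fun_eq_iff jac_def p1)
   then show ?thesis by (simp only: f_def)
  qed
  moreover have "(\<integral>\<^sup>+\<xi>. f (\<xi> ?s) \<partial>PiM (exps p) (%_. gauss)) = (\<integral>\<^sup>+t. f t \<partial>gauss)"
  proof -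
   have s: "?s \<in> exps p" using exps_single[of i0 1] p1 by simp
   have "(\<integral>\<^sup>+t. f t \<partial>gauss) = (\<integral>\<^sup>+t. f t \<partial>distr (PiM (exps p) (%_. gauss)) gauss (%\<xi>. \<xi> ?s))"
    by (simp only: distr_PiM_component[of "exps p" "%_. gauss", OF prob_space_gauss s])
   also have "\<dots> = (\<integral>\<^sup>+\<xi>. f (\<xi> ?s) \<partial>PiM (exps p) (%_. gauss))"
    by (rule nn_integral_distr) (rule measurable_component_singleton[OF s], use fm in \<open>simp add: gauss_def\<close>)
   finally show ?thesis by simp
  qed
  ultimately show "(\<integral>\<^sup>+\<xi>. ennreal \<bar>det (matK K (jac p i0 \<xi>))\<bar> \<partial>PiM (exps p) (%_. gauss)) =
   (\<integral>\<^sup>+t. Dex K [(sqrt (real p) * t, sqrt (real p - 1))] \<partial>gauss)" by simp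
 qed
qed

section \<open>Vandermonde integrals\<close>

definition pairs :: "nat set => (nat \<times> nat) set" where
 "pairs A = {(i, j). i \<in> A \<and> j \<in> A \<and> i < j}"

text \<open>Absolute values make the product symmetric in the points, so that integrals can run over
  all of space; the ordering, under which the differences are nonnegative, is imposed at the
  end.\<close>

definition vdm :: "nat set => (nat => real) => real" where
 "vdm A y = (\<Prod>(i, j)\<in>pairs A. \<bar>y j - y i\<bar>)"

definition cpv :: "nat set => (real \<times> real) list => (nat => real) => real" where
 "cpv A L y = (\<Prod>i\<in>A. lin L (y i)) * vdm A y"

lemma finite_pairs: "finite A ==> finite (pairs A)"
 by (rule finite_subset[of _ "A \<times> A"]) (auto simp: pairs_def)

lemma vdm_nonneg: "0 \<le> vdm A y"
 unfolding vdm_def by (rule prod_nonneg) auto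

lemma cpv_nonneg: "0 \<le> cpv A L y"
 unfolding cpv_def by (intro mult_nonneg_nonneg prod_nonneg vdm_nonneg) (auto simp: lin_nonneg)

lemma vdm_cong: "(!!i. i \<in> A ==> y i = z i) ==> vdm A y = vdm A z"
 unfolding vdm_def by (rule prod.cong) (auto simp: pairs_def)

lemma cpv_cong: "(!!i. i \<in> A ==> y i = z i) ==> cpv A L y = cpv A L z"
 unfolding cpv_def using vdm_cong[of A y z] by simp

text \<open>The differences to the new point form one more linear factor, with parameters (y a, 1),
  for the remaining points; this is the shape of \<open>goe_recursion\<close>. Taking the new index
  largest gives all new pairs the form (i, a).\<close>

lemma cpv_insert:
 assumes A: "finite A" and a: "!!i. i \<in> A ==> i < a"
 shows "cpv (insert a A) L y = lin L (y a) * cpv A ((y a, 1) # L) y"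
proof -
 have na: "a \<notin> A" using a by blast
 have pe: "pairs (insert a A) = pairs A \<union> (%i. (i, a)) ` A"
  using a by (auto simp: pairs_def dest: less_asym)
 have "vdm (insert a A) y = vdm A y * (\<Prod>(i, j)\<in>(%i. (i, a)) ` A. \<bar>y j - y i\<bar>)"
  unfolding vdm_def pe using A na by (intro prod.union_disjoint finite_pairs) (auto simp: pairs_def)
 also have "(\<Prod>(i, j)\<in>(%i. (i, a)) ` A. \<bar>y j - y i\<bar>) = (\<Prod>i\<in>A. \<bar>y a - y i\<bar>)"
  by (subst prod.reindex) (auto simp: inj_on_def)
 finally show ?thesis using A na by (simp add: cpv_def lin_Cons prod.distrib mult_ac)
qed

text \<open>The square is a product over all ordered pairs of distinct indices, which a permutation
  merely rearranges; nonnegativity then removes the square.\<close>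

lemma vdm_permute:
 assumes A: "finite A" and \<pi>: "\<pi> permutes A"
 shows "vdm A (%i. y (\<pi> i)) = vdm A y"
proof -
 define D where "D = {(i, j). i \<in> A \<and> j \<in> A \<and> i ~= j}"
 have sq: "(vdm A z)\<^sup>2 = (\<Prod>(i, j)\<in>D. \<bar>z j - z i\<bar>)" for z
 proof -
  have D: "D = pairs A \<union> prod.swap ` pairs A"
  proof -
   have "(i, j) \<in> prod.swap ` pairs A \<longleftrightarrow> (j, i) \<in> pairs A" for i j by force
   then show ?thesis by (auto simp: D_def pairs_def)
  qed
  have "pairs A \<inter> prod.swap ` pairs A = {}" by (auto simp: pairs_def)
  then have "(\<Prod>(i, j)\<in>D. \<bar>z j - z i\<bar>) = vdm A z * (\<Prod>(i, j)\<in>prod.swap ` pairs A. \<bar>z j - z i\<bar>)"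
   unfolding vdm_def D using finite_pairs[OF A] by (intro prod.union_disjoint) auto
  also have "(\<Prod>(i, j)\<in>prod.swap ` pairs A. \<bar>z j - z i\<bar>) = vdm A z"
   unfolding vdm_def by (subst prod.reindex) (auto intro!: prod.cong simp: inj_on_def abs_minus_commute)
  finally show ?thesis by (simp add: power2_eq_square)
 qed
 have bij: "bij_betw (map_prod \<pi> \<pi>) D D"
 proof (rule bij_betw_byWitness[where f' = "map_prod (inv \<pi>) (inv \<pi>)"])
  show "\<forall>a\<in>D. map_prod (inv \<pi>) (inv \<pi>) (map_prod \<pi> \<pi> a) = a" using permutes_inverses[OF \<pi>] by auto
  show "\<forall>a\<in>D. map_prod \<pi> \<pi> (map_prod (inv \<pi>) (inv \<pi>) a) = a" using permutes_inverses[OF \<pi>] by auto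
  show "map_prod \<pi> \<pi> ` D \<subseteq> D"
   using permutes_in_image[OF \<pi>] permutes_inj[OF \<pi>] by (auto simp: D_def dest: injD)
  show "map_prod (inv \<pi>) (inv \<pi>) ` D \<subseteq> D"
   using permutes_in_image[OF permutes_inv[OF \<pi>]] permutes_inj[OF permutes_inv[OF \<pi>]] by (auto simp: D_def dest: injD)
 qed
 have "(vdm A (%i. y (\<pi> i)))\<^sup>2 = (\<Prod>a\<in>D. (%(i, j). \<bar>y j - y i\<bar>) (map_prod \<pi> \<pi> a))"
  unfolding sq by (rule prod.cong) auto
 also have "\<dots> = (vdm A y)\<^sup>2"
  unfolding sq by (rule prod.reindex_bij_betw[OF bij])
 finally show ?thesis using vdm_nonneg by (simp add: power2_eq_iff_nonneg)
qed

lemma cpv_permute: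
 assumes A: "finite A" and \<pi>: "\<pi> permutes A"
 shows "cpv A L (%i. y (\<pi> i)) = cpv A L y"
 unfolding cpv_def vdm_permute[OF assms] using prod.permute[OF \<pi>, of "%i. lin L (y i)"] by (simp add: o_def)

lemma cpv_measurable:
 assumes A: "finite A" and L: "!!i. i \<in> A ==> (%x. y x i) \<in> borel_measurable M"
 shows "(%x. cpv A L (y x)) \<in> borel_measurable M"
proof -
 have "(%x. \<Prod>i\<in>A. lin L (y x i)) \<in> borel_measurable M"
  using measurable_compose[OF L lin_measurable] by (intro borel_measurable_prod)
 moreover have "(%x. \<Prod>a\<in>pairs A. \<bar>y x (snd a) - y x (fst a)\<bar>) \<in> borel_measurable M"
  by (intro borel_measurable_prod borel_measurable_abs borel_measurable_diff L) (auto simp: pairs_def)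
 ultimately show ?thesis unfolding cpv_def vdm_def case_prod_beta' by (rule borel_measurable_times)
qed

text \<open>The factor sqrt 2 gives the points variance 2, that is, the density exp(-l^2 / 4) of the
  theorem up to a constant.\<close>

definition VI :: "nat set => (real \<times> real) list => ennreal" where
 "VI A L = (\<integral>\<^sup>+x. ennreal (cpv A L (%i. sqrt 2 * x i)) \<partial>PiM A (%_. gauss))"

lemma VI_insert:
 assumes A: "finite A" and a: "!!i. i \<in> A ==> i < a"
 shows "VI (insert a A) L = (\<integral>\<^sup>+t. ennreal (lin L (sqrt 2 * t)) * VI A ((sqrt 2 * t, 1) # L) \<partial>gauss)"
proof -
 have na: "a \<notin> A" using a by blast
 have m: "(%x. ennreal (cpv B M (%i. sqrt 2 * x i))) \<in> borel_measurable (PiM B (%_. gauss))" if "finite B" for B M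
  using that gauss_component_measurable
  by (intro measurable_compose[OF _ measurable_ennreal] cpv_measurable borel_measurable_times) auto
 have "VI (insert a A) L = (\<integral>\<^sup>+t. (\<integral>\<^sup>+x. ennreal (cpv (insert a A) L (%i. sqrt 2 * (x(a := t)) i)) \<partial>PiM A (%_. gauss)) \<partial>gauss)"
  unfolding VI_def by (rule product_sigma_finite.product_nn_integral_insert_rev[OF psf_gauss A na m]) (use A in simp)
 also have "\<dots> = (\<integral>\<^sup>+t. ennreal (lin L (sqrt 2 * t)) * VI A ((sqrt 2 * t, 1) # L) \<partial>gauss)"
 proof (rule nn_integral_cong)
  fix t
  have c: "cpv (insert a A) L y = lin L (y a) * cpv A ((y a, 1) # L) y" for y by (rule cpv_insert[OF A a])
  have cA: "cpv A M (%i. sqrt 2 * (x(a := t)) i) = cpv A M (%i. sqrt 2 * x i)" for M and x :: "nat => real"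
   by (rule cpv_cong) (use na in auto)
  have "ennreal (cpv (insert a A) L (%i. sqrt 2 * (x(a := t)) i)) =
    ennreal (lin L (sqrt 2 * t)) * ennreal (cpv A ((sqrt 2 * t, 1) # L) (%i. sqrt 2 * x i))" for x
   unfolding c[of "%i. sqrt 2 * (x(a := t)) i"] cA fun_upd_same by (rule ennreal_mult[OF lin_nonneg cpv_nonneg])
  then show "(\<integral>\<^sup>+x. ennreal (cpv (insert a A) L (%i. sqrt 2 * (x(a := t)) i)) \<partial>PiM A (%_. gauss)) =
    ennreal (lin L (sqrt 2 * t)) * VI A ((sqrt 2 * t, 1) # L)"
   unfolding VI_def by (simp add: nn_integral_cmult[OF m[OF A]])
 qed
 finally show ?thesis .
qed

text \<open>Both sides arise from the same one-dimensional integral over t, with the list extended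
  by \<open>(sqrt 2 * t, 1)\<close>, and differ in each step by the factor
  \<open>absmom m * of_nat (Suc m)\<close>. The index set starts at 2 to match the variables of the
  theorem.\<close>

lemma Dex_VI:
 "card (J :: 'n::finite set) = m ==> (\<Prod>j<m. absmom j * of_nat (Suc j)) * Dex J L = VI {2..<m + 2} L"
proof (induction m arbitrary: J L)
 case 0
 interpret prob_space "PiM ({} :: nat set) (%_. gauss)" by (rule prob_space_PiM) (rule prob_space_gauss)
 have "cpv {} L y = 1" for y by (simp add: cpv_def vdm_def pairs_def)
 then show ?case using 0 by (simp add: Dex_empty VI_def emeasure_space_1)
next
 case (Suc m)
 obtain i0 K where J: "J = insert i0 K" "i0 \<notin> K" "card K = m" using Suc.prems card_eq_SucD by metis
 let ?c = "\<Prod>j<m. absmom j * of_nat (Suc j)"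
 have "(\<Prod>j<Suc m. absmom j * of_nat (Suc j)) * Dex J L = ?c * (absmom m * (of_nat (Suc m) * Dex J L))"
  by (simp add: mult_ac)
 also have "absmom m * (of_nat (Suc m) * Dex J L) = (\<integral>\<^sup>+t. ennreal (lin L (sqrt 2 * t)) * Dex K ((sqrt 2 * t, 1) # L) \<partial>gauss)"
  using goe_recursion[OF J(2)] unfolding J by simp
 also have "?c * \<dots> = (\<integral>\<^sup>+t. ?c * (ennreal (lin L (sqrt 2 * t)) * Dex K ((sqrt 2 * t, 1) # L)) \<partial>gauss)"
  by (intro nn_integral_cmult[symmetric] borel_measurable_times_ennreal Dex_measurable) (auto simp: gauss_def)
 also have "\<dots> = (\<integral>\<^sup>+t. ennreal (lin L (sqrt 2 * t)) * VI {2..<m + 2} ((sqrt 2 * t, 1) # L) \<partial>gauss)"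
  by (intro nn_integral_cong) (simp only: Suc.IH[OF J(3), symmetric] mult.left_commute)
 also have "\<dots> = VI (insert (m + 2) {2..<m + 2}) L" by (rule VI_insert[symmetric]) auto
 also have "insert (m + 2) {2..<m + 2} = {2..<Suc m + 2}" by auto
 finally show ?case .
qed

section \<open>Restriction to ordered points\<close>

lemma ex1_sorting_permutation:
 fixes x :: "nat => real"
 assumes x: "inj_on x {2..<m + 2}"
 shows "\<exists>!\<pi>. \<pi> permutes {2..<m + 2} \<and> (\<forall>i\<in>{2..<m + 2}. \<forall>j\<in>{2..<m + 2}. i \<le> j --> x (\<pi> i) \<le> x (\<pi> j))"
  (is "\<exists>!\<pi>. \<pi> permutes ?A \<and> ?s \<pi>")
proof (rule ex_ex1I)
 define ys where "ys = sorted_list_of_set (x ` ?A)"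
 have ys: "set ys = x ` ?A" "distinct ys" "sorted ys" by (simp_all add: ys_def)
 have len: "length ys = m" using distinct_card[OF ys(2)] card_image[OF x] unfolding ys(1) by simp
 \<comment> \<open>The index whose value stands at position i - 2 of the sorted list; the shift
   accounts for the indices starting at 2.\<close>
 define \<pi> where "\<pi> i = (if i \<in> ?A then inv_into ?A x (ys ! (i - 2)) else i)" for i
 have mem: "ys ! (i - 2) \<in> x ` ?A" if "i \<in> ?A" for i
  using that len nth_mem[of "i - 2" ys] ys(1) by auto
 have x\<pi>: "x (\<pi> i) = ys ! (i - 2)" and in\<pi>: "\<pi> i \<in> ?A" if "i \<in> ?A" for i
  using mem[OF that] that by (simp_all only: \<pi>_def if_True f_inv_into_f inv_into_into)
 have "inj_on \<pi> ?A"
 proof (rule inj_onI)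
  fix i j assume ij: "i \<in> ?A" "j \<in> ?A" "\<pi> i = \<pi> j"
  then have "ys ! (i - 2) = ys ! (j - 2)" using x\<pi> by metis
  then have "i - 2 = j - 2" using ij len ys(2) by (auto simp: nth_eq_iff_index_eq)
  then show "i = j" using ij by auto
 qed
 moreover from this have "\<pi> ` ?A = ?A" using in\<pi> by (intro endo_inj_surj) blast+
 ultimately have "bij_betw \<pi> ?A ?A" unfolding bij_betw_def ..
 then have "\<pi> permutes ?A" by (rule bij_imp_permutes) (simp only: \<pi>_def if_False)
 moreover have "?s \<pi>" using x\<pi> len ys(3) by (auto simp: sorted_iff_nth_mono)
 ultimately show "\<exists>\<pi>. \<pi> permutes ?A \<and> ?s \<pi>" by blast
next
 fix \<pi> \<pi>' assume a: "\<pi> permutes ?A \<and> ?s \<pi>" "\<pi>' permutes ?A \<and> ?s \<pi>'"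
 \<comment> \<open>Every sorting permutation lists the values in increasing order without
   repetition, and there is only one such list.\<close>
 have l: "sorted (map (%i. x (\<sigma> i)) [2..<m + 2]) \<and> distinct (map (%i. x (\<sigma> i)) [2..<m + 2]) \<and> set (map (%i. x (\<sigma> i)) [2..<m + 2]) = x ` ?A"
  if \<sigma>: "\<sigma> permutes ?A" "?s \<sigma>" for \<sigma>
 proof (intro conjI)
  show "sorted (map (%i. x (\<sigma> i)) [2..<m + 2])" using \<sigma>(2) by (auto simp: sorted_iff_nth_mono simp del: upt_Suc)
  have "inj_on (%i. x (\<sigma> i)) ?A"
   using x permutes_in_image[OF \<sigma>(1)] permutes_inj[OF \<sigma>(1)] by (auto intro!: inj_onI dest: inj_onD injD)
  then show "distinct (map (%i. x (\<sigma> i)) [2..<m + 2])" by (simp add: distinct_map del: upt_Suc)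
  show "set (map (%i. x (\<sigma> i)) [2..<m + 2]) = x ` ?A"
   using permutes_image[OF \<sigma>(1)] by (simp add: image_image[symmetric] del: upt_Suc)
 qed
 have "map (%i. x (\<pi> i)) [2..<m + 2] = map (%i. x (\<pi>' i)) [2..<m + 2]"
 proof -
  note p = l[OF conjunct1 conjunct2, OF a(1) a(1)] and p' = l[OF conjunct1 conjunct2, OF a(2) a(2)]
  show ?thesis
   by (rule sorted_distinct_set_unique[OF conjunct1[OF p] conjunct1[OF conjunct2[OF p]] conjunct1[OF p']
      conjunct1[OF conjunct2[OF p']] trans[OF conjunct2[OF conjunct2[OF p]] conjunct2[OF conjunct2[OF p'], symmetric]]])
 qed
 then have "x (\<pi> i) = x (\<pi>' i)" if "i \<in> ?A" for i using that by (simp del: upt_Suc)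
 then have "\<pi> i = \<pi>' i" if "i \<in> ?A" for i
  using that x permutes_in_image a by (metis inj_onD)
 then show "\<pi> = \<pi>'" using a by (metis permutes_not_in ext)
qed

definition ordset :: "nat set => (nat => real) set" where
 "ordset A = {x. \<forall>i\<in>A. \<forall>j\<in>A. i \<le> j --> x i \<le> x j}"

lemma ordset_measurable:
 assumes "finite A"
 shows "(%x. indicator (ordset A) x :: ennreal) \<in> borel_measurable (PiM A (%_. gauss))"
proof -
 have e: "indicator (ordset A) x = (\<Prod>a\<in>A \<times> A. if fst a \<le> snd a \<and> x (snd a) < x (fst a) then 0 else 1 :: ennreal)" for x
 proof (cases "x \<in> ordset A")
  case True
  have "(\<Prod>a\<in>A \<times> A. if fst a \<le> snd a \<and> x (snd a) < x (fst a) then 0 else 1 :: ennreal) = 1"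
   by (rule prod.neutral) (use True in \<open>fastforce simp: ordset_def dest: leD\<close>)
  then show ?thesis using True by simp
 next
  case False
  then obtain i j where ij: "i \<in> A" "j \<in> A" "i \<le> j" "x j < x i" unfolding ordset_def mem_Collect_eq by (meson not_le)
  have "(\<Prod>a\<in>A \<times> A. if fst a \<le> snd a \<and> x (snd a) < x (fst a) then 0 else 1 :: ennreal) = 0"
   by (rule prod_zero) (use assms ij in \<open>auto intro!: bexI[of _ "(i, j)"]\<close>)
  then show ?thesis using False by simp
 qed
 show ?thesis unfolding e
 proof (rule borel_measurable_prod_ennreal)
  fix a assume "a \<in> A \<times> A"
  then have m: "(%x. x (fst a)) \<in> borel_measurable (PiM A (%_. gauss))" "(%x. x (snd a)) \<in> borel_measurable (PiM A (%_. gauss))"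
   by (auto intro: gauss_component_measurable)
  show "(%x. if fst a \<le> snd a \<and> x (snd a) < x (fst a) then 0 else 1 :: ennreal) \<in> borel_measurable (PiM A (%_. gauss))"
   using borel_measurable_less[OF m(2,1)] by (cases "fst a \<le> snd a") (auto intro!: measurable_If)
 qed
qed

text \<open>The integrand is split according to the permutation that sorts the point. Points with a
  tie have a vanishing Vandermonde factor, so the splitting holds everywhere; each of the
  \<open>fact m\<close> parts has the same integral because the Gaussian coordinates are
  exchangeable.\<close>

lemma VI_ordered:
 fixes m :: nat defines "A \<equiv> {2..<m + 2}"
 shows "VI A L = fact m * (\<integral>\<^sup>+x. ennreal (cpv A L (%i. sqrt 2 * x i)) * indicator (ordset A) x \<partial>PiM A (%_. gauss))"
proof -
 have A: "finite A" "card A = m" by (simp_all add: A_def)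
 define H where "H x = ennreal (cpv A L (%i. sqrt 2 * x i))" for x
 define G where "G x = H x * indicator (ordset A) x" for x
 define r where "r \<pi> x = (\<lambda>i\<in>A. x (\<pi> i))" for \<pi> and x :: "nat => real"
 have Hm: "H \<in> borel_measurable (PiM A (%_. gauss))"
  unfolding H_def using A gauss_component_measurable
  by (intro measurable_compose[OF _ measurable_ennreal] cpv_measurable borel_measurable_times) auto
 have Gm: "G \<in> borel_measurable (PiM A (%_. gauss))"
  unfolding G_def by (intro borel_measurable_times_ennreal Hm ordset_measurable A)
 have rm: "r \<pi> \<in> PiM A (%_. gauss) \<rightarrow>\<^sub>M PiM A (%_. gauss)" if "\<pi> permutes A" for \<pi>
  unfolding r_def by (rule measurable_restrict, rule measurable_component_singleton) (use permutes_in_image[OF that] in simp)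
 have Hr: "H (r \<pi> x) = H x" if "\<pi> permutes A" for \<pi> x
 proof -
  have "cpv A L (%i. sqrt 2 * r \<pi> x i) = cpv A L (%i. sqrt 2 * x (\<pi> i))" by (rule cpv_cong) (simp add: r_def)
  also have "\<dots> = cpv A L (%i. sqrt 2 * x i)" by (rule cpv_permute[OF A(1) that])
  finally show ?thesis by (simp add: H_def)
 qed
 have split: "H x = (\<Sum>\<pi> | \<pi> permutes A. G (r \<pi> x))" for x
 proof (cases "inj_on x A")
  case False
  then obtain i j where "i \<in> A" "j \<in> A" "i < j" "x i = x j" by (metis inj_onI linorder_neqE_nat)
  then have "vdm A (%i. sqrt 2 * x i) = 0"
   unfolding vdm_def by (intro prod_zero finite_pairs A(1) bexI[of _ "(i, j)"]) (auto simp: pairs_def)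
  then have "H x = 0" by (simp add: H_def cpv_def)
  then show ?thesis using Hr by (simp add: G_def)
 next
  case True
  have o: "r \<pi> x \<in> ordset A \<longleftrightarrow> (\<forall>i\<in>A. \<forall>j\<in>A. i \<le> j --> x (\<pi> i) \<le> x (\<pi> j))" for \<pi> by (auto simp: ordset_def r_def)
  have "\<exists>!\<pi>. \<pi> permutes A \<and> r \<pi> x \<in> ordset A"
   unfolding o by (rule ex1_sorting_permutation[of x m, folded A_def, OF True])
  then obtain \<pi>0
   where p0: "\<pi>0 permutes A" "r \<pi>0 x \<in> ordset A" and u: "!!\<pi>. \<pi> permutes A ==> r \<pi> x \<in> ordset A ==> \<pi> = \<pi>0"
   by (elim ex1E conjE) blast
  have "(\<Sum>\<pi> | \<pi> permutes A. G (r \<pi> x)) = (\<Sum>\<pi> | \<pi> permutes A. if \<pi> = \<pi>0 then H x else 0)"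
  proof (rule sum.cong[OF refl])
   fix \<pi> assume "\<pi> \<in> {\<pi>. \<pi> permutes A}"
   then have \<pi>: "\<pi> permutes A" by simp
   show "G (r \<pi> x) = (if \<pi> = \<pi>0 then H x else 0)"
   proof (cases "\<pi> = \<pi>0")
    case True
    then show ?thesis using p0 by (simp add: G_def Hr)
   next
    case False
    then have "r \<pi> x \<notin> ordset A" using u[OF \<pi>] by blast
    then show ?thesis using False by (simp add: G_def)
   qed
  qed
  then show ?thesis using p0(1) finite_permutations[OF A(1)] by simp
 qed
 have "VI A L = (\<integral>\<^sup>+x. (\<Sum>\<pi> | \<pi> permutes A. G (r \<pi> x)) \<partial>PiM A (%_. gauss))"
  unfolding VI_def H_def[symmetric] split[symmetric] ..
 also have "\<dots> = (\<Sum>\<pi> | \<pi> permutes A. \<integral>\<^sup>+x. G (r \<pi> x) \<partial>PiM A (%_. gauss))"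
  by (rule nn_integral_sum) (use measurable_compose[OF rm Gm] in simp)
 also have "\<dots> = (\<Sum>\<pi> | \<pi> permutes A. \<integral>\<^sup>+x. G x \<partial>PiM A (%_. gauss))"
 proof (rule sum.cong[OF refl])
  fix \<pi> assume "\<pi> \<in> {\<pi>. \<pi> permutes A}"
  then have p: "\<pi> permutes A" by simp
  have i: "inj_on \<pi> A" by (rule inj_on_subset[OF permutes_inj[OF p]]) simp
  have "distr (PiM A (%_. gauss)) (PiM A (%_. gauss)) (r \<pi>) = PiM A (%_. gauss)"
   unfolding r_def by (rule distr_PiM_reindex)
    (use i permutes_in_image[OF p] in \<open>auto simp: prob_space_gauss\<close>)
  then show "(\<integral>\<^sup>+x. G (r \<pi> x) \<partial>PiM A (%_. gauss)) = (\<integral>\<^sup>+x. G x \<partial>PiM A (%_. gauss))"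
   using nn_integral_distr[OF rm[OF p], of G] Gm by simp
 qed
 also have "\<dots> = fact m * (\<integral>\<^sup>+x. G x \<partial>PiM A (%_. gauss))"
  using card_permutations[OF A(2,1)] by simp
 finally show ?thesis by (simp add: G_def H_def)
qed

text \<open>The factors \<open>Suc j\<close> accumulated by the recursion multiply to
  \<open>fact m\<close> and cancel the number of orderings, so only the absolute moments remain as a
  constant.\<close>

lemma expected_crit_ordered:
 fixes p m :: nat
 assumes p: "p \<ge> 1" and n: "CARD('n::finite) = Suc m"
 defines "A \<equiv> {2..<m + 2}"
 shows "(\<Prod>j<Suc m. absmom j) * (\<integral>\<^sup>+\<xi>. num_elements (crit True (UNIV :: 'n set) p \<xi>) \<partial>PiM (exps p) (%_. gauss)) =
  2 * (\<integral>\<^sup>+t. (\<integral>\<^sup>+x. ennreal (cpv A [(sqrt (real p) * t, sqrt (real p - 1))] (%i. sqrt 2 * x i)) * indicator (ordset A) x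
   \<partial>PiM A (%_. gauss)) \<partial>gauss)" (is "_ * ?E = 2 * (\<integral>\<^sup>+t. ?V t \<partial>gauss)")
proof -
 obtain i0 :: 'n where True by blast
 define K where "K = UNIV - {i0}"
 have K: "card K = m" using n by (simp add: K_def card_Diff_singleton)
 let ?c = "\<Prod>j<m. absmom j"
 have V: "?c * Dex K [(sqrt (real p) * t, sqrt (real p - 1))] = ?V t" for t
 proof -
  let ?L = "[(sqrt (real p) * t, sqrt (real p - 1))]"
  have "(\<Prod>j<m. absmom j * of_nat (Suc j)) = ?c * (fact m :: ennreal)"
   by (simp add: prod.distrib fact_prod_Suc atLeast0LessThan)
  then have "fact m * (?c * Dex K ?L) = fact m * ?V t"
   using Dex_VI[OF K, of ?L] VI_ordered[of m ?L] by (simp add: A_def mult_ac)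
  moreover have "(fact m :: ennreal) = of_nat (fact m)" by simp
  then have "(fact m :: ennreal) ~= 0" "(fact m :: ennreal) ~= \<top>" by (metis fact_nonzero of_nat_eq_0_iff, metis ennreal_of_nat_neq_top)
  ultimately show ?thesis by (simp add: ennreal_mult_cancel_left)
 qed
 have "(\<Prod>j<Suc m. absmom j) * ?E = ?c * (absmom (card K) * ?E)" unfolding K by (simp add: mult_ac)
 also have "absmom (card K) * ?E = 2 * (\<integral>\<^sup>+t. Dex K [(sqrt (real p) * t, sqrt (real p - 1))] \<partial>gauss)"
  unfolding K_def by (rule expected_crit[OF p])
 also have "?c * \<dots> = 2 * (\<integral>\<^sup>+t. ?c * Dex K [(sqrt (real p) * t, sqrt (real p - 1))] \<partial>gauss)"
 proof -
  have "?c * (\<integral>\<^sup>+t. Dex K [(sqrt (real p) * t, sqrt (real p - 1))] \<partial>gauss) = (\<integral>\<^sup>+t. ?c * Dex K [(sqrt (real p) * t, sqrt (real p - 1))] \<partial>gauss)"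
   by (rule nn_integral_cmult[symmetric], rule Dex_measurable) (simp add: gauss_def)
  then show ?thesis by (simp only: mult.left_commute)
 qed
 finally show ?thesis unfolding V .
qed

section \<open>The power manifold\<close>

lemma mcoeff_scale: "mcoeff (const_poly c * f) \<alpha> = c * mcoeff f \<alpha>"
 unfolding const_poly_def mult_map_scale_conv_mult[symmetric] by (simp add: map.rep_eq when_def)

lemma mcoeff_power:
 "mcoeff (linear_form (u :: real^'n::finite) ^ p) \<alpha> = (if \<alpha> \<in> exps p then multinom p \<alpha> * mon \<alpha> u else 0)"
proof -
 have "linear_form u ^ p = (\<Sum>\<alpha>\<in>exps p. Poly_Mapping.single \<alpha> (multinom p \<alpha> * mon \<alpha> u))"
 proof (induction p)
  case 0
  have "multinom 0 (0 :: 'n \<Rightarrow>\<^sub>0 nat) = 1" "mon 0 u = 1" by (simp_all add: multinom_def mon_def)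
  then show ?case by (simp add: exps_0 single_one)
 next
  case (Suc p)
  have lf: "linear_form u = (\<Sum>i\<in>UNIV. Poly_Mapping.single (unit_exp i) (u $ i))"
   by (simp add: linear_form_def const_poly_def var_poly_def mult_single)
  have "linear_form u ^ Suc p = linear_form u * (\<Sum>\<alpha>\<in>exps p. Poly_Mapping.single \<alpha> (multinom p \<alpha> * mon \<alpha> u))"
   by (simp only: power_Suc Suc)
  also have "\<dots> = (\<Sum>i\<in>UNIV. \<Sum>\<alpha>\<in>exps p. Poly_Mapping.single (\<alpha> + unit_exp i) (multinom p \<alpha> * mon (\<alpha> + unit_exp i) u))"
   unfolding lf sum_product mult_single mon_add mon_unit by (simp add: add.commute mult_ac)
  also have "\<dots> = (\<Sum>\<alpha>\<in>exps (Suc p). Poly_Mapping.single \<alpha> (multinom (Suc p) \<alpha> * mon \<alpha> u))" (is "?l = ?r")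
  proof (rule poly_mapping_eqI)
   fix \<gamma>
   define F where "F \<beta> = (if \<beta> = \<gamma> then mon \<beta> u else 0)" for \<beta>
   have s: "mcoeff (Poly_Mapping.single \<beta> (c * mon \<beta> u)) \<gamma> = c * F \<beta>" for \<beta> c
    by (auto simp: F_def lookup_single when_def)
   show "mcoeff ?l \<gamma> = mcoeff ?r \<gamma>"
    unfolding lookup_sum s by (rule multinomial_step)
  qed
  finally show ?case .
 qed
 then show ?thesis by (simp add: lookup_sum lookup_single when_def if_distrib cong: if_cong)
qed

lemma sym_power_iff: "f \<in> sym_power p \<longleftrightarrow> (\<forall>\<alpha>. \<alpha> \<notin> exps p --> mcoeff f \<alpha> = 0)"
 by (auto simp: sym_power_def exps_def in_keys_iff)

lemma bombieri_sum:
 assumes "f \<in> sym_power p"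
 shows "bombieri p f g = (\<Sum>\<alpha>\<in>exps p. mcoeff f \<alpha> * mcoeff g \<alpha> / multinom p \<alpha>)"
 unfolding bombieri_def multinom_def
 by (rule sum.mono_neutral_cong_left) (use assms in \<open>auto simp: sym_power_iff in_keys_iff\<close>)

text \<open>Coordinates in the orthonormal basis of scaled monomials: with them \<open>fld\<close>
  evaluates the polynomial, and the Bombieri product becomes the standard inner product.\<close>

definition coord :: "nat => ('n::finite) mpoly => ('n \<Rightarrow>\<^sub>0 nat) => real" where
 "coord p f \<alpha> = mcoeff f \<alpha> / sqrt (multinom p \<alpha>)"

lemma coord_mult: "coord p f \<alpha> * (sqrt (multinom p \<alpha>) * c) = mcoeff f \<alpha> * c"
 using multinom_pos[of p \<alpha>] by (simp add: coord_def)

lemma fld_coord: "fld p (coord p f) y = (\<Sum>\<alpha>\<in>exps p. mcoeff f \<alpha> * mon \<alpha> y)"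
 and dfld_coord: "dfld i p (coord p f) y = (\<Sum>\<alpha>\<in>exps p. mcoeff f \<alpha> * dmon i \<alpha> y)"
 by (simp_all add: fld_def dfld_def coord_mult)

lemma fld_power: "fld p (coord p (linear_form u ^ p)) y = (u \<bullet> y) ^ p"
 unfolding fld_coord bombieri_kernel[symmetric] by (intro sum.cong refl) (simp add: mcoeff_power)

lemma dfld_power: "dfld i p (coord p (linear_form u ^ p)) u = real p * (u \<bullet> u) ^ (p - 1) * u $ i"
proof -
 have "(fld p (coord p (linear_form u ^ p)) has_derivative (%w. real p * (u \<bullet> w) * (u \<bullet> u) ^ (p - 1))) (at u)"
  unfolding fld_power[abs_def] by (rule has_derivative_power[THEN has_derivative_eq_rhs]) (auto intro!: derivative_eq_intros)
 from has_derivative_unique[OF this fld_has_derivative]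
 have "real p * (u \<bullet> axis i 1) * (u \<bullet> u) ^ (p - 1) = (\<Sum>j\<in>UNIV. dfld j p (coord p (linear_form u ^ p)) u * axis i 1 $ j)"
  by (rule fun_cong)
 also have "\<dots> = dfld i p (coord p (linear_form u ^ p)) u"
  by (simp add: axis_def if_distrib[of "%c. _ * c"] cong: if_cong)
 finally show ?thesis by (simp add: inner_axis mult_ac)
qed

lemma linear_form_power_nonzero: "u ~= 0 ==> linear_form (u :: real^'n::finite) ^ p ~= 0"
 using fld_power[of p u u] by (auto simp: fld_coord)

lemma power_in_sym_power: "linear_form (u :: real^'n::finite) ^ p \<in> sym_power p" "- (linear_form u ^ p) \<in> sym_power p"
 by (auto simp: sym_power_iff mcoeff_power)

lemma power_manifold_eq:
 assumes p: "p \<ge> 1"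
 shows "power_manifold p = {const_poly \<epsilon> * linear_form u ^ p | \<epsilon> u. (\<epsilon> = 1 \<or> \<epsilon> = -1) \<and> u ~= (0 :: real^'n::finite)}" (is "_ = ?R")
proof -
 have "const_poly 1 * f = f" "const_poly (-1) * f = - f" for f :: "'n mpoly"
  by (rule poly_mapping_eqI, simp add: mcoeff_scale)+
 moreover have "linear_form (0 :: real^'n) ^ p = 0"
  using p by (intro poly_mapping_eqI) (auto simp: mcoeff_power mon_def exps_def)
 ultimately have c: "const_poly 1 * f = f" "const_poly (-1) * f = - f" "linear_form (0 :: real^'n) ^ p = 0" for f :: "'n mpoly" by auto
 show ?thesis
 proof (intro set_eqI iffI)
  fix x :: "'n mpoly" assume "x \<in> power_manifold p"
  then obtain u where u: "x ~= 0" "x = linear_form u ^ p \<or> x = - (linear_form u ^ p)" unfolding power_manifold_def by blast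
  then have "u ~= 0" using c(3) by auto
  moreover have "x = const_poly 1 * linear_form u ^ p \<or> x = const_poly (-1) * linear_form u ^ p" using u(2) by (simp only: c)
  ultimately show "x \<in> ?R" by blast
 next
  fix x assume "x \<in> ?R"
  then obtain \<epsilon> u where u: "x = const_poly \<epsilon> * linear_form u ^ p" "\<epsilon> = 1 \<or> \<epsilon> = -1" "u ~= 0" by blast
  then have "x = linear_form u ^ p \<or> x = - (linear_form u ^ p)" using c by auto
  moreover from this have "x ~= 0" using linear_form_power_nonzero[OF u(3), of p] by auto
  ultimately show "x \<in> power_manifold p" unfolding power_manifold_def by blast
 qed
qed

text \<open>The curve is the signed p-th power of the line u + t z. Its coefficients are polynomials
  in t, so iterated formal derivatives provide the whole sequence of derivatives that the definition
  of the tangent space asks for.\<close>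

lemma tangent_exists:
 fixes u z :: "real^'n::finite"
 assumes p: "p \<ge> 1" and \<epsilon>: "\<epsilon> = 1 \<or> \<epsilon> = -1" and u: "u ~= 0"
 shows "\<exists>w\<in>tangent_space (power_manifold p) (const_poly \<epsilon> * linear_form u ^ p).
  \<forall>\<alpha>\<in>exps p. mcoeff w \<alpha> = \<epsilon> * (multinom p \<alpha> * (\<Sum>i\<in>UNIV. dmon i \<alpha> u * z $ i))"
proof -
 define P where "P \<alpha> = [:\<epsilon> * multinom p \<alpha>:] * (\<Prod>i\<in>UNIV. [:u $ i, z $ i:] ^ Poly_Mapping.lookup \<alpha> i)" for \<alpha>
 define c where "c k t = (\<Sum>\<alpha>\<in>exps p. Poly_Mapping.single \<alpha> (poly ((pderiv ^^ k) (P \<alpha>)) t))" for k t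
 have lc: "mcoeff (c k t) \<alpha> = (if \<alpha> \<in> exps p then poly ((pderiv ^^ k) (P \<alpha>)) t else 0)" for k t \<alpha>
  by (simp add: c_def lookup_sum lookup_single when_def if_distrib cong: if_cong)
 have P: "poly (P \<alpha>) t = \<epsilon> * (multinom p \<alpha> * mon \<alpha> (u + t *\<^sub>R z))" for \<alpha> t
  by (simp add: P_def poly_prod mon_def)
 have c0: "c 0 t = const_poly \<epsilon> * linear_form (u + t *\<^sub>R z) ^ p" for t
  by (rule poly_mapping_eqI) (simp add: lc P mcoeff_scale mcoeff_power)
 \<comment> \<open>For |t| below this bound the line avoids 0, where it would leave the manifold;
   the summand 1 covers z = 0.\<close>
 define \<delta> where "\<delta> = norm u / (norm z + 1)"
 have \<delta>: "\<delta> > 0" using u unfolding \<delta>_def by (intro divide_pos_pos) (auto intro: add_nonneg_pos)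
 have nz: "u + t *\<^sub>R z ~= 0" if "t \<in> {-\<delta><..<\<delta>}" for t
 proof
  assume "u + t *\<^sub>R z = 0"
  then have "norm u = \<bar>t\<bar> * norm z" by (metis add_eq_0_iff norm_minus_cancel norm_scaleR)
  also have "\<dots> \<le> \<bar>t\<bar> * (norm z + 1)" by (intro mult_left_mono) auto
  also have "\<dots> < \<delta> * (norm z + 1)" using that by (intro mult_strict_right_mono) (auto intro: add_nonneg_pos)
  also have "\<dots> = norm u" unfolding \<delta>_def by (simp add: add_nonneg_eq_0_iff)
  finally show False by simp
 qed
 have "c 1 0 \<in> tangent_space (power_manifold p) (const_poly \<epsilon> * linear_form u ^ p)"
  unfolding tangent_space_def
 proof (intro CollectI exI[of _ \<delta>] exI[of _ c] conjI ballI allI)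
  show "c 0 0 = const_poly \<epsilon> * linear_form u ^ p" by (simp add: c0)
  fix t assume t: "t \<in> {-\<delta><..<\<delta>}"
  show "c 0 t \<in> power_manifold p" unfolding c0 power_manifold_eq[OF p] using \<epsilon> nz[OF t] by blast
  show "((%s. mcoeff (c k s) \<alpha>) has_real_derivative mcoeff (c (Suc k) t) \<alpha>) (at t)" for k \<alpha>
   by (cases "\<alpha> \<in> exps p") (simp_all add: lc poly_DERIV)
 qed (use \<delta> in auto)
 moreover have "mcoeff (c 1 0) \<alpha> = \<epsilon> * (multinom p \<alpha> * (\<Sum>i\<in>UNIV. dmon i \<alpha> u * z $ i))" if "\<alpha> \<in> exps p" for \<alpha>
 proof -
  have "((%t. u + t *\<^sub>R z) has_derivative (%h. h *\<^sub>R z)) (at 0)" by (auto intro!: derivative_eq_intros)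
  moreover have "(mon \<alpha> has_derivative (%w. \<Sum>i\<in>UNIV. dmon i \<alpha> u * w $ i)) (at (u + 0 *\<^sub>R z))" using mon_has_derivative[of \<alpha> u] by simp
  ultimately have "((%t. mon \<alpha> (u + t *\<^sub>R z)) has_derivative (%h. \<Sum>i\<in>UNIV. dmon i \<alpha> u * (h *\<^sub>R z) $ i)) (at 0)"
   by (rule has_derivative_compose)
  then have "((%t. \<epsilon> * (multinom p \<alpha> * mon \<alpha> (u + t *\<^sub>R z))) has_derivative
   (%h. \<epsilon> * (multinom p \<alpha> * (\<Sum>i\<in>UNIV. dmon i \<alpha> u * (h *\<^sub>R z) $ i)))) (at 0)"
   by (intro has_derivative_mult_right)
  then have "(poly (P \<alpha>) has_real_derivative \<epsilon> * (multinom p \<alpha> * (\<Sum>i\<in>UNIV. dmon i \<alpha> u * z $ i))) (at 0)"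
   unfolding has_field_derivative_def P[abs_def]
   by (rule has_derivative_eq_rhs) (auto simp: fun_eq_iff sum_distrib_left mult_ac)
  from DERIV_unique[OF this poly_DERIV] show ?thesis using that by (simp add: lc)
 qed
 ultimately show ?thesis by blast
qed

text \<open>A curve in the manifold is given by its coefficients, and lifting it to vectors u would
  involve choices of signs and roots. Instead it is factored near 0 as \<open>B i t\<close> times
  the p-th power of a direction \<open>h t\<close> with i-th coordinate 1. Both factors are rational
  in the coefficients, hence differentiable, and the product rule gives the form of the
  velocity.\<close>

lemma tangent_form:
 fixes u :: "real^'n::finite"
 assumes p: "p \<ge> 1" and \<epsilon>: "\<epsilon> = 1 \<or> \<epsilon> = -1" and u: "u ~= 0"
  and w: "w \<in> tangent_space (power_manifold p) (const_poly \<epsilon> * linear_form u ^ p)"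
 shows "\<exists>z :: real^'n. \<forall>\<alpha>\<in>exps p. mcoeff w \<alpha> = multinom p \<alpha> * (\<Sum>i\<in>UNIV. dmon i \<alpha> u * z $ i)"
proof -
 obtain i where i: "u $ i ~= 0" using u by (auto simp: vec_eq_iff)
 from w obtain \<delta> c where \<delta>: "\<delta> > 0" and c0: "c 0 0 = const_poly \<epsilon> * linear_form u ^ p" and c1: "c (1::nat) 0 = w"
  and cX: "!!t. t \<in> {-\<delta><..<\<delta>} ==> c 0 t \<in> power_manifold p"
  and cd: "!!t k \<alpha>. t \<in> {-\<delta><..<\<delta>} ==> ((%s. mcoeff (c k s) \<alpha>) has_real_derivative mcoeff (c (Suc k) t) \<alpha>) (at t)"
  unfolding tangent_space_def by blast
 \<comment> \<open>At a point \<epsilon> x^p this is \<open>\<epsilon> * x_i^(p-1) * x_j\<close>, so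
   the quotients \<open>B j t / B i t\<close> are the ratios x_j / x_i.\<close>
 define B where "B j t = mcoeff (c 0 t) (bexp i p j) / multinom p (bexp i p j)" for j t
 have bd: "((%t. mcoeff (c 0 t) \<alpha>) has_real_derivative mcoeff w \<alpha>) (at 0)" for \<alpha>
  using cd[of 0 0 \<alpha>] \<delta> c1 by simp
 define B' where "B' j = mcoeff w (bexp i p j) / multinom p (bexp i p j)" for j
 have Bd: "(B j has_real_derivative B' j) (at 0)" for j
  unfolding B_def B'_def by (rule DERIV_cdivide[OF bd])
 have mb: "mon (bexp i p j) x = x $ i ^ (p - 1) * x $ j" for x :: "real^'n" and j
  by (simp add: bexp_def mon_add mon_unit mon_single)
 have pp: "x ^ (p - 1) * x = x ^ p" for x :: real using p by (metis power_minus_mult less_le_trans zero_less_one)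
 have B_eq: "B j t = \<epsilon>' * (x $ i ^ (p - 1) * x $ j)" if "c 0 t = const_poly \<epsilon>' * linear_form x ^ p" for j t \<epsilon>' x
  using exps_bexp[OF p, of i j] multinom_pos[of p "bexp i p j"]
  by (simp add: B_def that mcoeff_scale mcoeff_power mb)
 have B0: "B i 0 ~= 0" using B_eq[OF c0, of i] i \<epsilon> by auto
 define h :: "real => real^'n" where "h t = (\<chi> j. B j t / B i t)" for t
 have h0: "h 0 = (1 / u $ i) *\<^sub>R u"
  using i \<epsilon> by (auto simp: h_def vec_eq_iff B_eq[OF c0])
 define q where "q j = (B' j * B i 0 - B j 0 * B' i) / (B i 0 * B i 0)" for j
 have hd: "(h has_derivative (%s. s *\<^sub>R (\<chi> j. q j))) (at 0)"
 proof (subst has_derivative_componentwise_within, rule ballI)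
  fix b :: "real^'n" assume "b \<in> Basis"
  then obtain j where b: "b = axis j 1" by (auto simp: Basis_vec_def)
  have "((%t. B j t / B i t) has_real_derivative q j) (at 0)"
   unfolding q_def by (rule DERIV_divide[OF Bd Bd B0])
  then show "((%t. h t \<bullet> b) has_derivative (%s. (s *\<^sub>R (\<chi> j. q j)) \<bullet> b)) (at 0)"
   by (simp add: b inner_axis h_def has_field_derivative_def mult_commute_abs)
 qed
 have ev: "\<forall>\<^sub>F t in at 0. mcoeff (c 0 t) \<alpha> = B i t * (multinom p \<alpha> * mon \<alpha> (h t))" if \<alpha>: "\<alpha> \<in> exps p" for \<alpha>
 proof -
  have "B i \<midarrow>0\<rightarrow> B i 0" using DERIV_isCont[OF Bd[of i]] by (simp add: isCont_def)
  then have 1: "\<forall>\<^sub>F t in at 0. B i t ~= 0" using B0 by (rule tendsto_imp_eventually_ne)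
  have 2: "\<forall>\<^sub>F t in at 0. t \<in> {-\<delta><..<\<delta>}" using \<delta> by (intro eventually_at_in_open') auto
  show ?thesis using 1 2
  proof eventually_elim
   case (elim t)
   from cX[OF elim(2)] obtain \<epsilon>' x where x: "c 0 t = const_poly \<epsilon>' * linear_form x ^ p"
    unfolding power_manifold_eq[OF p] by blast
   have nz: "\<epsilon>' ~= 0" "x $ i ~= 0" using elim(1) B_eq[OF x, of i] pp[of "x $ i"] p by auto
   have "h t = (1 / x $ i) *\<^sub>R x" using nz by (auto simp: h_def vec_eq_iff B_eq[OF x])
   then have "mon \<alpha> (h t) = (1 / x $ i) ^ p * mon \<alpha> x" by (simp only: mon_scale[OF \<alpha>])
   then show ?case using nz \<alpha> by (simp add: x mcoeff_scale mcoeff_power B_eq[OF x] pp[unfolded One_nat_def] power_one_over)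
  qed
 qed
 have main: "mcoeff w \<alpha> = multinom p \<alpha> * (\<Sum>j\<in>UNIV. dmon j \<alpha> u * ((1 / u $ i) ^ (p - 1) * (B' i / real p * h 0 $ j + B i 0 * q j)))"
  if \<alpha>: "\<alpha> \<in> exps p" for \<alpha>
 proof -
  have "((%t. mon \<alpha> (h t)) has_derivative (%s. \<Sum>j\<in>UNIV. dmon j \<alpha> (h 0) * (s *\<^sub>R (\<chi> j. q j)) $ j)) (at 0)"
   by (rule has_derivative_compose[OF hd mon_has_derivative])
  then have "((%t. mon \<alpha> (h t)) has_real_derivative (\<Sum>j\<in>UNIV. dmon j \<alpha> (h 0) * q j)) (at 0)"
   unfolding has_field_derivative_def by (rule has_derivative_eq_rhs) (auto simp: fun_eq_iff sum_distrib_left mult_ac)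
  then have "((%t. B i t * (multinom p \<alpha> * mon \<alpha> (h t))) has_real_derivative
    B' i * (multinom p \<alpha> * mon \<alpha> (h 0)) + multinom p \<alpha> * (\<Sum>j\<in>UNIV. dmon j \<alpha> (h 0) * q j) * B i 0) (at 0)"
   by (intro DERIV_mult Bd DERIV_cmult)
  moreover have "((%t. B i t * (multinom p \<alpha> * mon \<alpha> (h t))) has_real_derivative mcoeff w \<alpha>) (at 0)"
  proof -
   have "mcoeff (c 0 0) \<alpha> = B i 0 * (multinom p \<alpha> * mon \<alpha> (h 0))"
    using i \<alpha> by (simp only: h0 mon_scale[OF \<alpha>]) (simp add: c0 mcoeff_scale mcoeff_power B_eq[OF c0] pp[unfolded One_nat_def] power_one_over)
   then have ev': "\<forall>\<^sub>F t in nhds 0. mcoeff (c 0 t) \<alpha> = B i t * (multinom p \<alpha> * mon \<alpha> (h t))"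
    using ev[OF \<alpha>] by (simp add: eventually_nhds_conv_at)
   show ?thesis by (rule iffD1[OF DERIV_cong_ev[OF refl ev' refl] bd])
  qed
  ultimately have "B' i * (multinom p \<alpha> * mon \<alpha> (h 0)) + multinom p \<alpha> * (\<Sum>j\<in>UNIV. dmon j \<alpha> (h 0) * q j) * B i 0 = mcoeff w \<alpha>"
   by (rule DERIV_unique)
  then have "mcoeff w \<alpha> = B' i * (multinom p \<alpha> * mon \<alpha> (h 0)) + multinom p \<alpha> * (\<Sum>j\<in>UNIV. dmon j \<alpha> (h 0) * q j) * B i 0"
   by (rule sym)
  \<comment> \<open>Euler's identity writes the term from the derivative of \<open>B i\<close> as a
    derivative in the direction \<open>h 0\<close>, so that both terms combine into one
    direction.\<close>
  also have "mon \<alpha> (h 0) = (\<Sum>j\<in>UNIV. h 0 $ j * dmon j \<alpha> (h 0)) / real p"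
  proof -
   have "(\<Sum>j\<in>UNIV. h 0 $ j * dmon j \<alpha> (h 0)) = real (\<Sum>j\<in>UNIV. Poly_Mapping.lookup \<alpha> j) * mon \<alpha> (h 0)"
    by (simp add: coord_dmon sum_distrib_right)
   also have "(\<Sum>j\<in>UNIV. Poly_Mapping.lookup \<alpha> j) = p" using \<alpha> by (simp add: exps_def)
   finally show ?thesis using p by simp
  qed
  also have "B' i * (multinom p \<alpha> * ((\<Sum>j\<in>UNIV. h 0 $ j * dmon j \<alpha> (h 0)) / real p)) + multinom p \<alpha> * (\<Sum>j\<in>UNIV. dmon j \<alpha> (h 0) * q j) * B i 0 =
   multinom p \<alpha> * (\<Sum>j\<in>UNIV. dmon j \<alpha> (h 0) * (B' i / real p * h 0 $ j + B i 0 * q j))"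
   by (simp add: distrib_left sum.distrib sum_distrib_left sum_divide_distrib mult_ac)
  finally have w: "mcoeff w \<alpha> = multinom p \<alpha> * (\<Sum>j\<in>UNIV. dmon j \<alpha> (h 0) * (B' i / real p * h 0 $ j + B i 0 * q j))" .
  have dm: "dmon j \<alpha> (h 0) = dmon j \<alpha> u * (1 / u $ i) ^ (p - 1)" for j
   unfolding h0 dmon_scale[OF \<alpha>] by (rule mult.commute)
  show ?thesis unfolding w dm mult.assoc ..
 qed
 show ?thesis
  by (rule exI[of _ "\<chi> j. (1 / u $ i) ^ (p - 1) * (B' i / real p * h 0 $ j + B i 0 * q j)"]) (simp add: main)
qed

text \<open>Tangent vectors at \<epsilon> u^p are derivatives of powers in directions z, and pairing
  v - x with one of them is, up to sign, the derivative of the polynomial v - x at u in direction z.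
  Orthogonality to all of them therefore means that its gradient at u vanishes, and
  \<open>dfld_power\<close> supplies the part of x.\<close>

lemma critical_iff:
 fixes u :: "real^'n::finite"
 assumes p: "p \<ge> 1" and \<epsilon>: "\<epsilon> = 1 \<or> \<epsilon> = -1" and u: "u ~= 0" and v: "v \<in> sym_power p"
 shows "const_poly \<epsilon> * linear_form u ^ p \<in> critical_points p (power_manifold p) v \<longleftrightarrow>
  (\<forall>i. dfld i p (coord p v) u = \<epsilon> * (real p * (u \<bullet> u) ^ (p - 1) * u $ i))"
proof -
 define x where "x = const_poly \<epsilon> * linear_form u ^ p"
 define D where "D i = dfld i p (coord p v) u - \<epsilon> * (real p * (u \<bullet> u) ^ (p - 1) * u $ i)" for i
 have xX: "x \<in> power_manifold p" unfolding x_def power_manifold_eq[OF p] using \<epsilon> u by blast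
 have vx: "v - x \<in> sym_power p"
  using v by (auto simp: sym_power_iff lookup_minus x_def mcoeff_scale mcoeff_power)
 have D: "D i = (\<Sum>\<alpha>\<in>exps p. mcoeff (v - x) \<alpha> * dmon i \<alpha> u)" for i
  unfolding D_def dfld_power[symmetric] dfld_coord
  by (simp add: x_def mcoeff_scale lookup_minus sum_distrib_left left_diff_distrib sum_subtractf mult.assoc)
 have form: "bombieri p (v - x) w = c * (\<Sum>i\<in>UNIV. z $ i * D i)"
  if "\<forall>\<alpha>\<in>exps p. mcoeff w \<alpha> = c * (multinom p \<alpha> * (\<Sum>i\<in>UNIV. dmon i \<alpha> u * z $ i))" for w c and z :: "real^'n"
 proof -
  have "bombieri p (v - x) w = (\<Sum>\<alpha>\<in>exps p. \<Sum>i\<in>UNIV. c * (z $ i * (mcoeff (v - x) \<alpha> * dmon i \<alpha> u)))"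
   unfolding bombieri_sum[OF vx]
  proof (rule sum.cong[OF refl])
   fix \<alpha> :: "'n \<Rightarrow>\<^sub>0 nat" assume \<alpha>: "\<alpha> \<in> exps p"
   have "multinom p \<alpha> ~= 0" using multinom_pos[of p \<alpha>] by simp
   then have "mcoeff w \<alpha> / multinom p \<alpha> = c * (\<Sum>i\<in>UNIV. dmon i \<alpha> u * z $ i)" using that \<alpha> by simp
   then have "mcoeff (v - x) \<alpha> * mcoeff w \<alpha> / multinom p \<alpha> = mcoeff (v - x) \<alpha> * (c * (\<Sum>i\<in>UNIV. dmon i \<alpha> u * z $ i))"
    by (simp only: times_divide_eq_right[symmetric])
   then show "mcoeff (v - x) \<alpha> * mcoeff w \<alpha> / multinom p \<alpha> = (\<Sum>i\<in>UNIV. c * (z $ i * (mcoeff (v - x) \<alpha> * dmon i \<alpha> u)))"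
    by (simp add: sum_distrib_left mult_ac)
  qed
  also have "\<dots> = c * (\<Sum>i\<in>UNIV. z $ i * D i)"
   unfolding D sum_distrib_left by (rule sum.swap)
  finally show ?thesis .
 qed
 have "x \<in> critical_points p (power_manifold p) v \<longleftrightarrow> (\<forall>i. D i = 0)"
 proof
  assume c: "x \<in> critical_points p (power_manifold p) v"
  show "\<forall>i. D i = 0"
  proof
   fix i
   obtain w where w: "w \<in> tangent_space (power_manifold p) x"
     "\<forall>\<alpha>\<in>exps p. mcoeff w \<alpha> = \<epsilon> * (multinom p \<alpha> * (\<Sum>j\<in>UNIV. dmon j \<alpha> u * axis i 1 $ j))"
    using tangent_exists[OF p \<epsilon> u, of "axis i 1"] unfolding x_def[symmetric] by blast
   have "bombieri p (v - x) w = \<epsilon> * (\<Sum>j\<in>UNIV. axis i 1 $ j * D j)" by (rule form[OF w(2)])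
   also have "(\<Sum>j\<in>UNIV. axis i 1 $ j * D j) = D i" by (simp add: axis_def if_distrib[of "%c. c * _"] cong: if_cong)
   finally show "D i = 0" using c w(1) \<epsilon> by (auto simp: critical_points_def)
  qed
 next
  assume D0: "\<forall>i. D i = 0"
  have "bombieri p (v - x) w = 0" if w: "w \<in> tangent_space (power_manifold p) x" for w
  proof -
   obtain z :: "real^'n" where z: "\<forall>\<alpha>\<in>exps p. mcoeff w \<alpha> = multinom p \<alpha> * (\<Sum>i\<in>UNIV. dmon i \<alpha> u * z $ i)"
    using tangent_form[OF p \<epsilon> u] w unfolding x_def[symmetric] by blast
   show ?thesis using form[of w 1 z] z D0 by simp
  qed
  then show "x \<in> critical_points p (power_manifold p) v" using xX by (simp add: critical_points_def)
 qed
 then show ?thesis by (simp add: x_def D_def)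
qed

section \<open>From critical points on the sphere to critical points on the manifold\<close>

definition crit_image :: "nat => ('n::finite) mpoly => real^'n => 'n mpoly" where
 "crit_image p v s = const_poly (sgn (fld p (coord p v) s)) * linear_form (root p \<bar>fld p (coord p v) s\<bar> *\<^sub>R s) ^ p"

lemma fld_scaled_power: "fld p (coord p (const_poly c * linear_form u ^ p)) y = c * (u \<bullet> y) ^ p"
 unfolding fld_power[symmetric] fld_coord by (simp add: mcoeff_scale sum_distrib_left mult.assoc)

text \<open>The sign and the p-th root in \<open>crit_image\<close> exhibit the form of a member of
  the manifold. As a polynomial it is s^p times the value at s, which for a unit vector s is the
  orthogonal projection of v to the line of s^p.\<close>

lemma fld_crit_image:
 assumes "p \<ge> 1"
 shows "fld p (coord p (crit_image p v s)) y = fld p (coord p v) s * (s \<bullet> y) ^ p"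
proof -
 let ?f = "fld p (coord p v) s"
 have "(root p \<bar>?f\<bar>) ^ p = \<bar>?f\<bar>" using assms by (intro real_root_pow_pos2) auto
 moreover have "sgn ?f * \<bar>?f\<bar> = ?f" by (rule sgn_mult_abs)
 ultimately show ?thesis
  unfolding crit_image_def fld_scaled_power by (simp add: power_mult_distrib mult.assoc[symmetric])
qed

text \<open>Homogeneity passes between u and the unit vector in its direction. For a critical point
  \<epsilon> u^p, Euler's identity gives f(u) = \<epsilon> |u|^(2p), so the value at the unit vector
  is \<epsilon> |u|^p: it is nonzero and determines both the sign and the length.\<close>

lemma crit_image_onto:
 assumes p: "p \<ge> 1" and v: "v \<in> sym_power p"
 shows "crit_image p v ` crit True UNIV p (coord p v) = critical_points p (power_manifold p) (v :: ('n::finite) mpoly)"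
proof (intro set_eqI iffI)
 fix x assume "x \<in> crit_image p v ` crit True UNIV p (coord p v)"
 then obtain s where s: "norm s = 1" "crit_eq UNIV p (coord p v) s" "fld p (coord p v) s ~= 0" and x: "x = crit_image p v s"
  by (auto simp: crit_def)
 define f where "f = fld p (coord p v) s"
 define c where "c = root p \<bar>f\<bar>"
 have f: "f ~= 0" using s(3) by (simp add: f_def)
 have c: "c > 0" "c ^ p = \<bar>f\<bar>" unfolding c_def using f p by (auto intro: real_root_pow_pos2)
 have ss: "s \<bullet> s = 1" using s(1) by (simp add: norm_eq_1)
 have \<epsilon>: "sgn f = 1 \<or> sgn f = -1" using f by (auto simp: sgn_if)
 have cs: "c *\<^sub>R s ~= 0" using c s(1) by auto
 have cp: "c ^ (p - 1) * c = \<bar>f\<bar>" using p c(2) by (metis power_minus_mult less_le_trans zero_less_one)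
 have "dfld i p (coord p v) (c *\<^sub>R s) = sgn f * (real p * ((c *\<^sub>R s) \<bullet> (c *\<^sub>R s)) ^ (p - 1) * (c *\<^sub>R s) $ i)" for i
 proof -
  have "dfld i p (coord p v) s = real p * f * s $ i" using s(2) by (simp add: crit_eq_def ss f_def)
  then have "dfld i p (coord p v) (c *\<^sub>R s) = c ^ (p - 1) * (real p * (sgn f * \<bar>f\<bar>) * s $ i)"
   by (simp add: dfld_scale sgn_mult_abs)
  also have "\<dots> = sgn f * (real p * (c ^ (p - 1) * c ^ (p - 1)) * (c * s $ i))"
   unfolding cp[symmetric] by (simp only: mult_ac)
  also have "c ^ (p - 1) * c ^ (p - 1) = ((c *\<^sub>R s) \<bullet> (c *\<^sub>R s)) ^ (p - 1)" by (simp add: ss power_mult_distrib)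
  finally show ?thesis by simp
 qed
 then show "x \<in> critical_points p (power_manifold p) v"
  unfolding x crit_image_def f_def[symmetric] c_def[symmetric] critical_iff[OF p \<epsilon> cs v] by blast
next
 fix x assume xc: "x \<in> critical_points p (power_manifold p) v"
 then obtain \<epsilon> and u :: "real^'n" where \<epsilon>: "\<epsilon> = 1 \<or> \<epsilon> = -1" and u: "u ~= 0" and x: "x = const_poly \<epsilon> * linear_form u ^ p"
  unfolding critical_points_def power_manifold_eq[OF p] by blast
 let ?\<xi> = "coord p v"
 have d: "dfld i p ?\<xi> u = \<epsilon> * (real p * (u \<bullet> u) ^ (p - 1) * u $ i)" for i
  using xc unfolding x critical_iff[OF p \<epsilon> u v] by blast
 have uu: "(u \<bullet> u) ^ (p - 1) * (u \<bullet> u) = (u \<bullet> u) ^ p" using p by (metis power_minus_mult less_le_trans zero_less_one)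
 have "real p * fld p ?\<xi> u = (\<Sum>i\<in>UNIV. u $ i * dfld i p ?\<xi> u)" by (rule euler_fld[symmetric])
 also have "\<dots> = \<epsilon> * real p * (u \<bullet> u) ^ (p - 1) * (\<Sum>i\<in>UNIV. u $ i * u $ i)" by (simp add: d sum_distrib_left mult_ac)
 also have "(\<Sum>i\<in>UNIV. u $ i * u $ i) = u \<bullet> u" by (simp add: inner_vec_def)
 finally have fu: "fld p ?\<xi> u = \<epsilon> * (u \<bullet> u) ^ p" using p uu by (simp add: mult.assoc)
 have "crit_eq UNIV p ?\<xi> u"
  unfolding crit_eq_def d fu uu[symmetric] by (simp add: mult_ac)
 define s where "s = (1 / norm u) *\<^sub>R u"
 have s: "norm s = 1" using u by (simp add: s_def)
 have cs: "crit_eq UNIV p ?\<xi> s"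
  unfolding s_def by (subst crit_eq_scale) (use \<open>crit_eq UNIV p ?\<xi> u\<close> u p in auto)
 have fs: "fld p ?\<xi> s = \<epsilon> * norm u ^ p"
  unfolding s_def fld_scale fu using u
  by (simp add: power2_norm_eq_inner[symmetric] power_mult[symmetric] power_one_over mult_2 power_add)
 have np: "norm u ^ p > 0" using u by simp
 have "s \<in> crit True UNIV p ?\<xi>" using s cs fs np \<epsilon> u by (auto simp: crit_def coord_space_def)
 moreover have "x = crit_image p v s"
 proof -
  have "\<bar>fld p ?\<xi> s\<bar> = norm u ^ p" "sgn (fld p ?\<xi> s) = \<epsilon>" using fs np \<epsilon> u by (auto simp: abs_mult sgn_mult)
  moreover have "root p (norm u ^ p) = norm u" using p by (intro real_root_power_cancel) auto
  moreover have "norm u *\<^sub>R s = u" using u by (simp add: s_def)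
  ultimately show ?thesis by (simp add: x crit_image_def)
 qed
 ultimately show "x \<in> crit_image p v ` crit True UNIV p ?\<xi>" by blast
qed

lemma num_elements_two_to_one:
 assumes "!!a. a \<in> A ==> card {b \<in> A. f b = f a} = 2"
 shows "num_elements A = 2 * num_elements (f ` A)"
proof (cases "finite A")
 case True
 have "card A = (\<Sum>y\<in>f ` A. card {b \<in> A. f b = y})"
  using sum.group[where S = A and T = "f ` A" and g = f and h = "%_. 1 :: nat", OF True finite_imageI[OF True] order_refl] by simp
 also have "\<dots> = (\<Sum>y\<in>f ` A. 2)" using assms by (intro sum.cong) auto
 finally have "card A = 2 * card (f ` A)" by simp
 then show ?thesis using True by (simp add: num_elements_def)
next
 case False
 have "infinite (f ` A)"
 proof
  assume fin: "finite (f ` A)"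
  have "A = (\<Union>y\<in>f ` A. {b \<in> A. f b = y})" by auto
  moreover have "finite {b \<in> A. f b = y}" if "y \<in> f ` A" for y
   using assms that by (auto intro!: card_ge_0_finite)
  ultimately have "finite A" using fin by (metis (no_types, lifting) finite_UN)
  then show False using False by simp
 qed
 then show ?thesis using False by (simp add: num_elements_def ennreal_mult_top)
qed

text \<open>The vectors s and -s have the same image because the signs from \<open>fld\<close> and
  from the power cancel. Conversely, evaluating equal images at s and at t forces
  \<open>\<bar>s \<bullet> t\<bar> ^ (2 * p) = 1\<close>, the equality case of Cauchy-Schwarz for
  unit vectors.\<close>

lemma num_critical_points:
 assumes p: "p \<ge> 1" and v: "v \<in> sym_power p"
 shows "num_elements (crit True UNIV p (coord p v)) = 2 * num_elements (critical_points p (power_manifold p) (v :: ('n::finite) mpoly))"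
 unfolding crit_image_onto[OF assms, symmetric]
proof (rule num_elements_two_to_one)
 let ?C = "crit True UNIV p (coord p v)"
 fix s assume s: "s \<in> ?C"
 then have ns: "norm s = 1" and fs: "fld p (coord p v) s ~= 0" by (auto simp: crit_def)
 have ss: "s \<bullet> s = 1" using ns by (simp add: norm_eq_1)
 have fm: "fld p (coord p v) (- s) = (-1) ^ p * fld p (coord p v) s" using fld_scale[of p _ "-1" s] by simp
 have "{t \<in> ?C. crit_image p v t = crit_image p v s} = {s, - s}"
 proof (intro set_eqI iffI)
  fix t assume "t \<in> {t \<in> ?C. crit_image p v t = crit_image p v s}"
  then have t: "t \<in> ?C" "crit_image p v t = crit_image p v s" by auto
  then have nt: "norm t = 1" by (auto simp: crit_def)
  have tt: "t \<bullet> t = 1" using nt by (simp add: norm_eq_1)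
  have e: "fld p (coord p v) t * (t \<bullet> y) ^ p = fld p (coord p v) s * (s \<bullet> y) ^ p" for y
   using t(2) fld_crit_image[OF p, of v] by metis
  have "fld p (coord p v) s = fld p (coord p v) s * ((s \<bullet> t) ^ p * (s \<bullet> t) ^ p)"
   using e[of s] e[of t] by (simp add: ss tt inner_commute)
  then have st: "\<bar>s \<bullet> t\<bar> ^ (2 * p) = 1" using fs by (simp add: mult_2 power_add flip: power_mult_distrib power_even_abs)
  have "\<bar>s \<bullet> t\<bar> = 1" by (rule power_eq_imp_eq_base[of _ "2 * p"]) (use st p in simp_all)
  then have "norm s *\<^sub>R t = norm t *\<^sub>R s \<or> norm s *\<^sub>R t = - norm t *\<^sub>R s"
   using norm_cauchy_schwarz_abs_eq[of s t] ns nt by auto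
  then show "t \<in> {s, - s}" using ns nt by auto
 next
  fix t assume t: "t \<in> {s, - s}"
  have "- s \<in> ?C"
   using s crit_eq_scale[of "-1" p UNIV "coord p v" s] p fm by (auto simp: crit_def coord_space_def)
  moreover have "crit_image p v (- s) = crit_image p v s"
  proof (rule poly_mapping_eqI)
   fix \<alpha>
   have "mcoeff (crit_image p v r) \<alpha> = (if \<alpha> \<in> exps p then multinom p \<alpha> * (fld p (coord p v) r * mon \<alpha> r) else 0)" for r
   proof -
    have "(root p \<bar>fld p (coord p v) r\<bar>) ^ p = \<bar>fld p (coord p v) r\<bar>" using p by (intro real_root_pow_pos2) auto
    then have "sgn (fld p (coord p v) r) * (root p \<bar>fld p (coord p v) r\<bar>) ^ p = fld p (coord p v) r" by (simp add: sgn_mult_abs)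
    then show ?thesis
     by (auto simp: crit_image_def mcoeff_scale mcoeff_power mon_scale mult_ac)
   qed
   moreover have "mon \<alpha> (- s) = (-1) ^ p * mon \<alpha> s" if "\<alpha> \<in> exps p" using mon_scale[OF that, of "-1" s] by simp
   ultimately show "mcoeff (crit_image p v (- s)) \<alpha> = mcoeff (crit_image p v s) \<alpha>"
    by (simp add: fm flip: power_mult_distrib)
  qed
  ultimately show "t \<in> {t \<in> ?C. crit_image p v t = crit_image p v s}" using t s by auto
 qed
 moreover have "s ~= - s"
 proof
  assume "s = - s"
  then have "s \<bullet> s = - (s \<bullet> s)" by (metis inner_minus_left)
  then show False using ss by simp
 qed
 ultimately show "card {t \<in> ?C. crit_image p v t = crit_image p v s} = 2" by simp
qed

section \<open>Law of the coordinates of a Gaussian polynomial\<close>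

lemma bombieri_coord:
 assumes "f \<in> sym_power p"
 shows "bombieri p f g = (\<Sum>\<alpha>\<in>exps p. coord p f \<alpha> * coord p g \<alpha>)"
 unfolding bombieri_sum[OF assms]
 by (intro sum.cong refl) (simp add: coord_def abs_of_pos[OF multinom_pos])

lemma crit_restrict: "crit z J p (restrict \<xi> (exps p)) = crit z J p \<xi>"
 by (simp add: crit_def crit_eq_def fld_def dfld_def cong: sum.cong)

text \<open>The Gaussian law is given in some orthonormal basis \<open>B\<close>. The passage to the
  monomial basis is an orthogonal matrix with rows indexed by \<open>B\<close> and columns by
  exponents, so the coordinates in the monomial basis are again independent standard normal
  variables.\<close>

lemma standard_gaussian_law:
 fixes v :: "'w => ('n::finite) mpoly"
 assumes "standard_gaussian p M v"
 shows "\<alpha> \<in> exps p ==> (%\<omega>. coord p (v \<omega>) \<alpha>) \<in> borel_measurable M"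
  and "H \<in> borel_measurable (PiM (exps p) (%_. lborel)) ==>
   (\<integral>\<^sup>+\<omega>. H (restrict (coord p (v \<omega>)) (exps p)) \<partial>M) = (\<integral>\<^sup>+\<xi>. H \<xi> \<partial>PiM (exps p) (%_. gauss))"
proof -
 obtain B where ps: "prob_space M" and vs: "!!\<omega>. \<omega> \<in> space M ==> v \<omega> \<in> sym_power p"
  and B: "bombieri_orthonormal_basis p B"
  and ind: "prob_space.indep_vars M (%_. borel) (%b \<omega>. bombieri p (v \<omega>) b) B"
  and dis: "!!b. b \<in> B ==> distributed M lborel (%\<omega>. bombieri p (v \<omega>) b) std_normal_density"
  using assms unfolding standard_gaussian_def by blast
 interpret prob_space M by (rule ps)
 have fB: "finite B" and Bs: "B \<subseteq> sym_power p" and on: "!!f g. f \<in> B ==> g \<in> B ==> bombieri p f g = (if f = g then 1 else 0)"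
  and sp: "!!f. f \<in> sym_power p ==> \<exists>c. f = (\<Sum>g\<in>B. const_poly (c g) * g)"
  using B unfolding bombieri_orthonormal_basis_def by auto
 have expand: "coord p f \<alpha> = (\<Sum>b\<in>B. coord p b \<alpha> * bombieri p f b)" if f: "f \<in> sym_power p" for f \<alpha>
 proof -
  obtain c where c: "f = (\<Sum>g\<in>B. const_poly (c g) * g)" using sp[OF f] by blast
  have cf: "coord p f \<beta> = (\<Sum>g\<in>B. c g * coord p g \<beta>)" for \<beta>
   by (simp add: c coord_def lookup_sum mcoeff_scale sum_divide_distrib)
  have "bombieri p f b = c b" if b: "b \<in> B" for b
  proof -
   have "bombieri p f b = (\<Sum>\<beta>\<in>exps p. \<Sum>g\<in>B. c g * (coord p g \<beta> * coord p b \<beta>))"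
    unfolding bombieri_coord[OF f] cf sum_distrib_right by (simp only: mult.assoc)
   also have "\<dots> = (\<Sum>g\<in>B. c g * bombieri p g b)"
    using Bs by (subst sum.swap) (auto simp: sum_distrib_left bombieri_coord intro!: sum.cong)
   also have "\<dots> = (\<Sum>g\<in>B. if g = b then c g else 0)" using on[OF _ b] by (intro sum.cong) auto
   finally show ?thesis using fB b by simp
  qed
  then show ?thesis unfolding cf by (intro sum.cong) (auto simp: mult.commute)
 qed
 interpret Q: orth_matrix B "exps p" "coord p"
 proof
  show "(\<Sum>\<alpha>\<in>exps p. coord p b \<alpha> * coord p b' \<alpha>) = (if b = b' then 1 else 0)" if "b \<in> B" "b' \<in> B" for b b'
   using on[OF that] bombieri_coord[of b p b'] Bs that by auto
  fix \<alpha> \<beta> :: "'n \<Rightarrow>\<^sub>0 nat" assume ab: "\<alpha> \<in> exps p" "\<beta> \<in> exps p"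
  define f where "f = Poly_Mapping.single \<beta> (sqrt (multinom p \<beta>))"
  have f: "f \<in> sym_power p" using ab(2) by (auto simp: sym_power_iff f_def lookup_single when_def)
  have cf: "coord p f \<gamma> = (if \<gamma> = \<beta> then 1 else 0)" for \<gamma>
   using multinom_pos[of p \<beta>] by (auto simp: coord_def f_def lookup_single when_def)
  have "bombieri p f b = coord p b \<beta>" for b
   unfolding bombieri_coord[OF f] cf using ab(2) by (simp add: if_distrib[of "%c. c * _"] cong: if_cong)
  then show "(\<Sum>b\<in>B. coord p b \<alpha> * coord p b \<beta>) = (if \<alpha> = \<beta> then 1 else 0)"
   using expand[OF f, of \<alpha>] cf[of \<alpha>] by simp
 qed (use fB in auto)
 have Xm: "(%\<omega>. bombieri p (v \<omega>) b) \<in> borel_measurable M" if "b \<in> B" for b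
  using distributed_measurable[OF dis[OF that]] by simp
 show "(%\<omega>. coord p (v \<omega>) \<alpha>) \<in> borel_measurable M"
 proof -
  have "(%\<omega>. \<Sum>b\<in>B. coord p b \<alpha> * bombieri p (v \<omega>) b) \<in> borel_measurable M"
   by (intro borel_measurable_sum borel_measurable_times borel_measurable_const Xm)
  then show ?thesis by (subst measurable_cong[OF expand[OF vs]])
 qed
 assume H: "H \<in> borel_measurable (PiM (exps p) (%_. lborel))"
 let ?X = "%\<omega>. \<lambda>b\<in>B. bombieri p (v \<omega>) b"
 \<comment> \<open>The space contains the nonzero power of a linear form, so the basis cannot be
   empty; the characterisation of independence by the product law is for nonempty families.\<close>
 have ne: "B ~= {}"
 proof
  assume "B = {}"
  then have "linear_form (1 :: real^'n) ^ p = 0" using sp[OF power_in_sym_power(1)] by auto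
  then show False using linear_form_power_nonzero[of "1 :: real^'n" p] by simp
 qed
 have "distr M (PiM B (%_. borel)) ?X = PiM B (%b. distr M borel (%\<omega>. bombieri p (v \<omega>) b))"
  using iffD1[OF indep_vars_iff_distr_eq_PiM'[OF ne Xm] ind] .
 also have "\<dots> = PiM B (%_. gauss)"
 proof (rule PiM_cong[OF refl])
  fix b assume b: "b \<in> B"
  have "distr M borel (%\<omega>. bombieri p (v \<omega>) b) = distr M lborel (%\<omega>. bombieri p (v \<omega>) b)" by (rule distr_cong) auto
  then show "distr M borel (%\<omega>. bombieri p (v \<omega>) b) = gauss"
   using distributed_distr_eq_density[OF dis[OF b]] by (simp add: gauss_def)
 qed
 finally have law: "distr M (PiM B (%_. borel)) ?X = PiM B (%_. gauss)" .
 have appm: "(%x. H (Q.app x)) \<in> borel_measurable (PiM B (%_. gauss))"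
  unfolding measurable_PiM_gauss_iff by (rule measurable_compose[OF Q.app_measurable H])
 have Xr: "?X \<in> M \<rightarrow>\<^sub>M PiM B (%_. borel)" by (rule measurable_restrict[OF Xm])
 have appb: "(%x. H (Q.app x)) \<in> borel_measurable (PiM B (%_. borel))"
  using appm unfolding law[symmetric] by simp
 have "(\<integral>\<^sup>+\<omega>. H (restrict (coord p (v \<omega>)) (exps p)) \<partial>M) = (\<integral>\<^sup>+\<omega>. H (Q.app (?X \<omega>)) \<partial>M)"
 proof (rule nn_integral_cong)
  fix \<omega> assume "\<omega> \<in> space M"
  then have "Q.app (?X \<omega>) = restrict (coord p (v \<omega>)) (exps p)"
   using expand[OF vs] by (auto simp: Q.app_def fun_eq_iff)
  then show "H (restrict (coord p (v \<omega>)) (exps p)) = H (Q.app (?X \<omega>))" by simp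
 qed
 also have "\<dots> = (\<integral>\<^sup>+x. H (Q.app x) \<partial>distr M (PiM B (%_. borel)) ?X)"
  by (rule nn_integral_distr[symmetric, OF Xr]) (simp add: appb)
 also have "\<dots> = (\<integral>\<^sup>+\<xi>. H \<xi> \<partial>PiM (exps p) (%_. gauss))"
  unfolding law by (rule Q.nn_integral_gauss_app[OF H])
 finally show "(\<integral>\<^sup>+\<omega>. H (restrict (coord p (v \<omega>)) (exps p)) \<partial>M) = (\<integral>\<^sup>+\<xi>. H \<xi> \<partial>PiM (exps p) (%_. gauss))" .
qed

lemma expected_critical_points:
 fixes v :: "'w => ('n::finite) mpoly"
 assumes p: "p \<ge> 1" and g: "standard_gaussian p M v"
 shows "(%\<omega>. num_elements (critical_points p (power_manifold p) (v \<omega>))) \<in> borel_measurable M"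
  and "2 * (\<integral>\<^sup>+\<omega>. num_elements (critical_points p (power_manifold p) (v \<omega>)) \<partial>M) =
   (\<integral>\<^sup>+\<xi>. num_elements (crit True (UNIV :: 'n set) p \<xi>) \<partial>PiM (exps p) (%_. gauss))"
proof -
 have vs: "!!\<omega>. \<omega> \<in> space M ==> v \<omega> \<in> sym_power p" using g by (simp add: standard_gaussian_def)
 have nm: "(%\<omega>. num_elements (crit True UNIV p (coord p (v \<omega>)))) \<in> borel_measurable M"
  by (rule measurable_num_crit(2)[where \<Gamma> = "%_. 0"]) (auto intro: standard_gaussian_law(1)[OF g])
 have half: "ennreal (1 / 2) * (2 * x) = x" for x
 proof -
  have "ennreal (1 / 2) * 2 = ennreal (1 / 2 * 2)" unfolding ennreal_numeral[symmetric] by (rule ennreal_mult[symmetric]) auto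
  then show ?thesis by (simp add: mult.assoc[symmetric])
 qed
 have eq: "num_elements (critical_points p (power_manifold p) (v \<omega>)) = ennreal (1 / 2) * num_elements (crit True UNIV p (coord p (v \<omega>)))"
  if "\<omega> \<in> space M" for \<omega> unfolding num_critical_points[OF p vs[OF that]] half ..
 show m: "(%\<omega>. num_elements (critical_points p (power_manifold p) (v \<omega>))) \<in> borel_measurable M"
  by (rule iffD2[OF measurable_cong[OF eq] borel_measurable_times_ennreal[OF borel_measurable_const nm]])
 have Hm: "(%\<xi>. num_elements (crit True (UNIV :: 'n set) p \<xi>)) \<in> borel_measurable (PiM (exps p) (%_. lborel))"
  by (rule measurable_num_crit(2)[where \<Gamma> = "%_. 0"]) (auto intro: gauss_component_measurable[unfolded measurable_PiM_gauss_iff])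
 have "2 * (\<integral>\<^sup>+\<omega>. num_elements (critical_points p (power_manifold p) (v \<omega>)) \<partial>M) =
  (\<integral>\<^sup>+\<omega>. num_elements (crit True UNIV p (restrict (coord p (v \<omega>)) (exps p))) \<partial>M)"
  unfolding nn_integral_cmult[OF m, symmetric] crit_restrict
  by (rule nn_integral_cong) (simp add: num_critical_points[OF p vs])
 also have "\<dots> = (\<integral>\<^sup>+\<xi>. num_elements (crit True (UNIV :: 'n set) p \<xi>) \<partial>PiM (exps p) (%_. gauss))"
  by (rule standard_gaussian_law(2)[OF g Hm])
 finally show "2 * (\<integral>\<^sup>+\<omega>. num_elements (critical_points p (power_manifold p) (v \<omega>)) \<partial>M) =
  (\<integral>\<^sup>+\<xi>. num_elements (crit True (UNIV :: 'n set) p \<xi>) \<partial>PiM (exps p) (%_. gauss))" .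
qed

section \<open>Assembling the formula\<close>

lemma cpv_single: "cpv A [(a, b)] y = (\<Prod>i\<in>A. \<bar>a - b * y i\<bar>) * vdm A y"
 by (simp add: cpv_def lin_Cons lin_Nil)

text \<open>The substitution l = sqrt 2 x gives each coordinate the density exp(-l^2 / 4) / sqrt (4
  pi). Since \<open>F\<close> ignores coordinates outside \<open>A\<close>, the scaled argument may
  be replaced by its restriction, a point of the product space.\<close>

lemma nn_integral_gauss_to_lborel:
 fixes F :: "('a => real) => real"
 assumes A: "finite A" and F: "F \<in> borel_measurable (PiM A (%_. lborel))" "!!x. 0 \<le> F x" "!!x. F (restrict x A) = F x"
 shows "(\<integral>\<^sup>+x. ennreal (F (%i. sqrt 2 * x i)) \<partial>PiM A (%_. gauss)) =
  ennreal ((1 / sqrt (4 * pi)) ^ card A) * (\<integral>\<^sup>+l. ennreal (F l * exp (- (\<Sum>i\<in>A. (l i)\<^sup>2 / 4))) \<partial>PiM A (%_. lborel))"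
proof -
 let ?L = "PiM A (%_. lborel :: real measure)"
 let ?F = "%x. F (%i. sqrt 2 * x i)"
 let ?f = "%l. ennreal (F l * exp (- (\<Sum>i\<in>A. (l i)\<^sup>2 / 4)))"
 have Fr: "?F x = F (\<lambda>a\<in>A. sqrt 2 * x a)" for x
  using F(3)[of "%i. sqrt 2 * x i"] by (simp add: restrict_def)
 have "(%x. \<lambda>a\<in>A. sqrt 2 * x a) \<in> ?L \<rightarrow>\<^sub>M ?L" by measurable
 from measurable_compose[OF this F(1)] have Fm: "?F \<in> borel_measurable ?L" unfolding Fr .
 note [measurable] = F(1) Fm
 have fm: "?f \<in> borel_measurable ?L" by measurable
 have "(\<integral>\<^sup>+x. ennreal (?F x) \<partial>PiM A (%_. gauss)) =
   (\<integral>\<^sup>+x. (\<Prod>a\<in>A. ennreal (std_normal_density (x a))) * ennreal (?F x) \<partial>?L)"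
  by (rule nn_integral_PiM_gauss[OF A]) measurable
 also have "\<dots> = (\<integral>\<^sup>+x. ennreal ((1 / sqrt (2 * pi)) ^ card A) * ennreal (?F x * exp (- (\<Sum>a\<in>A. (x a)\<^sup>2) / 2)) \<partial>?L)"
  unfolding prod_std_normal_density using F(2)
  by (intro nn_integral_cong) (simp add: ennreal_mult'[symmetric] mult_ac)
 also have "\<dots> = ennreal ((1 / sqrt (2 * pi)) ^ card A) * (\<integral>\<^sup>+x. ennreal (?F x * exp (- (\<Sum>a\<in>A. (x a)\<^sup>2) / 2)) \<partial>?L)"
  by (rule nn_integral_cmult) measurable
 also have "ennreal ((1 / sqrt (2 * pi)) ^ card A) = ennreal ((1 / sqrt (4 * pi)) ^ card A) * ennreal (\<bar>sqrt 2\<bar> ^ card A)"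
 proof -
  have "1 / sqrt (2 * pi) = 1 / sqrt (4 * pi) * \<bar>sqrt 2\<bar>"
   using real_sqrt_mult[of 2 "2 * pi"] by simp
  then show ?thesis by (simp only: power_mult_distrib) (rule ennreal_mult; simp)
 qed
 also have "(%x. ennreal (?F x * exp (- (\<Sum>a\<in>A. (x a)\<^sup>2) / 2))) = (%x. ?f (\<lambda>a\<in>A. sqrt 2 * x a))"
  unfolding Fr by (simp add: fun_eq_iff power_mult_distrib sum_divide_distrib)
 also have "ennreal ((1 / sqrt (4 * pi)) ^ card A) * ennreal (\<bar>sqrt 2\<bar> ^ card A) * (\<integral>\<^sup>+x. ?f (\<lambda>a\<in>A. sqrt 2 * x a) \<partial>?L) =
   ennreal ((1 / sqrt (4 * pi)) ^ card A) * (\<integral>\<^sup>+l. ?f l \<partial>?L)"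
  by (subst nn_integral_PiM_lborel_scale[OF A fm, of "sqrt 2"]) (simp_all add: mult.assoc)
 finally show ?thesis .
qed

text \<open>The integrand has polynomial growth in t and x jointly. The outer variable t is stored
  as the coordinate with index 0, which lies outside \<open>A\<close>, so one moment bound on a
  product space covers both integrals.\<close>

lemma ordered_integral_finite:
 fixes b c :: real
 assumes A: "finite A" "0 \<notin> A"
 shows "(\<integral>\<^sup>+t. (\<integral>\<^sup>+x. ennreal (cpv A [(c * t, b)] (%i. sqrt 2 * x i)) * indicator (ordset A) x \<partial>PiM A (%_. gauss)) \<partial>gauss) < \<top>"
proof -
 let ?I = "insert 0 A"
 \<comment> \<open>Each linear factor is at most \<open>e\<close> times \<open>pbd\<close>, each
   difference at most 4 times; the 2 bounds the scaling by sqrt 2.\<close>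
 define e where "e = \<bar>c\<bar> + \<bar>b\<bar> * 2"
 define d where "d = card A + card (pairs A)"
 define k where "k = e ^ card A * 4 ^ card (pairs A)"
 have bound: "cpv A [(c * y 0, b)] (%i. sqrt 2 * y i) \<le> k * pbd ?I y ^ d" for y
 proof -
  let ?P = "pbd ?I y"
  have P: "\<bar>y i\<bar> \<le> ?P" if "i \<in> ?I" for i
  proof -
   have "\<bar>y i\<bar> \<le> (\<Sum>i\<in>?I. \<bar>y i\<bar>)" using A(1) that by (intro member_le_sum) auto
   also have "\<dots> \<le> ?P" using pbd_sum[of ?I y] A(1) by simp
   finally show ?thesis .
  qed
  have P0: "0 \<le> ?P" using pbd_ge_1[of ?I y] by simp
  have s2: "\<bar>sqrt 2 * y i\<bar> \<le> 2 * ?P" if "i \<in> ?I" for i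
   unfolding abs_mult using P[OF that] by (intro mult_mono) (auto intro: real_le_lsqrt)
  have "(\<Prod>i\<in>A. \<bar>c * y 0 - b * (sqrt 2 * y i)\<bar>) \<le> (\<Prod>i\<in>A. e * ?P)"
  proof (rule prod_mono, intro conjI)
   fix i assume i: "i \<in> A"
   have "\<bar>c * y 0 - b * (sqrt 2 * y i)\<bar> \<le> \<bar>c\<bar> * \<bar>y 0\<bar> + \<bar>b\<bar> * \<bar>sqrt 2 * y i\<bar>"
    using abs_triangle_ineq4[of "c * y 0" "b * (sqrt 2 * y i)"] by (simp add: abs_mult)
   also have "\<dots> \<le> \<bar>c\<bar> * ?P + \<bar>b\<bar> * (2 * ?P)" using i P[of 0] s2[of i] by (intro add_mono mult_left_mono) auto
   finally show "\<bar>c * y 0 - b * (sqrt 2 * y i)\<bar> \<le> e * ?P" by (simp add: e_def algebra_simps)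
  qed simp
  moreover have "vdm A (%i. sqrt 2 * y i) \<le> (\<Prod>a\<in>pairs A. 4 * ?P)"
   unfolding vdm_def case_prod_beta'
  proof (rule prod_mono, intro conjI)
   fix a assume "a \<in> pairs A"
   then have "\<bar>sqrt 2 * y (snd a)\<bar> \<le> 2 * ?P" "\<bar>sqrt 2 * y (fst a)\<bar> \<le> 2 * ?P" by (auto simp: pairs_def intro!: s2)
   then show "\<bar>sqrt 2 * y (snd a) - sqrt 2 * y (fst a)\<bar> \<le> 4 * ?P" by linarith
  qed simp
  ultimately have "cpv A [(c * y 0, b)] (%i. sqrt 2 * y i) \<le> (\<Prod>i\<in>A. e * ?P) * (\<Prod>a\<in>pairs A. 4 * ?P)"
   unfolding cpv_single using P0 by (intro mult_mono vdm_nonneg prod_nonneg) (auto simp: e_def)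
  also have "\<dots> = k * ?P ^ d" by (simp add: k_def d_def power_mult_distrib power_add)
  finally show ?thesis .
 qed
 have k0: "0 \<le> k" by (simp add: k_def e_def)
 define f where "f y = ennreal k * ennreal (pbd ?I y ^ d)" for y
 have fm: "f \<in> borel_measurable (PiM ?I (%_. gauss))" unfolding f_def measurable_PiM_gauss_iff by measurable
 have "(\<integral>\<^sup>+t. (\<integral>\<^sup>+x. ennreal (cpv A [(c * t, b)] (%i. sqrt 2 * x i)) * indicator (ordset A) x \<partial>PiM A (%_. gauss)) \<partial>gauss) \<le>
   (\<integral>\<^sup>+t. (\<integral>\<^sup>+x. f (x(0 := t)) \<partial>PiM A (%_. gauss)) \<partial>gauss)"
 proof (intro nn_integral_mono)
  fix t and x :: "nat => real"
  have "cpv A [(c * t, b)] (%i. sqrt 2 * x i) = cpv A [(c * (x(0 := t)) 0, b)] (%i. sqrt 2 * (x(0 := t)) i)"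
   unfolding fun_upd_same by (rule cpv_cong) (use A(2) in auto)
  also have "\<dots> \<le> k * pbd ?I (x(0 := t)) ^ d" by (rule bound)
  finally have "ennreal (cpv A [(c * t, b)] (%i. sqrt 2 * x i)) \<le> f (x(0 := t))"
   unfolding f_def ennreal_mult'[OF k0, symmetric] by (rule ennreal_leI)
  then show "ennreal (cpv A [(c * t, b)] (%i. sqrt 2 * x i)) * indicator (ordset A) x \<le> f (x(0 := t))"
   by (auto simp: indicator_def)
 qed
 also have "\<dots> = (\<integral>\<^sup>+y. f y \<partial>PiM ?I (%_. gauss))"
  by (rule product_sigma_finite.product_nn_integral_insert_rev[OF psf_gauss A fm, symmetric])
 also have "\<dots> = ennreal k * (\<integral>\<^sup>+y. ennreal (pbd ?I y ^ d) \<partial>PiM ?I (%_. gauss))"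
  unfolding f_def by (rule nn_integral_cmult) (simp add: measurable_PiM_gauss_iff)
 also have "\<dots> < \<top>"
  using nn_integral_pbd[of ?I d] A(1) by (simp add: ennreal_mult_less_top)
 finally show ?thesis .
qed

text \<open>Bochner integrals default to 0 without integrability, so finiteness must be known before
  the nonnegative integral can be replaced. The inner integral is infinite at most on a null set,
  where the default value does no harm.\<close>

lemma nn_integral_iterated_to_lebesgue:
 fixes S :: "'a => real => real"
 assumes M: "sigma_finite_measure M" and S: "(%(l, w). S l w) \<in> borel_measurable (M \<Otimes>\<^sub>M lborel)" and S0: "!!l w. 0 \<le> S l w"
  and fin: "(\<integral>\<^sup>+w. (\<integral>\<^sup>+l. ennreal (S l w) \<partial>M) \<partial>lborel) < \<top>"
 shows "ennreal (LINT l|M. (LINT w|lborel. S l w)) = (\<integral>\<^sup>+w. (\<integral>\<^sup>+l. ennreal (S l w) \<partial>M) \<partial>lborel)"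
proof -
 interpret M: sigma_finite_measure M by (rule M)
 interpret P: pair_sigma_finite M "lborel :: real measure" ..
 let ?N = "%l. \<integral>\<^sup>+w. ennreal (S l w) \<partial>lborel"
 have Sm: "(%(l, w). ennreal (S l w)) \<in> borel_measurable (M \<Otimes>\<^sub>M lborel)"
  using measurable_compose[OF S measurable_ennreal] by (simp add: case_prod_beta')
 have fub: "(\<integral>\<^sup>+w. (\<integral>\<^sup>+l. ennreal (S l w) \<partial>M) \<partial>lborel) = (\<integral>\<^sup>+l. ?N l \<partial>M)"
  using P.Fubini'[OF Sm] by simp
 have Nm: "?N \<in> borel_measurable M" by (rule lborel.borel_measurable_nn_integral[OF Sm])
 have inner: "(LINT w|lborel. S l w) = enn2real (?N l)" if "l \<in> space M" for l
  by (rule integral_eq_nn_integral) (use measurable_Pair2[OF S that] S0 in auto)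
 have "AE l in M. ?N l ~= \<infinity>" by (rule nn_integral_PInf_AE[OF Nm]) (use fin fub in auto)
 then have ae: "AE l in M. ennreal (enn2real (?N l)) = ?N l"
  by eventually_elim (auto simp: less_top)
 have "(LINT l|M. (LINT w|lborel. S l w)) = (LINT l|M. enn2real (?N l))"
  by (rule Bochner_Integration.integral_cong) (simp_all add: inner)
 also have "\<dots> = enn2real (\<integral>\<^sup>+l. ennreal (enn2real (?N l)) \<partial>M)"
  by (rule integral_eq_nn_integral) (use Nm in auto)
 also have "(\<integral>\<^sup>+l. ennreal (enn2real (?N l)) \<partial>M) = (\<integral>\<^sup>+l. ?N l \<partial>M)" by (rule nn_integral_cong_AE[OF ae])
 finally show ?thesis using fin unfolding fub by (simp add: less_top)
qed

text \<open>The exponent of 2 is the sum of j / 2 over j < n, and the Gamma arguments (j + 1) / 2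
  become i / 2 with i from 1 to n.\<close>

lemma absmom_prod:
 "(\<Prod>j<n. absmom j) = ennreal (2 powr (real n * (real n - 1) / 4) * (\<Prod>i=1..n. Gamma (real i / 2)) / sqrt pi ^ n)"
  and absmom_prod_pos: "0 < 2 powr (real n * (real n - 1) / 4) * (\<Prod>i=1..n. Gamma (real i / 2)) / sqrt pi ^ n"
proof -
 define g where "g n = 2 powr (real n * (real n - 1) / 4) * (\<Prod>i=1..n. Gamma (real i / 2)) / sqrt pi ^ n" for n
 have gp: "0 < g n" for n
  unfolding g_def by (intro divide_pos_pos mult_pos_pos prod_pos Gamma_real_pos) auto
 have "(\<Prod>j<n. absmom j) = ennreal (g n)" for n
 proof (induction n)
  case 0 then show ?case by (simp add: g_def)
 next
  case (Suc n)
  have "g (Suc n) = g n * (2 powr (real n / 2) * Gamma ((real n + 1) / 2) / sqrt pi)"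
  proof -
   have e: "real (Suc n) * (real (Suc n) - 1) / 4 = real n * (real n - 1) / 4 + real n / 2" by (simp add: algebra_simps add_divide_distrib diff_divide_distrib)
   show ?thesis unfolding g_def e powr_add by (simp add: add.commute mult_ac)
  qed
  moreover have "0 \<le> 2 powr (real n / 2) * Gamma ((real n + 1) / 2) / sqrt pi"
   by (intro divide_nonneg_nonneg mult_nonneg_nonneg less_imp_le[OF Gamma_real_pos]) auto
  moreover have "(\<Prod>j<Suc n. absmom j) = ennreal (g n) * ennreal (2 powr (real n / 2) * Gamma ((real n + 1) / 2) / sqrt pi)"
   unfolding prod.lessThan_Suc Suc by (simp only: absmom_eq)
  ultimately show ?case using gp[of n] by (simp only: ennreal_mult less_imp_le)
 qed
 then show "(\<Prod>j<n. absmom j) = ennreal (2 powr (real n * (real n - 1) / 4) * (\<Prod>i=1..n. Gamma (real i / 2)) / sqrt pi ^ n)"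
  and "0 < 2 powr (real n * (real n - 1) / 4) * (\<Prod>i=1..n. Gamma (real i / 2)) / sqrt pi ^ n"
  using gp unfolding g_def by auto
qed

text \<open>The exponent (n^2 + 3 n - 2) / 4 collects 1/2 from the density of w, n - 1 from the
  factors 1 / sqrt (4 pi), and n (n - 1) / 4 from the absolute moments; the powers of sqrt pi
  cancel.\<close>

lemma constant_eq:
 fixes n :: nat
 assumes n: "n \<ge> 1"
 shows "1 / sqrt (2 * pi) * (1 / sqrt (4 * pi)) ^ (n - 1) / (2 powr (real n * (real n - 1) / 4) * G / sqrt pi ^ n) =
  1 / (2 powr ((real n ^ 2 + 3 * real n - 2) / 4) * G)"
proof -
 obtain m where m: "n = Suc m" using n by (cases n) auto
 have s2: "sqrt (2 * pi) = 2 powr (1 / 2) * sqrt pi" by (simp add: real_sqrt_mult powr_half_sqrt)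
 have s4: "sqrt (4 * pi) = 2 * sqrt pi" by (simp add: real_sqrt_mult)
 have p2: "(2::real) ^ m = 2 powr real m" by (simp add: powr_realpow)
 have "(real n ^ 2 + 3 * real n - 2) / 4 = 1 / 2 + real m + real n * (real n - 1) / 4"
  by (simp add: m field_simps power2_eq_square)
 then have e: "2 powr ((real n ^ 2 + 3 * real n - 2) / 4) = 2 powr (1 / 2) * 2 powr real m * 2 powr (real n * (real n - 1) / 4)"
  by (simp only: powr_add)
 have h: "1 / sqrt (2 * pi) * (1 / sqrt (4 * pi)) ^ (n - 1) = 1 / (2 powr (1 / 2) * 2 powr real m * sqrt pi ^ n)"
  unfolding s2 s4 p2[symmetric] by (simp add: m power_mult_distrib power_divide)
 show ?thesis unfolding e h by (simp add: divide_simps)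
qed

theorem theorem1p5:
 fixes p n :: nat
  and M :: "'w measure"
  and v :: "'w \<Rightarrow> ('n::finite) mpoly"
 assumes "p \<ge> 1"
  and "n = CARD('n)"
  and "standard_gaussian p M v"
 shows "(\<lambda>\<omega>. num_elements (critical_points p (power_manifold p) (v \<omega>))) \<in> borel_measurable M \<and>
  (\<integral>\<^sup>+\<omega>. num_elements (critical_points p (power_manifold p) (v \<omega>)) \<partial>M) =
   ennreal (1 / (2 powr ((real n ^ 2 + 3 * real n - 2) / 4) * (\<Prod>i=1..n. Gamma (real i / 2))) *
    (LINT l:{l \<in> space (\<Pi>\<^sub>M i\<in>{2..n}. lborel). \<forall>i\<in>{2..n}. \<forall>j\<in>{2..n}. i \<le> j \<longrightarrow> l i \<le> l j}
      |(\<Pi>\<^sub>M i\<in>{2..n}. lborel).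
     (LINT w|lborel.
      (\<Prod>i\<in>{2..n}. \<bar>sqrt (real p) * w - sqrt (real p - 1) * l i\<bar>) *
      (\<Prod>(i, j)\<in>{(i, j). 2 \<le> i \<and> i < j \<and> j \<le> n}. l j - l i) *
      exp (- (w ^ 2) / 2 - (\<Sum>i\<in>{2..n}. (l i) ^ 2 / 4)))))"
proof -
 define A where "A = {2..n}"
 obtain m where m: "n = Suc m" using assms(2) by (metis card_gt_0_iff finite UNIV_not_empty gr0_implies_Suc)
 have A: "finite A" "0 \<notin> A" "card A = m" and A2: "{2..<m + 2} = A" by (auto simp: A_def m)
 let ?L = "PiM A (\<lambda>_. lborel :: real measure)"
 let ?E = "\<integral>\<^sup>+\<omega>. num_elements (critical_points p (power_manifold p) (v \<omega>)) \<partial>M"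
 define cp where "cp w l = cpv A [(sqrt (real p) * w, sqrt (real p - 1))] l" for w l
 \<comment> \<open>The ordering enters as an indicator in the integrand; on ordered points
   \<open>vdm\<close> equals the product of the differences without absolute values.\<close>
 define F where "F w l = cp w l * indicator (ordset A) l" for w l
 define S where "S l w = F w l * exp (- (\<Sum>i\<in>A. (l i)\<^sup>2 / 4)) * exp (- w\<^sup>2 / 2)" for l w
 \<comment> \<open>The Gaussian normalisation: one variable w of variance 1 and m points of variance
   2.\<close>
 define C where "C = 1 / sqrt (2 * pi) * (1 / sqrt (4 * pi)) ^ m"
 have C0: "0 \<le> C" by (simp add: C_def)
 have F0: "0 \<le> F w l" for w l by (simp add: F_def cp_def cpv_nonneg)
 have S0: "0 \<le> S l w" for l w unfolding S_def using F0 by (intro mult_nonneg_nonneg) auto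
 have om: "(\<lambda>l. indicator (ordset A) l :: real) \<in> borel_measurable ?L"
 proof -
  have "(\<lambda>l. enn2real (indicator (ordset A) l)) \<in> borel_measurable ?L"
   using ordset_measurable[OF A(1)] unfolding measurable_PiM_gauss_iff by (rule borel_measurable_enn2real)
  moreover have "enn2real (indicator (ordset A) l) = indicator (ordset A) l" for l by (cases "l \<in> ordset A") simp_all
  ultimately show ?thesis by simp
 qed
 have Fm: "(\<lambda>x. F (w x) (l x)) \<in> borel_measurable N"
  if "w \<in> borel_measurable N" "l \<in> N \<rightarrow>\<^sub>M ?L" for w l and N :: "'k measure"
 proof -
  have li: "(\<lambda>x. l x i) \<in> borel_measurable N" if "i \<in> A" for i
   using measurable_compose[OF \<open>l \<in> N \<rightarrow>\<^sub>M ?L\<close> measurable_component_singleton[OF that]] by simp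
  have "(\<lambda>x. \<Prod>a\<in>pairs A. \<bar>l x (snd a) - l x (fst a)\<bar>) \<in> borel_measurable N"
   by (intro borel_measurable_prod borel_measurable_abs borel_measurable_diff li) (auto simp: pairs_def)
  then have "(\<lambda>x. cp (w x) (l x)) \<in> borel_measurable N"
   unfolding cp_def cpv_single vdm_def case_prod_beta' using that(1) li
   by (intro borel_measurable_times borel_measurable_prod borel_measurable_abs borel_measurable_diff borel_measurable_const) (auto simp: pairs_def)
  then show ?thesis unfolding F_def using measurable_compose[OF that(2) om] by (rule borel_measurable_times)
 qed
 have Sm: "(\<lambda>(l, w). S l w) \<in> borel_measurable (?L \<Otimes>\<^sub>M lborel)"
 proof -
  have [measurable]: "(\<lambda>x. F (snd x) (fst x)) \<in> borel_measurable (?L \<Otimes>\<^sub>M lborel)" by (rule Fm) measurable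
  have [measurable]: "(\<lambda>x. fst x i) \<in> borel_measurable (?L \<Otimes>\<^sub>M (lborel :: real measure))" if "i \<in> A" for i
   using measurable_compose[OF measurable_fst measurable_component_singleton[OF that, of "\<lambda>_. lborel :: real measure"], of "lborel :: real measure"] by simp
  have "(\<lambda>x. exp (- (\<Sum>i\<in>A. (fst x i)\<^sup>2 / 4))) \<in> borel_measurable (?L \<Otimes>\<^sub>M (lborel :: real measure))" by measurable
  then show ?thesis unfolding S_def case_prod_beta' by measurable
 qed
 have Sm': "(\<lambda>(w, l). ennreal (S l w)) \<in> borel_measurable (lborel \<Otimes>\<^sub>M ?L)"
  using measurable_compose[OF measurable_compose[OF measurable_pair_swap' Sm] measurable_ennreal] by (simp add: case_prod_beta')
 interpret L: sigma_finite_measure ?L by (rule lborelP.sigma_finite[OF A(1)])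
 let ?N = "\<lambda>w. \<integral>\<^sup>+l. ennreal (S l w) \<partial>?L"
 have Nm: "?N \<in> borel_measurable lborel" by (rule L.borel_measurable_nn_integral[OF Sm'])
 let ?W = "\<integral>\<^sup>+t. (\<integral>\<^sup>+x. ennreal (cp t (\<lambda>i. sqrt 2 * x i)) * indicator (ordset A) x \<partial>PiM A (\<lambda>_. gauss)) \<partial>gauss"
 have W: "?W = ennreal C * (\<integral>\<^sup>+w. ?N w \<partial>lborel)"
 proof -
  have Fl: "F w \<in> borel_measurable ?L" for w by (rule Fm[of "\<lambda>_. w" ?L "\<lambda>l. l"]) auto
  have "cp w (restrict l A) = cp w l" for w l unfolding cp_def by (rule cpv_cong) simp
  then have Fr: "F w (restrict l A) = F w l" for w l by (simp add: F_def ordset_def indicator_def)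
  have s: "ennreal (cp t (\<lambda>i. sqrt 2 * x i)) * indicator (ordset A) x = ennreal (F t (\<lambda>i. sqrt 2 * x i))" for t x
   by (auto simp: F_def ordset_def indicator_def)
  have "(\<integral>\<^sup>+x. ennreal (cp t (\<lambda>i. sqrt 2 * x i)) * indicator (ordset A) x \<partial>PiM A (\<lambda>_. gauss)) =
   ennreal ((1 / sqrt (4 * pi)) ^ m * exp (t\<^sup>2 / 2)) * ?N t" for t
  proof -
   note [measurable] = Fl[of t]
   have "ennreal (F t l * exp (- (\<Sum>i\<in>A. (l i)\<^sup>2 / 4))) = ennreal (exp (t\<^sup>2 / 2)) * ennreal (S l t)" for l
    unfolding S_def using F0[of t l] by (simp add: ennreal_mult'[symmetric] exp_add[symmetric] mult_ac flip: exp_minus)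
   moreover have "(\<integral>\<^sup>+l. ennreal (exp (t\<^sup>2 / 2)) * ennreal (S l t) \<partial>?L) = ennreal (exp (t\<^sup>2 / 2)) * ?N t"
    by (rule nn_integral_cmult) (unfold S_def, measurable)
   ultimately show ?thesis
    unfolding s nn_integral_gauss_to_lborel[OF A(1) Fl F0 Fr] A(3) by (simp add: ennreal_mult mult.assoc)
  qed
  then have "?W = (\<integral>\<^sup>+t. ennreal ((1 / sqrt (4 * pi)) ^ m * exp (t\<^sup>2 / 2)) * ?N t \<partial>gauss)" by simp
  also have "\<dots> = (\<integral>\<^sup>+t. ennreal (std_normal_density t) * (ennreal ((1 / sqrt (4 * pi)) ^ m * exp (t\<^sup>2 / 2)) * ?N t) \<partial>lborel)"
   unfolding gauss_def by (rule nn_integral_density) (use Nm in measurable)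
  also have "\<dots> = (\<integral>\<^sup>+t. ennreal C * ?N t \<partial>lborel)"
  proof (rule nn_integral_cong)
   fix t :: real
   have "std_normal_density t * ((1 / sqrt (4 * pi)) ^ m * exp (t\<^sup>2 / 2)) = C"
    by (simp add: std_normal_density_def C_def exp_minus)
   moreover have "ennreal (std_normal_density t) * ennreal ((1 / sqrt (4 * pi)) ^ m * exp (t\<^sup>2 / 2)) =
    ennreal (std_normal_density t * ((1 / sqrt (4 * pi)) ^ m * exp (t\<^sup>2 / 2)))"
    by (rule ennreal_mult[symmetric]) auto
   ultimately show "ennreal (std_normal_density t) * (ennreal ((1 / sqrt (4 * pi)) ^ m * exp (t\<^sup>2 / 2)) * ?N t) = ennreal C * ?N t"
    by (simp only: mult.assoc[symmetric])
  qed
  also have "\<dots> = ennreal C * (\<integral>\<^sup>+w. ?N w \<partial>lborel)" by (rule nn_integral_cmult[OF Nm])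
  finally show ?thesis .
 qed
 \<comment> \<open>Finiteness is transferred from the Gaussian side, where moments bound the
   integral, to the Lebesgue side; it is what identifies the Bochner integral of the statement with
   the nonnegative one.\<close>
 have "ennreal C * (\<integral>\<^sup>+w. ?N w \<partial>lborel) < \<top>"
  unfolding W[symmetric] cp_def by (rule ordered_integral_finite[OF A(1,2)])
 moreover have "C > 0" by (simp add: C_def)
 ultimately have fin: "(\<integral>\<^sup>+w. ?N w \<partial>lborel) < \<top>" by (auto simp: ennreal_mult_less_top)
 define R where "R = (LINT l|?L. (LINT w|lborel. S l w))"
 have R: "ennreal R = (\<integral>\<^sup>+w. ?N w \<partial>lborel)"
  unfolding R_def by (rule nn_integral_iterated_to_lebesgue[OF L.sigma_finite_measure_axioms Sm S0 fin])
 have R0: "0 \<le> R" unfolding R_def by (intro Bochner_Integration.integral_nonneg S0)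
 define a where "a = 2 powr (real n * (real n - 1) / 4) * (\<Prod>i=1..n. Gamma (real i / 2)) / sqrt pi ^ n"
 have a: "0 < a" "(\<Prod>j<n. absmom j) = ennreal a" unfolding a_def by (rule absmom_prod_pos absmom_prod)+
 \<comment> \<open>The factor 2 on the left counts the pair s, -s over each critical point, the one
   on the right the two antipodal halves of a cap.\<close>
 have "2 * (ennreal a * ?E) = 2 * ?W"
 proof -
  have "2 * (ennreal a * ?E) = (\<Prod>j<Suc m. absmom j) * (2 * ?E)" unfolding a(2)[symmetric] m by (simp only: mult_ac)
  also have "\<dots> = 2 * ?W"
   unfolding expected_critical_points(2)[OF assms(1,3)] cp_def A2[symmetric]
   by (rule expected_crit_ordered[OF assms(1)]) (use assms(2) m in simp)
  finally show ?thesis .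
 qed
 then have "ennreal a * ?E = ennreal C * ennreal R" by (simp add: ennreal_mult_cancel_left W R)
 then have "ennreal (1 / a) * (ennreal a * ?E) = ennreal (1 / a) * (ennreal C * ennreal R)" by simp
 moreover have "ennreal (1 / a) * (ennreal a * ?E) = ?E"
  using a(1) by (simp add: mult.assoc[symmetric] ennreal_mult'[symmetric])
 moreover have "ennreal (1 / a) * (ennreal C * ennreal R) = ennreal (C / a * R)"
  using a(1) C0 R0 by (simp add: ennreal_mult'[symmetric] ennreal_mult''[symmetric])
 ultimately have E: "?E = ennreal (C / a * R)" by simp
 have Ca: "C / a = 1 / (2 powr ((real n ^ 2 + 3 * real n - 2) / 4) * (\<Prod>i=1..n. Gamma (real i / 2)))"
  using constant_eq[of n "\<Prod>i=1..n. Gamma (real i / 2)"] unfolding C_def a_def by (simp add: m)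
 have pe: "{(i, j). 2 \<le> i \<and> i < j \<and> j \<le> n} = pairs A" by (auto simp: pairs_def A_def)
 have "R = (LINT l:{l \<in> space ?L. \<forall>i\<in>A. \<forall>j\<in>A. i \<le> j \<longrightarrow> l i \<le> l j}|?L.
   (LINT w|lborel. (\<Prod>i\<in>A. \<bar>sqrt (real p) * w - sqrt (real p - 1) * l i\<bar>) * (\<Prod>(i, j)\<in>pairs A. l j - l i) *
    exp (- (w ^ 2) / 2 - (\<Sum>i\<in>A. (l i) ^ 2 / 4))))"
  unfolding R_def set_lebesgue_integral_def
 proof (rule Bochner_Integration.integral_cong[OF refl])
  fix l assume l: "l \<in> space ?L"
  show "(LINT w|lborel. S l w) = indicator {l \<in> space ?L. \<forall>i\<in>A. \<forall>j\<in>A. i \<le> j \<longrightarrow> l i \<le> l j} l *\<^sub>R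
   (LINT w|lborel. (\<Prod>i\<in>A. \<bar>sqrt (real p) * w - sqrt (real p - 1) * l i\<bar>) * (\<Prod>(i, j)\<in>pairs A. l j - l i) *
    exp (- (w ^ 2) / 2 - (\<Sum>i\<in>A. (l i) ^ 2 / 4)))"
  proof (cases "l \<in> ordset A")
   case True
   then have "vdm A l = (\<Prod>(i, j)\<in>pairs A. l j - l i)"
    unfolding vdm_def by (intro prod.cong) (auto simp: pairs_def ordset_def)
   moreover have "exp (- (w ^ 2) / 2 - s) = exp (- s) * exp (- (w ^ 2) / 2)" for w s :: real
    by (simp add: exp_add[symmetric])
   ultimately have "S l w = (\<Prod>i\<in>A. \<bar>sqrt (real p) * w - sqrt (real p - 1) * l i\<bar>) * (\<Prod>(i, j)\<in>pairs A. l j - l i) *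
    exp (- (w ^ 2) / 2 - (\<Sum>i\<in>A. (l i) ^ 2 / 4))" for w
    using True by (simp add: S_def F_def cp_def cpv_single mult.assoc)
   moreover have "l \<in> {l \<in> space ?L. \<forall>i\<in>A. \<forall>j\<in>A. i \<le> j \<longrightarrow> l i \<le> l j}" using True l by (simp add: ordset_def)
   ultimately show ?thesis by simp
  next
   case False
   then have "S l w = 0" for w by (simp add: S_def F_def)
   moreover have "l \<notin> {l \<in> space ?L. \<forall>i\<in>A. \<forall>j\<in>A. i \<le> j \<longrightarrow> l i \<le> l j}" using False by (simp add: ordset_def)
   ultimately show ?thesis by simp
  qed
 qed
 then show ?thesis
  using expected_critical_points(1)[OF assms(1,3)] E unfolding Ca pe A_def[symmetric] by simp
qed

end
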